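(* Let $r,n$ be positive integers. The braided tensor product $\mathsf{A}_{1,n}^{\otimes r}$ of $r$ copies of the quantum coordinate superalgebra $\mathsf{A}_{1,n}$ is isomorphic to $\mathsf{A}_{r,n}$ as $\mathrm{U}_q(\mathfrak{q}_n)$-supermodule superalgebras.
   Context: **Conventions.** The base field is $\mathbb{C}(q)$. Tensor products of superalgebras (apart from braided ones) use the Koszul sign rule $(x\otimes y)(x'\otimes y')=(-1)^{|y||x'|}xx'\otimes yy'$. For $N\ge1$, $I_{N|N}=\{-N,\dots,-1,1,\dots,N\}$, with $|i|=\bar0$ if $i>0$ and $|i|=\bar1$ if $i<0$. Matrix units $E_{ij}$ (possibly rectangular) have parity $|i|+|j|$. $\delta_{a<b}$ is $1$ if $a<b$ and $0$ otherwise; $\xi=q-q^{-1}$; $\varphi(i,j)=(-1)^{|j|}(\delta_{ij}+\delta_{i,-j})$. $V_q$ is the superspace with basis $v_i$, $i\in I_{n|n}$, $|v_i|=|i|$, and $$S=\sum_{i,j\in I_{n|n}}q^{\varphi(i,j)}E_{ii}\otimes E_{jj}+\xi\sum_{i<j}(-1)^{|i|}(E_{ji}+E_{-j,-i})\otimes E_{ij}=\sum_{i,j}S_{ij}\otimes E_{ij}\in\mathrm{End}(V_q)^{\otimes2}.$$ Superscripts indicate tensor positions, and a bracketed position is the one occupied by entries in a superalgebra other than a matrix superalgebra, e.g. $T^{1[3]}=\sum E_{ia}\otimes1\otimes t_{ia}$. **$\mathrm{U}_q(\mathfrak{q}_n)$** is the unital associative superalgebra generated by $L_{ij}$ of parity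 $|i|+|j|$, $i,j\in I_{n|n}$, $i\le j$, with relations $L_{ii}L_{-i,-i}=1=L_{-i,-i}L_{ii}$ and $L^{[1]2}L^{[1]3}S^{23}=S^{23}L^{[1]3}L^{[1]2}$, where $L=\sum_{i\le j}L_{ij}\otimes E_{ij}$ (put $L_{ij}=0$ for $i>j$). It is a Hopf superalgebra with $\Delta(L)=L\otimes L$, i.e. $\Delta(L_{ij})=\sum_k(-1)^{(|i|+|k|)(|k|+|j|)}L_{ik}\otimes L_{kj}$, $\varepsilon(L)=1$, antipode $L\mapsto L^{-1}$. A $\mathrm{U}_q(\mathfrak{q}_n)$-supermodule superalgebra is a unital associative superalgebra $B$ that is a $\mathrm{U}_q(\mathfrak{q}_n)$-supermodule with $u.(ab)=\sum_{(u)}(-1)^{|u_{(2)}||a|}(u_{(1)}.a)(u_{(2)}.b)$ and $u.1=\varepsilon(u)1$. **Quantum coordinate superalgebra $\mathsf{A}_{r,n}$.** Unital associative superalgebra generated by $t_{ia}$ of parity $|i|+|a|$, $i\in I_{r|r}$, $a\in I_{n|n}$, with relations $t_{ia}=t_{-i,-a}$ and $S^{12}T^{1[3]}T^{2[3]}=T^{2[3]}T^{1[3]}S^{12}$, where $T=\sum E_{ia}\otimes t_{ia}$ (the left $S$ is the matrix of the same form with indices in $I_{r|r}$). It is equivalently presented by generators $t_{ia}$, $1\le i\le r$, $a\in I_{n|n}$, with relations $$q^{\delta_{ij}}t_{ia}t_{jb}-(-1)^{|a||b|}q^{\varphi(a,b)}t_{jb}t_{ia}=\xi(\delta_{a<b}-\delta_{j<i})t_{ja}t_{ib}+(-1)^{|b|}\xi\,\delta_{-a<b}\,t_{j,-a}t_{i,-b}.$$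 It is a $\mathrm{U}_q(\mathfrak{q}_n)$-supermodule superalgebra with action $\Phi$ determined by $L^{[2]3}\cdot_\Phi T^{1[2]}=T^{1[2]}S^{13}$, where $L^{[2]3}\cdot_\Phi T^{1[2]}:=\sum(-1)^{(|a|+|b|)(|i|+|c|)}E_{ic}\otimes\Phi_{L_{ab}}(t_{ic})\otimes E_{ab}$. **Braided tensor product.** $\Theta:\mathsf{A}_{k,n}\otimes\mathsf{A}_{r,n}\to\mathsf{A}_{r,n}\otimes\mathsf{A}_{k,n}$ is the unique homomorphism of $\mathrm{U}_q(\mathfrak{q}_n)$-supermodules with $\Theta(1\otimes x)=x\otimes1$, $\Theta(y\otimes1)=1\otimes y$, $$\Theta(t_{jb}\otimes t_{ia})=(-1)^{|a||b|}q^{\varphi(b,a)}t_{ia}\otimes t_{jb}+\delta_{b<a}\xi\,t_{ib}\otimes t_{ja}+\delta_{-b<a}(-1)^{|a|}\xi\,t_{i,-b}\otimes t_{j,-a}$$ ($1\le i\le r$, $1\le j\le k$, $a,b\in I_{n|n}$), satisfying $\Theta\circ(1\otimes\mathrm{mul})=(\mathrm{mul}\otimes1)(1\otimes\Theta)(\Theta\otimes1)$ and $\Theta\circ(\mathrm{mul}\otimes1)=(1\otimes\mathrm{mul})(\Theta\otimes1)(1\otimes\Theta)$, where $\mathrm{mul}$ is multiplication. The braided tensor product is $\mathsf{A}_{r,n}\otimes\mathsf{A}_{k,n}$ with multiplication $(\mathrm{mul}\otimes\mathrm{mul})\circ(1\otimes\Theta\otimes1)$ and the tensor product action; it is a $\mathrm{U}_q(\mathfrak{q}_n)$-supermodule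 superalgebra, isomorphic to $\mathsf{A}_{r+k,n}$ via $x\otimes y\mapsto\iota_k(x)\iota_0(y)$, where $\iota_k(t_{ia})=t_{k+i,a}$ and $\iota_0(t_{jb})=t_{jb}$. Iterated braided tensor products are formed by using this isomorphism to regard a braided tensor product $\mathsf{A}_{r,n}\otimes\mathsf{A}_{k,n}$ as a quantum coordinate superalgebra $\mathsf{A}_{r+k,n}$ and transporting the braiding operator $\Theta$ along it; $\mathsf{A}_{1,n}^{\otimes r}$ is the $r$-fold iterated braided tensor product, $\mathsf{A}_{1,n}^{\otimes (m+1)}=\mathsf{A}_{1,n}^{\otimes m}\otimes\mathsf{A}_{1,n}$. *)

theory Defs
  imports
    "HOL-Library.Poly_Mapping"
    "HOL-Library.FuncSet"
    "HOL-Computational_Algebra.Polynomial"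
    "HOL-Computational_Algebra.Fraction_Field"
    "HOL-Algebra.QuotRing"
    "HOL-Algebra.Module"
    "HOL-Algebra.Algebraic_Closure_Type"
begin

section \<open>The base field and the index sets\<close>

type_synonym Cq = "complex poly fract"

abbreviation Cq_ring :: "Cq ring" where
  "Cq_ring \<equiv> ring_of_type_algebra"

definition qvar :: Cq where
  "qvar = Fraction_Field.Fract [:0, 1:] 1"

definition xi :: Cq where
  "xi = qvar - inverse qvar"

definition idx :: "nat \<Rightarrow> int set" where
  "idx N = {i. i \<noteq> 0 \<and> \<bar>i\<bar> \<le> int N}"

text \<open>Parities are natural numbers, to be read modulo 2.\<close>

definition ipar :: "int \<Rightarrow> nat" where
  "ipar i = (if i < 0 then 1 else 0)"

definition phi :: "int \<Rightarrow> int \<Rightarrow> int" where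
  "phi i j = (-1) ^ ipar j * (of_bool (i = j) + of_bool (i = -j))"


section \<open>Monomials and the Koszul product\<close>

text \<open>
  Types cannot depend on the number of tensor factors, so one type of monomials serves for all
  superspaces below: \<open>Mu i j\<close> is the matrix unit $E_{ij}$, \<open>Word\<close> builds the words in
  generators that carry two indices (both $t_{ia}$ and $L_{ij}$ have the parity of their index
  pair), and \<open>Tens\<close> builds the monomials of a tensor product.
\<close>

datatype mono = Mu int int | Word "(int \<times> int) list" | Tens mono mono

primrec par :: "mono \<Rightarrow> nat" where
  "par (Mu i j) = ipar i + ipar j"
| "par (Word w) = (\<Sum>(i, a)\<leftarrow>w. ipar i + ipar a)"
| "par (Tens a b) = par a + par b"

type_synonym vec = "mono \<Rightarrow>\<^sub>0 Cq"

definition scal :: "Cq \<Rightarrow> vec \<Rightarrow> vec" where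
  "scal c x = Poly_Mapping.map (\<lambda>d. c * d) x"

lemma lookup_scal [simp]: "Poly_Mapping.lookup (scal c x) m = c * Poly_Mapping.lookup x m"
  by (simp add: scal_def Poly_Mapping.map.rep_eq when_def)

interpretation vec: vector_space scal
  by unfold_locales (auto intro!: poly_mapping_eqI simp: lookup_add algebra_simps)

definition mon :: "mono \<Rightarrow> vec" where
  "mon m = Poly_Mapping.single m 1"

definition lin :: "(mono \<Rightarrow> vec) \<Rightarrow> vec \<Rightarrow> vec" where
  "lin f x = (\<Sum>m\<in>Poly_Mapping.keys x. scal (Poly_Mapping.lookup x m) (f m))"

definition vtens :: "vec \<Rightarrow> vec \<Rightarrow> vec"  (infixr \<open>\<boxtimes>\<close> 75) where
  "x \<boxtimes> y = lin (\<lambda>a. lin (\<lambda>b. mon (Tens a b)) y) x"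

text \<open>
  Matrix units of all sizes multiply by $E_{ij}E_{kl}=\delta_{jk}E_{il}$, words by concatenation,
  tensors by the Koszul sign rule; the remaining combinations never occur.
\<close>

fun kmono :: "mono \<Rightarrow> mono \<Rightarrow> vec" where
  "kmono (Mu i j) (Mu k l) = (if j = k then mon (Mu i l) else 0)"
| "kmono (Word u) (Word v) = mon (Word (u @ v))"
| "kmono (Tens a b) (Tens c d) = scal ((-1) ^ (par b * par c)) (kmono a c \<boxtimes> kmono b d)"
| "kmono _ _ = 0"

definition kprod :: "vec \<Rightarrow> vec \<Rightarrow> vec"  (infixl \<open>\<star>\<close> 70) where
  "x \<star> y = lin (\<lambda>a. lin (\<lambda>b. kmono a b) y) x"

abbreviation E :: "int \<Rightarrow> int \<Rightarrow> vec" where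
  "E i j \<equiv> mon (Mu i j)"

definition idm :: "nat \<Rightarrow> vec" where
  "idm N = (\<Sum>i\<in>idx N. E i i)"

abbreviation gen :: "int \<Rightarrow> int \<Rightarrow> vec" where
  "gen i a \<equiv> mon (Word [(i, a)])"

abbreviation w1 :: vec where
  "w1 \<equiv> mon (Word [])"

text \<open>
  The matrix $S$ for $I_{N|N}$; the bilinear map \<open>p\<close> places its two tensor factors, so that for
  instance $S^{13}$ is obtained with $p\,x\,y = x\otimes 1\otimes y$.
\<close>

definition Smat :: "nat \<Rightarrow> (vec \<Rightarrow> vec \<Rightarrow> vec) \<Rightarrow> vec" where
  "Smat N p =
     (\<Sum>i\<in>idx N. \<Sum>j\<in>idx N. scal (qvar powi phi i j) (p (E i i) (E j j)))
   + (\<Sum>(i, j)\<in>{(i, j). i \<in> idx N \<and> j \<in> idx N \<and> i < j}.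
        scal (xi * (-1) ^ ipar i) (p (E j i + E (-j) (-i)) (E i j)))"


section \<open>Quotient spaces, superspaces and superalgebras\<close>

text \<open>
  All superspaces are quotients of the span of a set \<open>bas\<close> of monomials by a subspace \<open>rels\<close>
  of that span; their elements are the cosets.  The fields \<open>mult\<close> and \<open>one\<close> are meaningless
  until an algebra structure is put on the space.
\<close>

record space = "(Cq, vec set) module" +
  bas :: "mono set"
  rels :: "vec set"

record uspace = space +
  act :: "vec set \<Rightarrow> vec set \<Rightarrow> vec set"

definition coset :: "vec set \<Rightarrow> vec \<Rightarrow> vec set" where
  "coset N x = {y. y - x \<in> N}"

definition rep :: "vec set \<Rightarrow> vec" where
  "rep Z = (SOME z. z \<in> Z)"

abbreviation cls :: "('z) space_scheme \<Rightarrow> vec \<Rightarrow> vec set" where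
  "cls V x \<equiv> coset (rels V) x"

abbreviation vspan :: "mono set \<Rightarrow> vec set" where
  "vspan B \<equiv> vec.span (mon ` B)"

definition qspace :: "mono set \<Rightarrow> vec set \<Rightarrow> space" where
  "qspace B N =
     \<lparr>carrier = coset N ` vspan B, monoid.mult = undefined, one = undefined, zero = coset N 0,
      add = (\<lambda>x y. coset N (rep x + rep y)), module.smult = (\<lambda>c x. coset N (scal c (rep x))),
      bas = B, rels = N\<rparr>"

definition homog :: "('z) space_scheme \<Rightarrow> nat \<Rightarrow> vec set set" where
  "homog V p = cls V ` vspan {m \<in> bas V. par m mod 2 = p}"

definition superspace :: "('z) space_scheme \<Rightarrow> bool" where
  "superspace V \<longleftrightarrow>
     module Cq_ring V \<and> submodule (homog V 0) Cq_ring V \<and> submodule (homog V 1) Cq_ring V \<and>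
     (\<forall>x\<in>carrier V. \<exists>!(y, z). y \<in> homog V 0 \<and> z \<in> homog V 1 \<and> x = y \<oplus>\<^bsub>V\<^esub> z)"

definition superalgebra :: "('z) space_scheme \<Rightarrow> bool" where
  "superalgebra A \<longleftrightarrow>
     superspace A \<and> ring A \<and>
     (\<forall>c. \<forall>x\<in>carrier A. \<forall>y\<in>carrier A.
        (c \<odot>\<^bsub>A\<^esub> x) \<otimes>\<^bsub>A\<^esub> y = c \<odot>\<^bsub>A\<^esub> (x \<otimes>\<^bsub>A\<^esub> y) \<and>
        x \<otimes>\<^bsub>A\<^esub> (c \<odot>\<^bsub>A\<^esub> y) = c \<odot>\<^bsub>A\<^esub> (x \<otimes>\<^bsub>A\<^esub> y)) \<and>
     \<one>\<^bsub>A\<^esub> \<in> homog A 0 \<and>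
     (\<forall>p\<in>{0, 1}. \<forall>p'\<in>{0, 1}. \<forall>x\<in>homog A p. \<forall>y\<in>homog A p'.
        x \<otimes>\<^bsub>A\<^esub> y \<in> homog A ((p + p') mod 2))"

definition even_linear ::
  "('y) space_scheme \<Rightarrow> ('z) space_scheme \<Rightarrow> (vec set \<Rightarrow> vec set) \<Rightarrow> bool" where
  "even_linear V W f \<longleftrightarrow>
     f \<in> carrier V \<rightarrow> carrier W \<and>
     (\<forall>x\<in>carrier V. \<forall>y\<in>carrier V. f (x \<oplus>\<^bsub>V\<^esub> y) = f x \<oplus>\<^bsub>W\<^esub> f y) \<and>
     (\<forall>c. \<forall>x\<in>carrier V. f (c \<odot>\<^bsub>V\<^esub> x) = c \<odot>\<^bsub>W\<^esub> f x) \<and>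
     (\<forall>p\<in>{0, 1}. f \<in> homog V p \<rightarrow> homog W p)"

text \<open>The superalgebra with generators \<open>G\<close> and relators \<open>R\<close>.\<close>

definition ideal_gen :: "(int \<times> int) set \<Rightarrow> vec set \<Rightarrow> vec set" where
  "ideal_gen G R =
     vec.span {mon (Word u) \<star> x \<star> mon (Word v) | u x v. u \<in> lists G \<and> x \<in> R \<and> v \<in> lists G}"

definition presented :: "(int \<times> int) set \<Rightarrow> vec set \<Rightarrow> space" where
  "presented G R = (let N = ideal_gen G R in
     (qspace (Word ` lists G) N)
       \<lparr>monoid.mult := (\<lambda>x y. coset N (rep x \<star> rep y)), one := coset N w1\<rparr>)"


section \<open>Tensor products of superspaces\<close>

text \<open>
  $V/N\otimes W/M = (V\otimes W)/(N\otimes W+V\otimes M)$.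
\<close>

definition tbas :: "('y) space_scheme \<Rightarrow> ('z) space_scheme \<Rightarrow> mono set" where
  "tbas V W = {Tens a b | a b. a \<in> bas V \<and> b \<in> bas W}"

definition trels :: "('y) space_scheme \<Rightarrow> ('z) space_scheme \<Rightarrow> vec set" where
  "trels V W = vec.span
     ({x \<boxtimes> y | x y. x \<in> rels V \<and> y \<in> vspan (bas W)} \<union>
      {x \<boxtimes> y | x y. x \<in> vspan (bas V) \<and> y \<in> rels W})"

definition tspace :: "('y) space_scheme \<Rightarrow> ('z) space_scheme \<Rightarrow> space" where
  "tspace V W = qspace (tbas V W) (trels V W)"

definition pure :: "('y) space_scheme \<Rightarrow> ('z) space_scheme \<Rightarrow> vec set \<Rightarrow> vec set \<Rightarrow> vec set" where
  "pure V W x y = cls (tspace V W) (rep x \<boxtimes> rep y)"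

text \<open>
  \<open>tsum N h Z\<close> expands an element \<open>Z\<close> of a tensor product into monomials $a\otimes b$ and replaces
  each $a\otimes b$ by \<open>h a b\<close>, modulo \<open>N\<close>.  \<open>tlift V W U f\<close> is the linear map
  $V\otimes W\to U$ with $x\otimes y\mapsto f(x,y)$, for bilinear \<open>f\<close>.
\<close>

definition tsum :: "vec set \<Rightarrow> (mono \<Rightarrow> mono \<Rightarrow> vec) \<Rightarrow> vec set \<Rightarrow> vec set" where
  "tsum N h Z = coset N (lin (\<lambda>m. case m of Tens a b \<Rightarrow> h a b | _ \<Rightarrow> 0) (rep Z))"

definition tlift ::
  "('x) space_scheme \<Rightarrow> ('y) space_scheme \<Rightarrow> ('z) space_scheme \<Rightarrow>
     (vec set \<Rightarrow> vec set \<Rightarrow> vec set) \<Rightarrow> vec set \<Rightarrow> vec set" where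
  "tlift V W U f Z = tsum (rels U) (\<lambda>a b. rep (f (cls V (mon a)) (cls W (mon b)))) Z"

definition tmap ::
  "('v) space_scheme \<Rightarrow> ('w) space_scheme \<Rightarrow> ('x) space_scheme \<Rightarrow> ('y) space_scheme \<Rightarrow>
     (vec set \<Rightarrow> vec set) \<Rightarrow> (vec set \<Rightarrow> vec set) \<Rightarrow> vec set \<Rightarrow> vec set" where
  "tmap V W V' W' f g = tlift V W (tspace V' W') (\<lambda>x y. pure V' W' (f x) (g y))"


section \<open>The quantum queer superalgebra and its supermodules\<close>

definition Ugens :: "nat \<Rightarrow> (int \<times> int) set" where
  "Ugens n = {(i, j). i \<in> idx n \<and> j \<in> idx n \<and> i \<le> j}"

definition Lgen :: "int \<Rightarrow> int \<Rightarrow> vec" where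
  "Lgen i j = (if i \<le> j then gen i j else 0)"

definition Lmat :: "nat \<Rightarrow> (vec \<Rightarrow> vec \<Rightarrow> vec) \<Rightarrow> vec" where
  "Lmat n p = (\<Sum>(i, j)\<in>Ugens n. p (Lgen i j) (E i j))"

text \<open>$L^{[1]2}L^{[1]3}S^{23}-S^{23}L^{[1]3}L^{[1]2}$\<close>

definition LLS :: "nat \<Rightarrow> vec" where
  "LLS n =
    (let L12 = Lmat n (\<lambda>x y. x \<boxtimes> y \<boxtimes> idm n);
         L13 = Lmat n (\<lambda>x y. x \<boxtimes> idm n \<boxtimes> y);
         S23 = Smat n (\<lambda>x y. w1 \<boxtimes> x \<boxtimes> y)
     in L12 \<star> L13 \<star> S23 - S23 \<star> L13 \<star> L12)"

text \<open>
  \<open>Poly_Mapping.map_key f x\<close> is \<open>\<lambda>w. lookup x (f w)\<close>; below it extracts the coefficient, lying in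
  the free superalgebra, of given matrix units.
\<close>

definition Urels :: "nat \<Rightarrow> vec set" where
  "Urels n =
     {gen i i \<star> gen (-i) (-i) - w1 | i. i \<in> idx n} \<union>
     {Poly_Mapping.map_key (\<lambda>w. Tens w (Tens (Mu i j) (Mu k l))) (LLS n) | i j k l.
        i \<in> idx n \<and> j \<in> idx n \<and> k \<in> idx n \<and> l \<in> idx n}"

definition Uq :: "nat \<Rightarrow> space" where
  "Uq n = presented (Ugens n) (Urels n)"

text \<open>The comultiplication and the counit, first on the free superalgebra on the $L_{ij}$.\<close>

primrec cowd :: "nat \<Rightarrow> (int \<times> int) list \<Rightarrow> vec" where
  "cowd n [] = w1 \<boxtimes> w1"
| "cowd n (l # w) = (case l of (i, j) \<Rightarrow>
     (\<Sum>k\<in>idx n. scal ((-1) ^ ((ipar i + ipar k) * (ipar k + ipar j))) (Lgen i k \<boxtimes> Lgen k j)))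
     \<star> cowd n w"

definition comult :: "nat \<Rightarrow> vec set \<Rightarrow> vec set" where
  "comult n u =
     cls (tspace (Uq n) (Uq n)) (lin (\<lambda>m. case m of Word w \<Rightarrow> cowd n w | _ \<Rightarrow> 0) (rep u))"

definition counit :: "vec set \<Rightarrow> Cq" where
  "counit u = (\<Sum>m\<in>Poly_Mapping.keys (rep u). Poly_Mapping.lookup (rep u) m *
     (case m of Word w \<Rightarrow> (\<Prod>(i, j)\<leftarrow>w. of_bool (i = j)) | _ \<Rightarrow> 0))"

definition supermodule :: "nat \<Rightarrow> ('z) uspace_scheme \<Rightarrow> bool" where
  "supermodule n V \<longleftrightarrow>
     superspace V \<and>
     (\<forall>u\<in>carrier (Uq n). \<forall>x\<in>carrier V. act V u x \<in> carrier V) \<and>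
     (\<forall>u\<in>carrier (Uq n). \<forall>x\<in>carrier V. \<forall>y\<in>carrier V.
        act V u (x \<oplus>\<^bsub>V\<^esub> y) = act V u x \<oplus>\<^bsub>V\<^esub> act V u y) \<and>
     (\<forall>u\<in>carrier (Uq n). \<forall>v\<in>carrier (Uq n). \<forall>x\<in>carrier V.
        act V (u \<oplus>\<^bsub>Uq n\<^esub> v) x = act V u x \<oplus>\<^bsub>V\<^esub> act V v x) \<and>
     (\<forall>c. \<forall>u\<in>carrier (Uq n). \<forall>x\<in>carrier V.
        act V u (c \<odot>\<^bsub>V\<^esub> x) = c \<odot>\<^bsub>V\<^esub> act V u x \<and>
        act V (c \<odot>\<^bsub>Uq n\<^esub> u) x = c \<odot>\<^bsub>V\<^esub> act V u x) \<and>
     (\<forall>x\<in>carrier V. act V \<one>\<^bsub>Uq n\<^esub> x = x) \<and>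
     (\<forall>u\<in>carrier (Uq n). \<forall>v\<in>carrier (Uq n). \<forall>x\<in>carrier V.
        act V (u \<otimes>\<^bsub>Uq n\<^esub> v) x = act V u (act V v x)) \<and>
     (\<forall>p\<in>{0, 1}. \<forall>p'\<in>{0, 1}. \<forall>u\<in>homog (Uq n) p. \<forall>x\<in>homog V p'.
        act V u x \<in> homog V ((p + p') mod 2))"

definition supermodule_hom ::
  "nat \<Rightarrow> ('y) uspace_scheme \<Rightarrow> ('z) uspace_scheme \<Rightarrow> (vec set \<Rightarrow> vec set) \<Rightarrow> bool" where
  "supermodule_hom n V W f \<longleftrightarrow>
     even_linear V W f \<and>
     (\<forall>u\<in>carrier (Uq n). \<forall>x\<in>carrier V. f (act V u x) = act W u (f x))"

definition supermodule_superalgebra :: "nat \<Rightarrow> ('z) uspace_scheme \<Rightarrow> bool" where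
  "supermodule_superalgebra n B \<longleftrightarrow>
     superalgebra B \<and> supermodule n B \<and>
     (\<forall>u\<in>carrier (Uq n). \<forall>p\<in>{0, 1}. \<forall>a\<in>homog B p. \<forall>b\<in>carrier B.
        act B u (a \<otimes>\<^bsub>B\<^esub> b) =
        tsum (rels B)
          (\<lambda>m1 m2. scal ((-1) ^ (par m2 * p))
             (rep (act B (cls (Uq n) (mon m1)) a \<otimes>\<^bsub>B\<^esub> act B (cls (Uq n) (mon m2)) b)))
          (comult n u)) \<and>
     (\<forall>u\<in>carrier (Uq n). act B u \<one>\<^bsub>B\<^esub> = counit u \<odot>\<^bsub>B\<^esub> \<one>\<^bsub>B\<^esub>)"

definition supermodule_superalgebra_iso ::
  "nat \<Rightarrow> ('y) uspace_scheme \<Rightarrow> ('z) uspace_scheme \<Rightarrow> (vec set \<Rightarrow> vec set) \<Rightarrow> bool" where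
  "supermodule_superalgebra_iso n A B f \<longleftrightarrow> f \<in> ring_iso A B \<and> supermodule_hom n A B f"

definition isomorphic_supermodule_superalgebras ::
  "nat \<Rightarrow> ('y) uspace_scheme \<Rightarrow> ('z) uspace_scheme \<Rightarrow> bool" where
  "isomorphic_supermodule_superalgebras n A B \<longleftrightarrow>
     supermodule_superalgebra n A \<and> supermodule_superalgebra n B \<and>
     (\<exists>f. supermodule_superalgebra_iso n A B f)"

text \<open>
  $u.(x\otimes y)=\sum(-1)^{|u_{(2)}||x|}u_{(1)}.x\otimes u_{(2)}.y$
\<close>

definition tensor :: "nat \<Rightarrow> ('y) uspace_scheme \<Rightarrow> ('z) uspace_scheme \<Rightarrow> uspace" where
  "tensor n V W = space.extend (tspace V W) (uspace.fields
     (\<lambda>u Z. tsum (trels V W)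
        (\<lambda>m1 m2. rep (tsum (trels V W)
           (\<lambda>a b. scal ((-1) ^ (par m2 * par a))
              (rep (act V (cls (Uq n) (mon m1)) (cls V (mon a))) \<boxtimes>
               rep (act W (cls (Uq n) (mon m2)) (cls W (mon b))))) Z))
        (comult n u)))"


section \<open>The quantum coordinate superalgebras\<close>

definition Agens :: "nat \<Rightarrow> nat \<Rightarrow> (int \<times> int) set" where
  "Agens r n = idx r \<times> idx n"

definition Tmat :: "nat \<Rightarrow> nat \<Rightarrow> (vec \<Rightarrow> vec \<Rightarrow> vec) \<Rightarrow> vec" where
  "Tmat r n p = (\<Sum>(i, a)\<in>Agens r n. p (E i a) (gen i a))"

text \<open>
  $S^{12}T^{1[3]}T^{2[3]}-T^{2[3]}T^{1[3]}S^{12}$.  As $T$ is rectangular, the unit in the matrix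
  position not occupied by $T$ has size $r|r$ or $n|n$ according to what it is multiplied with.
\<close>

definition STT :: "nat \<Rightarrow> nat \<Rightarrow> vec" where
  "STT r n =
    (let S12 = (\<lambda>N. Smat N (\<lambda>x y. x \<boxtimes> y \<boxtimes> w1));
         T1 = (\<lambda>N. Tmat r n (\<lambda>x t. x \<boxtimes> idm N \<boxtimes> t));
         T2 = (\<lambda>N. Tmat r n (\<lambda>x t. idm N \<boxtimes> x \<boxtimes> t))
     in S12 r \<star> T1 r \<star> T2 n - T2 r \<star> T1 n \<star> S12 n)"

definition Arels :: "nat \<Rightarrow> nat \<Rightarrow> vec set" where
  "Arels r n =
     {gen i a - gen (-i) (-a) | i a. i \<in> idx r \<and> a \<in> idx n} \<union>
     {Poly_Mapping.map_key (\<lambda>w. Tens (Mu i a) (Tens (Mu j b) w)) (STT r n) | i a j b.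
        i \<in> idx r \<and> a \<in> idx n \<and> j \<in> idx r \<and> b \<in> idx n}"

definition Aalg :: "nat \<Rightarrow> nat \<Rightarrow> space" where
  "Aalg r n = presented (Agens r n) (Arels r n)"

text \<open>$T^{1[2]}S^{13}$\<close>

definition TS :: "nat \<Rightarrow> nat \<Rightarrow> vec" where
  "TS r n = Tmat r n (\<lambda>x t. x \<boxtimes> t \<boxtimes> idm n) \<star> Smat n (\<lambda>x y. x \<boxtimes> w1 \<boxtimes> y)"

definition is_Phi :: "nat \<Rightarrow> nat \<Rightarrow> (vec set \<Rightarrow> vec set \<Rightarrow> vec set) \<Rightarrow> bool" where
  "is_Phi r n \<Phi> \<longleftrightarrow>
     \<Phi> \<in> carrier (Uq n) \<rightarrow>\<^sub>E (carrier (Aalg r n) \<rightarrow>\<^sub>E carrier (Aalg r n)) \<and>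
     supermodule_superalgebra n (space.extend (Aalg r n) (uspace.fields \<Phi>)) \<and>
     (\<forall>a\<in>idx n. \<forall>b\<in>idx n. \<forall>i\<in>idx r. \<forall>c\<in>idx n.
        (-1) ^ ((ipar a + ipar b) * (ipar i + ipar c)) \<odot>\<^bsub>Aalg r n\<^esub>
          \<Phi> (cls (Uq n) (Lgen a b)) (cls (Aalg r n) (gen i c)) =
        cls (Aalg r n) (Poly_Mapping.map_key (\<lambda>w. Tens (Mu i c) (Tens w (Mu a b))) (TS r n)))"

definition A :: "nat \<Rightarrow> nat \<Rightarrow> uspace" where
  "A r n = space.extend (Aalg r n) (uspace.fields (THE \<Phi>. is_Phi r n \<Phi>))"


section \<open>Braided tensor products\<close>

text \<open>
  The last two conditions are $\Theta\circ(1\otimes\mathrm{mul})=(\mathrm{mul}\otimes1)(1\otimes\Theta)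
  (\Theta\otimes1)$ and $\Theta\circ(\mathrm{mul}\otimes1)=(1\otimes\mathrm{mul})(\Theta\otimes1)
  (1\otimes\Theta)$, evaluated on $y\otimes x\otimes x'$ and on $y\otimes y'\otimes x$.
\<close>

definition is_Theta :: "nat \<Rightarrow> nat \<Rightarrow> nat \<Rightarrow> (vec set \<Rightarrow> vec set) \<Rightarrow> bool" where
  "is_Theta n k r \<Theta> \<longleftrightarrow>
    (let Ak = A k n; Ar = A r n; KR = tensor n Ak Ar; RK = tensor n Ar Ak in
     \<Theta> \<in> carrier KR \<rightarrow>\<^sub>E carrier RK \<and>
     supermodule_hom n KR RK \<Theta> \<and>
     (\<forall>x\<in>carrier Ar. \<Theta> (pure Ak Ar \<one>\<^bsub>Ak\<^esub> x) = pure Ar Ak x \<one>\<^bsub>Ak\<^esub>) \<and>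
     (\<forall>y\<in>carrier Ak. \<Theta> (pure Ak Ar y \<one>\<^bsub>Ar\<^esub>) = pure Ar Ak \<one>\<^bsub>Ar\<^esub> y) \<and>
     (\<forall>i\<in>{1..int r}. \<forall>j\<in>{1..int k}. \<forall>a\<in>idx n. \<forall>b\<in>idx n.
        \<Theta> (cls KR (gen j b \<boxtimes> gen i a)) =
        cls RK
          (scal ((-1) ^ (ipar a * ipar b) * qvar powi phi b a) (gen i a \<boxtimes> gen j b) +
           scal (of_bool (b < a) * xi) (gen i b \<boxtimes> gen j a) +
           scal (of_bool (-b < a) * (-1) ^ ipar a * xi) (gen i (-b) \<boxtimes> gen j (-a)))) \<and>
     (\<forall>y\<in>carrier Ak. \<forall>x\<in>carrier Ar. \<forall>x'\<in>carrier Ar.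
        \<Theta> (pure Ak Ar y (x \<otimes>\<^bsub>Ar\<^esub> x')) =
        tlift Ar Ak RK
          (\<lambda>e f. tlift Ar Ak RK (\<lambda>e' f'. pure Ar Ak (e \<otimes>\<^bsub>Ar\<^esub> e') f') (\<Theta> (pure Ak Ar f x')))
          (\<Theta> (pure Ak Ar y x))) \<and>
     (\<forall>y\<in>carrier Ak. \<forall>y'\<in>carrier Ak. \<forall>x\<in>carrier Ar.
        \<Theta> (pure Ak Ar (y \<otimes>\<^bsub>Ak\<^esub> y') x) =
        tlift Ar Ak RK
          (\<lambda>e f. tlift Ar Ak RK (\<lambda>e' f'. pure Ar Ak e' (f' \<otimes>\<^bsub>Ak\<^esub> f)) (\<Theta> (pure Ak Ar y e)))
          (\<Theta> (pure Ak Ar y' x))))"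

definition Theta :: "nat \<Rightarrow> nat \<Rightarrow> nat \<Rightarrow> vec set \<Rightarrow> vec set" where
  "Theta n k r = (THE \<Theta>. is_Theta n k r \<Theta>)"

text \<open>
  $V\otimes W$ with multiplication $(\mathrm{mul}\otimes\mathrm{mul})\circ(1\otimes\Theta\otimes1)$,
  for a braiding $\Theta: W\otimes V\to V\otimes W$.
\<close>

definition braided_tensor ::
  "nat \<Rightarrow> ('y) uspace_scheme \<Rightarrow> ('z) uspace_scheme \<Rightarrow> (vec set \<Rightarrow> vec set) \<Rightarrow> uspace" where
  "braided_tensor n V W \<Theta> = (let VW = tensor n V W in
     VW\<lparr>monoid.mult := (\<lambda>x y.
           tlift V W VW
             (\<lambda>a b. tlift V W VW
                (\<lambda>c d. tlift V W VW
                   (\<lambda>e f. pure V W (a \<otimes>\<^bsub>V\<^esub> e) (f \<otimes>\<^bsub>W\<^esub> d))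
                   (\<Theta> (pure W V b c)))
                y)
             x),
         one := pure V W \<one>\<^bsub>V\<^esub> \<one>\<^bsub>W\<^esub>\<rparr>)"

text \<open>
  $\iota_k(t_{ia})=t_{k+i,a}$ for $i>0$, hence $\iota_k(t_{-i,a})=t_{-(k+i),a}$ because
  $t_{-i,a}=t_{i,-a}$.  The target of \<open>iota k m n\<close> is $A_{m,n}$; its source may be any
  $A_{r,n}$ with $k+r\le m$.
\<close>

definition iota :: "nat \<Rightarrow> nat \<Rightarrow> nat \<Rightarrow> vec set \<Rightarrow> vec set" where
  "iota k m n x = cls (A m n)
     (lin (\<lambda>w. case w of
        Word l \<Rightarrow> mon (Word (map (\<lambda>(i, a). (if i > 0 then i + int k else i - int k, a)) l))
      | _ \<Rightarrow> 0) (rep x))"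

text \<open>$x\otimes y\mapsto\iota_k(x)\iota_0(y)$, from $A_{r,n}\otimes A_{k,n}$ to $A_{r+k,n}$\<close>

definition glue :: "nat \<Rightarrow> nat \<Rightarrow> nat \<Rightarrow> vec set \<Rightarrow> vec set" where
  "glue n r k = tlift (A r n) (A k n) (A (r + k) n)
     (\<lambda>x y. iota k (r + k) n x \<otimes>\<^bsub>A (r + k) n\<^esub> iota 0 (r + k) n y)"

text \<open>
  For $m\ge1$, \<open>tpower n m\<close> is the $m$-fold iterated braided tensor product $P_m$ of $A_{1,n}$ with
  itself, together with the identification $f_m: P_m\to A_{m,n}$.  The braiding
  $A_{1,n}\otimes P_m\to P_m\otimes A_{1,n}$ is the one of $A_{1,n}$ and $A_{m,n}$,
  transported along $f_m$.
\<close>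

fun tpower :: "nat \<Rightarrow> nat \<Rightarrow> uspace \<times> (vec set \<Rightarrow> vec set)" where
  "tpower n 0 = undefined"
| "tpower n (Suc 0) = (A 1 n, id)"
| "tpower n (Suc (Suc m')) =
    (let m = Suc m'; A1 = A 1 n; Am = A m n; P = fst (tpower n m); f = snd (tpower n m);
         \<Theta> = tmap Am A1 P A1 (inv_into (carrier P) f) id \<circ> Theta n 1 m \<circ> tmap A1 P A1 Am id f
     in (braided_tensor n P A1 \<Theta>, glue n m 1 \<circ> tmap P A1 Am A1 f id))"

definition braided_power :: "nat \<Rightarrow> nat \<Rightarrow> uspace" where
  "braided_power n r = fst (tpower n r)"

end

(*
  The map A_r \<otimes> A_k \<rightarrow> A_{r+k}, x \<otimes> y \<mapsto> iota_k(x) iota_0(y), is surjective because the defining relations of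
  A_{r+k} move the letters with large row index to the left.  For injectivity one lets the free algebra on
  the generators of A_{r+k} act on A_r \<otimes> A_k, a letter with small row index being first moved past A_r by the
  braiding; that the relations of A_{r+k} act by zero comes down to the braid relation and the
  Hecke relation for S.  Acting on 1 \<otimes> 1 then inverts the map.

  Once the map is known to be bijective, Theta is forced to be its inverse composed with
  y \<otimes> x \<mapsto> iota_0(y) iota_k(x).  Hence it exists and is unique, and the braided multiplication on A_r \<otimes> A_k
  is the multiplication of A_{r+k} pulled back along the map; the corollary follows by induction on r.
*)
theory Submission
  imports Defs
begin

text \<open>\<open>A\<close> and \<open>Theta\<close> are defined by THE and A_{r,n} is known only
  by generators and relations. So existence and uniqueness of the action and of the braiding are
  part of the proof, and every map out of A_{r,n} has to be defined on words and checked on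
  relators. One mechanism serves all these checks. The formula for \<Theta> on generators ignores
  row indices: it is an operator on pairs of column indices, and the relators of A_{r,n} say that
  this operator on columns equals a Hecke operator on rows. Moving a single column index through a
  word by this operator gives the action of L_ab in one direction (\<open>crw\<close>) and the
  exchange of a letter with a tensor factor in the other (\<open>cry\<close>). The braid relation is
  used four times: the action respects the relations of A_{r,n} (\<open>rho_crw_two\<close>) and of
  U_q (\<open>crw_crw_braid\<close>), and letters acting on A_{r,n} \<otimes> A_{k,n} respect the
  relators of the left factor (\<open>rho_cry_two\<close>) and their own
  (\<open>cry_cry_braid\<close>). The Hecke relation handles a letter with large row followed by one
  with small row.\<close>

definition cbraid :: "int \<Rightarrow> int \<Rightarrow> (int \<Rightarrow> int \<Rightarrow> Cq) \<Rightarrow> Cq" where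
  "cbraid b a h =
     (-1) ^ (ipar a * ipar b) * qvar powi phi b a * h a b
     + of_bool (b < a) * xi * h b a
     + of_bool (-b < a) * (-1) ^ ipar a * xi * h (-b) (-a)"

lemma qvar_nonzero: "qvar \<noteq> 0"
  by (simp add: qvar_def Zero_fract_def eq_fract)

section \<open>Braid and Hecke relations for the braiding of two column indices\<close>

context
  fixes p r :: Cq
  assumes pr: "p * r = 1"
begin

text \<open>\<open>p\<close> and \<open>r\<close> stand for q and its inverse. For nonzero indices
  \<phi>(b,a) is 1, -1 or 0, so the power of q becomes a case distinction and all identities are
  polynomial modulo \<open>p * r = 1\<close>. The functional \<open>h\<close> is evaluated at the
  image of the pair (b,a); nesting therefore composes operators, the outermost being applied
  first.\<close>

definition pbraid :: "int \<Rightarrow> int \<Rightarrow> (int \<Rightarrow> int \<Rightarrow> Cq) \<Rightarrow> Cq" where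
  "pbraid b a h =
     (if a < 0 \<and> b < 0 then -1 else 1) * (if a = b \<or> a = - b then (if 0 < a then p else r) else 1) * h a b
     + (if b < a then (p - r) * h b a else 0)
     + (if -b < a then (if a < 0 then -1 else 1) * (p - r) * h (-b) (-a) else 0)"

text \<open>On triples of indices the left side braids positions 12, 23, 12 and the right side 23,
  12, 23. As \<open>h\<close> is arbitrary, this is the operator identity.\<close>

definition pbraid_rel :: "int \<Rightarrow> int \<Rightarrow> int \<Rightarrow> bool" where
  "pbraid_rel a b c \<longleftrightarrow> (\<forall>h. pbraid a b (\<lambda>x y. pbraid y c (\<lambda>z w. pbraid x z (\<lambda>u v. h u v w)))
     = pbraid b c (\<lambda>x y. pbraid a x (\<lambda>z w. pbraid w y (\<lambda>u v. h z u v))))"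

lemma pr_simps: "p * r = 1" "r * p = 1" "p * (r * x) = x" "r * (p * x) = x"
  using pr by (simp_all add: mult.commute flip: mult.assoc)

text \<open>Braiding permutes the absolute values of its indices, and its coefficients depend only
  on signs and comparisons. So the relation splits into finite checks by the number of distinct
  absolute values: one here, at most two in \<open>pbraid_rel_2\<close>, three in
  \<open>pbraid_rel_3\<close>.\<close>

lemma pbraid_rel_1:
  assumes "0 < k" "a = k \<or> a = - k" "b = k \<or> b = - k" "c = k \<or> c = - k"
  shows "pbraid_rel a b c"
proof -
  have f: "k \<noteq> - k" "- k \<noteq> k" "\<not> k < 0" "\<not> k < -k" "-k < k" using assms by auto
  show ?thesis
    using assms(2-4)
    by (elim disjE; simp add: pbraid_rel_def pbraid_def f assms(1); simp add: algebra_simps pr_simps)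
qed

lemma pbraid_rel_2:
  assumes "0 < k" "k < l"
    "a = k \<or> a = - k \<or> a = l \<or> a = - l" "b = k \<or> b = - k \<or> b = l \<or> b = - l" "c = k \<or> c = - k \<or> c = l \<or> c = - l"
  shows "pbraid_rel a b c"
proof -
  have f: "k \<noteq> - k" "- k \<noteq> k" "\<not> k < 0" "\<not> k < -k" "-k < k" "0 < l" "k \<noteq> l" "l \<noteq> k" "-k \<noteq> l" "l \<noteq> - k" "k \<noteq> -l" "-l \<noteq> k"
     "l \<noteq> - l" "- l \<noteq> l" "\<not> l < 0" "\<not> l < -l" "-l < l" "\<not> l < k" "\<not> l < - k" "- l < k" "- k < l" "\<not> k < - l"
    using assms(1,2) by auto
  show ?thesis
    using assms(3-5)
    by (elim disjE; simp add: pbraid_rel_def pbraid_def f assms(1,2); simp add: algebra_simps pr_simps)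
qed

lemma pbraid_values:
  assumes "0 < k" "k < l"
  shows "pbraid k l h = h l k + (p - r) * h k l + (p - r) * h (- k) (- l)"
    "pbraid k (- l) h = h (- l) k"
    "pbraid (- k) l h = h l (- k) + (p - r) * h (- k) l + (p - r) * h k (- l)"
    "pbraid (- k) (- l) h = - h (- l) (- k)"
    "pbraid l k h = h k l + (p - r) * h (- l) (- k)"
    "pbraid l (- k) h = h (- k) l - (p - r) * h (- l) k"
    "pbraid (- l) k h = h k (- l) + (p - r) * h (- l) k"
    "pbraid (- l) (- k) h = - h (- k) (- l) + (p - r) * h (- l) (- k)"
  using assms by (simp_all add: pbraid_def algebra_simps)

lemma pbraid_rel_3:
  assumes "0 < k" "k < l" "l < m"
    "(a = k \<or> a = - k) \<and> (b = l \<or> b = - l) \<and> (c = m \<or> c = - m) \<or>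
    (a = k \<or> a = - k) \<and> (b = m \<or> b = - m) \<and> (c = l \<or> c = - l) \<or>
    (a = l \<or> a = - l) \<and> (b = k \<or> b = - k) \<and> (c = m \<or> c = - m) \<or>
    (a = l \<or> a = - l) \<and> (b = m \<or> b = - m) \<and> (c = k \<or> c = - k) \<or>
    (a = m \<or> a = - m) \<and> (b = k \<or> b = - k) \<and> (c = l \<or> c = - l) \<or>
    (a = m \<or> a = - m) \<and> (b = l \<or> b = - l) \<and> (c = k \<or> c = - k)"
  shows "pbraid_rel a b c"
proof -
  have "k < m" "0 < l" using assms(1-3) by auto
  note v = pbraid_values[OF assms(1,2)] pbraid_values[OF \<open>0 < l\<close> assms(3)] pbraid_values[OF assms(1) \<open>k < m\<close>]
  \<comment> \<open>For three distinct absolute values no power of q occurs except in p - r. Treated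
    as an atom \<open>s\<close>, it keeps the 48 identities small.\<close>
  obtain s where s: "p - r = s" by blast
  show ?thesis
    using assms(4) unfolding pbraid_rel_def
    by (elim disjE conjE; simp only: v[unfolded s] minus_minus; simp add: algebra_simps)
qed

lemma pbraid_rel_abs:
  assumes "0 < k" "0 < l" "0 < m" "a = k \<or> a = - k" "b = l \<or> b = - l" "c = m \<or> c = - m"
  shows "pbraid_rel a b c"
proof -
  \<comment> \<open>The thirteen weak orderings of three numbers.\<close>
  have "k = l \<and> k = m \<or> k = l \<and> k < m \<or> k = l \<and> m < k \<or> k = m \<and> k < l \<or> k = m \<and> l < k \<or> l = m \<and> k < l \<or> l = m \<and> l < k \<or> k < l \<and> l < m \<or> k < m \<and> m < l \<or> l < k \<and> k < m \<or> l < m \<and> m < k \<or> m < k \<and> k < l \<or> m < l \<and> l < k"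
    by (cases k l rule: linorder_cases; cases k m rule: linorder_cases; cases l m rule: linorder_cases; simp)
  then show ?thesis
  proof (elim disjE conjE, goal_cases)
    case 1 then show ?case using assms by (intro pbraid_rel_1[of k]) auto
  next
    case 2 then show ?case using assms by (intro pbraid_rel_2[of k m]) auto
  next
    case 3 then show ?case using assms by (intro pbraid_rel_2[of m k]) auto
  next
    case 4 then show ?case using assms by (intro pbraid_rel_2[of k l]) auto
  next
    case 5 then show ?case using assms by (intro pbraid_rel_2[of l k]) auto
  next
    case 6 then show ?case using assms by (intro pbraid_rel_2[of k l]) auto
  next
    case 7 then show ?case using assms by (intro pbraid_rel_2[of l k]) auto
  next
    case 8 then show ?case using assms by (intro pbraid_rel_3[of k l m]) auto
  next
    case 9 then show ?case using assms by (intro pbraid_rel_3[of k m l]) auto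
  next
    case 10 then show ?case using assms by (intro pbraid_rel_3[of l k m]) auto
  next
    case 11 then show ?case using assms by (intro pbraid_rel_3[of l m k]) auto
  next
    case 12 then show ?case using assms by (intro pbraid_rel_3[of m k l]) auto
  next
    case 13 then show ?case using assms by (intro pbraid_rel_3[of m l k]) auto
  qed
qed

lemma pbraid_rel:
  assumes "a \<noteq> 0" "b \<noteq> 0" "c \<noteq> 0"
  shows "pbraid_rel a b c"
  by (rule pbraid_rel_abs[of "\<bar>a\<bar>" "\<bar>b\<bar>" "\<bar>c\<bar>"]) (use assms in auto)

text \<open>This is (T - p)(T + r) = 0 for the braiding T, checked on the span of (a,b), (b,a),
  (-a,-b), (-b,-a), which T preserves.\<close>

lemma pbraid_hecke:
  assumes "a \<noteq> 0" "b \<noteq> 0"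
  shows "pbraid a b (\<lambda>x y. pbraid x y h) = h a b + (p - r) * pbraid a b h"
proof -
  consider "a = b" | "a = - b" "a < b" | "a = -b" "b < a" | "a \<noteq> b" "a \<noteq> - b" by linarith
  then show ?thesis
    using assms by cases (auto simp: pbraid_def algebra_simps pr_simps)
qed

end

lemma cbraid_eq_pbraid:
  assumes "a \<noteq> 0" "b \<noteq> 0"
  shows "cbraid b a h = pbraid qvar (inverse qvar) b a h"
  using assms
  by (auto simp: cbraid_def pbraid_def[of qvar] qvar_nonzero phi_def ipar_def xi_def power_int_minus)

text \<open>The column part of the formula for \<Theta> on generators: t_jb \<otimes> t_ia is sent
  to this combination with h x y = t_ix \<otimes> t_jy. The continuation \<open>h\<close> allows
  words, tensors and whole relators to be inserted in place of the pair.\<close>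

definition braid :: "int \<Rightarrow> int \<Rightarrow> (int \<Rightarrow> int \<Rightarrow> vec) \<Rightarrow> vec" where
  "braid b a h =
     scal ((-1) ^ (ipar a * ipar b) * qvar powi phi b a) (h a b)
     + scal (of_bool (b < a) * xi) (h b a)
     + scal (of_bool (-b < a) * (-1) ^ ipar a * xi) (h (-b) (-a))"

lemma lookup_braid: "Poly_Mapping.lookup (braid b a h) m = cbraid b a (\<lambda>x y. Poly_Mapping.lookup (h x y) m)"
  by (simp add: braid_def cbraid_def lookup_add)

theorem braid_relation:
  assumes "a \<noteq> 0" "b \<noteq> 0" "c \<noteq> 0"
  shows "braid a b (\<lambda>x y. braid y c (\<lambda>z w. braid x z (\<lambda>u v. h u v w)))
     = braid b c (\<lambda>x y. braid a x (\<lambda>z w. braid w y (\<lambda>u v. h z u v)))"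
proof (rule poly_mapping_eqI)
  fix m
  let ?h = "\<lambda>x y z. Poly_Mapping.lookup (h x y z) m"
  let ?p = "pbraid qvar (inverse qvar)"
  have pr: "qvar * inverse qvar = 1" by (simp add: qvar_nonzero)
  \<comment> \<open>The identification with \<open>pbraid\<close> holds for nonzero indices only;
    this congruence rule carries that condition into the inner braidings.\<close>
  have pc: "?p b a h = ?p b a h'" if "\<And>x y. x \<noteq> 0 \<Longrightarrow> y \<noteq> 0 \<Longrightarrow> h x y = h' x y" "a \<noteq> 0" "b \<noteq> 0" for a b h h'
    using that by (simp add: pbraid_def[OF pr])
  have "cbraid a b (\<lambda>x y. cbraid y c (\<lambda>z w. cbraid x z (\<lambda>u v. ?h u v w)))
      = ?p a b (\<lambda>x y. ?p y c (\<lambda>z w. ?p x z (\<lambda>u v. ?h u v w)))"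
    using assms by (simp add: cbraid_eq_pbraid cong: pc)
  moreover have "cbraid b c (\<lambda>x y. cbraid a x (\<lambda>z w. cbraid w y (\<lambda>u v. ?h z u v)))
      = ?p b c (\<lambda>x y. ?p a x (\<lambda>z w. ?p w y (\<lambda>u v. ?h z u v)))"
    using assms by (simp add: cbraid_eq_pbraid cong: pc)
  ultimately show "Poly_Mapping.lookup (braid a b (\<lambda>x y. braid y c (\<lambda>z w. braid x z (\<lambda>u v. h u v w)))) m
     = Poly_Mapping.lookup (braid b c (\<lambda>x y. braid a x (\<lambda>z w. braid w y (\<lambda>u v. h z u v)))) m"
    using pbraid_rel[OF pr assms] by (simp add: lookup_braid pbraid_rel_def[OF pr])
qed

theorem braid_hecke:
  assumes "a \<noteq> 0" "b \<noteq> 0"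
  shows "braid a b (\<lambda>x y. braid x y h) = h a b + scal xi (braid a b h)"
proof (rule poly_mapping_eqI)
  fix m
  let ?h = "\<lambda>x y. Poly_Mapping.lookup (h x y) m"
  let ?p = "pbraid qvar (inverse qvar)"
  have pr: "qvar * inverse qvar = 1" by (simp add: qvar_nonzero)
  have pc: "?p b a h = ?p b a h'" if "\<And>x y. x \<noteq> 0 \<Longrightarrow> y \<noteq> 0 \<Longrightarrow> h x y = h' x y" "a \<noteq> 0" "b \<noteq> 0" for a b h h'
    using that by (simp add: pbraid_def[OF pr])
  have "cbraid a b (\<lambda>x y. cbraid x y ?h) = ?p a b (\<lambda>x y. ?p x y ?h)"
    using assms by (simp add: cbraid_eq_pbraid cong: pc)
  then show "Poly_Mapping.lookup (braid a b (\<lambda>x y. braid x y h)) m = Poly_Mapping.lookup (h a b + scal xi (braid a b h)) m"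
    using pbraid_hecke[OF pr assms, of ?h] assms
    by (simp add: lookup_braid lookup_add cbraid_eq_pbraid xi_def)
qed

section \<open>Linear maps on formal linear combinations\<close>

abbreviation coeff_of :: "vec \<Rightarrow> mono \<Rightarrow> Cq" where
  "coeff_of \<equiv> Poly_Mapping.lookup"

abbreviation supp :: "vec \<Rightarrow> mono set" where
  "supp \<equiv> Poly_Mapping.keys"

text \<open>Linearity on the whole type \<open>vec\<close>: operators are defined on all monomials,
  and only afterwards compared on spans or reduced modulo relators.\<close>

definition vlin :: "(vec \<Rightarrow> vec) \<Rightarrow> bool" where
  "vlin f \<longleftrightarrow> (\<forall>x y. f (x + y) = f x + f y) \<and> (\<forall>c x. f (scal c x) = scal c (f x))"

lemma vlin_add: "vlin f \<Longrightarrow> f (x + y) = f x + f y"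
  and vlin_scal: "vlin f \<Longrightarrow> f (scal c x) = scal c (f x)"
  by (simp_all add: vlin_def)

lemma vlin_zero: "vlin f \<Longrightarrow> f 0 = 0"
  using vlin_scal[of f 0 0] by simp

lemma vlin_diff: "vlin f \<Longrightarrow> f (x - y) = f x - f y"
  using vlin_add[of f "x - y" y] by simp

lemma vlin_sum: "vlin f \<Longrightarrow> f (sum g S) = (\<Sum>i\<in>S. f (g i))"
  by (induction S rule: infinite_finite_induct) (simp_all add: vlin_zero vlin_add)

lemma vlin_intros [intro]:
  "vlin (\<lambda>x. x)" "vlin (\<lambda>x. 0)"
  "vlin f \<Longrightarrow> vlin g \<Longrightarrow> vlin (\<lambda>x. f x + g x)"
  "vlin f \<Longrightarrow> vlin g \<Longrightarrow> vlin (\<lambda>x. f x - g x)"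
  "vlin f \<Longrightarrow> vlin (\<lambda>x. scal c (f x))"
  by (simp_all add: vlin_def vec.scale_right_distrib vec.scale_right_diff_distrib mult.commute)

lemma vlin_comp: "vlin f \<Longrightarrow> vlin g \<Longrightarrow> vlin (\<lambda>x. f (g x))"
  by (simp add: vlin_def)

lemma coeff_sum: "coeff_of (sum g S) m = (\<Sum>i\<in>S. coeff_of (g i) m)"
  by (induction S rule: infinite_finite_induct) (simp_all add: lookup_add)

lemma lin_superset:
  assumes "finite S" "supp x \<subseteq> S"
  shows "lin f x = (\<Sum>m\<in>S. scal (coeff_of x m) (f m))"
  unfolding lin_def by (rule sum.mono_neutral_left) (use assms in \<open>auto simp: in_keys_iff\<close>)

lemma keys_scal: "supp (scal c x) \<subseteq> supp x"
  by (auto simp: in_keys_iff)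

lemma vlin_lin: "vlin (lin f)"
  unfolding vlin_def
proof safe
  fix x y :: vec
  let ?S = "supp x \<union> supp y"
  have "lin f (x + y) = (\<Sum>m\<in>?S. scal (coeff_of (x + y) m) (f m))"
    by (rule lin_superset) (auto simp: in_keys_iff lookup_add)
  then show "lin f (x + y) = lin f x + lin f y"
    by (simp add: lin_superset[of ?S] lookup_add vec.scale_left_distrib sum.distrib)
next
  fix c x
  have "lin f (scal c x) = (\<Sum>m\<in>supp x. scal (coeff_of (scal c x) m) (f m))"
    by (rule lin_superset) (auto simp: in_keys_iff)
  then show "lin f (scal c x) = scal c (lin f x)"
    by (simp add: lin_def vec.scale_sum_right)
qed

lemmas lin_add = vlin_add[OF vlin_lin] and lin_scal = vlin_scal[OF vlin_lin]
  and lin_zero = vlin_zero[OF vlin_lin] and lin_diff = vlin_diff[OF vlin_lin] and lin_sum = vlin_sum[OF vlin_lin]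

lemma lin_mon [simp]: "lin f (mon m) = f m"
  by (simp add: lin_def mon_def)

lemma vec_expand: "x = (\<Sum>m\<in>supp x. scal (coeff_of x m) (mon m))"
  by (rule poly_mapping_eqI) (auto simp: coeff_sum mon_def lookup_single when_def in_keys_iff if_distrib[of "(*) _"] cong: if_cong)

lemma vlin_eq_lin: "vlin f \<Longrightarrow> f x = lin (\<lambda>m. f (mon m)) x"
  by (subst vec_expand[of x]) (simp add: vlin_sum vlin_scal lin_def)

lemma lin_cong: "(\<And>m. m \<in> supp x \<Longrightarrow> f m = g m) \<Longrightarrow> lin f x = lin g x"
  by (simp add: lin_def)

lemma mem_vspan_iff: "x \<in> vspan B \<longleftrightarrow> supp x \<subseteq> B"
proof
  assume "x \<in> vspan B"
  then show "supp x \<subseteq> B"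
  proof (induction rule: vec.span_induct_alt)
    case base then show ?case by simp
  next
    case (step c x y)
    then show ?case using keys_scal[of c x] Poly_Mapping.keys_add[of "scal c x" y] by (fastforce simp: mon_def)
  qed
next
  assume "supp x \<subseteq> B"
  then show "x \<in> vspan B"
    by (subst vec_expand) (blast intro: vec.span_sum vec.span_scale vec.span_base)
qed

lemma mon_in_vspan [simp]: "m \<in> B \<Longrightarrow> mon m \<in> vspan B"
  by (auto intro: vec.span_base)

lemma vlin_ext:
  assumes "vlin f" "vlin g" "x \<in> vspan B" "\<And>m. m \<in> B \<Longrightarrow> f (mon m) = g (mon m)"
  shows "f x = g x"
proof -
  have "lin (\<lambda>m. f (mon m)) x = lin (\<lambda>m. g (mon m)) x"
    using assms(3,4) unfolding mem_vspan_iff by (blast intro: lin_cong)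
  then show ?thesis
    using vlin_eq_lin[OF assms(1), of x] vlin_eq_lin[OF assms(2), of x] by (simp only:)
qed

lemma lin_mem:
  assumes "vec.subspace W" "\<And>m. m \<in> supp x \<Longrightarrow> f m \<in> W"
  shows "lin f x \<in> W"
  unfolding lin_def using assms by (auto intro!: vec.subspace_sum vec.subspace_scale)

lemma lin_mem_vspan:
  assumes "x \<in> vspan B" "\<And>m. m \<in> B \<Longrightarrow> f m \<in> vspan B'"
  shows "lin f x \<in> vspan B'"
  by (rule lin_mem) (use assms in \<open>auto simp: mem_vspan_iff[of x] intro: vec.subspace_span\<close>)

lemma vlin_span_mem:
  assumes "vlin f" "vec.subspace W" "x \<in> vec.span S" "\<And>y. y \<in> S \<Longrightarrow> f y \<in> W"
  shows "f x \<in> W"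
  using assms(3)
  by (induction rule: vec.span_induct_alt)
    (use assms in \<open>auto simp: vlin_zero vlin_add vlin_scal vec.subspace_0 intro: vec.subspace_add vec.subspace_scale\<close>)

lemma vlin_lin_right [intro]: "(\<And>m. vlin (h m)) \<Longrightarrow> vlin (\<lambda>y. lin (\<lambda>m. h m y) x)"
  by (auto simp: vlin_def lin_def sum.distrib vec.scale_right_distrib vec.scale_sum_right mult.commute)

lemma vlin_lin_left [intro]: "vlin g \<Longrightarrow> vlin (\<lambda>x. lin f (g x))"
  using vlin_comp[OF vlin_lin] .

lemma lin_swap: "lin (\<lambda>a. lin (\<lambda>b. f a b) y) x = lin (\<lambda>b. lin (\<lambda>a. f a b) x) y"
  unfolding lin_def vec.scale_sum_right by (subst sum.swap) (simp add: mult.commute)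

lemma vtens_mon [simp]: "mon a \<boxtimes> mon b = mon (Tens a b)"
  by (simp add: vtens_def)

lemma kprod_mon [simp]: "mon a \<star> mon b = kmono a b"
  by (simp add: kprod_def)

lemma vlin_vtens_left [intro]: "vlin f \<Longrightarrow> vlin (\<lambda>x. f x \<boxtimes> y)"
  unfolding vtens_def by (rule vlin_lin_left)

lemma vlin_vtens_right [intro]: "vlin f \<Longrightarrow> vlin (\<lambda>x. y \<boxtimes> f x)"
  unfolding vtens_def by (intro vlin_lin_right vlin_lin_left)

lemma vlin_kprod_left [intro]: "vlin f \<Longrightarrow> vlin (\<lambda>x. f x \<star> y)"
  unfolding kprod_def by (rule vlin_lin_left)

lemma vlin_kprod_right [intro]: "vlin f \<Longrightarrow> vlin (\<lambda>x. y \<star> f x)"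
  unfolding kprod_def by (intro vlin_lin_right vlin_lin_left)

lemmas vtens_l = vlin_vtens_left[OF vlin_intros(1)] and vtens_r = vlin_vtens_right[OF vlin_intros(1)]
lemmas kprod_l = vlin_kprod_left[OF vlin_intros(1)] and kprod_r = vlin_kprod_right[OF vlin_intros(1)]

lemmas vtens_simps =
  vlin_add[OF vtens_l] vlin_add[OF vtens_r] vlin_scal[OF vtens_l] vlin_scal[OF vtens_r]
  vlin_zero[OF vtens_l] vlin_zero[OF vtens_r] vlin_diff[OF vtens_l] vlin_diff[OF vtens_r]
lemmas vtens_sum = vlin_sum[OF vtens_l] vlin_sum[OF vtens_r]
lemmas kprod_simps =
  vlin_add[OF kprod_l] vlin_add[OF kprod_r] vlin_scal[OF kprod_l] vlin_scal[OF kprod_r]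
  vlin_zero[OF kprod_l] vlin_zero[OF kprod_r] vlin_diff[OF kprod_l] vlin_diff[OF kprod_r]
lemmas kprod_sum = vlin_sum[OF kprod_l] vlin_sum[OF kprod_r]

lemma vtens_mem_vspan:
  assumes "x \<in> vspan B" "y \<in> vspan B'" "\<And>a b. a \<in> B \<Longrightarrow> b \<in> B' \<Longrightarrow> Tens a b \<in> B''"
  shows "x \<boxtimes> y \<in> vspan B''"
  unfolding vtens_def by (intro lin_mem_vspan[OF assms(1)] lin_mem_vspan[OF assms(2)]) (use assms(3) in simp)

section \<open>Quotient superspaces\<close>

definition even_part :: "vec \<Rightarrow> vec" where
  "even_part = lin (\<lambda>m. if even (par m) then mon m else 0)"

lemma vlin_even_part: "vlin even_part"
  unfolding even_part_def by (rule vlin_lin)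

lemma even_part_mem: "x \<in> vspan B \<Longrightarrow> even_part x \<in> vspan {m \<in> B. par m mod 2 = 0}"
  unfolding even_part_def by (erule lin_mem_vspan) (simp add: vec.span_zero even_iff_mod_2_eq_zero)

lemma odd_part_mem:
  assumes x: "x \<in> vspan B"
  shows "x - even_part x \<in> vspan {m \<in> B. par m mod 2 = 1}"
proof -
  let ?f = "\<lambda>m. mon m - (if even (par m) then mon m else 0)"
  have "lin ?f x \<in> vspan {m \<in> B. par m mod 2 = 1}"
    by (rule lin_mem_vspan[OF x]) (simp add: vec.span_zero odd_iff_mod_2_eq_one)
  moreover have "x - even_part x = lin ?f x"
    unfolding even_part_def by (rule vlin_ext[OF vlin_intros(4)[OF vlin_intros(1) vlin_lin] vlin_lin x]) simp
  ultimately show ?thesis by (simp only:)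
qed

lemma even_part_even: "x \<in> vspan {m \<in> B. par m mod 2 = 0} \<Longrightarrow> even_part x = x"
  unfolding even_part_def by (rule vlin_ext[OF vlin_lin vlin_intros(1)]) auto

lemma even_part_odd: "x \<in> vspan {m \<in> B. par m mod 2 = 1} \<Longrightarrow> even_part x = 0"
  unfolding even_part_def by (rule vlin_ext[OF vlin_lin vlin_intros(2)]) auto

lemma coset_eq_iff:
  assumes "vec.subspace N"
  shows "coset N x = coset N y \<longleftrightarrow> x - y \<in> N"
proof
  assume "coset N x = coset N y"
  moreover have "x \<in> coset N x" using assms by (simp add: coset_def vec.subspace_0)
  ultimately show "x - y \<in> N" by (simp add: coset_def)
next
  assume xy: "x - y \<in> N"
  have "z - x \<in> N \<longleftrightarrow> z - y \<in> N" for z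
    using vec.subspace_add[OF assms xy, of "z - x"] vec.subspace_diff[OF assms _ xy, of "z - y"]
    by (auto simp: algebra_simps)
  then show "coset N x = coset N y" by (simp add: coset_def)
qed

lemma rep_coset:
  assumes "vec.subspace N"
  shows "rep (coset N x) - x \<in> N"
proof -
  have "x \<in> coset N x" using assms by (simp add: coset_def vec.subspace_0)
  then have "rep (coset N x) \<in> coset N x" unfolding rep_def by (rule someI)
  then show ?thesis by (simp add: coset_def)
qed

lemma coset_rep: "vec.subspace N \<Longrightarrow> coset N (rep (coset N x)) = coset N x"
  by (simp add: coset_eq_iff rep_coset)

text \<open>An intrinsic form of \<open>qspace\<close>, stable under adding an action to the record
  and under replacing the multiplication. The last clause says that the relations form a graded
  subspace.\<close>

definition qsp :: "('z) space_scheme \<Rightarrow> bool" where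
  "qsp V \<longleftrightarrow> vec.subspace (rels V) \<and> rels V \<subseteq> vspan (bas V) \<and>
     carrier V = coset (rels V) ` vspan (bas V) \<and> \<zero>\<^bsub>V\<^esub> = cls V 0 \<and>
     (\<forall>x y. x \<oplus>\<^bsub>V\<^esub> y = cls V (rep x + rep y)) \<and> (\<forall>c x. c \<odot>\<^bsub>V\<^esub> x = cls V (scal c (rep x))) \<and>
     (\<forall>x\<in>rels V. even_part x \<in> rels V)"

lemma qsp_qspace:
  assumes "vec.subspace N" "N \<subseteq> vspan B" "\<And>x. x \<in> N \<Longrightarrow> even_part x \<in> N"
  shows "qsp (qspace B N)"
  using assms by (simp add: qsp_def qspace_def)

context
  fixes V :: "('z) space_scheme"
  assumes V: "qsp V"
begin

lemma qsp_sub: "vec.subspace (rels V)" using V by (simp add: qsp_def)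

lemma qsp_rels: "rels V \<subseteq> vspan (bas V)" using V by (simp add: qsp_def)

lemma cls_eq_iff: "cls V x = cls V y \<longleftrightarrow> x - y \<in> rels V"
  by (rule coset_eq_iff[OF qsp_sub])

lemma rep_cls: "rep (cls V x) - x \<in> rels V"
  by (rule rep_coset[OF qsp_sub])

lemma cls_closed [intro]: "x \<in> vspan (bas V) \<Longrightarrow> cls V x \<in> carrier V"
  using V by (simp add: qsp_def)

lemma cls_rep: "Z \<in> carrier V \<Longrightarrow> cls V (rep Z) = Z"
  using V by (auto simp: qsp_def coset_rep)

lemma rep_mem: "Z \<in> carrier V \<Longrightarrow> rep Z \<in> vspan (bas V)"
proof -
  assume "Z \<in> carrier V"
  then obtain x where x: "x \<in> vspan (bas V)" "Z = cls V x" using V by (auto simp: qsp_def)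
  then have "rep Z - x \<in> vspan (bas V)" using rep_cls[of x] qsp_rels by auto
  then show ?thesis using vec.span_add[OF _ x(1)] by fastforce
qed

lemma carrier_cls:
  assumes "Z \<in> carrier V"
  obtains x where "x \<in> vspan (bas V)" "Z = cls V x"
  using that[OF rep_mem[OF assms] cls_rep[OF assms, symmetric]] .

lemma cls_add: "cls V x \<oplus>\<^bsub>V\<^esub> cls V y = cls V (x + y)"
proof -
  have "cls V x \<oplus>\<^bsub>V\<^esub> cls V y = cls V (rep (cls V x) + rep (cls V y))" using V by (simp add: qsp_def)
  also have "\<dots> = cls V (x + y)"
    unfolding cls_eq_iff using vec.subspace_add[OF qsp_sub rep_cls[of x] rep_cls[of y]] by (simp add: algebra_simps)
  finally show ?thesis .
qed

lemma cls_smult: "c \<odot>\<^bsub>V\<^esub> cls V x = cls V (scal c x)"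
proof -
  have "c \<odot>\<^bsub>V\<^esub> cls V x = cls V (scal c (rep (cls V x)))" using V by (simp add: qsp_def)
  also have "\<dots> = cls V (scal c x)"
    unfolding cls_eq_iff using vec.subspace_scale[OF qsp_sub rep_cls[of x], of c] by (simp add: vec.scale_right_diff_distrib)
  finally show ?thesis .
qed

lemma zero_cls: "\<zero>\<^bsub>V\<^esub> = cls V 0" using V by (simp add: qsp_def)

lemma qsp_add_closed: "x \<in> carrier V \<Longrightarrow> y \<in> carrier V \<Longrightarrow> x \<oplus>\<^bsub>V\<^esub> y \<in> carrier V"
  by (elim carrier_cls) (auto simp: cls_add intro: vec.span_add)

lemma qsp_smult_closed: "x \<in> carrier V \<Longrightarrow> c \<odot>\<^bsub>V\<^esub> x \<in> carrier V"
  by (elim carrier_cls) (auto simp: cls_smult intro: vec.span_scale)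

lemma homogE:
  assumes "Z \<in> homog V p"
  obtains x where "x \<in> vspan {m \<in> bas V. par m mod 2 = p}" "Z = cls V x"
  using assms by (auto simp: homog_def)

lemma homog_carrier: "homog V p \<subseteq> carrier V"
  using vec.span_mono[of "mon ` {m \<in> bas V. par m mod 2 = p}" "mon ` bas V"] by (auto simp: homog_def)

lemma homog_add: "x \<in> homog V p \<Longrightarrow> y \<in> homog V p \<Longrightarrow> x \<oplus>\<^bsub>V\<^esub> y \<in> homog V p"
  by (elim homogE) (auto simp: cls_add homog_def intro!: imageI vec.span_add)

lemma homog_smult: "x \<in> homog V p \<Longrightarrow> c \<odot>\<^bsub>V\<^esub> x \<in> homog V p"
  by (elim homogE) (auto simp: cls_smult homog_def intro!: imageI vec.span_scale)

lemma homog_mon: "m \<in> bas V \<Longrightarrow> cls V (mon m) \<in> homog V (par m mod 2)"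
  by (auto simp: homog_def)

lemma qsp_module: "module Cq_ring V"
proof (rule moduleI)
  show "cring Cq_ring"
    by (rule cring_from_type_algebra)
  show "abelian_group V"
  proof (rule abelian_groupI)
    fix x assume "x \<in> carrier V"
    then obtain u where u: "u \<in> vspan (bas V)" "x = cls V u" by (rule carrier_cls)
    then show "\<exists>y\<in>carrier V. y \<oplus>\<^bsub>V\<^esub> x = \<zero>\<^bsub>V\<^esub>"
      by (intro bexI[of _ "cls V (- u)"]) (auto simp: cls_add zero_cls intro!: vec.span_neg)
    show "\<zero>\<^bsub>V\<^esub> \<oplus>\<^bsub>V\<^esub> x = x" using u by (simp add: zero_cls cls_add)
    fix y assume "y \<in> carrier V"
    then obtain v where v: "v \<in> vspan (bas V)" "y = cls V v" by (rule carrier_cls)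
    then show "x \<oplus>\<^bsub>V\<^esub> y = y \<oplus>\<^bsub>V\<^esub> x" using u by (simp add: cls_add add.commute)
    fix z assume "z \<in> carrier V"
    then obtain w where w: "w \<in> vspan (bas V)" "z = cls V w" by (rule carrier_cls)
    then show "x \<oplus>\<^bsub>V\<^esub> y \<oplus>\<^bsub>V\<^esub> z = x \<oplus>\<^bsub>V\<^esub> (y \<oplus>\<^bsub>V\<^esub> z)" using u v by (simp add: cls_add add.assoc)
  qed (auto simp: zero_cls qsp_add_closed intro: vec.span_zero)
next
  fix c d :: Cq and x assume "x \<in> carrier V"
  then obtain u where u: "u \<in> vspan (bas V)" "x = cls V u" by (rule carrier_cls)
  show "(c \<oplus>\<^bsub>Cq_ring\<^esub> d) \<odot>\<^bsub>V\<^esub> x = c \<odot>\<^bsub>V\<^esub> x \<oplus>\<^bsub>V\<^esub> d \<odot>\<^bsub>V\<^esub> x"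
    using u by (simp add: ring_of_type_algebra_def cls_smult cls_add vec.scale_left_distrib)
  show "(c \<otimes>\<^bsub>Cq_ring\<^esub> d) \<odot>\<^bsub>V\<^esub> x = c \<odot>\<^bsub>V\<^esub> (d \<odot>\<^bsub>V\<^esub> x)"
    using u by (simp add: ring_of_type_algebra_def cls_smult)
  show "\<one>\<^bsub>Cq_ring\<^esub> \<odot>\<^bsub>V\<^esub> x = x"
    using u by (simp add: ring_of_type_algebra_def cls_smult)
  fix y assume "y \<in> carrier V"
  then obtain v where v: "v \<in> vspan (bas V)" "y = cls V v" by (rule carrier_cls)
  show "c \<odot>\<^bsub>V\<^esub> (x \<oplus>\<^bsub>V\<^esub> y) = c \<odot>\<^bsub>V\<^esub> x \<oplus>\<^bsub>V\<^esub> c \<odot>\<^bsub>V\<^esub> y"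
    using u v by (simp add: cls_smult cls_add vec.scale_right_distrib)
qed (auto intro: qsp_smult_closed)

lemma a_inv_smult: 
  assumes "x \<in> carrier V"
  shows "\<ominus>\<^bsub>V\<^esub> x = (-1) \<odot>\<^bsub>V\<^esub> x"
proof -
  interpret module Cq_ring V by (rule qsp_module)
  obtain u where u: "u \<in> vspan (bas V)" "x = cls V u" using assms by (rule carrier_cls)
  have "x \<oplus>\<^bsub>V\<^esub> ((-1) \<odot>\<^bsub>V\<^esub> x) = \<zero>\<^bsub>V\<^esub>"
    using u by (simp add: cls_smult cls_add zero_cls)
  then have "((-1) \<odot>\<^bsub>V\<^esub> x) \<oplus>\<^bsub>V\<^esub> x = \<zero>\<^bsub>V\<^esub>"
    using assms by (simp add: M.a_comm qsp_smult_closed)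
  then show ?thesis
    using assms by (intro M.minus_equality) (auto simp: qsp_smult_closed)
qed

lemma qsp_homog_submodule: "submodule (homog V p) Cq_ring V"
proof -
  interpret module Cq_ring V by (rule qsp_module)
  show ?thesis
  proof (rule submoduleI)
    show "\<zero>\<^bsub>V\<^esub> \<in> homog V p" by (auto simp: zero_cls homog_def intro!: imageI vec.span_zero)
  qed (use homog_carrier[of p] a_inv_smult homog_smult homog_add in auto)
qed

text \<open>Uniqueness rests on the gradedness of the relations: if two decompositions differ by a
  relation, its even part is again a relation, and this compares the even components.\<close>

lemma qsp_decomp:
  assumes "x \<in> carrier V"
  shows "\<exists>!(y, z). y \<in> homog V 0 \<and> z \<in> homog V 1 \<and> x = y \<oplus>\<^bsub>V\<^esub> z"
proof -
  obtain u where u: "u \<in> vspan (bas V)" "x = cls V u" using assms by (rule carrier_cls)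
  show ?thesis
  proof (rule ex1I[of _ "(cls V (even_part u), cls V (u - even_part u))"], goal_cases)
    case 1
    show ?case using even_part_mem[OF u(1)] odd_part_mem[OF u(1)] u(2) by (auto simp: homog_def cls_add)
  next
    case (2 yz)
    obtain y z where yz: "yz = (y, z)" by force
    with 2 obtain v w where v: "v \<in> vspan {m \<in> bas V. par m mod 2 = 0}" "y = cls V v"
      and w: "w \<in> vspan {m \<in> bas V. par m mod 2 = 1}" "z = cls V w" and "x = cls V (v + w)"
      by (auto elim!: homogE simp: cls_add)
    then have *: "u - (v + w) \<in> rels V" using u(2) by (simp add: cls_eq_iff)
    then have "even_part (u - (v + w)) \<in> rels V" using V by (simp add: qsp_def)
    then have **: "even_part u - v \<in> rels V"
      by (simp add: vlin_diff[OF vlin_even_part] vlin_add[OF vlin_even_part] even_part_even[OF v(1)] even_part_odd[OF w(1)])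
    then have "(u - even_part u) - w \<in> rels V"
      using vec.subspace_diff[OF qsp_sub * **] by (simp add: algebra_simps)
    with ** have "cls V (even_part u) = cls V v" "cls V (u - even_part u) = cls V w" by (simp_all add: cls_eq_iff)
    then show ?case by (simp add: yz v(2) w(2))
  qed
qed

lemma qsp_superspace: "superspace V"
  unfolding superspace_def using qsp_module qsp_homog_submodule qsp_decomp by blast

end

section \<open>Linear and bilinear maps between quotient superspaces\<close>

definition lmap :: "('y) space_scheme \<Rightarrow> ('z) space_scheme \<Rightarrow> (vec set \<Rightarrow> vec set) \<Rightarrow> bool" where
  "lmap V W F \<longleftrightarrow> F \<in> carrier V \<rightarrow> carrier W \<and>
     (\<forall>x\<in>carrier V. \<forall>y\<in>carrier V. F (x \<oplus>\<^bsub>V\<^esub> y) = F x \<oplus>\<^bsub>W\<^esub> F y) \<and>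
     (\<forall>c. \<forall>x\<in>carrier V. F (c \<odot>\<^bsub>V\<^esub> x) = c \<odot>\<^bsub>W\<^esub> F x)"

lemma lmapD:
  assumes "lmap V W F"
  shows "x \<in> carrier V \<Longrightarrow> F x \<in> carrier W"
    and "x \<in> carrier V \<Longrightarrow> y \<in> carrier V \<Longrightarrow> F (x \<oplus>\<^bsub>V\<^esub> y) = F x \<oplus>\<^bsub>W\<^esub> F y"
    and "x \<in> carrier V \<Longrightarrow> F (c \<odot>\<^bsub>V\<^esub> x) = c \<odot>\<^bsub>W\<^esub> F x"
  using assms by (auto simp: lmap_def)

lemma lmapI:
  assumes "\<And>x. x \<in> carrier V \<Longrightarrow> F x \<in> carrier W"
    "\<And>x y. x \<in> carrier V \<Longrightarrow> y \<in> carrier V \<Longrightarrow> F (x \<oplus>\<^bsub>V\<^esub> y) = F x \<oplus>\<^bsub>W\<^esub> F y"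
    "\<And>x c. x \<in> carrier V \<Longrightarrow> F (c \<odot>\<^bsub>V\<^esub> x) = c \<odot>\<^bsub>W\<^esub> F x"
  shows "lmap V W F"
  using assms by (auto simp: lmap_def)

lemma even_linear_iff:
  "even_linear V W F \<longleftrightarrow> lmap V W F \<and> (\<forall>p\<in>{0, 1}. F \<in> homog V p \<rightarrow> homog W p)"
  by (auto simp: even_linear_def lmap_def)

lemma lmap_comp: "lmap V W F \<Longrightarrow> lmap W U G \<Longrightarrow> lmap V U (\<lambda>x. G (F x))"
  by (auto simp: lmap_def Pi_iff)

lemma lmap_cls_sum:
  assumes V: "qsp V" and W: "qsp W" and F: "lmap V W F" and "finite S"
    and h: "\<And>i. i \<in> S \<Longrightarrow> h i \<in> vspan (bas V)"
  shows "F (cls V (\<Sum>i\<in>S. scal (c i) (h i))) = cls W (\<Sum>i\<in>S. scal (c i) (rep (F (cls V (h i)))))"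
  using \<open>finite S\<close> h
proof (induction S)
  case empty
  have "cls V 0 \<in> carrier V" using V by (auto intro: vec.span_zero)
  then have "F (0 \<odot>\<^bsub>V\<^esub> cls V 0) = 0 \<odot>\<^bsub>W\<^esub> F (cls V 0)" "F (cls V 0) \<in> carrier W"
    using F by (auto dest: lmapD)
  then show ?case
    using cls_smult[OF V, of 0 0] cls_smult[OF W, of 0 "rep (F (cls V 0))"] cls_rep[OF W, of "F (cls V 0)"] by simp
next
  case (insert i S)
  have c: "cls V (h i) \<in> carrier V" "cls V (\<Sum>i\<in>S. scal (c i) (h i)) \<in> carrier V"
    using insert.prems V by (auto intro!: vec.span_sum vec.span_scale)
  have *: "F (c i \<odot>\<^bsub>V\<^esub> cls V (h i)) = c i \<odot>\<^bsub>W\<^esub> cls W (rep (F (cls V (h i))))"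
    using c lmapD[OF F] by (simp add: cls_rep[OF W])
  have "F (cls V (\<Sum>i\<in>insert i S. scal (c i) (h i)))
      = F (c i \<odot>\<^bsub>V\<^esub> cls V (h i) \<oplus>\<^bsub>V\<^esub> cls V (\<Sum>i\<in>S. scal (c i) (h i)))"
    using insert.hyps by (simp add: cls_smult[OF V] cls_add[OF V])
  also have "\<dots> = F (c i \<odot>\<^bsub>V\<^esub> cls V (h i)) \<oplus>\<^bsub>W\<^esub> F (cls V (\<Sum>i\<in>S. scal (c i) (h i)))"
    using c by (intro lmapD(2)[OF F]) (simp_all add: qsp_smult_closed[OF V])
  finally show ?case
    using insert * by (simp add: cls_smult[OF W] cls_add[OF W])
qed

lemma lmap_cls_lin:
  assumes "qsp V" "qsp W" "lmap V W F" "\<And>m. m \<in> supp x \<Longrightarrow> h m \<in> vspan (bas V)"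
  shows "F (cls V (lin h x)) = cls W (lin (\<lambda>m. rep (F (cls V (h m)))) x)"
  unfolding lin_def using assms by (intro lmap_cls_sum) auto

lemma lmap_cls:
  assumes "qsp V" "qsp W" "lmap V W F" "x \<in> vspan (bas V)"
  shows "F (cls V x) = cls W (lin (\<lambda>m. rep (F (cls V (mon m)))) x)"
proof -
  have "lin mon x = x" using vlin_eq_lin[OF vlin_intros(1), of x] by simp
  moreover have "mon m \<in> vspan (bas V)" if "m \<in> supp x" for m
    using assms(4) that by (auto simp: mem_vspan_iff[of x])
  ultimately show ?thesis
    using lmap_cls_lin[OF assms(1-3), of x mon] by simp
qed

lemma lmap_ext:
  assumes "qsp V" "qsp W" "lmap V W F" "lmap V W G" "\<And>m. m \<in> bas V \<Longrightarrow> F (cls V (mon m)) = G (cls V (mon m))"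
    and "Z \<in> carrier V"
  shows "F Z = G Z"
proof -
  obtain x where x: "x \<in> vspan (bas V)" "Z = cls V x" using carrier_cls[OF assms(1,6)] .
  have "lin (\<lambda>m. rep (F (cls V (mon m)))) x = lin (\<lambda>m. rep (G (cls V (mon m)))) x"
    using x(1) assms(5) by (intro lin_cong) (auto simp: mem_vspan_iff)
  then show ?thesis using lmap_cls[OF assms(1,2,3) x(1)] lmap_cls[OF assms(1,2,4) x(1)] x(2) by simp
qed

lemma lmap_of_vlin:
  assumes "qsp V" "qsp W" "vlin f" "\<And>m. m \<in> bas V \<Longrightarrow> f (mon m) \<in> vspan (bas W)"
    and "\<And>x. x \<in> rels V \<Longrightarrow> f x \<in> rels W"
    and "\<And>x. x \<in> vspan (bas V) \<Longrightarrow> F (cls V x) = cls W (f x)"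
  shows "lmap V W F"
proof -
  have c: "f x \<in> vspan (bas W)" if "x \<in> vspan (bas V)" for x
    using vlin_span_mem[OF assms(3) vec.subspace_span that] assms(4) by auto
  show ?thesis
    by (rule lmapI; (elim carrier_cls[OF assms(1)])?)
      (auto simp: cls_add[OF assms(1)] cls_add[OF assms(2)] cls_smult[OF assms(1)] cls_smult[OF assms(2)] assms(6)
        vlin_add[OF assms(3)] vlin_scal[OF assms(3)] c vec.span_add vec.span_scale intro!: cls_closed[OF assms(2)])
qed

lemma lmap_homog:
  assumes V: "qsp V" and W: "qsp W" and F: "lmap V W F"
    and m: "\<And>m. m \<in> bas V \<Longrightarrow> par m mod 2 = p \<Longrightarrow> F (cls V (mon m)) \<in> homog W p"
  shows "F \<in> homog V p \<rightarrow> homog W p"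
proof
  fix Z assume "Z \<in> homog V p"
  then obtain x where x: "x \<in> vspan {m \<in> bas V. par m mod 2 = p}" "Z = cls V x" by (rule homogE[OF V])
  have "F (cls V x) \<in> homog W p \<and> x \<in> vspan (bas V)"
    using x(1)
  proof (induction rule: vec.span_induct_alt)
    case base
    have "F (cls V 0) = cls W 0" using lmap_cls[OF V W F vec.span_zero] by (simp add: lin_zero)
    then show ?case by (auto simp: homog_def intro!: imageI vec.span_zero)
  next
    case (step c x y)
    then obtain m where m': "x = mon m" "m \<in> bas V" "par m mod 2 = p" by auto
    have "F (cls V (scal c x + y)) = F (c \<odot>\<^bsub>V\<^esub> cls V x \<oplus>\<^bsub>V\<^esub> cls V y)"
      by (simp add: cls_smult[OF V] cls_add[OF V])
    also have "\<dots> = c \<odot>\<^bsub>W\<^esub> F (cls V x) \<oplus>\<^bsub>W\<^esub> F (cls V y)"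
      using m' step.IH by (simp add: lmapD[OF F] qsp_smult_closed[OF V] cls_closed[OF V])
    finally show ?case
      using m[OF m'(2,3)] step.IH m' by (auto intro!: homog_add[OF W] homog_smult[OF W] vec.span_add vec.span_scale)
  qed
  then show "F Z \<in> homog W p" using x(2) by simp
qed

lemma bilinear_ext:
  assumes "\<And>y. vlin (\<lambda>x. f x y)" "\<And>x. vlin (f x)" "\<And>y. vlin (\<lambda>x. g x y)" "\<And>x. vlin (g x)"
    and "\<And>a b. a \<in> B \<Longrightarrow> b \<in> B' \<Longrightarrow> f (mon a) (mon b) = g (mon a) (mon b)"
    and x: "x \<in> vspan B" and y: "y \<in> vspan B'"
  shows "f x y = g x y"
  by (rule vlin_ext[OF assms(1,3) x], rule vlin_ext[OF assms(2,4) y], rule assms(5))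

lemma UNIV_vspan [simp]: "x \<in> vspan UNIV"
  by (simp add: mem_vspan_iff)

lemmas vlin_rules = vlin_intros vlin_lin vlin_lin_left vlin_lin_right vlin_vtens_left vlin_vtens_right
  vlin_kprod_left vlin_kprod_right

section \<open>Tensor products\<close>

lemma even_part_vtens:
  "even_part (x \<boxtimes> y) = even_part x \<boxtimes> even_part y + (x - even_part x) \<boxtimes> (y - even_part y)"
proof (rule bilinear_ext[where f = "\<lambda>x y. even_part (x \<boxtimes> y)" and B = UNIV and B' = UNIV
      and g = "\<lambda>x y. even_part x \<boxtimes> even_part y + (x - even_part x) \<boxtimes> (y - even_part y)"])
  fix a b
  show "even_part (mon a \<boxtimes> mon b)
      = even_part (mon a) \<boxtimes> even_part (mon b) + (mon a - even_part (mon a)) \<boxtimes> (mon b - even_part (mon b))"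
    by (auto simp: even_part_def vtens_simps)
qed (intro vlin_rules vlin_even_part vlin_comp[OF vlin_even_part] UNIV_vspan)+

lemma qsp_tspace:
  assumes V: "qsp V" and W: "qsp W"
  shows "qsp (tspace V W)"
  unfolding tspace_def
proof (rule qsp_qspace)
  show "vec.subspace (trels V W)" by (simp add: trels_def vec.subspace_span)
  show "trels V W \<subseteq> vspan (tbas V W)"
    unfolding trels_def
  proof (rule vec.span_minimal)
    show "{x \<boxtimes> y |x y. x \<in> rels V \<and> y \<in> vspan (bas W)} \<union> {x \<boxtimes> y |x y. x \<in> vspan (bas V) \<and> y \<in> rels W} \<subseteq> vspan (tbas V W)"
      using qsp_rels[OF V] qsp_rels[OF W] by (auto intro!: vtens_mem_vspan simp: tbas_def)
  qed (rule vec.subspace_span)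
  fix x assume "x \<in> trels V W"
  then show "even_part x \<in> trels V W"
    unfolding trels_def
  proof (rule vlin_span_mem[OF vlin_even_part vec.subspace_span])
    fix z assume z: "z \<in> {x \<boxtimes> y |x y. x \<in> rels V \<and> y \<in> vspan (bas W)} \<union> {x \<boxtimes> y |x y. x \<in> vspan (bas V) \<and> y \<in> rels W}"
    \<comment> \<open>\<open>e\<close> and \<open>e'\<close> are the same fact at the record types
      of \<open>W\<close> and of \<open>V\<close>, whose type variables are fixed inside this
      proof.\<close>
    have e: "even_part x \<in> rels V'" "x - even_part x \<in> rels V'" if "qsp V'" "x \<in> rels V'" for x and V' :: "('d) space_scheme"
      using that vec.subspace_diff[of "rels V'"] by (auto simp: qsp_def)
    have e': "even_part x \<in> rels V'" "x - even_part x \<in> rels V'" if "qsp V'" "x \<in> rels V'" for x and V' :: "('c) space_scheme"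
      using that vec.subspace_diff[of "rels V'"] by (auto simp: qsp_def)
    have o: "even_part x \<in> vspan B" "x - even_part x \<in> vspan B" if "x \<in> vspan B" for x B
      using even_part_mem[OF that] odd_part_mem[OF that] vec.span_mono[of "mon ` {m \<in> B. par m mod 2 = 0}" "mon ` B"]
        vec.span_mono[of "mon ` {m \<in> B. par m mod 2 = 1}" "mon ` B"] by auto
    let ?S = "{x \<boxtimes> y |x y. x \<in> rels V \<and> y \<in> vspan (bas W)} \<union> {x \<boxtimes> y |x y. x \<in> vspan (bas V) \<and> y \<in> rels W}"
    have m1: "x \<boxtimes> y \<in> vec.span ?S" if "x \<in> rels V" "y \<in> vspan (bas W)" for x y
      using that by (intro vec.span_base) blast
    have m2: "x \<boxtimes> y \<in> vec.span ?S" if "x \<in> vspan (bas V)" "y \<in> rels W" for x y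
      using that by (intro vec.span_base) blast
    from z consider x y where "z = x \<boxtimes> y" "x \<in> rels V" "y \<in> vspan (bas W)"
      | x y where "z = x \<boxtimes> y" "x \<in> vspan (bas V)" "y \<in> rels W" by blast
    then show "even_part z \<in> vec.span ?S"
    proof cases
      case 1
      show ?thesis unfolding 1(1) even_part_vtens
        by (intro vec.span_add m1 e'[OF V] o 1)
    next
      case 2
      show ?thesis unfolding 2(1) even_part_vtens
        by (intro vec.span_add m2 e[OF W] o 2)
    qed
  qed
qed

lemma tspace_simps [simp]:
  "bas (tspace V W) = tbas V W" "rels (tspace V W) = trels V W"
  by (simp_all add: tspace_def qspace_def)

lemma Tens_tbas [simp]: "Tens a b \<in> tbas V W \<longleftrightarrow> a \<in> bas V \<and> b \<in> bas W"
  by (simp add: tbas_def)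

lemma tbasE:
  assumes "m \<in> tbas V W" obtains a b where "m = Tens a b" "a \<in> bas V" "b \<in> bas W"
  using assms by (auto simp: tbas_def)

lemma vtens_tbas: "x \<in> vspan (bas V) \<Longrightarrow> y \<in> vspan (bas W) \<Longrightarrow> x \<boxtimes> y \<in> vspan (tbas V W)"
  by (rule vtens_mem_vspan) auto

abbreviation tcase :: "(mono \<Rightarrow> mono \<Rightarrow> vec) \<Rightarrow> mono \<Rightarrow> vec" where
  "tcase h m \<equiv> (case m of Tens a b \<Rightarrow> h a b | _ \<Rightarrow> 0)"

lemma lin_tcase_vtens: "lin (tcase h) (x \<boxtimes> y) = lin (\<lambda>a. lin (\<lambda>b. h a b) y) x"
  by (rule bilinear_ext[where f = "\<lambda>x y. lin (tcase h) (x \<boxtimes> y)" and g = "\<lambda>x y. lin (\<lambda>a. lin (\<lambda>b. h a b) y) x"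
      and B = UNIV and B' = UNIV]) (simp_all, (intro vlin_rules)+)

context
  fixes V :: "('y) space_scheme" and W :: "('z) space_scheme"
  assumes V: "qsp V" and W: "qsp W"
begin

lemmas tspace_facts =
  cls_closed[OF qsp_tspace[OF V W], unfolded tspace_simps] cls_add[OF qsp_tspace[OF V W], unfolded tspace_simps]
  cls_smult[OF qsp_tspace[OF V W], unfolded tspace_simps]

lemma pure_cls:
  assumes x: "x \<in> vspan (bas V)" and y: "y \<in> vspan (bas W)"
  shows "pure V W (cls V x) (cls W y) = cls (tspace V W) (x \<boxtimes> y)"
proof -
  let ?x = "rep (cls V x)" and ?y = "rep (cls W y)"
  have "(?x - x) \<boxtimes> ?y \<in> trels V W" "x \<boxtimes> (?y - y) \<in> trels V W"
    unfolding trels_def using rep_cls[OF V, of x] rep_cls[OF W, of y] rep_mem[OF W cls_closed[OF W y]] x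
    by (blast intro: vec.span_base)+
  then have "(?x - x) \<boxtimes> ?y + x \<boxtimes> (?y - y) \<in> trels V W"
    unfolding trels_def by (rule vec.span_add)
  then show ?thesis
    unfolding pure_def cls_eq_iff[OF qsp_tspace[OF V W]] by (simp add: vtens_simps)
qed

lemma pure_mon: "a \<in> bas V \<Longrightarrow> b \<in> bas W \<Longrightarrow> pure V W (cls V (mon a)) (cls W (mon b)) = cls (tspace V W) (mon (Tens a b))"
  by (simp add: pure_cls)

lemma pure_closed: "x \<in> carrier V \<Longrightarrow> y \<in> carrier W \<Longrightarrow> pure V W x y \<in> carrier (tspace V W)"
  by (elim carrier_cls[OF V] carrier_cls[OF W])
    (auto simp: pure_cls intro!: tspace_facts(1) vtens_tbas)

lemma rep_tspace: "Z \<in> carrier (tspace V W) \<Longrightarrow> supp (rep Z) \<subseteq> tbas V W"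
  using rep_mem[OF qsp_tspace[OF V W]] by (simp add: mem_vspan_iff)

lemma tsum_cong:
  assumes U: "qsp U" and Z: "Z \<in> carrier (tspace V W)"
    and h: "\<And>a b. a \<in> bas V \<Longrightarrow> b \<in> bas W \<Longrightarrow> cls U (h a b) = cls U (h' a b)"
  shows "tsum (rels U) h Z = tsum (rels U) h' Z"
proof -
  have "lin (\<lambda>m. tcase h m - tcase h' m) (rep Z) \<in> rels U"
    using rep_tspace[OF Z] h by (intro lin_mem[OF qsp_sub[OF U]]) (auto elim!: tbasE simp: cls_eq_iff[OF U])
  moreover have "lin (\<lambda>m. tcase h m - tcase h' m) (rep Z) = lin (tcase h) (rep Z) - lin (tcase h') (rep Z)"
    by (simp add: lin_def vec.scale_right_diff_distrib sum_subtractf)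
  ultimately show ?thesis unfolding tsum_def by (simp add: cls_eq_iff[OF U])
qed

lemma tsum_closed:
  assumes U: "qsp U" and Z: "Z \<in> carrier (tspace V W)"
    and h: "\<And>a b. a \<in> bas V \<Longrightarrow> b \<in> bas W \<Longrightarrow> h a b \<in> vspan (bas U)"
  shows "tsum (rels U) h Z \<in> carrier U"
  unfolding tsum_def
  using rep_mem[OF qsp_tspace[OF V W] Z] h by (intro cls_closed[OF U] lin_mem_vspan) (auto elim!: tbasE)

lemma tsum_push:
  assumes U: "qsp U" and U': "qsp U'" and F: "lmap U U' F" and Z: "Z \<in> carrier (tspace V W)"
    and h: "\<And>a b. a \<in> bas V \<Longrightarrow> b \<in> bas W \<Longrightarrow> h a b \<in> vspan (bas U)"
  shows "F (tsum (rels U) h Z) = tsum (rels U') (\<lambda>a b. rep (F (cls U (h a b)))) Z"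
proof -
  have "F (tsum (rels U) h Z) = cls U' (lin (\<lambda>m. rep (F (cls U (tcase h m)))) (rep Z))"
    unfolding tsum_def using rep_tspace[OF Z] h by (intro lmap_cls_lin[OF U U' F]) (auto elim!: tbasE)
  also have "lin (\<lambda>m. rep (F (cls U (tcase h m)))) (rep Z) = lin (tcase (\<lambda>a b. rep (F (cls U (h a b))))) (rep Z)"
    using rep_tspace[OF Z] by (intro lin_cong) (auto elim!: tbasE)
  finally show ?thesis by (simp add: tsum_def)
qed

lemma tlift_cong:
  assumes "qsp U" "Z \<in> carrier (tspace V W)"
    and "\<And>a b. a \<in> bas V \<Longrightarrow> b \<in> bas W \<Longrightarrow> f (cls V (mon a)) (cls W (mon b)) = g (cls V (mon a)) (cls W (mon b))"
  shows "tlift V W U f Z = tlift V W U g Z"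
  unfolding tlift_def using assms by (intro tsum_cong) auto

lemma tlift_closed:
  assumes U: "qsp U" and "Z \<in> carrier (tspace V W)"
    and "\<And>x y. x \<in> carrier V \<Longrightarrow> y \<in> carrier W \<Longrightarrow> f x y \<in> carrier U"
  shows "tlift V W U f Z \<in> carrier U"
  unfolding tlift_def
  by (intro tsum_closed[OF U assms(2)] rep_mem[OF U] assms(3) cls_closed[OF V] cls_closed[OF W] mon_in_vspan)

lemma tlift_push:
  assumes U: "qsp U" and U': "qsp U'" and F: "lmap U U' F" and Z: "Z \<in> carrier (tspace V W)"
    and f: "\<And>x y. x \<in> carrier V \<Longrightarrow> y \<in> carrier W \<Longrightarrow> f x y \<in> carrier U"
  shows "F (tlift V W U f Z) = tlift V W U' (\<lambda>x y. F (f x y)) Z"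
proof -
  have f': "f (cls V (mon a)) (cls W (mon b)) \<in> carrier U" if "a \<in> bas V" "b \<in> bas W" for a b
    by (intro f cls_closed[OF V] cls_closed[OF W] mon_in_vspan that)
  have "F (tlift V W U f Z)
      = tsum (rels U') (\<lambda>a b. rep (F (cls U (rep (f (cls V (mon a)) (cls W (mon b))))))) Z"
    unfolding tlift_def using f' by (intro tsum_push[OF U U' F Z] rep_mem[OF U])
  also have "\<dots> = tlift V W U' (\<lambda>x y. F (f x y)) Z"
    unfolding tlift_def using f' by (intro tsum_cong[OF U' Z]) (simp add: cls_rep[OF U])
  finally show ?thesis .
qed

lemma tspace_ext:
  assumes U: "qsp U" and "lmap (tspace V W) U F" "lmap (tspace V W) U G" "Z \<in> carrier (tspace V W)"
    and *: "\<And>a b. a \<in> bas V \<Longrightarrow> b \<in> bas W \<Longrightarrow> F (pure V W (cls V (mon a)) (cls W (mon b))) = G (pure V W (cls V (mon a)) (cls W (mon b)))"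
  shows "F Z = G Z"
  by (rule lmap_ext[OF qsp_tspace[OF V W] assms(1-3) _ assms(4)])
    (use * in \<open>auto elim!: tbasE simp: pure_mon\<close>)

definition bil :: "('x) space_scheme \<Rightarrow> (vec set \<Rightarrow> vec set \<Rightarrow> vec set) \<Rightarrow> bool" where
  "bil U f \<longleftrightarrow> (\<forall>x\<in>carrier V. lmap W U (f x)) \<and> (\<forall>y\<in>carrier W. lmap V U (\<lambda>x. f x y))"

lemma bil_cls:
  assumes U: "qsp U" and f: "bil U f" and x: "x \<in> vspan (bas V)" and y: "y \<in> vspan (bas W)"
  shows "cls U (lin (\<lambda>a. lin (\<lambda>b. rep (f (cls V (mon a)) (cls W (mon b)))) y) x) = f (cls V x) (cls W y)"
proof -
  have m: "cls W (mon m) \<in> carrier W" if "m \<in> bas W" for m using that by (auto intro!: cls_closed[OF W])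
  have m': "cls V (mon m) \<in> carrier V" if "m \<in> bas V" for m using that by (auto intro!: cls_closed[OF V])
  have "f (cls V x) (cls W y) = cls U (lin (\<lambda>a. rep (f (cls V (mon a)) (cls W y))) x)"
    using f y by (intro lmap_cls[OF V U _ x, of "\<lambda>x. f x (cls W y)"]) (auto simp: bil_def intro!: cls_closed[OF W])
  also have "\<dots> = cls U (lin (\<lambda>a. lin (\<lambda>b. rep (f (cls V (mon a)) (cls W (mon b)))) y) x)"
  proof -
    have "lin (\<lambda>a. rep (f (cls V (mon a)) (cls W y)) - lin (\<lambda>b. rep (f (cls V (mon a)) (cls W (mon b)))) y) x \<in> rels U"
    proof (rule lin_mem[OF qsp_sub[OF U]])
      fix a assume "a \<in> supp x"
      then have a: "a \<in> bas V" using x by (auto simp: mem_vspan_iff)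
      then have "lmap W U (f (cls V (mon a)))" using f m' by (auto simp: bil_def)
      from lmap_cls[OF W U this y] lmapD(1)[OF this cls_closed[OF W y]]
      show "rep (f (cls V (mon a)) (cls W y)) - lin (\<lambda>b. rep (f (cls V (mon a)) (cls W (mon b)))) y \<in> rels U"
        using cls_rep[OF U] by (simp add: cls_eq_iff[OF U, symmetric])
    qed
    then show ?thesis
      by (simp add: cls_eq_iff[OF U] lin_def vec.scale_right_diff_distrib sum_subtractf)
  qed
  finally show ?thesis by simp
qed

text \<open>\<open>tlift\<close> evaluates at a chosen representative. By bilinearity the sum over
  monomials vanishes on both families of tensor relators, so any representative gives the same
  value.\<close>

lemma tlift_cls:
  assumes U: "qsp U" and f: "bil U f" and z: "z \<in> vspan (tbas V W)"
  shows "tlift V W U f (cls (tspace V W) z) = cls U (lin (tcase (\<lambda>a b. rep (f (cls V (mon a)) (cls W (mon b))))) z)"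
proof -
  let ?h = "tcase (\<lambda>a b. rep (f (cls V (mon a)) (cls W (mon b))))"
  have "lin ?h z \<in> rels U" if "z \<in> trels V W" for z
    using that unfolding trels_def
  proof (rule vlin_span_mem[OF vlin_lin qsp_sub[OF U]])
    fix w assume w: "w \<in> {x \<boxtimes> y |x y. x \<in> rels V \<and> y \<in> vspan (bas W)} \<union> {x \<boxtimes> y |x y. x \<in> vspan (bas V) \<and> y \<in> rels W}"
    then obtain x y where xy: "w = x \<boxtimes> y" "x \<in> rels V \<and> y \<in> vspan (bas W) \<or> x \<in> vspan (bas V) \<and> y \<in> rels W" by auto
    then have m: "x \<in> vspan (bas V)" "y \<in> vspan (bas W)" using qsp_rels[OF V] qsp_rels[OF W] by auto
    have z: "f (cls V x) (cls W y) = cls U 0"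
      using xy(2)
    proof
      assume a: "x \<in> rels V \<and> y \<in> vspan (bas W)"
      then have "lmap V U (\<lambda>x. f x (cls W y))" using f by (auto simp: bil_def intro!: cls_closed[OF W])
      from lmap_cls[OF V U this vec.span_zero] show ?thesis
        using a cls_eq_iff[OF V, of x 0] by (simp add: lin_zero)
    next
      assume a: "x \<in> vspan (bas V) \<and> y \<in> rels W"
      then have "lmap W U (f (cls V x))" using f by (auto simp: bil_def intro!: cls_closed[OF V])
      from lmap_cls[OF W U this vec.span_zero] show ?thesis
        using a cls_eq_iff[OF W, of y 0] by (simp add: lin_zero)
    qed
    show "lin ?h w \<in> rels U"
      using bil_cls[OF U f m] z unfolding xy(1) lin_tcase_vtens by (simp add: cls_eq_iff[OF U])
  qed
  then have "lin ?h (rep (cls (tspace V W) z) - z) \<in> rels U"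
    using rep_cls[OF qsp_tspace[OF V W], of z] by simp
  then show ?thesis
    unfolding tlift_def tsum_def by (simp add: cls_eq_iff[OF U] lin_diff)
qed

lemma tlift_pure:
  assumes U: "qsp U" and f: "bil U f" and "x \<in> carrier V" "y \<in> carrier W"
  shows "tlift V W U f (pure V W x y) = f x y"
  using assms(3,4)
  by (elim carrier_cls[OF V] carrier_cls[OF W])
    (simp add: pure_cls tlift_cls[OF U f, unfolded tspace_simps] vtens_tbas lin_tcase_vtens bil_cls[OF U f])

lemma lmap_tlift:
  assumes U: "qsp U" and f: "bil U f"
  shows "lmap (tspace V W) U (tlift V W U f)"
proof -
  note T = qsp_tspace[OF V W]
  have c: "z \<in> carrier (tspace V W) \<Longrightarrow> tlift V W U f z \<in> carrier U" for z
    using f by (intro tlift_closed[OF U]) (auto simp: bil_def dest: lmapD)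
  show ?thesis
    by (rule lmapI[OF c], assumption; elim carrier_cls[OF T])
      (auto simp: tspace_facts cls_add[OF U] cls_smult[OF U] tlift_cls[OF U f, unfolded tspace_simps] lin_add lin_scal
        vec.span_add vec.span_scale)
qed

lemma bil_pure: "bil (tspace V W) (pure V W)"
proof -
  note T = qsp_tspace[OF V W]
  have "lmap W (tspace V W) (pure V W x)" if "x \<in> carrier V" for x
    using that pure_closed by (intro lmapI) (auto elim!: carrier_cls[OF V] carrier_cls[OF W]
      simp: cls_add[OF W] cls_smult[OF W] tspace_facts pure_cls vtens_simps vec.span_add vec.span_scale)
  moreover have "lmap V (tspace V W) (\<lambda>x. pure V W x y)" if "y \<in> carrier W" for y
    using that pure_closed by (intro lmapI) (auto elim!: carrier_cls[OF V] carrier_cls[OF W]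
      simp: cls_add[OF V] cls_smult[OF V] tspace_facts pure_cls vtens_simps vec.span_add vec.span_scale)
  ultimately show ?thesis by (simp add: bil_def)
qed

end

text \<open>The action on a tensor product sums over the comultiplication outside and over the
  element inside, whereas the product axiom of a supermodule superalgebra concerns one fixed pair of
  factors. This exchange mediates between the two in \<open>tlift_supermodule_hom\<close>.\<close>

lemma tsum_commute:
  assumes "vec.subspace N"
  shows "tsum N (\<lambda>a b. rep (tsum N (h a b) Y)) Z = tsum N (\<lambda>c d. rep (tsum N (\<lambda>a b. h a b c d) Z)) Y"
proof -
  have rep: "tsum N (\<lambda>a b. rep (coset N (g a b))) Z = coset N (lin (tcase g) (rep Z))" for g Z
  proof -
    have "lin (\<lambda>m. tcase (\<lambda>a b. rep (coset N (g a b))) m - tcase g m) (rep Z) \<in> N"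
      by (rule lin_mem[OF assms]) (auto split: mono.split intro: rep_coset[OF assms] vec.subspace_0[OF assms])
    then show ?thesis
      unfolding tsum_def by (simp add: coset_eq_iff[OF assms] lin_def vec.scale_right_diff_distrib sum_subtractf)
  qed
  have c: "tcase (\<lambda>a b. lin (f a b) y) m = lin (\<lambda>m'. tcase (\<lambda>a b. f a b m') m) y" for f y m
    by (cases m) (simp_all add: lin_def)
  have c': "tcase (\<lambda>a b. tcase (h a b) m') m = tcase (\<lambda>c d. tcase (\<lambda>a b. h a b c d) m) m'" for m m'
    by (cases m; cases m') simp_all
  show ?thesis
    unfolding rep tsum_def[of N "h _ _"] tsum_def[of N "\<lambda>a b. h a b _ _"] c
    by (subst lin_swap) (simp only: c')
qed

lemma bilI:
  assumes "\<And>x. x \<in> carrier V \<Longrightarrow> lmap W U (f x)" "\<And>y. y \<in> carrier W \<Longrightarrow> lmap V U (\<lambda>x. f x y)"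
    and "qsp V" "qsp W"
  shows "bil V W U f"
  using assms by (simp add: bil_def)

lemma bil_comp:
  assumes "qsp V" "qsp W" "qsp V'" "qsp W'" "bil V W U f" "lmap V' V F" "lmap W' W G"
  shows "bil V' W' U (\<lambda>x y. f (F x) (G y))"
  using assms by (auto simp: bil_def dest: lmapD(1) intro: lmap_comp[of V' V F U] lmap_comp[of W' W G U])

section \<open>Presented superalgebras\<close>

abbreviation wd :: "(int \<times> int) list \<Rightarrow> vec" where
  "wd w \<equiv> mon (Word w)"

abbreviation wspan :: "(int \<times> int) set \<Rightarrow> vec set" where
  "wspan G \<equiv> vspan (Word ` lists G)"

lemma wspan_mono: "G \<subseteq> G' \<Longrightarrow> wspan G \<subseteq> wspan G'"
  by (intro vec.span_mono image_mono) (auto simp: lists_mono)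

lemma wd_wspan: "w \<in> lists G \<Longrightarrow> wd w \<in> wspan G"
  by simp

lemma wd_wspan_set: "\<forall>x\<in>set w. x \<in> G \<Longrightarrow> wd w \<in> wspan G"
  by (simp add: in_lists_conv_set)

lemma kprod_wspan: "x \<in> wspan G \<Longrightarrow> y \<in> wspan G \<Longrightarrow> x \<star> y \<in> wspan G"
  unfolding kprod_def by (intro lin_mem_vspan[where B = "Word ` lists G"]) (auto intro!: wd_wspan_set)

lemma kprod_assoc:
  assumes "x \<in> wspan G" "y \<in> wspan G" "z \<in> wspan G"
  shows "x \<star> y \<star> z = x \<star> (y \<star> z)"
proof (rule vlin_ext[where f = "\<lambda>x. x \<star> y \<star> z" and g = "\<lambda>x. x \<star> (y \<star> z)", OF _ _ assms(1)])
  fix m assume "m \<in> Word ` lists G"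
  then obtain u where u: "m = Word u" by auto
  show "mon m \<star> y \<star> z = mon m \<star> (y \<star> z)"
  proof (rule bilinear_ext[where f = "\<lambda>y z. mon m \<star> y \<star> z" and g = "\<lambda>y z. mon m \<star> (y \<star> z)", OF _ _ _ _ _ assms(2,3)])
    fix a b assume "a \<in> Word ` lists G" "b \<in> Word ` lists G"
    then show "mon m \<star> mon a \<star> mon b = mon m \<star> (mon a \<star> mon b)" by (auto simp: u)
  qed (intro vlin_rules)+
qed (intro vlin_rules)+

lemma kprod_w1: "x \<in> wspan G \<Longrightarrow> w1 \<star> x = x" "x \<in> wspan G \<Longrightarrow> x \<star> w1 = x"
  by (rule vlin_ext[OF _ _ _, where g = "\<lambda>x. x" and B = "Word ` lists G"]; (intro vlin_rules)?; auto)+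

lemma ideal_gen_subspace: "vec.subspace (ideal_gen G R)"
  by (simp add: ideal_gen_def vec.subspace_span)

lemma ideal_gen_base: "u \<in> lists G \<Longrightarrow> x \<in> R \<Longrightarrow> v \<in> lists G \<Longrightarrow> wd u \<star> x \<star> wd v \<in> ideal_gen G R"
  unfolding ideal_gen_def by (rule vec.span_base) blast

lemma ideal_gen_induct:
  assumes "vlin f" "vec.subspace W" "x \<in> ideal_gen G R"
    and "\<And>u x v. u \<in> lists G \<Longrightarrow> x \<in> R \<Longrightarrow> v \<in> lists G \<Longrightarrow> f (wd u \<star> x \<star> wd v) \<in> W"
  shows "f x \<in> W"
  using assms(3) unfolding ideal_gen_def by (rule vlin_span_mem[OF assms(1,2)]) (use assms(4) in blast)

text \<open>Homogeneous relators generate a graded ideal, which is the last clause of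
  \<open>qsp\<close>.\<close>

definition homog_relators :: "(int \<times> int) set \<Rightarrow> vec set \<Rightarrow> bool" where
  "homog_relators G R \<longleftrightarrow> (\<forall>x\<in>R. \<exists>p\<in>{0, 1}. x \<in> vspan {m \<in> Word ` lists G. par m mod 2 = p})"

context
  fixes G :: "(int \<times> int) set" and R :: "vec set"
  assumes R: "homog_relators G R"
begin

lemma relator_wspan: "x \<in> R \<Longrightarrow> x \<in> wspan G"
proof -
  assume "x \<in> R"
  then obtain p where "x \<in> vspan {m \<in> Word ` lists G. par m mod 2 = p}" using R by (auto simp: homog_relators_def)
  then show ?thesis by (auto simp: mem_vspan_iff)
qed

lemma ideal_gen_wspan: "ideal_gen G R \<subseteq> wspan G"
  unfolding ideal_gen_def
  by (rule vec.span_minimal[OF _ vec.subspace_span]) (safe; intro kprod_wspan; simp add: relator_wspan wd_wspan_set)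

lemma ideal_gen_left:
  assumes x: "x \<in> ideal_gen G R" and y: "y \<in> wspan G"
  shows "y \<star> x \<in> ideal_gen G R"
proof (rule ideal_gen_induct[where f = "\<lambda>x. y \<star> x", OF _ ideal_gen_subspace x])
  fix u x v assume *: "u \<in> lists G" "x \<in> R" "v \<in> lists G"
  show "y \<star> (wd u \<star> x \<star> wd v) \<in> ideal_gen G R"
  proof (rule vlin_span_mem[where f = "\<lambda>y. y \<star> (wd u \<star> x \<star> wd v)", OF _ ideal_gen_subspace y])
    fix z assume "z \<in> mon ` Word ` lists G"
    then obtain w where w: "z = wd w" "w \<in> lists G" by auto
    have "z \<star> (wd u \<star> x \<star> wd v) = wd (w @ u) \<star> x \<star> wd v"
      using * w relator_wspan[OF *(2)]
      by (simp add: kprod_assoc[of _ G, symmetric] kprod_wspan wd_wspan)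
    then show "z \<star> (wd u \<star> x \<star> wd v) \<in> ideal_gen G R"
      using ideal_gen_base[of "w @ u" G x R v] * w(2) by simp
  qed (intro vlin_rules)
qed (intro vlin_rules)

lemma ideal_gen_right:
  assumes x: "x \<in> ideal_gen G R" and y: "y \<in> wspan G"
  shows "x \<star> y \<in> ideal_gen G R"
proof (rule ideal_gen_induct[where f = "\<lambda>x. x \<star> y", OF _ ideal_gen_subspace x])
  fix u x v assume *: "u \<in> lists G" "x \<in> R" "v \<in> lists G"
  show "wd u \<star> x \<star> wd v \<star> y \<in> ideal_gen G R"
  proof (rule vlin_span_mem[where f = "\<lambda>y. wd u \<star> x \<star> wd v \<star> y", OF _ ideal_gen_subspace y])
    fix z assume "z \<in> mon ` Word ` lists G"
    then obtain w where w: "z = wd w" "w \<in> lists G" by auto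
    have "wd u \<star> x \<star> wd v \<star> z = wd u \<star> x \<star> wd (v @ w)"
      using * w relator_wspan[OF *(2)]
      by (simp add: kprod_assoc[of _ G] kprod_wspan wd_wspan)
    then show "wd u \<star> x \<star> wd v \<star> z \<in> ideal_gen G R"
      using ideal_gen_base[of u G x R "v @ w"] * w(2) by simp
  qed (intro vlin_rules)
qed (intro vlin_rules)

lemma homog_kprod:
  assumes "x \<in> vspan {m \<in> Word ` lists G. par m mod 2 = p}" "y \<in> vspan {m \<in> Word ` lists G. par m mod 2 = p'}"
  shows "x \<star> y \<in> vspan {m \<in> Word ` lists G. par m mod 2 = (p + p') mod 2}"
  unfolding kprod_def
proof (rule lin_mem_vspan[OF assms(1)], rule lin_mem_vspan[OF assms(2)])
  fix a b assume "a \<in> {m \<in> Word ` lists G. par m mod 2 = p}" "b \<in> {m \<in> Word ` lists G. par m mod 2 = p'}"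
  then have ab: "a \<in> Word ` lists G" "b \<in> Word ` lists G" "par a mod 2 = p" "par b mod 2 = p'" by auto
  then obtain u v where "a = Word u" "b = Word v" "u \<in> lists G" "v \<in> lists G" by blast
  then show "kmono a b \<in> vspan {m \<in> Word ` lists G. par m mod 2 = (p + p') mod 2}"
    using ab(3,4) by (auto intro!: mon_in_vspan imageI simp: mod_add_eq)
qed

lemma ideal_gen_even_part:
  assumes "x \<in> ideal_gen G R"
  shows "even_part x \<in> ideal_gen G R"
proof (rule ideal_gen_induct[OF vlin_even_part ideal_gen_subspace assms])
  fix u x v assume *: "u \<in> lists G" "x \<in> R" "v \<in> lists G"
  then obtain p where "x \<in> vspan {m \<in> Word ` lists G. par m mod 2 = p}" using R by (auto simp: homog_relators_def)
  then have h: "wd u \<star> x \<star> wd v \<in> vspan {m \<in> Word ` lists G. par m mod 2 = ((par (Word u) mod 2 + p) mod 2 + par (Word v) mod 2) mod 2}"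
    using * by (intro homog_kprod mon_in_vspan) auto
  have "((par (Word u) mod 2 + p) mod 2 + par (Word v) mod 2) mod 2 \<in> {0, 1}" by auto
  with h have "even_part (wd u \<star> x \<star> wd v) \<in> {0, wd u \<star> x \<star> wd v}"
    using even_part_even even_part_odd by fastforce
  then show "even_part (wd u \<star> x \<star> wd v) \<in> ideal_gen G R"
    using ideal_gen_base[OF *] vec.subspace_0[OF ideal_gen_subspace] by auto
qed

end

text \<open>A predicate instead of the term \<open>presented G R\<close>, so that one set of lemmas
  covers \<open>Uq\<close>, \<open>Aalg\<close> and \<open>A\<close>, the last of which carries an
  action as an additional field.\<close>

definition palg :: "(int \<times> int) set \<Rightarrow> vec set \<Rightarrow> ('z) space_scheme \<Rightarrow> bool" where
  "palg G R V \<longleftrightarrow> homog_relators G R \<and> qsp V \<and> bas V = Word ` lists G \<and> rels V = ideal_gen G R \<and>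
     (\<forall>x y. x \<otimes>\<^bsub>V\<^esub> y = cls V (rep x \<star> rep y)) \<and> \<one>\<^bsub>V\<^esub> = cls V w1"

lemma palg_presented: "homog_relators G R \<Longrightarrow> palg G R (presented G R)"
  unfolding palg_def presented_def Let_def
  by (auto simp: qspace_def qsp_def ideal_gen_subspace ideal_gen_even_part intro: ideal_gen_wspan[THEN subsetD])

lemma extend_simps [simp]:
  "carrier (space.extend V f) = carrier V" "monoid.mult (space.extend V f) = monoid.mult V"
  "monoid.one (space.extend V f) = monoid.one V" "ring.zero (space.extend V f) = ring.zero V"
  "ring.add (space.extend V f) = ring.add V" "module.smult (space.extend V f) = module.smult V" "bas (space.extend V f) = bas V" "rels (space.extend V f) = rels V"
  "act (space.extend V (uspace.fields g)) = g"
  by (simp_all add: space.defs uspace.defs)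

lemma qsp_extend [simp]: "qsp (space.extend V f) \<longleftrightarrow> qsp V"
  by (simp add: qsp_def)

lemma palg_extend [simp]: "palg G R (space.extend V f) \<longleftrightarrow> palg G R V"
  by (simp add: palg_def)

lemma homog_extend [simp]: "homog (space.extend V f) p = homog V p"
  by (simp add: homog_def)

context
  fixes G R and V :: "('z) space_scheme"
  assumes V: "palg G R V"
begin

lemma palg_qsp: "qsp V" and palg_bas: "bas V = Word ` lists G" and palg_rels: "rels V = ideal_gen G R"
  and palg_one: "\<one>\<^bsub>V\<^esub> = cls V w1" and palg_homog: "homog_relators G R"
  using V by (simp_all add: palg_def)

lemma palg_closed: "x \<in> wspan G \<Longrightarrow> cls V x \<in> carrier V"
  using cls_closed[OF palg_qsp] palg_bas by simp

lemma palg_one_closed: "\<one>\<^bsub>V\<^esub> \<in> carrier V"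
  unfolding palg_one by (intro palg_closed wd_wspan) simp

lemma palg_carrier:
  assumes "Z \<in> carrier V" obtains x where "x \<in> wspan G" "Z = cls V x"
  using carrier_cls[OF palg_qsp assms] palg_bas by metis

lemma palg_rep: "Z \<in> carrier V \<Longrightarrow> rep Z \<in> wspan G"
  using rep_mem[OF palg_qsp] palg_bas by simp

text \<open>Changing the representatives one after the other costs (x' - x) y' and x (y' - y), both
  in the two-sided ideal.\<close>

lemma palg_mult:
  assumes x: "x \<in> wspan G" and y: "y \<in> wspan G"
  shows "cls V x \<otimes>\<^bsub>V\<^esub> cls V y = cls V (x \<star> y)"
proof -
  let ?x = "rep (cls V x)" and ?y = "rep (cls V y)"
  have "(?x - x) \<star> ?y \<in> rels V"
    using ideal_gen_right[OF palg_homog _ palg_rep[OF palg_closed[OF y]]] rep_cls[OF palg_qsp, of x] by (simp add: palg_rels)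
  moreover have "x \<star> (?y - y) \<in> rels V"
    using ideal_gen_left[OF palg_homog _ x] rep_cls[OF palg_qsp, of y] by (simp add: palg_rels)
  ultimately have "(?x - x) \<star> ?y + x \<star> (?y - y) \<in> rels V" by (rule vec.subspace_add[OF qsp_sub[OF palg_qsp]])
  moreover have "cls V x \<otimes>\<^bsub>V\<^esub> cls V y = cls V (?x \<star> ?y)" using V by (simp add: palg_def)
  ultimately show ?thesis by (simp add: cls_eq_iff[OF palg_qsp] kprod_simps)
qed

lemma palg_mult_closed: "x \<in> carrier V \<Longrightarrow> y \<in> carrier V \<Longrightarrow> x \<otimes>\<^bsub>V\<^esub> y \<in> carrier V"
  by (elim palg_carrier) (auto simp: palg_mult intro!: palg_closed kprod_wspan)

lemma palg_assoc:
  assumes "x \<in> carrier V" "y \<in> carrier V" "z \<in> carrier V"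
  shows "x \<otimes>\<^bsub>V\<^esub> y \<otimes>\<^bsub>V\<^esub> z = x \<otimes>\<^bsub>V\<^esub> (y \<otimes>\<^bsub>V\<^esub> z)"
  using assms by (elim palg_carrier) (simp add: palg_mult kprod_wspan kprod_assoc[of _ G])

lemma palg_unit: "x \<in> carrier V \<Longrightarrow> \<one>\<^bsub>V\<^esub> \<otimes>\<^bsub>V\<^esub> x = x" "x \<in> carrier V \<Longrightarrow> x \<otimes>\<^bsub>V\<^esub> \<one>\<^bsub>V\<^esub> = x"
  by (elim palg_carrier; simp add: palg_one palg_mult wd_wspan kprod_w1[of _ G])+

lemma palg_lmap_mult:
  assumes "x \<in> carrier V"
  shows "lmap V V (\<lambda>y. x \<otimes>\<^bsub>V\<^esub> y)" "lmap V V (\<lambda>y. y \<otimes>\<^bsub>V\<^esub> x)"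
proof -
  obtain u where u: "u \<in> wspan G" "x = cls V u" using assms by (rule palg_carrier)
  note simps = u cls_add[OF palg_qsp] cls_smult[OF palg_qsp] palg_mult vec.span_add vec.span_scale kprod_simps
    palg_closed kprod_wspan
  show "lmap V V (\<lambda>y. x \<otimes>\<^bsub>V\<^esub> y)" by (rule lmapI; elim palg_carrier; simp add: simps)
  show "lmap V V (\<lambda>y. y \<otimes>\<^bsub>V\<^esub> x)" by (rule lmapI; elim palg_carrier; simp add: simps)
qed

lemma palg_bil_mult: "bil V V V (\<lambda>x y. x \<otimes>\<^bsub>V\<^esub> y)"
  by (intro bilI palg_lmap_mult palg_qsp)

lemma palg_superalgebra: "superalgebra V"
proof -
  interpret module Cq_ring V by (rule qsp_module[OF palg_qsp])
  have "ring V"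
  proof (rule ringI)
    show "monoid V"
      by (rule monoidI) (auto simp: palg_mult_closed palg_one_closed palg_assoc palg_unit)
  qed (rule M.abelian_group_axioms | rule lmapD(2)[OF palg_lmap_mult(1)] lmapD(2)[OF palg_lmap_mult(2)], assumption+)+
  moreover have "\<one>\<^bsub>V\<^esub> \<in> homog V 0"
    using homog_mon[OF palg_qsp, of "Word []"] by (simp add: palg_one palg_bas)
  moreover have "x \<otimes>\<^bsub>V\<^esub> y \<in> homog V ((p + p') mod 2)" if h: "x \<in> homog V p" "y \<in> homog V p'" for x y p p'
  proof -
    obtain u where u: "u \<in> vspan {m \<in> Word ` lists G. par m mod 2 = p}" "x = cls V u"
      using homogE[OF palg_qsp h(1)] palg_bas by metis
    obtain v where v: "v \<in> vspan {m \<in> Word ` lists G. par m mod 2 = p'}" "y = cls V v"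
      using homogE[OF palg_qsp h(2)] palg_bas by metis
    have "u \<in> wspan G" "v \<in> wspan G" using u(1) v(1) by (auto simp: mem_vspan_iff)
    then show ?thesis
      using homog_kprod[OF palg_homog u(1) v(1)] u(2) v(2) by (simp add: palg_mult homog_def palg_bas)
  qed
  ultimately show ?thesis
    unfolding superalgebra_def
    using qsp_superspace[OF palg_qsp] lmapD(3)[OF palg_lmap_mult(1)] lmapD(3)[OF palg_lmap_mult(2)] by auto
qed

end

section \<open>Matrix coefficients of the defining relations\<close>

text \<open>The coefficient of E_dc \<otimes> E_ab in S.\<close>

definition Sc :: "int \<Rightarrow> int \<Rightarrow> int \<Rightarrow> int \<Rightarrow> Cq" where
  "Sc d c a b = of_bool (d = c \<and> a = b) * qvar powi phi d a
     + of_bool (a < b) * (xi * (-1) ^ ipar a) * (of_bool (d = b \<and> c = a) + of_bool (d = -b \<and> c = -a))"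

lemma finite_idx [simp]: "finite (idx N)"
  by (rule finite_subset[of _ "{- int N..int N}"]) (auto simp: idx_def)

lemma uminus_idx [simp]: "- i \<in> idx N \<longleftrightarrow> i \<in> idx N"
  by (simp add: idx_def)

lemma ipar_uminus: "i \<noteq> 0 \<Longrightarrow> ipar (- i) = 1 - ipar i"
  by (simp add: ipar_def)

lemma idx_nonzero: "i \<in> idx N \<Longrightarrow> i \<noteq> 0"
  by (simp add: idx_def)

lemma sum_delta2:
  fixes f :: "'a \<Rightarrow> 'b \<Rightarrow> 'c::comm_monoid_add"
  assumes "finite S" "finite T" "i \<in> S" "j \<in> T"
    and "\<And>x y. x \<in> S \<Longrightarrow> y \<in> T \<Longrightarrow> \<not> (x = i \<and> y = j) \<Longrightarrow> f x y = 0"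
  shows "(\<Sum>x\<in>S. \<Sum>y\<in>T. f x y) = f i j"
proof -
  have "(\<Sum>x\<in>S. \<Sum>y\<in>T. f x y) = (\<Sum>x\<in>{i}. \<Sum>y\<in>T. f x y)"
    using assms by (intro sum.mono_neutral_right) (auto intro!: sum.neutral)
  also have "\<dots> = (\<Sum>y\<in>T. f i y)" by simp
  also have "\<dots> = (\<Sum>y\<in>{j}. f i y)"
    using assms by (intro sum.mono_neutral_right) auto
  finally show ?thesis by simp
qed

lemma sum_of_bool2:
  assumes "finite S" "finite T" "i \<in> S" "j \<in> T"
  shows "(\<Sum>x\<in>S. \<Sum>y\<in>T. scal (of_bool (x = i \<and> y = j) * k) (F x y)) = scal k (F i j)"
  using sum_delta2[OF assms, of "\<lambda>x y. scal (of_bool (x = i \<and> y = j) * k) (F x y)"] by simp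

lemma of_bool_distrib_cases:
  assumes "Q \<Longrightarrow> P = P1" "R \<Longrightarrow> P = P2" "Q = Q'" "R = R'"
  shows "of_bool P * k * (of_bool Q + of_bool R) = of_bool Q' * (of_bool P1 * k) + of_bool R' * (of_bool P2 * (k::Cq))"
  using assms by (cases Q; cases R; simp add: algebra_simps)

text \<open>In the row pair (i,j) the matrix S has entries at most in the column pairs (i,j), (j,i)
  and (-j,-i). The next lemma is the analogue for a fixed column pair.\<close>

lemma Sc_sum_right:
  assumes "i \<in> idx N" "j \<in> idx N"
  shows "(\<Sum>c\<in>idx N. \<Sum>d\<in>idx N. scal (Sc i c j d) (F c d)) =
    scal (qvar powi phi i j) (F i j) + scal (of_bool (j < i) * xi * (-1) ^ ipar j) (F j i)
    + scal (of_bool (j < -i) * xi * (-1) ^ ipar j) (F (-j) (-i))"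
proof -
  have e: "Sc i c j d = of_bool (c = i \<and> d = j) * (qvar powi phi i j)
     + (of_bool (c = j \<and> d = i) * (of_bool (j < i) * (xi * (-1) ^ ipar j))
     + of_bool (c = -j \<and> d = -i) * (of_bool (j < -i) * (xi * (-1) ^ ipar j)))" for c d
    unfolding Sc_def by (rule arg_cong2[where f = "(+)"], simp add: eq_commute[of i] eq_commute[of j], rule of_bool_distrib_cases) auto
  have n: "- i \<in> idx N" "- j \<in> idx N" using assms by simp_all
  show ?thesis
    unfolding e vec.scale_left_distrib sum.distrib add.assoc[symmetric] mult.assoc
    by (simp only: sum_of_bool2[OF finite_idx finite_idx assms] sum_of_bool2[OF finite_idx finite_idx assms(2,1)]
        sum_of_bool2[OF finite_idx finite_idx n(2,1)])
qed

lemma Sc_sum_left: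
  assumes "a \<in> idx N" "b \<in> idx N"
  shows "(\<Sum>c\<in>idx N. \<Sum>d\<in>idx N. scal (Sc c a d b) (F c d)) =
    scal (qvar powi phi a b) (F a b) + scal (of_bool (a < b) * xi * (-1) ^ ipar a) (F b a)
    + scal (of_bool (-a < b) * xi * (-1) ^ ipar (-a)) (F (-b) (-a))"
proof -
  have e: "Sc c a d b = of_bool (c = a \<and> d = b) * (qvar powi phi a b)
     + (of_bool (c = b \<and> d = a) * (of_bool (a < b) * (xi * (-1) ^ ipar a))
     + of_bool (c = -b \<and> d = -a) * (of_bool (-a < b) * (xi * (-1) ^ ipar (-a))))" for c d
  proof -
    have "Sc c a d b = of_bool (c = a \<and> d = b) * (qvar powi phi c d)
     + of_bool (d < b) * (xi * (-1) ^ ipar d) * (of_bool (c = b \<and> a = d) + of_bool (c = - b \<and> a = - d))"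
      by (simp only: Sc_def)
    also have "\<dots> = of_bool (c = a \<and> d = b) * (qvar powi phi a b)
     + of_bool (d < b) * (xi * (-1) ^ ipar d) * (of_bool (c = b \<and> a = d) + of_bool (c = - b \<and> a = - d))"
      by (cases "c = a \<and> d = b") auto
    also have "\<dots> = of_bool (c = a \<and> d = b) * (qvar powi phi a b)
     + (of_bool (c = b \<and> d = a) * (of_bool (a < b) * (xi * (-1) ^ ipar a))
     + of_bool (c = -b \<and> d = -a) * (of_bool (-a < b) * (xi * (-1) ^ ipar (-a))))"
      by (cases "a = d"; cases "a = - d") (auto simp: distrib_left)
    finally show ?thesis .
  qed
  have n: "- a \<in> idx N" "- b \<in> idx N" using assms by simp_all
  show ?thesis
    unfolding e vec.scale_left_distrib sum.distrib add.assoc[symmetric] mult.assoc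
    by (simp only: sum_of_bool2[OF finite_idx finite_idx assms] sum_of_bool2[OF finite_idx finite_idx assms(2,1)]
        sum_of_bool2[OF finite_idx finite_idx n(2,1)])
qed

text \<open>The entries of the braiding are, up to sign, those of $S$.\<close>

lemma braid_Sc:
  assumes "c \<in> idx N" "b \<in> idx N"
  shows "braid c b h = (\<Sum>a\<in>idx N. \<Sum>d\<in>idx N. scal ((-1) ^ (ipar b * ipar d + ipar a + ipar b) * Sc d c a b) (h a d))"
proof -
  have s: "(-1::Cq) ^ (ipar b * ipar d + ipar a + ipar b) * Sc d c a b
     = of_bool (a = b \<and> d = c) * ((-1) ^ (ipar b * ipar c) * qvar powi phi c b)
     + of_bool (a = c \<and> d = b) * (of_bool (c < b) * xi)
     + of_bool (a = -c \<and> d = -b) * (of_bool (-c < b) * (-1) ^ ipar b * xi)" for a d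
    using assms unfolding Sc_def by (auto simp: idx_def ipar_def)
  have n: "- b \<in> idx N" "- c \<in> idx N" using assms by simp_all
  show ?thesis
    unfolding s vec.scale_left_distrib sum.distrib braid_def
    by (simp only: sum_of_bool2[OF finite_idx finite_idx assms] sum_of_bool2[OF finite_idx finite_idx assms(2,1)]
        sum_of_bool2[OF finite_idx finite_idx n(2,1)])
qed

text \<open>Every nonzero entry of S keeps or swaps the pair of indices and negates both or neither,
  so S is even.\<close>

lemma Sc_even:
  assumes "d \<noteq> 0" "a \<noteq> 0" "c \<noteq> 0" "b \<noteq> 0" "Sc d c a b \<noteq> 0"
  shows "even (ipar d + ipar c + ipar a + ipar b)"
proof -
  have "d = c \<and> a = b \<or> d = b \<and> c = a \<or> d = -b \<and> c = -a"
  proof (rule ccontr)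
    assume "\<not> ?thesis"
    then have "(d = c \<and> a = b) = False" "(d = b \<and> c = a) = False" "(d = -b \<and> c = -a) = False" by blast+
    then have "Sc d c a b = 0" unfolding Sc_def by (simp only: of_bool_eq mult_zero_left mult_zero_right add_0_right)
    with assms show False by simp
  qed
  then show ?thesis using assms(1-4) by (elim disjE conjE) (simp_all add: ipar_def)
qed

section \<open>Matrix coefficients of products with Koszul signs\<close>

definition sgnop :: "nat \<Rightarrow> vec \<Rightarrow> vec" where
  "sgnop s = lin (\<lambda>m. scal ((-1) ^ (s * par m)) (mon m))"

lemma vlin_sgnop: "vlin (sgnop s)"
  unfolding sgnop_def by (rule vlin_lin)

text \<open>\<open>cfA\<close>, \<open>cfU\<close> and \<open>cfT\<close> differ in the tensor slot
  that holds the word: the third for the relations of T, the first for those of L, the second for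
  the action formula T S.\<close>

definition cfA :: "int \<Rightarrow> int \<Rightarrow> int \<Rightarrow> int \<Rightarrow> vec \<Rightarrow> vec" where
  "cfA i a j b = Poly_Mapping.map_key (\<lambda>w. Tens (Mu i a) (Tens (Mu j b) w))"

definition cfU :: "int \<Rightarrow> int \<Rightarrow> int \<Rightarrow> int \<Rightarrow> vec \<Rightarrow> vec" where
  "cfU i j k l = Poly_Mapping.map_key (\<lambda>w. Tens w (Tens (Mu i j) (Mu k l)))"

definition cfT :: "int \<Rightarrow> int \<Rightarrow> int \<Rightarrow> int \<Rightarrow> vec \<Rightarrow> vec" where
  "cfT i c a b = Poly_Mapping.map_key (\<lambda>w. Tens (Mu i c) (Tens w (Mu a b)))"

lemma vlin_map_key: "inj f \<Longrightarrow> vlin (Poly_Mapping.map_key f)"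
  by (auto simp: vlin_def map_key.rep_eq lookup_add intro!: poly_mapping_eqI)

lemma map_key_mon: "inj f \<Longrightarrow> Poly_Mapping.map_key f (mon m) = (if \<exists>w. m = f w then mon (the_inv f m) else 0)"
  by (auto simp: map_key.rep_eq mon_def lookup_single when_def the_inv_f_f inj_def intro!: poly_mapping_eqI)

lemma inj_slots:
  "inj (\<lambda>w. Tens (Mu i a) (Tens (Mu j b) w))" "inj (\<lambda>w. Tens w (Tens (Mu i j) (Mu k l)))"
  "inj (\<lambda>w. Tens (Mu i c) (Tens w (Mu a b)))"
  by (simp_all add: inj_def)

lemma vlin_cf: "vlin (cfA i a j b)" "vlin (cfU i j k l)" "vlin (cfT i c a b)"
  by (simp_all add: cfA_def cfU_def cfT_def vlin_map_key inj_slots)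

lemma cfA_mon: "cfA i a j b (mon (Tens (Mu i' a') (Tens (Mu j' b') w)))
    = (if i' = i \<and> a' = a \<and> j' = j \<and> b' = b then mon w else 0)"
  using the_inv_f_f[OF inj_slots(1)[of i a j b], of w] by (auto simp: cfA_def map_key_mon inj_slots)

lemma cfU_mon: "cfU i j k l (mon (Tens w (Tens (Mu i' j') (Mu k' l'))))
    = (if i' = i \<and> j' = j \<and> k' = k \<and> l' = l then mon w else 0)"
  using the_inv_f_f[OF inj_slots(2)[of i j k l], of w] by (auto simp: cfU_def map_key_mon inj_slots)

lemma cfT_mon: "cfT i c a b (mon (Tens (Mu i' c') (Tens w (Mu a' b'))))
    = (if i' = i \<and> c' = c \<and> a' = a \<and> b' = b then mon w else 0)"
  using the_inv_f_f[OF inj_slots(3)[of i c a b], of w] by (auto simp: cfT_def map_key_mon inj_slots)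

text \<open>Bounding the column indices by \<open>J\<close> makes the sum over the inner indices of
  a matrix product finite.\<close>

definition Amons :: "int set \<Rightarrow> mono set" where
  "Amons J = {Tens (Mu i c) (Tens (Mu j d) (Word w)) | i c j d w. c \<in> J \<and> d \<in> J}"

definition Umons :: "int set \<Rightarrow> mono set" where
  "Umons J = {Tens (Word w) (Tens (Mu i c) (Mu j d)) | i c j d w. c \<in> J \<and> d \<in> J}"

text \<open>In the product E_jd passes E_ca, which gives the displayed sign, and the word of the
  left factor passes both E_ca and E_db, which gives \<open>sgnop\<close>.\<close>

lemma cfA_kprod:
  assumes J: "finite J" and U: "U \<in> vspan (Amons J)" and W: "W \<in> vspan (Amons UNIV)"
  shows "cfA i a j b (U \<star> W) = (\<Sum>c\<in>J. \<Sum>d\<in>J. scal ((-1) ^ ((ipar j + ipar d) * (ipar c + ipar a)))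
     (sgnop (ipar c + ipar a + ipar d + ipar b) (cfA i c j d U) \<star> cfA c a d b W))"
proof (rule bilinear_ext[OF _ _ _ _ _ U W, where f = "\<lambda>U W. cfA i a j b (U \<star> W)" and
      g = "\<lambda>U W. \<Sum>c\<in>J. \<Sum>d\<in>J. scal ((-1) ^ ((ipar j + ipar d) * (ipar c + ipar a)))
     (sgnop (ipar c + ipar a + ipar d + ipar b) (cfA i c j d U) \<star> cfA c a d b W)"], goal_cases)
  case (1 y) show ?case by (intro vlin_rules vlin_comp[OF vlin_cf(1)])
next
  case (2 y) show ?case by (intro vlin_rules vlin_comp[OF vlin_cf(1)])
next
  case (3 y) show ?case
    by (simp add: vlin_def vlin_add[OF vlin_cf(1)] vlin_scal[OF vlin_cf(1)] vlin_add[OF vlin_sgnop] vlin_scal[OF vlin_sgnop]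
        kprod_simps sum.distrib vec.scale_right_distrib vec.scale_sum_right mult.commute)
next
  case (4 y) show ?case
    by (simp add: vlin_def vlin_add[OF vlin_cf(1)] vlin_scal[OF vlin_cf(1)]
        kprod_simps sum.distrib vec.scale_right_distrib vec.scale_sum_right mult.commute)
next
  case (5 m m')
  then obtain i1 c1 j1 d1 x i2 a2 j2 b2 y where m: "m = Tens (Mu i1 c1) (Tens (Mu j1 d1) (Word x))"
    "m' = Tens (Mu i2 a2) (Tens (Mu j2 b2) (Word y))" and c: "c1 \<in> J" "d1 \<in> J"
    by (auto simp: Amons_def)
  show ?case
    by (subst sum_delta2[OF J J c])
      (auto simp: m cfA_mon sgnop_def lin_zero vtens_simps kprod_simps vlin_zero[OF vlin_cf(1)] vlin_scal[OF vlin_cf(1)]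
         simp flip: power_add mult.assoc simp: algebra_simps)
qed

text \<open>Here the words stand first, so it is the word of the right factor that passes the matrix
  units E_ic and E_kd.\<close>

lemma cfU_kprod:
  assumes J: "finite J" and U: "U \<in> vspan (Umons J)" and W: "W \<in> vspan (Umons UNIV)"
  shows "cfU i j k l (U \<star> W) = (\<Sum>c\<in>J. \<Sum>d\<in>J. scal ((-1) ^ ((ipar k + ipar d) * (ipar c + ipar j)))
     (cfU i c k d U \<star> sgnop (ipar i + ipar c + ipar k + ipar d) (cfU c j d l W)))"
proof (rule bilinear_ext[OF _ _ _ _ _ U W, where f = "\<lambda>U W. cfU i j k l (U \<star> W)" and
      g = "\<lambda>U W. \<Sum>c\<in>J. \<Sum>d\<in>J. scal ((-1) ^ ((ipar k + ipar d) * (ipar c + ipar j)))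
     (cfU i c k d U \<star> sgnop (ipar i + ipar c + ipar k + ipar d) (cfU c j d l W))"], goal_cases)
  case (1 y) show ?case by (intro vlin_rules vlin_comp[OF vlin_cf(2)])
next
  case (2 y) show ?case by (intro vlin_rules vlin_comp[OF vlin_cf(2)])
next
  case (3 y) show ?case
    by (simp add: vlin_def vlin_add[OF vlin_cf(2)] vlin_scal[OF vlin_cf(2)]
        kprod_simps sum.distrib vec.scale_right_distrib vec.scale_sum_right mult.commute)
next
  case (4 y) show ?case
    by (simp add: vlin_def vlin_add[OF vlin_cf(2)] vlin_scal[OF vlin_cf(2)] vlin_add[OF vlin_sgnop] vlin_scal[OF vlin_sgnop]
        kprod_simps sum.distrib vec.scale_right_distrib vec.scale_sum_right mult.commute)
next
  case (5 m m')
  then obtain i1 c1 j1 d1 x i2 a2 j2 b2 y where m: "m = Tens (Word x) (Tens (Mu i1 c1) (Mu j1 d1))"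
    "m' = Tens (Word y) (Tens (Mu i2 a2) (Mu j2 b2))" and c: "c1 \<in> J" "d1 \<in> J"
    by (auto simp: Umons_def)
  show ?case
    by (subst sum_delta2[OF J J c])
      (auto simp: m cfU_mon sgnop_def lin_zero vtens_simps kprod_simps vlin_zero[OF vlin_cf(2)] vlin_scal[OF vlin_cf(2)]
         simp flip: power_add mult.assoc simp: algebra_simps)
qed

text \<open>Any linear \<open>f\<close> selecting one pair of matrix units is allowed, so that S may
  be placed in positions 12, 23 or 13 and may already be multiplied by something. The rows and
  columns of a nonzero entry agree up to order and sign, hence range conditions on either of them
  suffice.\<close>

lemma Smat_extract:
  assumes f: "vlin f" and p: "\<And>x y z. p (x + y) z = p x z + p y z"
    and v: "\<And>d c a b. f (p (E d c) (E a b)) = (if d = D \<and> c = C \<and> a = A' \<and> b = B then v else 0)"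
    and idx: "D \<in> idx N \<and> A' \<in> idx N \<or> C \<in> idx N \<and> B \<in> idx N"
  shows "f (Smat N p) = scal (Sc D C A' B) v"
proof -
  have 1: "(\<Sum>i\<in>idx N. \<Sum>j\<in>idx N. scal (qvar powi phi i j) (f (p (E i i) (E j j))))
     = scal (of_bool (D = C \<and> A' = B) * qvar powi phi D A') v"
  proof (cases "D = C \<and> A' = B")
    case True
    then have DA: "D \<in> idx N" "A' \<in> idx N" using idx by auto
    show ?thesis using True by (subst sum_delta2[OF finite_idx finite_idx DA]) (auto simp: v)
  next
    case False
    then show ?thesis by (auto simp: v intro!: sum.neutral)
  qed
  let ?g = "\<lambda>(i, j). scal (xi * (-1) ^ ipar i) (f (p (E j i) (E i j)) + f (p (E (-j) (-i)) (E i j)))"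
  have g: "?g x = (if x = (A', B) then scal ((xi * (-1) ^ ipar A') * (of_bool (D = B \<and> C = A') + of_bool (D = -B \<and> C = -A'))) v else 0)" for x
  proof (cases "x = (A', B)")
    case True
    have "(- B = D \<and> - A' = C) = (D = -B \<and> C = -A')" "(B = D \<and> A' = C) = (D = B \<and> C = A')" by auto
    then show ?thesis
      using True by (simp only: v prod.case) (simp add: vec.scale_left_distrib vec.scale_right_distrib distrib_left of_bool_def)
  next
    case False
    obtain a b where x: "x = (a, b)" by force
    with False have "\<And>P Q. (P \<and> Q \<and> a = A' \<and> b = B) = False" by auto
    with False x show ?thesis by (simp only: v prod.case if_False add_0_right vec.scale_zero_right)
  qed
  have "finite {(i, j). i \<in> idx N \<and> j \<in> idx N \<and> i < j}"
    by (rule finite_subset[of _ "idx N \<times> idx N"]) auto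
  then have 2: "(\<Sum>x\<in>{(i, j). i \<in> idx N \<and> j \<in> idx N \<and> i < j}. ?g x)
     = scal (of_bool (A' < B) * (xi * (-1) ^ ipar A') * (of_bool (D = B \<and> C = A') + of_bool (D = -B \<and> C = -A'))) v"
    unfolding g using idx by (cases "A' < B"; cases "D = B \<and> C = A'"; cases "D = - B \<and> C = - A'") auto
  have "f (Smat N p) = (\<Sum>i\<in>idx N. \<Sum>j\<in>idx N. scal (qvar powi phi i j) (f (p (E i i) (E j j))))
     + (\<Sum>x\<in>{(i, j). i \<in> idx N \<and> j \<in> idx N \<and> i < j}. ?g x)"
    unfolding Smat_def by (simp add: vlin_add[OF f] vlin_sum[OF f] vlin_scal[OF f] p case_prod_beta)
  then show ?thesis unfolding 1 2 by (simp add: Sc_def vec.scale_left_distrib)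
qed

lemma finite_Agens [simp]: "finite (Agens r n)"
  by (simp add: Agens_def)

lemma finite_Ugens [simp]: "finite (Ugens n)"
  by (rule finite_subset[of _ "idx n \<times> idx n"]) (auto simp: Ugens_def)

lemma Smat_mem:
  assumes W: "vec.subspace W" and p: "\<And>x y z. p (x + y) z = p x z + p y z"
    and m: "\<And>d c a b. d \<in> idx N \<Longrightarrow> c \<in> idx N \<Longrightarrow> a \<in> idx N \<Longrightarrow> b \<in> idx N \<Longrightarrow> p (E d c) (E a b) \<in> W"
  shows "Smat N p \<in> W"
  unfolding Smat_def p
  by (intro vec.subspace_add[OF W] vec.subspace_sum[OF W] vec.subspace_scale[OF W] m; clarsimp)
    (intro vec.subspace_add[OF W] vec.subspace_scale[OF W] m; simp)

lemma Tmat_first: "Tmat r n (\<lambda>x t. x \<boxtimes> idm N \<boxtimes> t)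
    = (\<Sum>(i, a)\<in>Agens r n. \<Sum>k\<in>idx N. mon (Tens (Mu i a) (Tens (Mu k k) (Word [(i, a)]))))"
  by (simp add: Tmat_def idm_def vtens_sum case_prod_beta)

lemma Tmat_second: "Tmat r n (\<lambda>x t. idm N \<boxtimes> x \<boxtimes> t)
    = (\<Sum>(i, a)\<in>Agens r n. \<Sum>k\<in>idx N. mon (Tens (Mu k k) (Tens (Mu i a) (Word [(i, a)]))))"
  by (simp add: Tmat_def idm_def vtens_sum case_prod_beta)

lemma sum_single:
  fixes f :: "'a \<Rightarrow> 'b::comm_monoid_add"
  assumes "finite S" "\<And>x. x \<in> S \<Longrightarrow> x \<noteq> i \<Longrightarrow> f x = 0"
  shows "sum f S = (if i \<in> S then f i else 0)"
proof -
  have "sum f S = (\<Sum>x\<in>S. if x = i then f i else 0)" using assms(2) by (intro sum.cong) auto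
  then show ?thesis using assms(1) by simp
qed

lemma cfA_Tmat_first: "cfA c a d b (Tmat r n (\<lambda>x t. x \<boxtimes> idm N \<boxtimes> t))
    = (if c \<in> idx r \<and> a \<in> idx n \<and> d \<in> idx N \<and> d = b then gen c a else 0)"
  unfolding Tmat_first vlin_sum[OF vlin_cf(1)]
  by (subst sum_single[of _ "(c, a)"])
    (auto simp: Agens_def vlin_sum[OF vlin_cf(1)] cfA_mon intro!: sum.neutral sum.neutral[THEN trans] split: if_splits)

lemma cfA_Tmat_second: "cfA c a d b (Tmat r n (\<lambda>x t. idm N \<boxtimes> x \<boxtimes> t))
    = (if d \<in> idx r \<and> b \<in> idx n \<and> c \<in> idx N \<and> c = a then gen d b else 0)"
  unfolding Tmat_second vlin_sum[OF vlin_cf(1)]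
  by (subst sum_single[of _ "(d, b)"])
    (auto simp: Agens_def vlin_sum[OF vlin_cf(1)] cfA_mon intro!: sum.neutral sum.neutral[THEN trans] split: if_splits)

lemma cfA_Smat:
  assumes "D \<in> idx N \<and> A' \<in> idx N \<or> C \<in> idx N \<and> B \<in> idx N"
  shows "cfA D C A' B (Smat N (\<lambda>x y. x \<boxtimes> y \<boxtimes> w1)) = scal (Sc D C A' B) w1"
  by (rule Smat_extract[OF vlin_cf(1) _ _ assms]) (auto simp: vtens_simps cfA_mon)

lemma Amons_kprod:
  assumes "x \<in> vspan (Amons UNIV)" "y \<in> vspan (Amons J)"
  shows "x \<star> y \<in> vspan (Amons J)"
  unfolding kprod_def
proof (rule lin_mem_vspan[OF assms(1)], rule lin_mem_vspan[OF assms(2)])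
  fix m m' assume "m \<in> Amons UNIV" "m' \<in> Amons J"
  then obtain i1 c1 j1 d1 x i2 a2 j2 b2 y where m: "m = Tens (Mu i1 c1) (Tens (Mu j1 d1) (Word x))"
    "m' = Tens (Mu i2 a2) (Tens (Mu j2 b2) (Word y))" and c: "a2 \<in> J" "b2 \<in> J"
    by (auto simp: Amons_def)
  then have "mon (Tens (Mu i1 a2) (Tens (Mu j1 b2) (Word (x @ y)))) \<in> vspan (Amons J)"
    by (intro mon_in_vspan) (auto simp: Amons_def)
  then show "kmono m m' \<in> vspan (Amons J)"
    by (simp add: m vtens_simps vec.span_scale vec.span_zero)
qed

lemma Amons_Smat: "Smat N (\<lambda>x y. x \<boxtimes> y \<boxtimes> w1) \<in> vspan (Amons (idx N))"
  by (rule Smat_mem[OF vec.subspace_span]) (auto simp: vtens_simps Amons_def intro!: mon_in_vspan)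

lemma Amons_Tmat:
  "Tmat r n (\<lambda>x t. x \<boxtimes> idm N \<boxtimes> t) \<in> vspan (Amons (idx n \<union> idx N))"
  "Tmat r n (\<lambda>x t. idm N \<boxtimes> x \<boxtimes> t) \<in> vspan (Amons (idx n \<union> idx N))"
  unfolding Tmat_first Tmat_second
  by (auto intro!: vec.span_sum mon_in_vspan simp: Amons_def Agens_def)

lemma vspan_Amons_mono: "x \<in> vspan (Amons J) \<Longrightarrow> J \<subseteq> J' \<Longrightarrow> x \<in> vspan (Amons J')"
  using vec.span_mono[OF image_mono[of "Amons J" "Amons J'" mon]] by (fastforce simp: Amons_def)

lemma sgnop_mon: "sgnop s (mon m) = scal ((-1) ^ (s * par m)) (mon m)"
  by (simp add: sgnop_def)

abbreviation ip2 :: "int \<Rightarrow> int \<Rightarrow> nat" where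
  "ip2 i j \<equiv> ipar i + ipar j"

text \<open>T has an identity matrix in its idle position, which collapses the inner sums of both
  triple products; only the two indices summed against S remain.\<close>

lemma cfA_STT:
  assumes i: "i \<in> idx r" "j \<in> idx r" and a: "a \<in> idx n" "b \<in> idx n"
  shows "cfA i a j b (STT r n) =
    (\<Sum>c\<in>idx r. \<Sum>d\<in>idx r. scal (Sc i c j d)
        (scal ((-1) ^ (ip2 j d * ip2 c a + ip2 d b * ip2 c a)) (wd [(c, a), (d, b)])))
    - (\<Sum>c\<in>idx n. \<Sum>d\<in>idx n. scal (Sc c a d b)
        (scal ((-1) ^ (ip2 j d * ip2 c a + (ip2 c a + ip2 d b) * (ip2 j d + ip2 i c))) (wd [(j, d), (i, c)])))"
proof -
  let ?S = "\<lambda>N. Smat N (\<lambda>x y. x \<boxtimes> y \<boxtimes> w1)"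
  let ?T1 = "\<lambda>N. Tmat r n (\<lambda>x t. x \<boxtimes> idm N \<boxtimes> t)" and ?T2 = "\<lambda>N. Tmat r n (\<lambda>x t. idm N \<boxtimes> x \<boxtimes> t)"
  \<comment> \<open>T is rectangular, so inner indices run through the row or the column index set;
    the union serves for both.\<close>
  let ?J = "idx r \<union> idx n"
  have J: "finite ?J" by simp
  have u: "x \<in> vspan (Amons J) \<Longrightarrow> x \<in> vspan (Amons UNIV)" for x J by (erule vspan_Amons_mono) simp
  have ST: "?S r \<star> ?T1 r \<in> vspan (Amons ?J)"
    using Amons_kprod[OF u[OF Amons_Smat] Amons_Tmat(1)] by (simp add: Un_commute)
  have T2: "?T2 r \<in> vspan (Amons ?J)" using Amons_Tmat(2)[of r n r] by (simp add: Un_commute)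
  have TT: "?T2 r \<star> ?T1 n \<in> vspan (Amons (idx n))"
    using Amons_kprod[OF u[OF Amons_Tmat(2)[of r n r]] Amons_Tmat(1)[of r n n]] by simp
  have 1: "cfA i c j d (?S r \<star> ?T1 r) = (if d \<in> idx r \<and> c \<in> idx n then
      \<Sum>c'\<in>idx r. scal (Sc i c' j d * (-1) ^ (ip2 j d * ip2 c' c)) (gen c' c) else 0)" for c d
    unfolding cfA_kprod[OF finite_idx Amons_Smat u[OF Amons_Tmat(1)]] using i
    by (auto simp: cfA_Tmat_first cfA_Smat vlin_scal[OF vlin_sgnop] sgnop_mon kprod_simps mult.commute
        if_distrib[of "\<lambda>x. _ \<star> x"] if_distrib[of "scal _"] cong: if_cong intro!: sum.cong sum.neutral)
  have 2: "cfA i a j b (?S r \<star> ?T1 r \<star> ?T2 n) =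
     (\<Sum>d\<in>idx r. \<Sum>c\<in>idx r. scal (Sc i c j d) (scal ((-1) ^ (ip2 j d * ip2 c a + ip2 d b * ip2 c a)) (wd [(c, a), (d, b)])))"
  proof -
    have "cfA i a j b (?S r \<star> ?T1 r \<star> ?T2 n) = (\<Sum>c\<in>?J. \<Sum>d\<in>?J. scal ((-1) ^ (ip2 j d * ip2 c a))
       (sgnop (ipar c + ipar a + ipar d + ipar b) (cfA i c j d (?S r \<star> ?T1 r)) \<star> cfA c a d b (?T2 n)))"
      by (rule cfA_kprod[OF J ST u[OF Amons_Tmat(2)]])
    also have "\<dots> = (\<Sum>d\<in>?J. scal ((-1) ^ (ip2 j d * ip2 a a))
       (sgnop (ipar a + ipar a + ipar d + ipar b) (cfA i a j d (?S r \<star> ?T1 r)) \<star> cfA a a d b (?T2 n)))"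
      using a by (subst sum_single[of _ a]) (auto simp: cfA_Tmat_second kprod_simps)
    also have "\<dots> = (\<Sum>d\<in>idx r. scal ((-1) ^ (ip2 j d * ip2 a a))
       (sgnop (ipar a + ipar a + ipar d + ipar b) (cfA i a j d (?S r \<star> ?T1 r)) \<star> cfA a a d b (?T2 n)))"
      by (rule sum.mono_neutral_right) (auto simp: cfA_Tmat_second kprod_simps)
    also have "\<dots> = (\<Sum>d\<in>idx r. \<Sum>c\<in>idx r. scal (Sc i c j d) (scal ((-1) ^ (ip2 j d * ip2 c a + ip2 d b * ip2 c a)) (wd [(c, a), (d, b)])))"
    proof (rule sum.cong[OF refl])
      fix d assume d: "d \<in> idx r"
      have s: "(-1::Cq) ^ (ip2 j d * ip2 a a) * ((Sc i c j d * (-1) ^ (ip2 j d * ip2 c a)) * (-1) ^ ((ipar a + ipar a + ipar d + ipar b) * ip2 c a))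
         = Sc i c j d * (-1) ^ (ip2 j d * ip2 c a + ip2 d b * ip2 c a)" for c
        by (cases "even (ip2 j d)"; cases "even (ip2 c a)"; cases "even (ip2 d b)") (auto simp: power_add)
      show "scal ((-1) ^ (ip2 j d * ip2 a a))
         (sgnop (ipar a + ipar a + ipar d + ipar b) (cfA i a j d (?S r \<star> ?T1 r)) \<star> cfA a a d b (?T2 n))
        = (\<Sum>c\<in>idx r. scal (Sc i c j d) (scal ((-1) ^ (ip2 j d * ip2 c a + ip2 d b * ip2 c a)) (wd [(c, a), (d, b)])))"
        using a d by (simp add: 1 cfA_Tmat_second vlin_sum[OF vlin_sgnop] vlin_scal[OF vlin_sgnop] sgnop_mon
            kprod_sum kprod_simps vec.scale_sum_right s flip: s)
    qed
    finally show ?thesis .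
  qed
  have 3: "cfA i c j d (?T2 r \<star> ?T1 n) = (if c \<in> idx n \<and> d \<in> idx n then wd [(j, d), (i, c)] else 0)" for c d
  proof -
    have "cfA i c j d (?T2 r \<star> ?T1 n) = (\<Sum>c'\<in>?J. \<Sum>d'\<in>?J. scal ((-1) ^ (ip2 j d' * ip2 c' c))
       (sgnop (ipar c' + ipar c + ipar d' + ipar d) (cfA i c' j d' (?T2 r)) \<star> cfA c' c d' d (?T1 n)))"
      by (rule cfA_kprod[OF J T2 u[OF Amons_Tmat(1)]])
    also have "\<dots> = (if c \<in> idx n \<and> d \<in> idx n then wd [(j, d), (i, c)] else 0)"
    proof (cases "c \<in> idx n \<and> d \<in> idx n")
      case True
      have s: "(-1::Cq) ^ (ip2 j d * ip2 i c) * (-1) ^ ((ipar i + ipar c + ipar d + ipar d) * ip2 j d) = 1"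
        by (cases "even (ip2 j d)"; cases "even (ip2 i c)") auto
      show ?thesis using True i
        by (subst sum_delta2[OF J J, of i d]) (auto simp: cfA_Tmat_first cfA_Tmat_second vlin_zero[OF vlin_sgnop] sgnop_mon kprod_simps s)
    qed (auto simp: cfA_Tmat_first kprod_simps intro!: sum.neutral)
    finally show ?thesis .
  qed
  have 4: "cfA i a j b (?T2 r \<star> ?T1 n \<star> ?S n) = (\<Sum>c\<in>idx n. \<Sum>d\<in>idx n. scal (Sc c a d b)
        (scal ((-1) ^ (ip2 j d * ip2 c a + (ip2 c a + ip2 d b) * (ip2 j d + ip2 i c))) (wd [(j, d), (i, c)])))"
    unfolding cfA_kprod[OF finite_idx TT u[OF Amons_Smat]] using a
    by (auto simp: 3 cfA_Smat sgnop_mon kprod_simps power_add mult.commute add.assoc intro!: sum.cong)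
  show ?thesis
    unfolding STT_def Let_def vlin_diff[OF vlin_cf(1)] 2 4 by (subst sum.swap) simp
qed

text \<open>S is extracted behind each single term of T, the functional in
  \<open>Smat_extract\<close> being multiplication by that term followed by
  \<open>cfT\<close>.\<close>

lemma cfT_TS:
  assumes i: "i \<in> idx r" and a: "a \<in> idx n" "b \<in> idx n" "c \<in> idx n"
  shows "cfT i c a b (TS r n) = (\<Sum>d\<in>idx n. scal (Sc d c a b * (-1) ^ (ip2 i d * ip2 d c)) (gen i d))"
proof -
  let ?S = "Smat n (\<lambda>x y. x \<boxtimes> w1 \<boxtimes> y)"
  have *: "cfT i c a b (mon (Tens (Mu i' d) (Tens (Word [(i', d)]) (Mu k k))) \<star> ?S)
      = scal (Sc d c k b) (if i' = i \<and> k = a then scal ((-1) ^ (ip2 i' d * ip2 d c)) (gen i' d) else 0)"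
    if "d \<in> idx n" "k \<in> idx n" for i' d k
  proof (rule Smat_extract[where f = "\<lambda>x. cfT i c a b (mon (Tens (Mu i' d) (Tens (Word [(i', d)]) (Mu k k))) \<star> x)"])
    show "vlin (\<lambda>x. cfT i c a b (mon (Tens (Mu i' d) (Tens (Word [(i', d)]) (Mu k k))) \<star> x))"
      by (intro vlin_comp[OF vlin_cf(3)] vlin_rules)
    have s: "(-1::Cq) ^ ((ipar i' + (ipar d + (ipar k + ipar k))) * m) = (-1) ^ (ip2 i' d * m)" for m
      by (cases "even (ip2 i' d)"; cases "even m") auto
    show "cfT i c a b (mon (Tens (Mu i' d) (Tens (Word [(i', d)]) (Mu k k))) \<star> (E d' c' \<boxtimes> w1 \<boxtimes> E a' b'))
      = (if d' = d \<and> c' = c \<and> a' = k \<and> b' = b then if i' = i \<and> k = a then scal ((-1) ^ (ip2 i' d * ip2 d c)) (gen i' d) else 0 else 0)"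
      for d' c' a' b'
      by (auto simp: cfT_mon vtens_simps vlin_zero[OF vlin_cf(3)] vlin_scal[OF vlin_cf(3)] add.assoc s)
  qed (use that in \<open>auto simp: vtens_simps\<close>)
  have "cfT i c a b (TS r n) = (\<Sum>(i', d)\<in>Agens r n. \<Sum>k\<in>idx n. 
      cfT i c a b (mon (Tens (Mu i' d) (Tens (Word [(i', d)]) (Mu k k))) \<star> ?S))"
    by (simp add: TS_def Tmat_def idm_def vtens_sum kprod_sum vlin_sum[OF vlin_cf(3)] case_prod_beta)
  also have "\<dots> = (\<Sum>i'\<in>idx r. \<Sum>d\<in>idx n. \<Sum>k\<in>idx n.
      scal (Sc d c k b) (if i' = i \<and> k = a then scal ((-1) ^ (ip2 i' d * ip2 d c)) (gen i' d) else 0))"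
    unfolding Agens_def by (simp add: sum.cartesian_product[symmetric] *)
  also have "\<dots> = (\<Sum>d\<in>idx n. \<Sum>k\<in>idx n.
      scal (Sc d c k b) (if k = a then scal ((-1) ^ (ip2 i d * ip2 d c)) (gen i d) else 0))"
    using i by (subst sum_single[of _ i]) auto
  also have "\<dots> = (\<Sum>d\<in>idx n. scal (Sc d c a b * (-1) ^ (ip2 i d * ip2 d c)) (gen i d))"
    using a by (intro sum.cong refl, subst sum_single[of _ a]) auto
  finally show ?thesis .
qed

section \<open>The relators of the quantum queer superalgebra in coordinates\<close>

lemma Lmat_first: "Lmat n (\<lambda>x y. x \<boxtimes> y \<boxtimes> idm n)
    = (\<Sum>(i, a)\<in>Ugens n. \<Sum>k\<in>idx n. mon (Tens (Word [(i, a)]) (Tens (Mu i a) (Mu k k))))"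
  unfolding Lmat_def idm_def by (rule sum.cong[OF refl]) (auto simp: Lgen_def Ugens_def vtens_sum)

lemma Lmat_second: "Lmat n (\<lambda>x y. x \<boxtimes> idm n \<boxtimes> y)
    = (\<Sum>(i, a)\<in>Ugens n. \<Sum>k\<in>idx n. mon (Tens (Word [(i, a)]) (Tens (Mu k k) (Mu i a))))"
  unfolding Lmat_def idm_def by (rule sum.cong[OF refl]) (auto simp: Lgen_def Ugens_def vtens_sum)

lemma cfU_Lmat_first: "cfU c a d b (Lmat n (\<lambda>x y. x \<boxtimes> y \<boxtimes> idm n))
    = (if c \<in> idx n \<and> a \<in> idx n \<and> d \<in> idx n \<and> d = b then Lgen c a else 0)"
  unfolding Lmat_first vlin_sum[OF vlin_cf(2)]
  by (subst sum_single[OF finite_Ugens, where i = "(c, a)"])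
    (auto simp: Ugens_def Lgen_def vlin_sum[OF vlin_cf(2)] cfU_mon intro!: sum.neutral sum.neutral[THEN trans] split: if_splits)

lemma cfU_Lmat_second: "cfU c a d b (Lmat n (\<lambda>x y. x \<boxtimes> idm n \<boxtimes> y))
    = (if d \<in> idx n \<and> b \<in> idx n \<and> c \<in> idx n \<and> c = a then Lgen d b else 0)"
  unfolding Lmat_second vlin_sum[OF vlin_cf(2)]
  by (subst sum_single[OF finite_Ugens, where i = "(d, b)"])
    (auto simp: Ugens_def Lgen_def vlin_sum[OF vlin_cf(2)] cfU_mon intro!: sum.neutral sum.neutral[THEN trans] split: if_splits)

lemma cfU_Smat:
  assumes "D \<in> idx N \<and> A' \<in> idx N \<or> C \<in> idx N \<and> B \<in> idx N"
  shows "cfU D C A' B (Smat N (\<lambda>x y. w1 \<boxtimes> x \<boxtimes> y)) = scal (Sc D C A' B) w1"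
  by (rule Smat_extract[OF vlin_cf(2) _ _ assms]) (auto simp: vtens_simps cfU_mon)

lemma Umons_kprod:
  assumes "x \<in> vspan (Umons UNIV)" "y \<in> vspan (Umons J)"
  shows "x \<star> y \<in> vspan (Umons J)"
  unfolding kprod_def
proof (rule lin_mem_vspan[OF assms(1)], rule lin_mem_vspan[OF assms(2)])
  fix m m' assume "m \<in> Umons UNIV" "m' \<in> Umons J"
  then obtain i1 c1 j1 d1 x i2 a2 j2 b2 y where m: "m = Tens (Word x) (Tens (Mu i1 c1) (Mu j1 d1))"
    "m' = Tens (Word y) (Tens (Mu i2 a2) (Mu j2 b2))" and c: "a2 \<in> J" "b2 \<in> J"
    by (auto simp: Umons_def)
  then have "mon (Tens (Word (x @ y)) (Tens (Mu i1 a2) (Mu j1 b2))) \<in> vspan (Umons J)"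
    by (intro mon_in_vspan) (auto simp: Umons_def)
  then show "kmono m m' \<in> vspan (Umons J)"
    by (simp add: m vtens_simps vec.span_scale vec.span_zero)
qed

lemma Umons_Smat: "Smat N (\<lambda>x y. w1 \<boxtimes> x \<boxtimes> y) \<in> vspan (Umons (idx N))"
  by (rule Smat_mem[OF vec.subspace_span]) (auto simp: vtens_simps Umons_def intro!: mon_in_vspan)

lemma Umons_Lmat:
  "Lmat n (\<lambda>x y. x \<boxtimes> y \<boxtimes> idm n) \<in> vspan (Umons (idx n))"
  "Lmat n (\<lambda>x y. x \<boxtimes> idm n \<boxtimes> y) \<in> vspan (Umons (idx n))"
  unfolding Lmat_first Lmat_second
  by (auto intro!: vec.span_sum mon_in_vspan simp: Umons_def Ugens_def)

lemma sgnop_Lgen: "sgnop s (Lgen i j) = scal ((-1) ^ (s * ip2 i j)) (Lgen i j)"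
  by (simp add: Lgen_def sgnop_mon vlin_zero[OF vlin_sgnop])

lemma w1_Lgen: "w1 \<star> Lgen i j = Lgen i j" "Lgen i j \<star> Lgen k l \<star> w1 = Lgen i j \<star> Lgen k l"
  by (simp_all add: Lgen_def kprod_simps)

lemma cfU_LLS:
  assumes i: "i \<in> idx n" "k \<in> idx n" and a: "j \<in> idx n" "l \<in> idx n"
  shows "cfU i j k l (LLS n) =
    (\<Sum>b\<in>idx n. \<Sum>d\<in>idx n. scal (Sc b j d l * (-1) ^ (ip2 k d * ip2 i b + ip2 k d * ip2 b j)) (Lgen i b \<star> Lgen k d))
    - (\<Sum>c\<in>idx n. \<Sum>d\<in>idx n. scal (Sc i c k d * (-1) ^ ((ipar i + ipar c + ipar k + ipar d) * ip2 d l
         + ip2 k l * ip2 c j + (ipar i + ipar c + ipar k + ipar l) * ip2 c j)) (Lgen d l \<star> Lgen c j))"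
proof -
  let ?S = "Smat n (\<lambda>x y. w1 \<boxtimes> x \<boxtimes> y)"
  let ?L1 = "Lmat n (\<lambda>x y. x \<boxtimes> y \<boxtimes> idm n)" and ?L2 = "Lmat n (\<lambda>x y. x \<boxtimes> idm n \<boxtimes> y)"
  have u: "x \<in> vspan (Umons J) \<Longrightarrow> x \<in> vspan (Umons UNIV)" for x J unfolding mem_vspan_iff by (auto simp: Umons_def)
  have LL: "?L1 \<star> ?L2 \<in> vspan (Umons (idx n))" and SL: "?S \<star> ?L2 \<in> vspan (Umons (idx n))"
    by (intro Umons_kprod u[OF Umons_Lmat(1)] Umons_Lmat u[OF Umons_Smat])+
  have 1: "cfU i c k d (?L1 \<star> ?L2) = scal ((-1) ^ (ip2 k d * ip2 i c)) (Lgen i c \<star> Lgen k d)"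
    if cd: "c \<in> idx n" "d \<in> idx n" for c d
  proof -
    have s: "(-1::Cq) ^ (ip2 k k * ip2 c c) * (-1) ^ ((ipar i + ipar c + ipar k + ipar k) * ip2 k d) = (-1) ^ (ip2 k d * ip2 i c)"
      by (cases "even (ip2 k d)"; cases "even (ip2 i c)") auto
    show ?thesis
      unfolding cfU_kprod[OF finite_idx Umons_Lmat(1) u[OF Umons_Lmat(2)]] using i cd s
      by (subst sum_delta2[OF finite_idx finite_idx, of c n k])
        (auto simp: cfU_Lmat_first cfU_Lmat_second kprod_simps vlin_zero[OF vlin_sgnop] sgnop_Lgen)
  qed
  have 2: "cfU i j k l (?L1 \<star> ?L2 \<star> ?S) =
    (\<Sum>b\<in>idx n. \<Sum>d\<in>idx n. scal (Sc b j d l * (-1) ^ (ip2 k d * ip2 i b + ip2 k d * ip2 b j)) (Lgen i b \<star> Lgen k d))"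
    unfolding cfU_kprod[OF finite_idx LL u[OF Umons_Smat]] using a
    by (auto simp: 1 cfU_Smat vlin_scal[OF vlin_sgnop] sgnop_mon kprod_simps w1_Lgen power_add mult.commute mult.left_commute intro!: sum.cong)
  have 3: "cfU i c k d (?S \<star> ?L2) =
     (\<Sum>d'\<in>idx n. scal (Sc i c k d' * (-1) ^ (ip2 k d' * ip2 c c + (ipar i + ipar c + ipar k + ipar d') * ip2 d' d)) (Lgen d' d))"
    if cd: "c \<in> idx n" "d \<in> idx n" for c d
    unfolding cfU_kprod[OF finite_idx Umons_Smat u[OF Umons_Lmat(2)]]
    using i cd
    by (subst sum_single[of _ c])
      (auto simp: cfU_Smat cfU_Lmat_second sgnop_Lgen vlin_zero[OF vlin_sgnop] kprod_simps w1_Lgen power_add mult.commute mult.left_commute intro!: sum.cong)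
  have 4: "cfU i j k l (?S \<star> ?L2 \<star> ?L1) =
     (\<Sum>c\<in>idx n. \<Sum>d\<in>idx n. scal (Sc i c k d * (-1) ^ ((ipar i + ipar c + ipar k + ipar d) * ip2 d l
         + ip2 k l * ip2 c j + (ipar i + ipar c + ipar k + ipar l) * ip2 c j)) (Lgen d l \<star> Lgen c j))"
    unfolding cfU_kprod[OF finite_idx SL u[OF Umons_Lmat(1)]]
  proof (rule sum.cong[OF refl])
    fix c assume c: "c \<in> idx n"
    have s: "(-1::Cq) ^ (ip2 k l * ip2 c j) * ((Sc i c k d * (-1) ^ (ip2 k d * ip2 c c + (ipar i + ipar c + ipar k + ipar d) * ip2 d l))
         * (-1) ^ ((ipar i + ipar c + ipar k + ipar l) * ip2 c j))
       = Sc i c k d * (-1) ^ ((ipar i + ipar c + ipar k + ipar d) * ip2 d l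
         + ip2 k l * ip2 c j + (ipar i + ipar c + ipar k + ipar l) * ip2 c j)" for d
      by (simp add: power_add power_mult_distrib mult.commute mult.left_commute flip: mult_2 power_mult)
    show "(\<Sum>d\<in>idx n. scal ((-1) ^ (ip2 k d * ip2 c j)) (cfU i c k d (?S \<star> ?L2) \<star> sgnop (ipar i + ipar c + ipar k + ipar d) (cfU c j d l ?L1)))
       = (\<Sum>d\<in>idx n. scal (Sc i c k d * (-1) ^ ((ipar i + ipar c + ipar k + ipar d) * ip2 d l
         + ip2 k l * ip2 c j + (ipar i + ipar c + ipar k + ipar l) * ip2 c j)) (Lgen d l \<star> Lgen c j))"
      using a c
      by (subst sum_single[of _ l])
        (auto simp: 3 cfU_Lmat_first sgnop_Lgen vlin_zero[OF vlin_sgnop] kprod_sum kprod_simps vec.scale_sum_right s[symmetric] mult.assoc mult.left_commute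
           intro!: sum.cong)
  qed
  show ?thesis
    unfolding LLS_def Let_def vlin_diff[OF vlin_cf(2)] 2 4 ..
qed

section \<open>The relations of the quantum coordinate superalgebras\<close>

text \<open>The member with positive row of each pair of letters identified by t_ia =
  t_{-i,-a}.\<close>

definition nrm :: "int \<times> int \<Rightarrow> int \<times> int" where
  "nrm l = (if fst l < 0 then (- fst l, - snd l) else l)"

text \<open>
  The relators in the generators with positive row index, read off as expressions in the values
  \<open>F\<close> of words.
\<close>

definition rho :: "int \<Rightarrow> int \<Rightarrow> int \<Rightarrow> int \<Rightarrow> ((int \<times> int) list \<Rightarrow> vec) \<Rightarrow> vec" where
  "rho i j a b F = braid a b (\<lambda>c d. F [(j, c), (i, d)])
     - scal (if i = j then qvar else 1) (F [(i, a), (j, b)]) - scal (of_bool (j < i) * xi) (F [(j, a), (i, b)])"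

text \<open>The relator of S T T = T T S at (ia, jb), for rows of any sign, with the sums over the
  entries of S reduced to three terms each.\<close>

definition stt :: "int \<Rightarrow> int \<Rightarrow> int \<Rightarrow> int \<Rightarrow> ((int \<times> int) list \<Rightarrow> vec) \<Rightarrow> vec" where
  "stt i a j b H =
    (let F = (\<lambda>c d. scal ((-1) ^ (ip2 j d * ip2 c a + ip2 d b * ip2 c a)) (H [(c, a), (d, b)]));
         F' = (\<lambda>c d. scal ((-1) ^ (ip2 j d * ip2 c a + (ip2 c a + ip2 d b) * (ip2 j d + ip2 i c))) (H [(j, d), (i, c)]))
     in (scal (qvar powi phi i j) (F i j) + scal (of_bool (j < i) * xi * (-1) ^ ipar j) (F j i)
          + scal (of_bool (j < -i) * xi * (-1) ^ ipar j) (F (-j) (-i)))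
      - (scal (qvar powi phi a b) (F' a b) + scal (of_bool (a < b) * xi * (-1) ^ ipar a) (F' b a)
          + scal (of_bool (-a < b) * xi * (-1) ^ ipar (-a)) (F' (-b) (-a))))"

text \<open>The linear map absorbs the context of a relator: it will be multiplication by words on
  both sides followed by the map under study.\<close>

lemma vlin_STT:
  assumes i: "i \<in> idx r" "j \<in> idx r" and a: "a \<in> idx n" "b \<in> idx n" and f: "vlin f"
  shows "f (cfA i a j b (STT r n)) = stt i a j b (\<lambda>z. f (wd z))"
  unfolding cfA_STT[OF assms(1-4)] Sc_sum_right[OF i] Sc_sum_left[OF a] stt_def Let_def
  by (simp only: vlin_add[OF f] vlin_diff[OF f] vlin_scal[OF f])

lemma phi_cases:
  "phi i i = (if i = 0 then 2 else if i < 0 then -1 else 1)" "phi i (-i) = (if i = 0 then 2 else if i < 0 then 1 else -1)"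
  "phi (-i) i = (if i = 0 then 2 else if i < 0 then -1 else 1)"
  "i \<noteq> j \<Longrightarrow> i \<noteq> - j \<Longrightarrow> phi i j = 0"
  by (auto simp: phi_def ipar_def)

text \<open>This is the passage from the matrix relations to the presentation by positive rows: once
  \<open>H\<close> depends only on normal forms of letters, negating row and column of a letter
  changes a relator by a global sign.\<close>

lemma stt_signs:
  assumes I: "0 < I" "0 < J" and x: "0 < x" "0 < y" and a: "a = x \<or> a = - x" "b = y \<or> b = - y"
    and H: "\<And>k c d. H [(- I, c), (k, d)] = H [(I, - c), (k, d)]" "\<And>k c d. H [(k, d), (- I, c)] = H [(k, d), (I, - c)]"
    "\<And>k c d. H [(- J, c), (k, d)] = H [(J, - c), (k, d)]" "\<And>k c d. H [(k, d), (- J, c)] = H [(k, d), (J, - c)]"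
    and s: "s = 1 \<or> s = -1" "t = 1 \<or> t = -1"
  shows "stt (s * I) (s * a) (t * J) (t * b) H = scal (- ((-1) ^ (ip2 (s * I) (s * a) * ip2 (t * J) (t * b)))) (rho I J a b H)"
proof (rule poly_mapping_eqI)
  fix m
  define h where "h z = coeff_of (H z) m" for z
  have h: "\<And>k c d. h [(- I, c), (k, d)] = h [(I, - c), (k, d)]" "\<And>k c d. h [(k, d), (- I, c)] = h [(k, d), (I, - c)]"
    "\<And>k c d. h [(- J, c), (k, d)] = h [(J, - c), (k, d)]" "\<And>k c d. h [(k, d), (- J, c)] = h [(k, d), (J, - c)]"
    by (simp_all add: h_def H)
  have z: "- y < x" "- x < y" "- x \<noteq> y" "- y \<noteq> x" "\<not> x < - y" "\<not> y < - x" "\<not> x < 0" "\<not> y < 0" "x \<noteq> -x" "y \<noteq> - y" "x \<noteq> - y" "y \<noteq> - x"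
    "- I < J" "- J < I" "- I \<noteq> J" "- J \<noteq> I" "\<not> I < - J" "\<not> J < - I" "\<not> I < 0" "\<not> J < 0" "I \<noteq> -I" "J \<noteq> - J" "J \<noteq> - I" "I \<noteq> - J"
    "x \<noteq> 0" "y \<noteq> 0" "I \<noteq> 0" "J \<noteq> 0"
    using I x by auto
  have ip: "ipar x = 0" "ipar y = 0" "ipar I = 0" "ipar J = 0" "ipar (- x) = 1" "ipar (- y) = 1" "ipar (- I) = 1" "ipar (- J) = 1"
    using I x by (simp_all add: ipar_def)
  have st: "\<And>k::int. (k < k) = False" by simp
  have xy: "x < y \<and> x \<noteq> y \<and> \<not> y < x \<and> y \<noteq> x \<or> x = y \<or> y < x \<and> x \<noteq> y \<and> \<not> x < y \<and> y \<noteq> x" by auto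
  have IJ: "I < J \<and> I \<noteq> J \<and> \<not> J < I \<and> J \<noteq> I \<or> I = J \<or> J < I \<and> I \<noteq> J \<and> \<not> I < J \<and> J \<noteq> I" by auto
  show "coeff_of (stt (s * I) (s * a) (t * J) (t * b) H) m
     = coeff_of (scal (- ((-1) ^ (ip2 (s * I) (s * a) * ip2 (t * J) (t * b)))) (rho I J a b H)) m"
    \<comment> \<open>144 cases: the signs of \<open>a\<close>, \<open>b\<close>, \<open>s\<close>,
      \<open>t\<close> and the orders of \<open>x\<close>, \<open>y\<close> and of \<open>I\<close>,
      \<open>J\<close>.\<close>
    using a s xy IJ unfolding stt_def rho_def Let_def braid_def lookup_add lookup_minus lookup_scal h_def[symmetric]
    by (elim disjE conjE; simp add: z ip h x I phi_cases qvar_nonzero power_int_minus; simp add: xi_def algebra_simps qvar_nonzero)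
qed

lemma stt_nrm:
  assumes "i \<noteq> 0" "j \<noteq> 0" "a \<noteq> 0" "b \<noteq> 0" and H: "\<And>z. H z = H (map nrm z)"
  shows "\<exists>s. stt i a j b H = scal s (rho (fst (nrm (i, a))) (fst (nrm (j, b))) (snd (nrm (i, a))) (snd (nrm (j, b))) H)"
proof -
  have *: "\<exists>I s a'. 0 < I \<and> (s = 1 \<or> s = -1) \<and> i = s * I \<and> a = s * a' \<and> nrm (i, a) = (I, a') \<and> a' \<noteq> 0"
    if "i \<noteq> 0" "a \<noteq> 0" for i a :: int
    by (rule exI[of _ "\<bar>i\<bar>"], rule exI[of _ "sgn i"], rule exI[of _ "sgn i * a"])
      (use that in \<open>auto simp: nrm_def sgn_if\<close>)
  obtain I s a' where i: "0 < I" "s = 1 \<or> s = -1" "i = s * I" "a = s * a'" "nrm (i, a) = (I, a')" "a' \<noteq> 0"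
    using *[OF assms(1,3)] by blast
  obtain J t b' where j: "0 < J" "t = 1 \<or> t = -1" "j = t * J" "b = t * b'" "nrm (j, b) = (J, b')" "b' \<noteq> 0"
    using *[OF assms(2,4)] by blast
  have n: "nrm (- k, c) = nrm (k, - c)" if "0 < k" for k c using that by (simp add: nrm_def)
  have H': "H [(- k, c), (k', d)] = H [(k, - c), (k', d)]" "H [(k', d), (- k, c)] = H [(k', d), (k, - c)]" if "0 < k" for k c k' d
    using that H[of "[(- k, c), (k', d)]"] H[of "[(k, - c), (k', d)]"] H[of "[(k', d), (- k, c)]"] H[of "[(k', d), (k, - c)]"]
    by (simp_all add: n)
  have ab: "x = \<bar>x\<bar> \<or> x = - \<bar>x\<bar>" for x :: int by auto
  have "stt i a j b H = scal (- ((-1) ^ (ip2 (s * I) (s * a') * ip2 (t * J) (t * b')))) (rho I J a' b' H)"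
    unfolding i(3,4) j(3,4)
    by (rule stt_signs[OF i(1) j(1) _ _ ab ab H'[OF i(1)] H'[OF j(1)] i(2) j(2)]) (use i(6) j(6) in auto)
  then show ?thesis unfolding i(5) j(5) fst_conv snd_conv by blast
qed

lemma rho_stt:
  assumes "0 < i" "0 < j" "a \<noteq> 0" "b \<noteq> 0"
  shows "\<exists>s. rho i j a b H = scal s (stt i a j b H)"
proof -
  \<comment> \<open>For positive rows both \<open>stt\<close> and \<open>rho\<close> evaluate only
    words with rows \<open>i\<close> and \<open>j\<close>, as the term with negative rows requires j
    < -i. So \<open>H\<close> may be replaced by a function of normal forms, to which
    \<open>stt_signs\<close> applies.\<close>
  define H' where "H' z = H (map nrm z)" for z
  have n: "nrm (nrm l) = nrm l" for l by (auto simp: nrm_def)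
  have H': "H' z = H' (map nrm z)" for z by (simp add: H'_def n comp_def)
  have nn: "nrm (i, c) = (i, c)" "nrm (j, c) = (j, c)" for c using assms by (auto simp: nrm_def)
  have p: "H' [(i, c), (j, d)] = H [(i, c), (j, d)]" "H' [(j, c), (i, d)] = H [(j, c), (i, d)]" for c d
    by (simp_all add: H'_def nn)
  have m: "H' [(- k, c), (k', d)] = H' [(k, - c), (k', d)]" "H' [(k', d), (- k, c)] = H' [(k', d), (k, - c)]" if "0 < k" for k c k' d
    using that by (simp_all add: H'_def nrm_def)
  have "stt i a j b H' = scal (- ((-1) ^ (ip2 i a * ip2 j b))) (rho i j a b H')"
  proof -
    have ab: "x = \<bar>x\<bar> \<or> x = - \<bar>x\<bar>" for x :: int by auto
    have "stt (1 * i) (1 * a) (1 * j) (1 * b) H' = scal (- ((-1) ^ (ip2 (1 * i) (1 * a) * ip2 (1 * j) (1 * b)))) (rho i j a b H')"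
      by (rule stt_signs[OF assms(1,2) _ _ ab ab m[OF assms(1)] m[OF assms(2)]]) (use assms(3,4) in auto)
    then show ?thesis by (simp only: mult_1)
  qed
  moreover have "stt i a j b H' = stt i a j b H"
    using assms by (auto simp: stt_def Let_def p)
  moreover have "rho i j a b H' = rho i j a b H" by (simp add: rho_def p)
  moreover have "- ((-1) ^ (ip2 i a * ip2 j b)) * - ((-1) ^ (ip2 i a * ip2 j b)) = (1::Cq)"
    by (cases "even (ip2 i a * ip2 j b)") auto
  ultimately show ?thesis
    by (intro exI[of _ "- ((-1) ^ (ip2 i a * ip2 j b))"]) simp
qed

lemma idx_positive: "i \<in> {1..int r} \<Longrightarrow> i \<in> idx r"
  by (auto simp: idx_def)

lemma nrm_Agens: "l \<in> Agens r n \<Longrightarrow> nrm l \<in> Agens r n \<and> fst (nrm l) \<in> {1..int r}"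
  by (auto simp: nrm_def Agens_def idx_def)

lemma scal_mem_homog:
  assumes "c \<noteq> 0 \<Longrightarrow> m \<in> B \<and> par m mod 2 = p"
  shows "scal c (mon m) \<in> vspan {m \<in> B. par m mod 2 = p}"
  using assms by (cases "c = 0") (auto intro: vec.span_zero vec.span_scale)

lemma mod2_mem: "n mod 2 \<in> {0, 1 :: nat}"
  by auto

lemma homog_Arels: "homog_relators (Agens r n) (Arels r n)"
  unfolding homog_relators_def
proof
  fix x assume "x \<in> Arels r n"
  then consider i a where "x = gen i a - gen (-i) (-a)" "i \<in> idx r" "a \<in> idx n"
    | i a j b where "x = cfA i a j b (STT r n)" "i \<in> idx r" "a \<in> idx n" "j \<in> idx r" "b \<in> idx n"
    unfolding Arels_def cfA_def by blast
  then show "\<exists>p\<in>{0, 1}. x \<in> vspan {m \<in> Word ` lists (Agens r n). par m mod 2 = p}"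
  proof cases
    case 1
    have "par (Word [(i, a)]) mod 2 = par (Word [(-i, -a)]) mod 2"
      using 1(2,3) by (auto simp: idx_def ipar_def)
    then have "x \<in> vspan {m \<in> Word ` lists (Agens r n). par m mod 2 = par (Word [(i, a)]) mod 2}"
      unfolding 1(1) using 1(2,3) by (intro vec.span_diff mon_in_vspan) (auto simp: Agens_def)
    then show ?thesis by (rule bexI[OF _ mod2_mem])
  next
    case 2
    note two = 2
    let ?p = "(ip2 i a + ip2 j b) mod 2"
    have e: "p mod 2 = q mod 2" if "p + q = s + 2 * t" "even s" for p q s t :: nat
      using that by presburger
    have "x \<in> vspan {m \<in> Word ` lists (Agens r n). par m mod 2 = ?p}"
      unfolding 2(1) cfA_STT[OF 2(2,4,3,5)] vec.scale_scale
    proof (intro vec.span_diff vec.span_sum scal_mem_homog, goal_cases)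
      case (1 c d)
      have "Sc i c j d \<noteq> 0" using 1 by (metis mult_zero_left)
      then have ev: "even (ipar i + ipar c + ipar j + ipar d)"
        by (intro Sc_even) (use 1(1,2) 2(2-5) in \<open>auto dest: idx_nonzero\<close>)
      have "par (Word [(c, a), (d, b)]) mod 2 = ?p" by (rule e[OF _ ev, of _ _ "ipar a + ipar b"]) auto
      then show ?case using 1(1,2) 2 by (auto simp: Agens_def)
    next
      case (2 c d)
      have "Sc c a d b \<noteq> 0" using 2 by (metis mult_zero_left)
      then have ev: "even (ipar c + ipar a + ipar d + ipar b)"
        by (intro Sc_even) (use 2(1,2) two(2-5) in \<open>auto dest: idx_nonzero\<close>)
      have "par (Word [(j, d), (i, c)]) mod 2 = ?p" by (rule e[OF _ ev, of _ _ "ipar i + ipar j"]) auto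
      then show ?case using 2(1,2) two by (auto simp: Agens_def)
    qed
    then show ?thesis by (rule bexI[OF _ mod2_mem])
  qed
qed

lemma parity_cancel: "even s \<Longrightarrow> p = s + 2 * t \<Longrightarrow> even (p::nat)"
  by simp

lemma homog_Urels: "homog_relators (Ugens n) (Urels n)"
  unfolding homog_relators_def
proof
  fix x assume "x \<in> Urels n"
  then consider i where "x = gen i i \<star> gen (-i) (-i) - w1" "i \<in> idx n"
    | i j k l where "x = cfU i j k l (LLS n)" "i \<in> idx n" "j \<in> idx n" "k \<in> idx n" "l \<in> idx n"
    unfolding Urels_def cfU_def by blast
  then show "\<exists>p\<in>{0, 1}. x \<in> vspan {m \<in> Word ` lists (Ugens n). par m mod 2 = p}"
  proof cases
    case 1
    then have "x \<in> vspan {m \<in> Word ` lists (Ugens n). par m mod 2 = 0}"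
      by (auto simp: Ugens_def intro!: vec.span_diff mon_in_vspan)
    then show ?thesis by (rule bexI) simp
  next
    case 2
    let ?p = "(ip2 i j + ip2 k l) mod 2"
    have L: "scal c (Lgen i' j' \<star> Lgen k' l') \<in> vspan {m \<in> Word ` lists (Ugens n). par m mod 2 = ?p}"
      if "i' \<in> idx n" "j' \<in> idx n" "k' \<in> idx n" "l' \<in> idx n" "c \<noteq> 0 \<Longrightarrow> even (ip2 i' j' + ip2 k' l' + (ip2 i j + ip2 k l))"
      for c i' j' k' l'
    proof (cases "i' \<le> j' \<and> k' \<le> l'")
      case True
      then have "Lgen i' j' \<star> Lgen k' l' = wd [(i', j'), (k', l')]" by (simp add: Lgen_def)
      moreover have "scal c (wd [(i', j'), (k', l')]) \<in> vspan {m \<in> Word ` lists (Ugens n). par m mod 2 = ?p}"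
        using that True by (intro scal_mem_homog) (auto simp: Ugens_def mod2_eq_if)
      ultimately show ?thesis by simp
    next
      case False
      then have "Lgen i' j' \<star> Lgen k' l' = 0" by (auto simp: Lgen_def kprod_simps)
      then show ?thesis by (simp add: vec.span_zero)
    qed
    have "x \<in> vspan {m \<in> Word ` lists (Ugens n). par m mod 2 = ?p}"
      unfolding 2(1) cfU_LLS[OF 2(2,4,3,5)]
    proof (intro vec.span_diff vec.span_sum L, goal_cases)
      case (5 b d)
      have "Sc b j d l \<noteq> 0" using 5 by (metis mult_zero_left)
      then have ev: "even (ipar b + ipar j + ipar d + ipar l)"
        by (intro Sc_even) (use 5(1,2) 2(2-5) in \<open>auto dest: idx_nonzero\<close>)
      show ?case by (rule parity_cancel[OF ev, where t = "ipar i + ipar k"]) simp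
    next
      case (10 c d)
      have "Sc i c k d \<noteq> 0" using 10 by (metis mult_zero_left)
      then have ev: "even (ipar i + ipar c + ipar k + ipar d)"
        by (intro Sc_even) (use 10(1,2) 2(2-5) in \<open>auto dest: idx_nonzero\<close>)
      show ?case by (rule parity_cancel[OF ev, where t = "ipar l + ipar j"]) simp
    qed (use 2 in auto)
    then show ?thesis by (rule bexI[OF _ mod2_mem])
  qed
qed

lemma palg_Aalg: "palg (Agens r n) (Arels r n) (Aalg r n)"
  unfolding Aalg_def by (rule palg_presented[OF homog_Arels])

lemma palg_A: "palg (Agens r n) (Arels r n) (A r n)"
  unfolding A_def using palg_Aalg by simp

lemma palg_Uq: "palg (Ugens n) (Urels n) (Uq n)"
  unfolding Uq_def by (rule palg_presented[OF homog_Urels])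

abbreviation NA :: "nat \<Rightarrow> nat \<Rightarrow> vec set" where
  "NA r n \<equiv> ideal_gen (Agens r n) (Arels r n)"

abbreviation wcase :: "((int \<times> int) list \<Rightarrow> vec) \<Rightarrow> mono \<Rightarrow> vec" where
  "wcase h m \<equiv> (case m of Word w \<Rightarrow> h w | _ \<Rightarrow> 0)"

lemma rho_mem_NA:
  assumes "i \<in> {1..int r}" "j \<in> {1..int r}" "a \<in> idx n" "b \<in> idx n" "u \<in> lists (Agens r n)" "v \<in> lists (Agens r n)"
  shows "rho i j a b (\<lambda>z. wd (u @ z @ v)) \<in> NA r n"
proof -
  let ?x = "cfA i a j b (STT r n)"
  have "?x \<in> Arels r n" unfolding Arels_def cfA_def using assms idx_positive by blast
  then have "wd u \<star> ?x \<star> wd v \<in> NA r n" using assms by (intro ideal_gen_base)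
  moreover have "wd u \<star> ?x \<star> wd v = stt i a j b (\<lambda>z. wd u \<star> wd z \<star> wd v)"
    using assms idx_positive by (intro vlin_STT[where f = "\<lambda>x. wd u \<star> x \<star> wd v"]) (blast | intro vlin_rules)+
  moreover obtain s where "rho i j a b (\<lambda>z. wd (u @ z @ v)) = scal s (stt i a j b (\<lambda>z. wd (u @ z @ v)))"
    using rho_stt[of i j a b "\<lambda>z. wd (u @ z @ v)"] assms by (auto simp: idx_def)
  ultimately show ?thesis
    using vec.subspace_scale[OF ideal_gen_subspace] by simp
qed

lemma gen_swap_mem_NA:
  assumes "i \<in> idx r" "a \<in> idx n" "u \<in> lists (Agens r n)" "v \<in> lists (Agens r n)"
  shows "wd (u @ [(i, a)] @ v) - wd (u @ [(-i, -a)] @ v) \<in> NA r n"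
proof -
  have "gen i a - gen (-i) (-a) \<in> Arels r n" unfolding Arels_def using assms by blast
  then have "wd u \<star> (gen i a - gen (-i) (-a)) \<star> wd v \<in> NA r n" using assms by (intro ideal_gen_base)
  then show ?thesis by (simp add: kprod_simps)
qed

lemma nrm_mem_NA:
  assumes "u \<in> lists (Agens r n)" "v \<in> lists (Agens r n)"
  shows "wd (v @ u) - wd (v @ map nrm u) \<in> NA r n"
  using assms
proof (induction u arbitrary: v rule: list.induct)
  case Nil
  then show ?case by (simp add: vec.subspace_0[OF ideal_gen_subspace])
next
  case (Cons l u)
  obtain i a where l: "l = (i, a)" by force
  have "l \<in> Agens r n" using Cons.prems(1) by (simp only: Cons_in_lists_iff)
  then have ia: "i \<in> idx r" "a \<in> idx n" by (auto simp: Agens_def l)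
  have "wd (v @ [l] @ u) - wd (v @ [nrm l] @ u) \<in> NA r n"
    using gen_swap_mem_NA[of i r a n v u] Cons.prems l ia
    by (simp add: nrm_def vec.subspace_0[OF ideal_gen_subspace])
  moreover have "wd ((v @ [nrm l]) @ u) - wd ((v @ [nrm l]) @ map nrm u) \<in> NA r n"
    using Cons.prems nrm_Agens by (intro Cons.IH) auto
  ultimately have "(wd (v @ [l] @ u) - wd (v @ [nrm l] @ u)) + (wd ((v @ [nrm l]) @ u) - wd ((v @ [nrm l]) @ map nrm u)) \<in> NA r n"
    by (rule vec.subspace_add[OF ideal_gen_subspace])
  then show ?case by simp
qed

text \<open>The criterion behind every map out of A_{r,n}. Modulo \<open>W\<close> the map
  \<open>f\<close> agrees with \<open>f\<close> after normalisation of letters, and this composite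
  depends only on normal forms, so \<open>stt_nrm\<close> reduces its values on all matrix relators
  to \<open>rho\<close> in context.\<close>

lemma NA_kill:
  assumes f: "vlin f" and W: "vec.subspace W" and x: "x \<in> NA r n"
    and nrm: "\<And>w. w \<in> lists (Agens r n) \<Longrightarrow> f (wd w) - f (wd (map nrm w)) \<in> W"
    and rho: "\<And>i j a b u v. i \<in> {1..int r} \<Longrightarrow> j \<in> {1..int r} \<Longrightarrow> a \<in> idx n \<Longrightarrow> b \<in> idx n \<Longrightarrow>
      u \<in> lists (Agens r n) \<Longrightarrow> v \<in> lists (Agens r n) \<Longrightarrow> rho i j a b (\<lambda>z. f (wd (u @ z @ v))) \<in> W"
  shows "f x \<in> W"
proof -
  define N where "N = lin (wcase (\<lambda>w. wd (map nrm w)))"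
  have vN: "vlin N" unfolding N_def by (rule vlin_lin)
  have N: "N (wd w) = wd (map nrm w)" for w by (simp add: N_def)
  have nn: "map nrm (map nrm w) = map nrm w" for w by (auto simp: nrm_def)
  have d: "f y - f (N y) \<in> W" if "y \<in> wspan (Agens r n)" for y
    by (rule vlin_span_mem[OF vlin_intros(4)[OF f vlin_comp[OF f vN]] W that]) (elim imageE, hypsubst, simp only: N, rule nrm)
  have "f (N x) \<in> W"
    using x
  proof (rule ideal_gen_induct[where f = "\<lambda>x. f (N x)", OF vlin_comp[OF f vN] W])
    fix u y v assume uv: "u \<in> lists (Agens r n)" "v \<in> lists (Agens r n)" and y: "y \<in> Arels r n"
    let ?u = "map nrm u" and ?v = "map nrm v"
    have uv': "?u \<in> lists (Agens r n)" "?v \<in> lists (Agens r n)" using uv nrm_Agens by auto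
    let ?g = "\<lambda>y. f (N (wd u \<star> y \<star> wd v))"
    have g: "vlin ?g" by (intro vlin_comp[OF f] vlin_comp[OF vN] vlin_rules)
    have gw: "?g (wd z) = f (wd (?u @ map nrm z @ ?v))" for z by (simp add: N)
    from y consider i a where "y = gen i a - gen (-i) (-a)" "i \<in> idx r" "a \<in> idx n"
      | i a j b where "y = cfA i a j b (STT r n)" "i \<in> idx r" "a \<in> idx n" "j \<in> idx r" "b \<in> idx n"
      unfolding Arels_def cfA_def by blast
    then show "?g y \<in> W"
    proof cases
      case 1
      then have "nrm (i, a) = nrm (- i, - a)" by (auto simp: nrm_def idx_def)
      then have "?g y = 0" unfolding 1(1) vlin_diff[OF g] gw by simp
      then show ?thesis using vec.subspace_0[OF W] by simp
    next
      case 2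
      let ?H = "\<lambda>z. f (wd (?u @ map nrm z @ ?v))"
      obtain I a' J b' where IJ: "nrm (i, a) = (I, a')" "nrm (j, b) = (J, b')" by force
      have m: "I \<in> {1..int r}" "J \<in> {1..int r}" "a' \<in> idx n" "b' \<in> idx n"
        using nrm_Agens[of "(i, a)" r n] nrm_Agens[of "(j, b)" r n] 2 IJ by (auto simp: Agens_def)
      have "?g y = stt i a j b ?H"
        unfolding 2(1) using vlin_STT[OF 2(2,4,3,5) g] unfolding gw .
      moreover obtain s where "stt i a j b ?H = scal s (rho I J a' b' ?H)"
      proof -
        have "?H z = ?H (map nrm z)" for z by (simp only: nn)
        with stt_nrm[of i j a b ?H] 2 IJ that show ?thesis by (auto dest: idx_nonzero)
      qed
      moreover have "rho I J a' b' ?H = rho I J a' b' (\<lambda>z. f (wd (?u @ z @ ?v)))"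
        using m by (simp add: rho_def nrm_def)
      ultimately show ?thesis using vec.subspace_scale[OF W rho[OF m uv']] by simp
    qed
  qed
  then have "(f x - f (N x)) + f (N x) \<in> W"
    using d[OF subsetD[OF ideal_gen_wspan[OF homog_Arels] x]] by (intro vec.subspace_add[OF W])
  then show ?thesis by simp
qed

section \<open>Moving an index past a word\<close>

lemma braid_add: "braid b a (\<lambda>x y. f x y + g x y) = braid b a f + braid b a g"
  by (simp add: braid_def vec.scale_right_distrib)

lemma braid_vlin: "vlin F \<Longrightarrow> F (braid b a f) = braid b a (\<lambda>x y. F (f x y))"
  by (simp add: braid_def vlin_add vlin_scal)

lemma braid_cong:
  assumes "b \<in> idx n" "a \<in> idx n" "\<And>x y. x \<in> idx n \<Longrightarrow> y \<in> idx n \<Longrightarrow> f x y = g x y"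
  shows "braid b a f = braid b a g"
  using assms by (simp add: braid_def)

text \<open>The bound \<open>x \<le> a\<close> is triangularity: the index leaving on the left is
  \<open>a\<close> itself, or \<open>b\<close> when b < a, or \<open>-b\<close> when -b < a. It
  matches L_ab = 0 for a > b. The parity condition says that the braiding is even.\<close>

lemma braid_mem:
  assumes W: "vec.subspace W" and "b \<in> idx n" "a \<in> idx n"
    and h: "\<And>x y. x \<in> idx n \<Longrightarrow> y \<in> idx n \<Longrightarrow> x \<le> a \<Longrightarrow> even (ipar b + ipar a + ipar x + ipar y) \<Longrightarrow> h x y \<in> W"
  shows "braid b a h \<in> W"
proof -
  have 1: "h a b \<in> W" using assms(2,3) by (intro h) auto
  have 2: "scal (of_bool (b < a) * xi) (h b a) \<in> W"
    using assms(2,3) h[of b a] by (cases "b < a") (auto intro: vec.subspace_scale[OF W] vec.subspace_0[OF W])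
  have "even (ipar b + ipar a + ipar (-b) + ipar (-a))"
    using assms(2,3) by (auto simp: idx_def ipar_def)
  then have 3: "scal (of_bool (-b < a) * (-1) ^ ipar a * xi) (h (-b) (-a)) \<in> W"
    using assms(2,3) h[of "-b" "-a"] by (cases "-b < a") (auto intro: vec.subspace_scale[OF W] vec.subspace_0[OF W])
  show ?thesis unfolding braid_def by (intro vec.subspace_add[OF W] vec.subspace_scale[OF W] 1 2 3)
qed

lemma rho_vlin: "vlin F \<Longrightarrow> F (rho i j a b f) = rho i j a b (\<lambda>z. F (f z))"
  by (simp add: rho_def vlin_diff vlin_scal braid_vlin)

text \<open>
  \<open>crw w b h\<close> moves the index \<open>b\<close> from the right of \<open>w\<close> to its left by means of the braiding, and
  \<open>cry w b h\<close> moves it from left to right; the resulting pairs of a word and an index are passed to \<open>h\<close>.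
\<close>

primrec crw :: "(int \<times> int) list \<Rightarrow> int \<Rightarrow> (int \<Rightarrow> (int \<times> int) list \<Rightarrow> vec) \<Rightarrow> vec" where
  "crw [] b h = h b []"
| "crw (l # w) b h = crw w b (\<lambda>k w'. braid (snd (nrm l)) k (\<lambda>a s. h a ((fst (nrm l), s) # w')))"

primrec cry :: "(int \<times> int) list \<Rightarrow> int \<Rightarrow> ((int \<times> int) list \<Rightarrow> int \<Rightarrow> vec) \<Rightarrow> vec" where
  "cry [] b h = h [] b"
| "cry (l # w) b h = braid b (snd (nrm l)) (\<lambda>c d. cry w d (\<lambda>w' e. h ((fst (nrm l), c) # w') e))"

definition Pgens :: "nat \<Rightarrow> nat \<Rightarrow> (int \<times> int) set" where
  "Pgens r n = {1..int r} \<times> idx n"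

lemma Pgens_Agens: "l \<in> Pgens r n \<Longrightarrow> l \<in> Agens r n"
  by (auto simp: Pgens_def Agens_def idx_positive)

lemma lists_Pgens_Agens: "w \<in> lists (Pgens r n) \<Longrightarrow> w \<in> lists (Agens r n)"
  by (auto dest: Pgens_Agens)

lemma Agens_nrm: "l \<in> Agens r n \<Longrightarrow> nrm l \<in> Pgens r n"
  using nrm_Agens[of l r n] by (cases "nrm l") (auto simp: Pgens_def Agens_def)

lemma nrm_idx: "l \<in> Agens r n \<Longrightarrow> snd (nrm l) \<in> idx n" "l \<in> Agens r n \<Longrightarrow> fst (nrm l) \<in> {1..int r}"
  using Agens_nrm[of l r n] by (auto simp: Pgens_def mem_Times_iff)

lemma crw_add: "crw w b (\<lambda>u w'. f u w' + g u w') = crw w b f + crw w b g"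
  by (induction w arbitrary: b f g) (simp_all add: braid_add)

lemma crw_vlin: "vlin F \<Longrightarrow> F (crw w b f) = crw w b (\<lambda>u w'. F (f u w'))"
  by (induction w arbitrary: b f) (simp_all add: braid_vlin)

lemma crw_scal: "crw w b (\<lambda>u w'. scal c (f u w')) = scal c (crw w b f)"
  by (rule crw_vlin[symmetric]) (intro vlin_rules)

lemma crw_zero: "crw w b (\<lambda>u w'. 0) = 0"
  using crw_scal[of w b 0 "\<lambda>_ _. 0"] by simp

lemma crw_braid: "crw w b (\<lambda>u w'. braid p q (\<lambda>x y. F u w' x y)) = braid p q (\<lambda>x y. crw w b (\<lambda>u w'. F u w' x y))"
  by (simp add: braid_def crw_add crw_scal)

lemma crw_minus: "crw w b (\<lambda>u w'. f u w' - g u w') = crw w b f - crw w b g"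
  using crw_add[of w b "\<lambda>u w'. f u w' - g u w'" g] by simp

lemma rho_crw_commute: "rho i j a b (\<lambda>z. crw w c (\<lambda>u w'. F z u w')) = crw w c (\<lambda>u w'. rho i j a b (\<lambda>z. F z u w'))"
  unfolding rho_def by (simp add: crw_minus crw_scal crw_braid)

lemma crw_append: "crw (x @ y) b h = crw y b (\<lambda>k y'. crw x k (\<lambda>a x'. h a (x' @ y')))"
  by (induction x arbitrary: h) simp_all

lemma crw_nrm: "crw (map nrm w) b h = crw w b h"
  by (induction w arbitrary: h) (simp_all add: nrm_def)

lemma cry_nrm: "cry (map nrm w) b h = cry w b h"
  by (induction w arbitrary: b h) (simp_all add: nrm_def)

text \<open>The facts offered about the outcome have separate purposes: the length for the stability
  of the span of generators, the bound \<open>u \<le> b\<close> for L_ab = 0 when a > b, the parity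
  for all signs.\<close>

lemma crw_mem:
  assumes W: "vec.subspace W" and w: "w \<in> lists (Agens r n)" and b: "b \<in> idx n"
    and h: "\<And>u w'. u \<in> idx n \<Longrightarrow> w' \<in> lists (Pgens r n) \<Longrightarrow> length w' = length w \<Longrightarrow> u \<le> b \<Longrightarrow>
      even (par (Word w) + ipar b + par (Word w') + ipar u) \<Longrightarrow> h u w' \<in> W"
  shows "crw w b h \<in> W"
  using w h
proof (induction w arbitrary: h)
  case Nil
  then show ?case using b by simp
next
  case (Cons l w)
  obtain i a where l: "nrm l = (i, a)" by force
  have i: "i \<in> {1..int r}" "a \<in> idx n" using nrm_idx[OF Cons.hyps(1)] l by auto
  have p: "even (ipar (fst l) + ipar (snd l) + ipar i + ipar a)"
    using l Cons.hyps(1) by (auto simp: nrm_def ipar_def Agens_def idx_def split: if_splits)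
  show ?case
    unfolding crw.simps l fst_conv snd_conv
  proof (rule Cons.IH, rule braid_mem[OF W i(2)])
    fix u w' x y
    assume *: "u \<in> idx n" "w' \<in> lists (Pgens r n)" "length w' = length w" "u \<le> b" "even (par (Word w) + ipar b + par (Word w') + ipar u)"
      "x \<in> idx n" "y \<in> idx n" "x \<le> u" "even (ipar a + ipar u + ipar x + ipar y)"
    have "even (par (Word (l # w)) + ipar b + par (Word ((i, y) # w')) + ipar x)"
      using *(5,9) p by (auto simp: case_prod_beta)
    then show "h x ((i, y) # w') \<in> W"
      using * i by (intro Cons.prems) (auto simp: Pgens_def)
  qed
qed

lemma crw_cong:
  assumes "w \<in> lists (Agens r n)" "b \<in> idx n"
    and "\<And>u w'. u \<in> idx n \<Longrightarrow> w' \<in> lists (Pgens r n) \<Longrightarrow> even (par (Word w) + ipar b + par (Word w') + ipar u) \<Longrightarrow> f u w' = g u w'"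
  shows "crw w b f = crw w b g"
proof -
  have "crw w b (\<lambda>u w'. f u w' - g u w') \<in> {0}"
    using assms by (intro crw_mem[OF _ assms(1,2)]) (auto simp: vec.subspace_def)
  then show ?thesis by (simp add: crw_minus)
qed

text \<open>Both indices pass each letter in turn, and the braid relation exchanges this passage
  with the braiding of the two indices. The matrix coefficients of this identity are, up to signs,
  the relations L L S = S L L.\<close>

theorem crw_crw_braid:
  assumes "a \<in> idx n" "e \<in> idx n" "w \<in> lists (Agens r n)"
  shows "braid a e (\<lambda>f c. crw w f (\<lambda>d w1. crw w1 c (\<lambda>c' w2. h d c' w2)))
    = crw w a (\<lambda>c w1. crw w1 e (\<lambda>f w2. braid c f (\<lambda>d c'. h d c' w2)))"
  using assms(3)
proof (induction w arbitrary: h)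
  case Nil
  then show ?case by simp
next
  case (Cons l w)
  obtain i p where l: "nrm l = (i, p)" by force
  have i: "i \<in> {1..int r}" "p \<in> idx n" using nrm_idx[OF Cons.hyps(1)] l by auto
  then have n: "nrm (i, s) = (i, s)" for s by (auto simp: nrm_def)
  have "braid a e (\<lambda>f c. crw (l # w) f (\<lambda>d w1. crw w1 c (\<lambda>c' w2. h d c' w2)))
      = braid a e (\<lambda>f c. crw w f (\<lambda>k w1. crw w1 c (\<lambda>l w2. braid p k (\<lambda>d s. braid s l (\<lambda>c' s'. h d c' ((i, s') # w2))))))"
    by (simp add: l n crw_braid)
  also have "\<dots> = crw w a (\<lambda>c w1. crw w1 e (\<lambda>f w2. braid c f (\<lambda>k l. braid p k (\<lambda>d s. braid s l (\<lambda>c' s'. h d c' ((i, s') # w2))))))"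
    by (rule Cons.IH)
  also have "\<dots> = crw w a (\<lambda>c w1. crw w1 e (\<lambda>f w2. braid p c (\<lambda>x y. braid y f (\<lambda>z s'. braid x z (\<lambda>d c'. h d c' ((i, s') # w2))))))"
  proof (rule crw_cong[OF Cons.hyps(2) assms(1)])
    fix c w1 assume c: "c \<in> idx n" and w1: "w1 \<in> lists (Pgens r n)"
    show "crw w1 e (\<lambda>f w2. braid c f (\<lambda>k l. braid p k (\<lambda>d s. braid s l (\<lambda>c' s'. h d c' ((i, s') # w2)))))
      = crw w1 e (\<lambda>f w2. braid p c (\<lambda>x y. braid y f (\<lambda>z s'. braid x z (\<lambda>d c'. h d c' ((i, s') # w2)))))"
      using c i(2) by (intro crw_cong[OF lists_Pgens_Agens[OF w1] assms(2)] braid_relation[symmetric]) (auto dest: idx_nonzero)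
  qed
  also have "\<dots> = crw (l # w) a (\<lambda>c w1. crw w1 e (\<lambda>f w2. braid c f (\<lambda>d c'. h d c' w2)))"
    by (simp add: l n crw_braid)
  finally show ?case .
qed

text \<open>\<open>rho\<close> is the braiding of two columns minus terms that only rearrange rows.
  The latter commute with a passing index, and so does the former by the braid relation; hence an
  index passing a relator leaves relators behind.\<close>

lemma rho_crw_two:
  assumes "0 < i" "0 < j" "a \<noteq> 0" "b \<noteq> 0" "k \<noteq> 0"
  shows "rho i j a b (\<lambda>z. crw z k G) = braid b k (\<lambda>m s'. braid a m (\<lambda>x s. rho i j s s' (G x)))"
proof -
  have n: "nrm (i, s) = (i, s)" "nrm (j, s) = (j, s)" for s using assms by (auto simp: nrm_def)
  have "braid a b (\<lambda>c d. braid d k (\<lambda>m s'. braid c m (\<lambda>x s. G x [(j, s), (i, s')])))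
      = braid b k (\<lambda>m s'. braid a m (\<lambda>x s. braid s s' (\<lambda>u v. G x [(j, u), (i, v)])))"
    using assms by (intro braid_relation) auto
  then show ?thesis
    unfolding rho_def by (simp add: n braid_def vec.scale_right_distrib vec.scale_right_diff_distrib mult_ac)
qed

lemma rho_crw_mem:
  assumes W: "vec.subspace W" and ij: "i \<in> {1..int r}" "j \<in> {1..int r}" and ab: "a \<in> idx n" "b \<in> idx n"
    and uv: "u \<in> lists (Agens r n)" "v \<in> lists (Agens r n)" and e: "e \<in> idx n"
    and H: "\<And>k a b u v. k \<in> idx n \<Longrightarrow> a \<in> idx n \<Longrightarrow> b \<in> idx n \<Longrightarrow> u \<in> lists (Agens r n) \<Longrightarrow> v \<in> lists (Agens r n) \<Longrightarrow>
      rho i j a b (\<lambda>z. H k (u @ z @ v)) \<in> W"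
  shows "rho i j a b (\<lambda>z. crw (u @ z @ v) e H) \<in> W"
  unfolding crw_append rho_crw_commute
proof (rule crw_mem[OF W uv(2) e])
  fix k v' assume k: "k \<in> idx n" and v': "v' \<in> lists (Pgens r n)"
  have "rho i j a b (\<lambda>z. crw z k (\<lambda>l z'. crw u l (\<lambda>m u'. H m ((u' @ z') @ v'))))
    = braid b k (\<lambda>m s'. braid a m (\<lambda>x s. rho i j s s' (\<lambda>z'. crw u x (\<lambda>m u'. H m ((u' @ z') @ v')))))"
    using ij ab k by (intro rho_crw_two) (auto dest: idx_nonzero)
  also have "\<dots> = braid b k (\<lambda>m s'. braid a m (\<lambda>x s. crw u x (\<lambda>m u'. rho i j s s' (\<lambda>z'. H m (u' @ z' @ v')))))"
    by (simp add: rho_crw_commute)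
  finally have *: "rho i j a b (\<lambda>z. crw z k (\<lambda>l z'. crw u l (\<lambda>m u'. H m ((u' @ z') @ v'))))
     = braid b k (\<lambda>m s'. braid a m (\<lambda>x s. crw u x (\<lambda>m u'. rho i j s s' (\<lambda>z'. H m (u' @ z' @ v')))))" .
  have "braid b k (\<lambda>m s'. braid a m (\<lambda>x s. crw u x (\<lambda>m u'. rho i j s s' (\<lambda>z'. H m (u' @ z' @ v'))))) \<in> W"
  proof (rule braid_mem[OF W ab(2) k])
    fix m s' assume m: "m \<in> idx n" "s' \<in> idx n"
    show "braid a m (\<lambda>x s. crw u x (\<lambda>m u'. rho i j s s' (\<lambda>z'. H m (u' @ z' @ v')))) \<in> W"
    proof (rule braid_mem[OF W ab(1) m(1)])
      fix x s assume x: "x \<in> idx n" "s \<in> idx n"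
      show "crw u x (\<lambda>m u'. rho i j s s' (\<lambda>z'. H m (u' @ z' @ v'))) \<in> W"
      proof (rule crw_mem[OF W uv(1) x(1)])
        fix m u' assume "m \<in> idx n" "u' \<in> lists (Pgens r n)"
        then show "rho i j s s' (\<lambda>z'. H m (u' @ z' @ v')) \<in> W"
          by (intro H x m lists_Pgens_Agens v')
      qed
    qed
  qed
  then show "rho i j a b (\<lambda>z. crw z k (\<lambda>l z'. crw u l (\<lambda>m u'. H m (u' @ z' @ v')))) \<in> W"
    using * by simp
qed

section \<open>The action of the quantum queer superalgebra on words\<close>

text \<open>The matrix coefficients of braiding words with the vector superspace V_q, as operators
  on words.\<close>

definition gop :: "int \<Rightarrow> int \<Rightarrow> (int \<times> int) list \<Rightarrow> vec" where
  "gop a b w = crw w b (\<lambda>u w'. if u = a then wd w' else 0)"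

text \<open>
  The operators \<open>gop a b\<close> satisfy the sign-free product rule \<open>gop_append\<close>; the generator $L_{ab}$ acts by
  \<open>gop a b\<close> followed by $|b|$ times the parity automorphism.
\<close>

definition Lword :: "int \<times> int \<Rightarrow> (int \<times> int) list \<Rightarrow> vec" where
  "Lword l w = scal ((-1) ^ (ipar (snd l) * (ipar (fst l) + ipar (snd l) + par (Word w)))) (gop (fst l) (snd l) w)"

definition lact :: "int \<times> int \<Rightarrow> vec \<Rightarrow> vec" where
  "lact l = lin (wcase (Lword l))"

text \<open>Free words act on free words here. That this descends to both quotients is the content
  of \<open>ua_Urels\<close> and \<open>ua_NA\<close>.\<close>

definition ua :: "vec \<Rightarrow> vec \<Rightarrow> vec" where
  "ua u x = lin (wcase (\<lambda>ls. foldr lact ls x)) u"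

lemma vlin_lact: "vlin (lact l)"
  unfolding lact_def by (rule vlin_lin)

lemma lact_wd: "lact l (wd w) = Lword l w"
  by (simp add: lact_def)

lemma vlin_foldr_lact: "vlin (foldr lact ls)"
proof (induction ls)
  case (Cons l ls)
  show ?case using vlin_comp[OF vlin_lact Cons.IH] by (simp add: comp_def)
qed (simp add: id_def vlin_intros)

lemma vlin_ua_left: "vlin (\<lambda>u. ua u x)"
  unfolding ua_def by (rule vlin_lin)

lemma vlin_ua_right: "vlin (ua u)"
proof -
  have "vlin (\<lambda>x. wcase (\<lambda>ls. foldr lact ls x) m)" for m
    by (cases m) (auto simp: vlin_foldr_lact intro: vlin_rules)
  then show ?thesis unfolding ua_def by (intro vlin_lin_right)
qed

lemma ua_wd: "ua (wd ls) x = foldr lact ls x"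
  by (simp add: ua_def)

lemma par_map_nrm: "w \<in> lists (Agens r n) \<Longrightarrow> even (par (Word (map nrm w)) + par (Word w))"
  by (induction w) (auto simp: nrm_def Agens_def idx_def ipar_def)

lemma minus_one_cong: "even (p + q) \<Longrightarrow> (-1::Cq) ^ p = (-1) ^ q"
  by (auto simp: minus_one_power_iff)

lemma Lword_nrm: "w \<in> lists (Agens r n) \<Longrightarrow> Lword l (map nrm w) = Lword l w"
proof -
  assume w: "w \<in> lists (Agens r n)"
  have "(-1::Cq) ^ (ipar (snd l) * (ipar (fst l) + ipar (snd l) + par (Word (map nrm w))))
      = (-1) ^ (ipar (snd l) * (ipar (fst l) + ipar (snd l) + par (Word w)))"
    using par_map_nrm[OF w] by (intro minus_one_cong) (auto simp del: par.simps)
  then show ?thesis unfolding Lword_def gop_def crw_nrm by simp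
qed

lemma gop_mem_homog:
  assumes "w \<in> lists (Agens r n)" "b \<in> idx n"
  shows "gop a b w \<in> vspan {m \<in> Word ` lists (Pgens r n). even (par (Word w) + ipar b + par m + ipar a) \<and> (\<exists>w'. m = Word w' \<and> length w' = length w)}"
  unfolding gop_def using assms
  by (intro crw_mem[OF vec.subspace_span]) (auto intro!: mon_in_vspan simp: vec.span_zero)

lemma gop_zero:
  assumes "w \<in> lists (Agens r n)" "b \<in> idx n" "\<not> a \<le> b"
  shows "gop a b w = 0"
proof -
  have "gop a b w \<in> {0}"
    unfolding gop_def using assms
    by (intro crw_mem[of _ w r n]) (auto simp: vec.subspace_def)
  then show ?thesis by simp
qed

text \<open>The outcomes are sorted by the index that emerges on the left.\<close>

lemma crw_expand:
  assumes "w \<in> lists (Agens r n)" "b \<in> idx n"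
  shows "crw w b h = (\<Sum>a\<in>idx n. lin (wcase (h a)) (gop a b w))"
proof -
  have s: "crw w b (\<lambda>u w'. \<Sum>a\<in>S. f a u w') = (\<Sum>a\<in>S. crw w b (f a))" if "finite S" for S :: "int set" and f
    using that
  proof (induction S)
    case empty
    show ?case using crw_scal[of w b 0 "\<lambda>_ _. 0"] by simp
  qed (simp add: crw_add)
  have "(\<Sum>a\<in>idx n. lin (wcase (h a)) (gop a b w)) = (\<Sum>a\<in>idx n. crw w b (\<lambda>u w'. if u = a then h a w' else 0))"
    unfolding gop_def crw_vlin[OF vlin_lin]
    by (intro sum.cong refl arg_cong[where f = "crw w b"] ext) (simp add: lin_zero)
  also have "\<dots> = crw w b (\<lambda>u w'. \<Sum>a\<in>idx n. if u = a then h a w' else 0)" by (rule s[symmetric]) simp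
  also have "\<dots> = crw w b h" by (rule crw_cong[OF assms]) (simp add: sum.delta)
  finally show ?thesis ..
qed

text \<open>The index first passes \<open>y\<close>, leaves it as some k and then passes
  \<open>x\<close> starting from k. This is the source of the comultiplication of L_ab.\<close>

lemma gop_append:
  assumes "x \<in> lists (Agens r n)" "y \<in> lists (Agens r n)" "b \<in> idx n"
  shows "gop a b (x @ y) = (\<Sum>k\<in>idx n. gop a k x \<star> gop k b y)"
proof -
  have "gop a b (x @ y) = (\<Sum>k\<in>idx n. lin (wcase (\<lambda>y'. crw x k (\<lambda>u x'. if u = a then wd (x' @ y') else 0))) (gop k b y))"
    unfolding gop_def[of a b] crw_append by (rule crw_expand[OF assms(2,3)])
  also have "\<dots> = (\<Sum>k\<in>idx n. gop a k x \<star> gop k b y)"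
  proof (rule sum.cong[OF refl])
    fix k
    show "lin (wcase (\<lambda>y'. crw x k (\<lambda>u x'. if u = a then wd (x' @ y') else 0))) (gop k b y) = gop a k x \<star> gop k b y"
      unfolding gop_def[of k b] crw_vlin[OF vlin_lin] crw_vlin[OF kprod_r]
      by (intro arg_cong[where f = "crw y b"] ext)
        (simp add: gop_def crw_vlin[OF kprod_l] crw_zero lin_zero kprod_simps if_distrib[of "\<lambda>x. x \<star> _"] cong: if_cong)
  qed
  finally show ?thesis .
qed

lemma crw_sum: "finite S \<Longrightarrow> crw w b (\<lambda>u w'. \<Sum>a\<in>S. f a u w') = (\<Sum>a\<in>S. crw w b (f a))"
proof (induction S rule: finite_induct)
  case empty
  show ?case using crw_scal[of w b 0 "\<lambda>_ _. 0"] by simp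
qed (simp add: crw_add)

lemma crw_split:
  assumes "w \<in> lists (Agens r n)" "b \<in> idx n"
  shows "crw w b h = (\<Sum>a\<in>idx n. crw w b (\<lambda>u w'. if u = a then h a w' else 0))"
  unfolding crw_sum[OF finite_idx, symmetric] by (rule crw_cong[OF assms]) (simp add: sum.delta)

lemma gop_mem:
  assumes "w \<in> lists (Agens r n)" "b \<in> idx n"
  shows "gop a b w \<in> wspan (Pgens r n)"
  using gop_mem_homog[OF assms, of a] by (auto simp: mem_vspan_iff)

lemma wspan_Pgens: "x \<in> wspan (Pgens r n) \<Longrightarrow> x \<in> wspan (Agens r n)"
  using wspan_mono[of "Pgens r n" "Agens r n"] Pgens_Agens by blast

lemma vspan_wordE:
  assumes "vlin f" "vec.subspace W" "x \<in> vspan B" "B \<subseteq> range Word" "\<And>w. Word w \<in> B \<Longrightarrow> f (wd w) \<in> W"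
  shows "f x \<in> W"
  by (rule vlin_span_mem[OF assms(1-3)]) (use assms(4,5) in auto)

lemma lact_mem:
  assumes "x \<in> wspan (Agens r n)" "b \<in> idx n"
  shows "lact (a, b) x \<in> wspan (Agens r n)"
proof (rule vspan_wordE[OF vlin_lact vec.subspace_span assms(1)])
  fix w assume "Word w \<in> Word ` lists (Agens r n)"
  then have "w \<in> lists (Agens r n)" by blast
  then show "lact (a, b) (wd w) \<in> wspan (Agens r n)"
    unfolding lact_wd Lword_def by (intro vec.span_scale wspan_Pgens gop_mem) (simp_all add: assms(2))
qed auto

abbreviation hspan :: "(int \<times> int) set \<Rightarrow> nat \<Rightarrow> vec set" where
  "hspan G p \<equiv> vspan {m \<in> Word ` lists G. par m mod 2 = p mod 2}"

lemma hspan_wspan: "x \<in> hspan G p \<Longrightarrow> x \<in> wspan G"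
  by (auto simp: mem_vspan_iff)

lemma lact_homog:
  assumes "x \<in> hspan (Agens r n) p" "b \<in> idx n"
  shows "lact (a, b) x \<in> hspan (Agens r n) (p + ipar a + ipar b)"
proof (rule vspan_wordE[OF vlin_lact vec.subspace_span assms(1)])
  fix w assume "Word w \<in> {m \<in> Word ` lists (Agens r n). par m mod 2 = p mod 2}"
  then have w: "w \<in> lists (Agens r n)" and p: "par (Word w) mod 2 = p mod 2" by blast+
  have "gop a b w \<in> hspan (Agens r n) (p + ipar a + ipar b)"
  proof (rule subsetD[OF vec.span_mono[OF image_mono] gop_mem_homog[OF w assms(2)]], rule subsetI)
    fix m assume m: "m \<in> {m \<in> Word ` lists (Pgens r n). even (par (Word w) + ipar b + par m + ipar a) \<and> (\<exists>w'. m = Word w' \<and> length w' = length w)}"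
    then obtain w' where w': "m = Word w'" "w' \<in> lists (Pgens r n)" by blast
    have e: "even (par (Word w) + ipar b + par m + ipar a)" using m by (simp only: mem_Collect_eq)
    have *: "z mod 2 = (p + x + y) mod 2" if "even (k + y + z + x)" "k mod 2 = p mod 2" for k x y z :: nat
      using that by presburger
    have "par m mod 2 = (p + ipar a + ipar b) mod 2" by (rule *[OF e p])
    moreover have "m \<in> Word ` lists (Agens r n)" using lists_Pgens_Agens[OF w'(2)] w'(1) by blast
    ultimately show "m \<in> {m \<in> Word ` lists (Agens r n). par m mod 2 = (p + ipar a + ipar b) mod 2}"
      by (simp only: mem_Collect_eq)
  qed
  then show "lact (a, b) (wd w) \<in> hspan (Agens r n) (p + ipar a + ipar b)"
    unfolding lact_wd Lword_def by (auto intro: vec.span_scale)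
qed auto

text \<open>All words of a relator have the same parity, so a sign depending on the parity of the
  word is a common factor.\<close>

lemma rho_sign:
  assumes "i \<noteq> 0" "j \<noteq> 0" "p \<noteq> 0" "q \<noteq> 0"
  shows "rho i j p q (\<lambda>z. scal ((-1) ^ (m * (k + par (Word (u @ z @ v))))) (F z))
    = scal ((-1) ^ (m * (k + (par (Word u) + par (Word v) + ip2 i p + ip2 j q)))) (rho i j p q F)"
proof -
  have s: "(-1::Cq) ^ (m * (k + par (Word (u @ [(i', c), (j', d)] @ v)))) = (-1) ^ (m * (k + (par (Word u) + par (Word v) + ip2 i p + ip2 j q)))"
    if "even (ip2 i' c + ip2 j' d + (ip2 i p + ip2 j q))" for i' c j' d
    using that by (intro minus_one_cong) auto
  have e: "even (ip2 j q + ip2 i p + (ip2 i p + ip2 j q))" "even (ip2 j p + ip2 i q + (ip2 i p + ip2 j q))"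
    "even (ip2 j (- p) + ip2 i (- q) + (ip2 i p + ip2 j q))" "even (ip2 i p + ip2 j q + (ip2 i p + ip2 j q))"
    using assms by (auto simp: ipar_uminus ipar_def)
  show ?thesis
    unfolding rho_def braid_def s[OF e(1)] s[OF e(2)] s[OF e(3)] s[OF e(4)]
    by (simp only: vec.scale_right_distrib vec.scale_right_diff_distrib vec.scale_scale mult.commute)
qed

lemma lact_NA:
  assumes "x \<in> NA r n" "b \<in> idx n"
  shows "lact (a, b) x \<in> NA r n"
proof (rule NA_kill[OF vlin_lact ideal_gen_subspace assms(1)])
  fix w assume "w \<in> lists (Agens r n)"
  then show "lact (a, b) (wd w) - lact (a, b) (wd (map nrm w)) \<in> NA r n"
    by (simp add: lact_wd Lword_nrm vec.subspace_0[OF ideal_gen_subspace] del: in_lists_conv_set)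
next
  fix i j p q u v
  assume ij: "i \<in> {1..int r}" "j \<in> {1..int r}" and pq: "p \<in> idx n" "q \<in> idx n"
    and uv: "u \<in> lists (Agens r n)" "v \<in> lists (Agens r n)"
  have "rho i j p q (\<lambda>z. gop a b (u @ z @ v)) \<in> NA r n"
    unfolding gop_def
  proof (rule rho_crw_mem[OF ideal_gen_subspace ij pq uv assms(2)])
    fix k p q u v
    assume "k \<in> idx n" "p \<in> idx n" "q \<in> idx n" "u \<in> lists (Agens r n)" "v \<in> lists (Agens r n)"
    then have "rho i j p q (\<lambda>z. wd (u @ z @ v)) \<in> NA r n" by (intro rho_mem_NA ij)
    moreover have "rho i j p q (\<lambda>z. 0) = 0" by (simp add: rho_def braid_def)
    ultimately show "rho i j p q (\<lambda>z. if k = a then wd (u @ z @ v) else 0) \<in> NA r n"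
      using vec.subspace_0[OF ideal_gen_subspace] by (cases "k = a") simp_all
  qed
  then have "scal s (rho i j p q (\<lambda>z. gop a b (u @ z @ v))) \<in> NA r n" for s
    by (rule vec.subspace_scale[OF ideal_gen_subspace])
  moreover have "i \<noteq> 0" "j \<noteq> 0" "p \<noteq> 0" "q \<noteq> 0" using ij pq by (auto simp: idx_def)
  ultimately show "rho i j p q (\<lambda>z. lact (a, b) (wd (u @ z @ v))) \<in> NA r n"
    unfolding lact_wd Lword_def fst_conv snd_conv by (subst rho_sign; simp only: not_False_eq_True)
qed

section \<open>The relations of the quantum queer superalgebra act by zero\<close>

definition ggop :: "int \<Rightarrow> int \<Rightarrow> int \<Rightarrow> int \<Rightarrow> (int \<times> int) list \<Rightarrow> vec" where
  "ggop i b k d w = crw w d (\<lambda>u w1. if u = k then gop i b w1 else 0)"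

text \<open>The inner operator shifts the parity of the word by that of (k,d), so the sign of the
  outer operator is constant over its terms.\<close>

lemma lact_lact:
  assumes w: "w \<in> lists (Agens r n)" and d: "d \<in> idx n"
  shows "lact (i, b) (lact (k, d) (wd w)) =
    scal ((-1) ^ (ipar d * (ipar k + ipar d + par (Word w)) + ipar b * (ipar i + ipar b + (par (Word w) + ipar k + ipar d)))) (ggop i b k d w)"
proof -
  have "lact (i, b) (gop k d w) = crw w d (\<lambda>u w1. lact (i, b) (if u = k then wd w1 else 0))"
    unfolding gop_def by (rule crw_vlin[OF vlin_lact])
  also have "\<dots> = crw w d (\<lambda>u w1. scal ((-1) ^ (ipar b * (ipar i + ipar b + (par (Word w) + ipar k + ipar d)))) (if u = k then gop i b w1 else 0))"
  proof (rule crw_cong[OF w d])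
    fix u w1 assume e: "even (par (Word w) + ipar d + par (Word w1) + ipar u)"
    have "(-1::Cq) ^ (ipar b * (ipar i + ipar b + par (Word w1))) = (-1) ^ (ipar b * (ipar i + ipar b + (par (Word w) + ipar k + ipar d)))"
      if "u = k" using e that by (intro minus_one_cong) (auto simp del: par.simps)
    then show "lact (i, b) (if u = k then wd w1 else 0)
      = scal ((-1) ^ (ipar b * (ipar i + ipar b + (par (Word w) + ipar k + ipar d)))) (if u = k then gop i b w1 else 0)"
      by (simp add: lact_wd Lword_def vlin_zero[OF vlin_lact] del: par.simps)
  qed
  finally show ?thesis
    by (simp add: lact_wd Lword_def vlin_scal[OF vlin_lact] crw_scal ggop_def power_add del: par.simps)
qed

lemma lact_zero:
  assumes "x \<in> wspan (Agens r n)" "b \<in> idx n" "\<not> a \<le> b"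
  shows "lact (a, b) x = 0"
proof -
  have "lact (a, b) x \<in> {0}"
  proof (rule vspan_wordE[OF vlin_lact _ assms(1)])
    fix w assume "Word w \<in> Word ` lists (Agens r n)"
    then have "w \<in> lists (Agens r n)" by blast
    then show "lact (a, b) (wd w) \<in> {0}" using gop_zero[OF _ assms(2,3)] by (simp add: lact_wd Lword_def)
  qed (auto simp: vec.subspace_def)
  then show ?thesis by simp
qed

text \<open>For a > b the left side vanishes by the convention L_ab = 0 and the right side by
  triangularity.\<close>

lemma ua_Lgen: "b \<in> idx n \<Longrightarrow> x \<in> wspan (Agens r n) \<Longrightarrow> ua (Lgen a b) x = lact (a, b) x"
  by (auto simp: Lgen_def ua_wd vlin_zero[OF vlin_ua_left] lact_zero)

lemma ua_Lgen_Lgen: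
  assumes x: "x \<in> wspan (Agens r n)" and "b \<in> idx n" "d \<in> idx n"
  shows "ua (Lgen i b \<star> Lgen k d) x = lact (i, b) (lact (k, d) x)"
proof (cases "i \<le> b \<and> k \<le> d")
  case True
  then show ?thesis by (simp add: Lgen_def ua_wd)
next
  case False
  then have "Lgen i b \<star> Lgen k d = 0" by (auto simp: Lgen_def kprod_simps)
  moreover have "lact (i, b) (lact (k, d) x) = 0"
    using False lact_zero[OF x assms(3)] lact_zero[OF lact_mem[OF x assms(3)] assms(2)] vlin_zero[OF vlin_lact] by metis
  ultimately show ?thesis by (simp add: vlin_zero[OF vlin_ua_left])
qed

text \<open>The variables are parities of indices, with w for the word. On the right the first
  factor is free of the summation indices b and d and is the same as in
  \<open>LLS_sign_second\<close>; the second is the sign between entries of S and of the braiding in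
  \<open>braid_Sc\<close>. So the signed matrix relation becomes an identity of braidings.\<close>

lemma LLS_sign_first:
  fixes b j d l k i w :: nat
  assumes "even (b + j + d + l)"
  shows "(-1::Cq) ^ ((k + d) * (i + b) + (k + d) * (b + j)) * (-1) ^ (d * (k + d + w) + b * (i + b + (w + k + d)))
    = (-1) ^ (k * i + k * j + (j + l) * (i + k + w) + j + j * l + l) * (-1) ^ (l * b + d + l)"
  unfolding power_add[symmetric]
  by (rule minus_one_cong)
    (use assms in \<open>cases "even b"; cases "even j"; cases "even d"; cases "even k"; cases "even i"; cases "even w"; simp\<close>)

lemma LLS_sign_second:
  fixes c j d l k i w :: nat
  assumes "even (i + c + k + d)"
  shows "(-1::Cq) ^ ((i + c + k + d) * (d + l) + (k + l) * (c + j) + (i + c + k + l) * (c + j)) * (-1) ^ (j * (c + j + w) + l * (d + l + (w + c + j)))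
    = (-1) ^ (k * i + k * j + (j + l) * (i + k + w) + j + j * l + l) * (-1) ^ (d * i + k + d)"
  unfolding power_add[symmetric]
  by (rule minus_one_cong)
    (use assms in \<open>cases "even c"; cases "even j"; cases "even d"; cases "even l"; cases "even i"; cases "even w"; simp\<close>)

text \<open>A matrix coefficient of \<open>crw_crw_braid\<close>: two indices start as j and l, and
  the terms in which they leave as k and i are kept. Braiding before the passage gives the left
  side, braiding after it the right side.\<close>

lemma ggop_relation:
  assumes w: "w \<in> lists (Agens r n)" and ij: "i \<in> idx n" "j \<in> idx n" "k \<in> idx n" "l \<in> idx n"
  shows "(\<Sum>b\<in>idx n. \<Sum>d\<in>idx n. scal ((-1) ^ (ipar l * ipar b + ipar d + ipar l) * Sc b j d l) (ggop i b k d w))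
    = (\<Sum>c\<in>idx n. \<Sum>d\<in>idx n. scal ((-1) ^ (ipar d * ipar i + ipar k + ipar d) * Sc i c k d) (ggop d l c j w))"
proof -
  let ?h = "\<lambda>d c' w2. if d = k then if c' = i then wd w2 else 0 else 0"
  let ?K = "\<lambda>c f. (-1) ^ (ipar f * ipar i + ipar k + ipar f) * Sc i c k f"
  have "(\<Sum>b\<in>idx n. \<Sum>d\<in>idx n. scal ((-1) ^ (ipar l * ipar b + ipar d + ipar l) * Sc b j d l) (ggop i b k d w))
     = braid j l (\<lambda>d b. ggop i b k d w)"
    unfolding braid_Sc[OF ij(2,4)] by (subst sum.swap) (simp only:)
  also have "\<dots> = braid j l (\<lambda>d b. crw w d (\<lambda>u w1. crw w1 b (\<lambda>c' w2. ?h u c' w2)))"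
    unfolding ggop_def gop_def by (intro arg_cong[where f = "braid j l"] ext arg_cong[where f = "crw w _"]) (simp add: crw_zero)
  also have "\<dots> = crw w j (\<lambda>c w1. crw w1 l (\<lambda>f w2. braid c f (\<lambda>d c'. ?h d c' w2)))"
    by (rule crw_crw_braid[OF ij(2,4) w])
  also have "\<dots> = crw w j (\<lambda>c w1. crw w1 l (\<lambda>f w2. scal (?K c f) (wd w2)))"
  proof (rule crw_cong[OF w ij(2)])
    fix c w1 assume c: "c \<in> idx n" and w1: "w1 \<in> lists (Pgens r n)"
    show "crw w1 l (\<lambda>f w2. braid c f (\<lambda>d c'. ?h d c' w2)) = crw w1 l (\<lambda>f w2. scal (?K c f) (wd w2))"
    proof (rule crw_cong[OF lists_Pgens_Agens[OF w1] ij(4)])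
      fix f w2 assume f: "f \<in> idx n"
      show "braid c f (\<lambda>d c'. ?h d c' w2) = scal (?K c f) (wd w2)"
        unfolding braid_Sc[OF c f] by (subst sum_delta2[OF finite_idx finite_idx ij(3,1)]) auto
    qed
  qed
  also have "\<dots> = (\<Sum>c\<in>idx n. crw w j (\<lambda>u w1. if u = c then crw w1 l (\<lambda>f w2. scal (?K c f) (wd w2)) else 0))"
    by (rule crw_split[OF w ij(2)])
  also have "\<dots> = (\<Sum>c\<in>idx n. \<Sum>d\<in>idx n. scal (?K c d) (ggop d l c j w))"
  proof (rule sum.cong[OF refl])
    fix c assume "c \<in> idx n"
    have "crw w j (\<lambda>u w1. if u = c then crw w1 l (\<lambda>f w2. scal (?K c f) (wd w2)) else 0)
      = crw w j (\<lambda>u w1. \<Sum>d\<in>idx n. scal (?K c d) (if u = c then gop d l w1 else 0))"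
    proof (rule crw_cong[OF w ij(2)])
      fix u w1 assume w1: "w1 \<in> lists (Pgens r n)"
      have "crw w1 l (\<lambda>f w2. scal (?K c f) (wd w2)) = (\<Sum>d\<in>idx n. crw w1 l (\<lambda>u w'. if u = d then scal (?K c d) (wd w') else 0))"
        by (rule crw_split[OF lists_Pgens_Agens[OF w1] ij(4)])
      also have "\<dots> = (\<Sum>d\<in>idx n. scal (?K c d) (gop d l w1))"
        unfolding gop_def crw_scal[symmetric] by (intro sum.cong refl arg_cong[where f = "crw w1 l"] ext) simp
      finally show "(if u = c then crw w1 l (\<lambda>f w2. scal (?K c f) (wd w2)) else 0)
        = (\<Sum>d\<in>idx n. scal (?K c d) (if u = c then gop d l w1 else 0))" by simp
    qed
    then show "crw w j (\<lambda>u w1. if u = c then crw w1 l (\<lambda>f w2. scal (?K c f) (wd w2)) else 0)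
      = (\<Sum>d\<in>idx n. scal (?K c d) (ggop d l c j w))"
      by (simp only: crw_sum[OF finite_idx] crw_scal ggop_def)
  qed
  finally show ?thesis .
qed

text \<open>Both halves of the relator carry the same sign \<open>?s\<close>, so they cancel already
  on free words.\<close>

lemma ua_LLS:
  assumes w: "w \<in> lists (Agens r n)" and ij: "i \<in> idx n" "j \<in> idx n" "k \<in> idx n" "l \<in> idx n"
  shows "ua (cfU i j k l (LLS n)) (wd w) = 0"
proof -
  let ?w = "par (Word w)"
  let ?s = "(-1::Cq) ^ (ipar k * ipar i + ipar k * ipar j + (ipar j + ipar l) * (ipar i + ipar k + ?w) + ipar j + ipar j * ipar l + ipar l)"
  have nz: "x \<in> idx n \<Longrightarrow> x \<noteq> 0" for x by (rule idx_nonzero)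
  have x: "wd w \<in> wspan (Agens r n)" by (rule wd_wspan[OF w])
  have 1: "scal (Sc b j d l * (-1) ^ (ip2 k d * ip2 i b + ip2 k d * ip2 b j)) (ua (Lgen i b \<star> Lgen k d) (wd w))
      = scal ?s (scal ((-1) ^ (ipar l * ipar b + ipar d + ipar l) * Sc b j d l) (ggop i b k d w))"
    if bd: "b \<in> idx n" "d \<in> idx n" for b d
  proof (cases "Sc b j d l = 0")
    case False
    then have "even (ipar b + ipar j + ipar d + ipar l)" using ij bd nz by (intro Sc_even) auto
    from LLS_sign_first[OF this, of "ipar k" "ipar i" ?w] show ?thesis
      unfolding ua_Lgen_Lgen[OF x bd] lact_lact[OF w bd(2)] vec.scale_scale
      by (simp only: mult.assoc mult.left_commute mult.commute)
  qed simp
  have 2: "scal (Sc i c k d * (-1) ^ ((ipar i + ipar c + ipar k + ipar d) * ip2 d l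
         + ip2 k l * ip2 c j + (ipar i + ipar c + ipar k + ipar l) * ip2 c j)) (ua (Lgen d l \<star> Lgen c j) (wd w))
      = scal ?s (scal ((-1) ^ (ipar d * ipar i + ipar k + ipar d) * Sc i c k d) (ggop d l c j w))"
    if cd: "c \<in> idx n" "d \<in> idx n" for c d
  proof (cases "Sc i c k d = 0")
    case False
    then have "even (ipar i + ipar c + ipar k + ipar d)" using ij cd nz by (intro Sc_even) auto
    from LLS_sign_second[OF this, of "ipar l" "ipar j" ?w] show ?thesis
      unfolding ua_Lgen_Lgen[OF x ij(4,2)] lact_lact[OF w ij(2)] vec.scale_scale
      by (simp only: mult.assoc mult.left_commute mult.commute)
  qed simp
  have "ua (cfU i j k l (LLS n)) (wd w) =
      scal ?s (\<Sum>b\<in>idx n. \<Sum>d\<in>idx n. scal ((-1) ^ (ipar l * ipar b + ipar d + ipar l) * Sc b j d l) (ggop i b k d w))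
    - scal ?s (\<Sum>c\<in>idx n. \<Sum>d\<in>idx n. scal ((-1) ^ (ipar d * ipar i + ipar k + ipar d) * Sc i c k d) (ggop d l c j w))"
    unfolding cfU_LLS[OF ij(1,3,2,4)] vlin_diff[OF vlin_ua_left] vlin_sum[OF vlin_ua_left] vlin_scal[OF vlin_ua_left] vec.scale_sum_right
    by (intro arg_cong2[where f = "(-)"] sum.cong refl 1 2)
  then show ?thesis by (simp only: ggop_relation[OF w ij] diff_self)
qed

lemma gop_diag_letter:
  assumes "l \<in> Agens r n" "b \<in> idx n"
  shows "gop b b [l] = scal ((-1) ^ (ipar (snd (nrm l)) * ipar b) * qvar powi phi (snd (nrm l)) b) (wd [nrm l])"
proof -
  obtain i p where l: "nrm l = (i, p)" by force
  have "p \<in> idx n" using nrm_idx[OF assms(1)] l by simp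
  then show ?thesis
    using assms(2) by (auto simp: gop_def l braid_def idx_def mult.commute)
qed

text \<open>Triangularity forces b \<le> k \<le> b for the intermediate index k of
  \<open>gop_append\<close>, so L_bb acts diagonally up to normalisation of letters.\<close>

lemma gop_diag_cons:
  assumes "l \<in> Agens r n" "w \<in> lists (Agens r n)" "b \<in> idx n"
  shows "gop b b (l # w) = gop b b [l] \<star> gop b b w"
proof -
  have "gop b b ([l] @ w) = (\<Sum>k\<in>idx n. gop b k [l] \<star> gop k b w)"
    using assms by (intro gop_append[of _ r]) auto
  also have "\<dots> = gop b b [l] \<star> gop b b w"
    by (subst sum_single[of _ b])
      (use assms gop_zero[OF assms(2,3)] gop_zero[of "[l]" r n _ b] in \<open>force simp: kprod_simps\<close>)+
  finally show ?thesis by simp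
qed

text \<open>The powers of q in the two eigenvalues cancel because \<phi>(p,b) + \<phi>(p,-b) = 0.
  Exactly one of b and -b is negative, which leaves one sign for every odd letter.\<close>

lemma gop_diag:
  assumes "w \<in> lists (Agens r n)" "b \<in> idx n"
  shows "\<exists>c c'. gop b b w = scal c (wd (map nrm w)) \<and> gop (-b) (-b) w = scal c' (wd (map nrm w)) \<and> c * c' = (-1) ^ par (Word w)"
  using assms(1)
proof (induction w)
  case Nil
  show ?case by (intro exI[of _ 1]) (simp add: gop_def)
next
  case (Cons l w)
  then obtain c c' where c: "gop b b w = scal c (wd (map nrm w))" "gop (-b) (-b) w = scal c' (wd (map nrm w))" "c * c' = (-1) ^ par (Word w)"
    by blast
  let ?p = "snd (nrm l)"
  let ?e = "\<lambda>b. (-1) ^ (ipar ?p * ipar b) * qvar powi phi ?p b"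
  have b: "- b \<in> idx n" "b \<noteq> 0" "?p \<noteq> 0" using assms(2) nrm_idx(1)[OF Cons.hyps(1)] by (auto simp: idx_def)
  have g: "gop b b (l # w) = scal (?e b * c) (wd (map nrm (l # w)))" "gop (-b) (-b) (l # w) = scal (?e (-b) * c') (wd (map nrm (l # w)))"
    using gop_diag_cons[OF Cons.hyps(1,2)] gop_diag_letter[OF Cons.hyps(1)] assms(2) b c by (simp_all add: kprod_simps mult.commute)
  have "?e b * ?e (-b) = (-1) ^ ipar ?p"
  proof -
    have "phi ?p b + phi ?p (-b) = 0" using b by (auto simp: phi_def ipar_def)
    then have "qvar powi phi ?p b * qvar powi phi ?p (-b) = 1"
      using qvar_nonzero by (simp flip: power_int_add)
    moreover have "(-1::Cq) ^ (ipar ?p * ipar b) * (-1) ^ (ipar ?p * ipar (-b)) = (-1) ^ ipar ?p"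
      using b by (auto simp: ipar_def)
    moreover have "?e b * ?e (-b) = ((-1) ^ (ipar ?p * ipar b) * (-1) ^ (ipar ?p * ipar (-b))) * (qvar powi phi ?p b * qvar powi phi ?p (-b))"
      by (simp only: mult_ac)
    ultimately show ?thesis by (simp only: mult_1_right)
  qed
  moreover have "(-1::Cq) ^ par (Word (l # w)) = (-1) ^ ipar ?p * (-1) ^ par (Word w)"
    unfolding power_add[symmetric] using Cons.hyps(1)
    by (intro minus_one_cong) (auto simp: nrm_def ipar_def Agens_def idx_def)
  moreover have "(?e b * c) * (?e (-b) * c') = (?e b * ?e (-b)) * (c * c')"
    by (simp only: mult_ac)
  ultimately have "(?e b * c) * (?e (-b) * c') = (-1) ^ par (Word (l # w))"
    by (simp only: c(3))
  with g show ?case by blast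
qed

lemma lact_diag:
  assumes w: "w \<in> lists (Agens r n)" and b: "b \<in> idx n"
  shows "lact (b, b) (lact (-b, -b) (wd w)) = wd (map nrm w)"
proof -
  let ?w = "map nrm w"
  obtain c c' where c: "gop b b w = scal c (wd ?w)" "gop (-b) (-b) w = scal c' (wd ?w)" "c * c' = (-1) ^ par (Word w)"
    using gop_diag[OF w b] by blast
  have p: "even (par (Word ?w) + par (Word w))" by (rule par_map_nrm[OF w])
  have w': "?w \<in> lists (Pgens r n)" using w Agens_nrm by (induction w) auto
  have "lact (b, b) (wd ?w) = lact (b, b) (wd w)" by (simp only: lact_wd Lword_nrm[OF w])
  then have "lact (b, b) (lact (-b, -b) (wd w))
      = scal ((-1) ^ (ipar (-b) * (2 * ipar (-b) + par (Word w))) * c' * ((-1) ^ (ipar b * (2 * ipar b + par (Word w))) * c)) (wd ?w)"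
    by (simp add: lact_wd Lword_def c(1,2) vlin_scal[OF vlin_lact] mult_2 del: par.simps)
  \<comment> \<open>Exactly one of b and -b is odd, so the two twists in \<open>Lword\<close>
    combine to the sign of the word and cancel the one from \<open>gop_diag\<close>.\<close>
  also have "(-1) ^ (ipar (-b) * (2 * ipar (-b) + par (Word w))) * c' * ((-1) ^ (ipar b * (2 * ipar b + par (Word w))) * c)
     = (-1) ^ par (Word w) * (c * c')"
    using b by (auto simp: idx_def ipar_def power_add simp del: par.simps)
  also have "\<dots> = 1" unfolding c(3) by (simp flip: power_add mult_2 del: par.simps)
  finally show ?thesis by simp
qed

lemma lact_foldr_mem:
  assumes "ls \<in> lists (Ugens n)" "x \<in> wspan (Agens r n)"
  shows "foldr lact ls x \<in> wspan (Agens r n)"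
  using assms by (induction ls) (auto simp: Ugens_def intro: lact_mem)

lemma lact_foldr_NA:
  assumes "ls \<in> lists (Ugens n)" "x \<in> NA r n"
  shows "foldr lact ls x \<in> NA r n"
  using assms by (induction ls) (auto simp: Ugens_def intro: lact_NA)

lemma ua_mem:
  assumes "u \<in> wspan (Ugens n)" "x \<in> wspan (Agens r n)"
  shows "ua u x \<in> wspan (Agens r n)"
  by (rule vspan_wordE[OF vlin_ua_left vec.subspace_span assms(1)]) (use lact_foldr_mem[OF _ assms(2)] in \<open>auto simp: ua_wd\<close>)

lemma ua_NA:
  assumes "u \<in> wspan (Ugens n)" "x \<in> NA r n"
  shows "ua u x \<in> NA r n"
  by (rule vspan_wordE[OF vlin_ua_left ideal_gen_subspace assms(1)]) (use lact_foldr_NA[OF _ assms(2)] in \<open>auto simp: ua_wd\<close>)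

lemma ua_kprod:
  assumes "u \<in> wspan (Ugens n)" "v \<in> wspan (Ugens n)"
  shows "ua (u \<star> v) x = ua u (ua v x)"
proof (rule bilinear_ext[OF _ _ _ _ _ assms, where f = "\<lambda>u v. ua (u \<star> v) x" and g = "\<lambda>u v. ua u (ua v x)"], goal_cases)
  case (5 a b)
  then show ?case by (auto simp: ua_wd)
qed (intro vlin_comp[OF vlin_ua_left] vlin_comp[OF vlin_ua_right vlin_ua_left] vlin_ua_left vlin_rules)+

lemma ua_Urels:
  assumes u: "u \<in> ideal_gen (Ugens n) (Urels n)" and x: "x \<in> wspan (Agens r n)"
  shows "ua u x \<in> NA r n"
proof (rule ideal_gen_induct[OF vlin_ua_left ideal_gen_subspace u])
  fix v y w assume v: "v \<in> lists (Ugens n)" "w \<in> lists (Ugens n)" and y: "y \<in> Urels n"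
  have yw: "y \<in> wspan (Ugens n)" by (rule relator_wspan[OF homog_Urels y])
  have *: "ua y (wd w) \<in> NA r n" if w: "w \<in> lists (Agens r n)" for w
  proof -
    from y consider i where "y = gen i i \<star> gen (-i) (-i) - w1" "i \<in> idx n"
      | i j k l where "y = cfU i j k l (LLS n)" "i \<in> idx n" "j \<in> idx n" "k \<in> idx n" "l \<in> idx n"
      unfolding Urels_def cfU_def by blast
    then show ?thesis
    proof cases
      case 1
      \<comment> \<open>L_bb L_{-b,-b} returns the normal form of the word, which equals the word
        modulo the ideal.\<close>
      have "ua y (wd w) = wd (map nrm w) - wd w"
        unfolding 1(1) by (simp add: vlin_diff[OF vlin_ua_left] ua_wd lact_diag[OF w 1(2)])
      also have "\<dots> = - (wd ([] @ w) - wd ([] @ map nrm w))" by simp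
      finally show ?thesis using vec.subspace_neg[OF ideal_gen_subspace nrm_mem_NA[OF w, of "[]"]] by simp
    next
      case 2
      show ?thesis unfolding 2(1) ua_LLS[OF w 2(2-5)] by (rule vec.subspace_0[OF ideal_gen_subspace])
    qed
  qed
  have z: "ua y z \<in> NA r n" if "z \<in> wspan (Agens r n)" for z
    by (rule vspan_wordE[OF vlin_ua_right ideal_gen_subspace that]) (use * in auto)
  have "foldr lact v (ua y (foldr lact w x)) \<in> NA r n"
    by (rule lact_foldr_NA[OF v(1) z[OF lact_foldr_mem[OF v(2) x]]])
  then show "ua (wd v \<star> y \<star> wd w) x \<in> NA r n"
    using v yw by (simp add: ua_kprod[of _ n] kprod_wspan wd_wspan ua_wd del: in_lists_conv_set)
qed

section \<open>The action on the quantum coordinate superalgebras\<close>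

text \<open>This is \<open>gop_append\<close> with signs: the twists of \<open>Lword\<close> on x, y
  and xy differ by the sign in the comultiplication of L_ab and by the Koszul sign of L_kb passing
  x.\<close>

lemma lact_product_words:
  assumes w: "x \<in> lists (Agens r n)" "y \<in> lists (Agens r n)" and b: "b \<in> idx n"
  shows "lact (a, b) (wd x \<star> wd y) = (\<Sum>k\<in>idx n. scal ((-1) ^ (ip2 a k * ip2 k b + ip2 k b * par (Word x)))
     (lact (a, k) (wd x) \<star> lact (k, b) (wd y)))"
proof -
  have "lact (a, b) (wd x \<star> wd y) = scal ((-1) ^ (ipar b * (ipar a + ipar b + (par (Word x) + par (Word y))))) (\<Sum>k\<in>idx n. gop a k x \<star> gop k b y)"
    by (simp add: lact_wd Lword_def gop_append[OF w b])
  also have "\<dots> = (\<Sum>k\<in>idx n. scal ((-1) ^ (ip2 a k * ip2 k b + ip2 k b * par (Word x))) (lact (a, k) (wd x) \<star> lact (k, b) (wd y)))"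
    unfolding vec.scale_sum_right
  proof (rule sum.cong[OF refl])
    fix k
    have s: "(-1::Cq) ^ (b * (a + b + (x + y))) = (-1) ^ ((a + k) * (k + b) + (k + b) * x) * ((-1) ^ (b * (k + b + y)) * (-1) ^ (k * (a + k + x)))"
      for a b k x y :: nat
      unfolding power_add[symmetric]
      by (rule minus_one_cong) (cases "even a"; cases "even b"; cases "even k"; cases "even x"; cases "even y"; simp)
    show "scal ((-1) ^ (ipar b * (ipar a + ipar b + (par (Word x) + par (Word y))))) (gop a k x \<star> gop k b y)
       = scal ((-1) ^ (ip2 a k * ip2 k b + ip2 k b * par (Word x))) (lact (a, k) (wd x) \<star> lact (k, b) (wd y))"
      by (simp add: lact_wd Lword_def kprod_simps s[of "ipar b" "ipar a" "par (Word x)" "par (Word y)" "ipar k"] mult_ac del: par.simps)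
  qed
  finally show ?thesis .
qed

lemma lact_product:
  assumes x: "x \<in> hspan (Agens r n) s" and y: "y \<in> wspan (Agens r n)" and b: "b \<in> idx n"
  shows "lact (a, b) (x \<star> y) = (\<Sum>k\<in>idx n. scal ((-1) ^ (ip2 a k * ip2 k b + ip2 k b * s)) (lact (a, k) x \<star> lact (k, b) y))"
proof (rule bilinear_ext[OF _ _ _ _ _ x y, where f = "\<lambda>x y. lact (a, b) (x \<star> y)" and
    g = "\<lambda>x y. \<Sum>k\<in>idx n. scal ((-1) ^ (ip2 a k * ip2 k b + ip2 k b * s)) (lact (a, k) x \<star> lact (k, b) y)"], goal_cases)
  case (3 y)
  show ?case
    by (simp add: vlin_def vlin_add[OF vlin_lact] vlin_scal[OF vlin_lact] kprod_simps sum.distrib vec.scale_right_distrib vec.scale_sum_right mult.commute)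
next
  case (4 x)
  show ?case
    by (simp add: vlin_def vlin_add[OF vlin_lact] vlin_scal[OF vlin_lact] kprod_simps sum.distrib vec.scale_right_distrib vec.scale_sum_right mult.commute)
next
  case (5 m m')
  then obtain u v where u: "m = Word u" "m' = Word v" "u \<in> lists (Agens r n)" "v \<in> lists (Agens r n)" "par (Word u) mod 2 = s mod 2" by blast
  have e: "even (k + c * p + (k + c * q))" if "p mod 2 = q mod 2" for k c p q :: nat
  proof -
    have "even (p + q)" using that by presburger
    then have "even (c * (p + q) + 2 * k)" by simp
    then show ?thesis by (simp add: algebra_simps)
  qed
  have "(-1::Cq) ^ (ip2 a k * ip2 k b + ip2 k b * par (Word u)) = (-1) ^ (ip2 a k * ip2 k b + ip2 k b * s)" for k
    by (rule minus_one_cong, rule e[OF u(5)])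
  then show ?case unfolding u(1,2) lact_product_words[OF u(3,4) b] by (simp only:)
qed (intro vlin_comp[OF vlin_lact] vlin_rules)+

lemma foldr_lact_homog:
  assumes "ls \<in> lists (Ugens n)" "x \<in> hspan (Agens r n) p"
  shows "foldr lact ls x \<in> hspan (Agens r n) (p + par (Word ls))"
  using assms(1)
proof (induction ls)
  case Nil
  show ?case using assms(2) by simp
next
  case (Cons l ls)
  obtain a b where l: "l = (a, b)" by force
  have "b \<in> idx n" using Cons.hyps(1) l by (auto simp: Ugens_def)
  from lact_homog[OF Cons.IH this, of a] show ?case by (simp add: l add_ac)
qed

section \<open>The product rule for the whole quantum queer superalgebra\<close>

definition Tmons :: "nat \<Rightarrow> mono set" where
  "Tmons n = {Tens (Word u) (Word v) | u v. u \<in> lists (Ugens n) \<and> v \<in> lists (Ugens n)}"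

lemma tbas_Uq: "tbas (Uq n) (Uq n) = Tmons n"
  unfolding tbas_def Tmons_def palg_bas[OF palg_Uq] by blast

definition comul1 :: "nat \<Rightarrow> int \<Rightarrow> int \<Rightarrow> vec" where
  "comul1 n i j = (\<Sum>k\<in>idx n. scal ((-1) ^ (ip2 i k * ip2 k j)) (Lgen i k \<boxtimes> Lgen k j))"

lemma cowd_Cons: "cowd n ((i, j) # w) = comul1 n i j \<star> cowd n w"
  by (simp add: comul1_def)

text \<open>The action of z in U \<otimes> U on x \<otimes> y followed by multiplication, where p is
  the parity of x.\<close>

definition tact :: "vec \<Rightarrow> nat \<Rightarrow> vec \<Rightarrow> vec \<Rightarrow> vec" where
  "tact z p x y = lin (tcase (\<lambda>m1 m2. scal ((-1) ^ (par m2 * p)) (ua (mon m1) x \<star> ua (mon m2) y))) z"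

lemma vlin_tact: "vlin (\<lambda>z. tact z p x y)"
  unfolding tact_def by (rule vlin_lin)

lemma Lgen_step:
  assumes "i \<in> idx n" "k \<in> idx n" "j \<in> idx n" "u \<in> lists (Ugens n)" "v \<in> lists (Ugens n)"
  shows "(Lgen i k \<boxtimes> Lgen k j) \<star> mon (Tens (Word u) (Word v)) = (if i \<le> k \<and> k \<le> j
    then scal ((-1) ^ (ip2 k j * par (Word u))) (mon (Tens (Word ((i, k) # u)) (Word ((k, j) # v)))) else 0)"
  by (auto simp: Lgen_def vtens_simps kprod_simps)

lemma comul1_step_mem:
  assumes "i \<in> idx n" "j \<in> idx n" "z \<in> vspan (Tmons n)"
  shows "comul1 n i j \<star> z \<in> vspan (Tmons n)"
proof (rule vlin_span_mem[OF kprod_r vec.subspace_span assms(3)])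
  fix t assume "t \<in> mon ` Tmons n"
  then obtain u v where t: "t = mon (Tens (Word u) (Word v))" "u \<in> lists (Ugens n)" "v \<in> lists (Ugens n)"
    by (auto simp: Tmons_def)
  show "comul1 n i j \<star> t \<in> vspan (Tmons n)"
    unfolding comul1_def kprod_sum kprod_simps t(1)
  proof (intro vec.span_sum vec.span_scale)
    fix k assume k: "k \<in> idx n"
    show "(Lgen i k \<boxtimes> Lgen k j) \<star> mon (Tens (Word u) (Word v)) \<in> vspan (Tmons n)"
      unfolding Lgen_step[OF assms(1) k assms(2) t(2,3)] using t(2,3) k assms(1,2)
      by (auto intro!: vec.span_scale mon_in_vspan simp: vec.span_zero Tmons_def Ugens_def)
  qed
qed

lemma cowd_mem: "ls \<in> lists (Ugens n) \<Longrightarrow> cowd n ls \<in> vspan (Tmons n)"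
proof (induction ls rule: lists.induct)
  case Nil
  show ?case by (auto simp: Tmons_def intro!: mon_in_vspan)
next
  case (Cons l ls)
  obtain a b where l: "l = (a, b)" by force
  have "a \<in> idx n" "b \<in> idx n" using Cons.hyps(1) l by (auto simp: Ugens_def)
  then show ?case unfolding l cowd_Cons by (intro comul1_step_mem Cons.IH)
qed

text \<open>The product rule for a single L_ab, applied to a product that is already expanded, is
  left multiplication by the comultiplication of L_ab; the Koszul sign of U \<otimes> U accounts for
  L_kb passing the first factor.\<close>

lemma lact_tact:
  assumes x: "x \<in> hspan (Agens r n) p" and y: "y \<in> wspan (Agens r n)" and ab: "a \<in> idx n" "b \<in> idx n"
    and z: "z \<in> vspan (Tmons n)"
  shows "lact (a, b) (tact z p x y) = tact (comul1 n a b \<star> z) p x y"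
proof (rule vlin_ext[OF _ _ z, where f = "\<lambda>z. lact (a, b) (tact z p x y)" and g = "\<lambda>z. tact (comul1 n a b \<star> z) p x y"])
  show "vlin (\<lambda>z. lact (a, b) (tact z p x y))" by (rule vlin_comp[OF vlin_lact vlin_tact])
  show "vlin (\<lambda>z. tact (comul1 n a b \<star> z) p x y)" by (rule vlin_comp[OF vlin_tact kprod_r])
  fix m assume "m \<in> Tmons n"
  then obtain u v where m: "m = Tens (Word u) (Word v)" "u \<in> lists (Ugens n)" "v \<in> lists (Ugens n)"
    by (auto simp: Tmons_def)
  let ?X = "foldr lact u x" and ?Y = "foldr lact v y"
  have X: "?X \<in> hspan (Agens r n) (p + par (Word u))" by (rule foldr_lact_homog[OF m(2) x])
  have Y: "?Y \<in> wspan (Agens r n)" by (rule lact_foldr_mem[OF m(3) y])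
  have s: "(-1::Cq) ^ (v * p) * (-1) ^ (c * d + d * (p + u)) = (-1) ^ (c * d) * ((-1) ^ (d * u) * (-1) ^ ((d + v) * p))" for c d u v :: nat
    by (simp add: power_add algebra_simps)
  have "lact (a, b) (tact (mon m) p x y) = (\<Sum>k\<in>idx n. scal ((-1) ^ (par (Word v) * p) * (-1) ^ (ip2 a k * ip2 k b + ip2 k b * (p + par (Word u))))
       (lact (a, k) ?X \<star> lact (k, b) ?Y))"
    by (simp add: m(1) tact_def ua_wd vlin_scal[OF vlin_lact] lact_product[OF X Y ab(2)] vec.scale_sum_right del: par.simps)
  also have "\<dots> = (\<Sum>k\<in>idx n. scal ((-1) ^ (ip2 a k * ip2 k b)) (tact ((Lgen a k \<boxtimes> Lgen k b) \<star> mon m) p x y))"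
  proof (rule sum.cong[OF refl])
    fix k assume k: "k \<in> idx n"
    show "scal ((-1) ^ (par (Word v) * p) * (-1) ^ (ip2 a k * ip2 k b + ip2 k b * (p + par (Word u)))) (lact (a, k) ?X \<star> lact (k, b) ?Y)
      = scal ((-1) ^ (ip2 a k * ip2 k b)) (tact ((Lgen a k \<boxtimes> Lgen k b) \<star> mon m) p x y)"
    proof (cases "a \<le> k \<and> k \<le> b")
      case True
      then show ?thesis
        unfolding m(1) Lgen_step[OF ab(1) k ab(2) m(2,3)] s
        by (simp add: tact_def lin_scal ua_wd add.assoc)
    next
      case False
      then have "lact (a, k) ?X \<star> lact (k, b) ?Y = 0"
        using lact_zero[OF hspan_wspan[OF X] k] lact_zero[OF Y ab(2)] by (auto simp: kprod_simps)
      then show ?thesis unfolding m(1) Lgen_step[OF ab(1) k ab(2) m(2,3)] using False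
        by (auto simp: vlin_zero[OF vlin_tact])
    qed
  qed
  also have "\<dots> = tact (comul1 n a b \<star> mon m) p x y"
    by (simp add: comul1_def kprod_sum kprod_simps vlin_sum[OF vlin_tact] vlin_scal[OF vlin_tact])
  finally show "lact (a, b) (tact (mon m) p x y) = tact (comul1 n a b \<star> mon m) p x y" .
qed

lemma foldr_lact_product:
  assumes x: "x \<in> hspan (Agens r n) p" and y: "y \<in> wspan (Agens r n)" and ls: "ls \<in> lists (Ugens n)"
  shows "foldr lact ls (x \<star> y) = tact (cowd n ls) p x y"
  using ls
proof (induction ls)
  case Nil
  show ?case by (simp add: tact_def ua_wd)
next
  case (Cons l ls)
  obtain a b where l: "l = (a, b)" by force
  have ab: "a \<in> idx n" "b \<in> idx n" using Cons.hyps(1) l by (auto simp: Ugens_def)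
  have "foldr lact (l # ls) (x \<star> y) = lact (a, b) (tact (cowd n ls) p x y)" by (simp add: l Cons.IH)
  also have "\<dots> = tact (cowd n (l # ls)) p x y"
    unfolding l cowd_Cons by (rule lact_tact[OF x y ab cowd_mem[OF Cons.hyps(2)]])
  finally show ?case .
qed

lemma ua_product:
  assumes x: "x \<in> hspan (Agens r n) p" and y: "y \<in> wspan (Agens r n)" and u: "u \<in> wspan (Ugens n)"
  shows "ua u (x \<star> y) = tact (lin (wcase (cowd n)) u) p x y"
proof (rule vlin_ext[OF vlin_ua_left vlin_comp[OF vlin_tact vlin_lin] u])
  fix m assume "m \<in> Word ` lists (Ugens n)"
  then obtain ls where "m = Word ls" "ls \<in> lists (Ugens n)" by blast
  then show "ua (mon m) (x \<star> y) = tact (lin (wcase (cowd n)) (mon m)) p x y"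
    using foldr_lact_product[OF x y] by (simp add: ua_wd)
qed

lemma sgnop_parts: "sgnop s x = even_part x + scal ((-1) ^ s) (x - even_part x)"
proof (rule vlin_ext[OF vlin_sgnop _ UNIV_vspan])
  show "vlin (\<lambda>x. even_part x + scal ((-1) ^ s) (x - even_part x))"
    by (intro vlin_rules vlin_even_part)
  fix m
  show "sgnop s (mon m) = even_part (mon m) + scal ((-1) ^ s) (mon m - even_part (mon m))"
    by (cases "even (par m)") (auto simp: sgnop_mon even_part_def minus_one_power_iff)
qed

lemma sgnop_mem_ideal:
  assumes "homog_relators G R" "x \<in> ideal_gen G R"
  shows "sgnop s x \<in> ideal_gen G R"
  unfolding sgnop_parts
  by (intro vec.subspace_add[OF ideal_gen_subspace] vec.subspace_scale[OF ideal_gen_subspace] vec.subspace_diff[OF ideal_gen_subspace]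
      ideal_gen_even_part assms)

lemma sgnop_mem_wspan: "x \<in> wspan G \<Longrightarrow> sgnop s x \<in> wspan G"
  unfolding sgnop_def by (erule lin_mem_vspan) (auto intro!: vec.span_scale wd_wspan_set)

lemma tact_vtens: "tact (u \<boxtimes> v) p x y = ua u x \<star> ua (sgnop p v) y"
proof (rule bilinear_ext[where f = "\<lambda>u v. tact (u \<boxtimes> v) p x y" and g = "\<lambda>u v. ua u x \<star> ua (sgnop p v) y" and B = UNIV and B' = UNIV], goal_cases)
  case (5 a b)
  show ?case by (simp add: tact_def sgnop_mon vlin_scal[OF vlin_ua_left] kprod_simps mult.commute)
qed (simp_all, (intro vlin_comp[OF vlin_tact] vlin_rules vlin_ua_left vlin_comp[OF vlin_ua_left vlin_sgnop])+)

text \<open>By \<open>tact_vtens\<close> the Koszul sign turns v into \<open>sgnop p v\<close>,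
  which stays in the ideal of U because this ideal is graded. So both families of tensor relators
  act into \<open>NA r n\<close>.\<close>

lemma tact_trels:
  assumes z: "z \<in> trels (Uq n) (Uq n)" and x: "x \<in> wspan (Agens r n)" and y: "y \<in> wspan (Agens r n)"
  shows "tact z p x y \<in> NA r n"
  using z unfolding trels_def
proof (rule vlin_span_mem[OF vlin_tact ideal_gen_subspace])
  fix t
  assume "t \<in> {u \<boxtimes> v |u v. u \<in> rels (Uq n) \<and> v \<in> vspan (bas (Uq n))} \<union> {u \<boxtimes> v |u v. u \<in> vspan (bas (Uq n)) \<and> v \<in> rels (Uq n)}"
  then consider u v where "t = u \<boxtimes> v" "u \<in> ideal_gen (Ugens n) (Urels n)" "v \<in> wspan (Ugens n)"
    | u v where "t = u \<boxtimes> v" "u \<in> wspan (Ugens n)" "v \<in> ideal_gen (Ugens n) (Urels n)"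
    unfolding palg_rels[OF palg_Uq] palg_bas[OF palg_Uq] by blast
  then show "tact t p x y \<in> NA r n"
  proof cases
    case 1
    show ?thesis unfolding 1(1) tact_vtens
      by (rule ideal_gen_right[OF homog_Arels ua_Urels[OF 1(2) x] ua_mem[OF sgnop_mem_wspan[OF 1(3)] y]])
  next
    case 2
    show ?thesis unfolding 2(1) tact_vtens
      by (rule ideal_gen_left[OF homog_Arels ua_Urels[OF sgnop_mem_ideal[OF homog_Urels 2(3)] y] ua_mem[OF 2(2) x]])
  qed
qed

lemma foldr_lact_one: "ls \<in> lists (Ugens n) \<Longrightarrow> foldr lact ls w1 = scal (\<Prod>(i, j)\<leftarrow>ls. of_bool (i = j)) w1"
proof (induction ls rule: lists.induct)
  case (Cons l ls)
  obtain a b where l: "l = (a, b)" by force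
  have "lact (a, b) w1 = scal (of_bool (a = b)) w1"
    by (auto simp: lact_wd Lword_def gop_def)
  then show ?case by (simp add: Cons.IH l vlin_scal[OF vlin_lact] mult.commute)
qed simp

lemma comult_eq: "comult n u = cls (tspace (Uq n) (Uq n)) (lin (wcase (cowd n)) (rep u))"
  by (simp add: comult_def)

lemma comult_carrier:
  assumes "u \<in> carrier (Uq n)"
  shows "comult n u \<in> carrier (tspace (Uq n) (Uq n))"
  unfolding comult_eq
  using palg_rep[OF palg_Uq assms] palg_qsp[OF palg_Uq]
  by (intro cls_closed[OF qsp_tspace] lin_mem_vspan[where B = "Word ` lists (Ugens n)"]) (auto simp: tbas_Uq intro!: cowd_mem)

text \<open>Stated for an arbitrary record, as the action has to be inserted into the algebra before
  \<open>A\<close> can be identified.\<close>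

lemma palg_supermodule_superalgebra:
  fixes V :: "('z) uspace_scheme"
  assumes V: "palg (Agens r n) (Arels r n) V"
    and act: "\<And>u x. u \<in> wspan (Ugens n) \<Longrightarrow> x \<in> wspan (Agens r n) \<Longrightarrow> act V (cls (Uq n) u) (cls V x) = cls V (ua u x)"
  shows "supermodule_superalgebra n V"
proof -
  note U = palg_Uq[of n]
  note VQ = palg_qsp[OF V] and UQ = palg_qsp[OF U]
  note cV = palg_carrier[OF V] and cU = palg_carrier[OF U]
  note lins = cls_add[OF VQ] cls_smult[OF VQ] cls_add[OF UQ] cls_smult[OF UQ] vec.span_add vec.span_scale
    vlin_add[OF vlin_ua_right] vlin_scal[OF vlin_ua_right] vlin_add[OF vlin_ua_left] vlin_scal[OF vlin_ua_left] act ua_mem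
    palg_mult[OF U] kprod_wspan ua_kprod[of _ n]
  have closed: "\<forall>u\<in>carrier (Uq n). \<forall>x\<in>carrier V. act V u x \<in> carrier V"
    by (intro ballI; elim cV cU) (simp add: act palg_closed[OF V] ua_mem)
  have sm: "supermodule n V"
    unfolding supermodule_def
  proof (intro conjI closed)
    show "superspace V" by (rule qsp_superspace[OF VQ])
    show "\<forall>u\<in>carrier (Uq n). \<forall>x\<in>carrier V. \<forall>y\<in>carrier V. act V u (x \<oplus>\<^bsub>V\<^esub> y) = act V u x \<oplus>\<^bsub>V\<^esub> act V u y"
      by (intro ballI; elim cV cU) (simp add: lins)
    show "\<forall>u\<in>carrier (Uq n). \<forall>v\<in>carrier (Uq n). \<forall>x\<in>carrier V. act V (u \<oplus>\<^bsub>Uq n\<^esub> v) x = act V u x \<oplus>\<^bsub>V\<^esub> act V v x"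
      by (intro ballI; elim cV cU) (simp add: lins)
    show "\<forall>c. \<forall>u\<in>carrier (Uq n). \<forall>x\<in>carrier V. act V u (c \<odot>\<^bsub>V\<^esub> x) = c \<odot>\<^bsub>V\<^esub> act V u x \<and> act V (c \<odot>\<^bsub>Uq n\<^esub> u) x = c \<odot>\<^bsub>V\<^esub> act V u x"
      by (intro ballI allI; elim cV cU) (simp add: lins)
    show "\<forall>x\<in>carrier V. act V \<one>\<^bsub>Uq n\<^esub> x = x"
      by (intro ballI; elim cV) (simp add: palg_one[OF U] act wd_wspan ua_wd)
    show "\<forall>u\<in>carrier (Uq n). \<forall>v\<in>carrier (Uq n). \<forall>x\<in>carrier V. act V (u \<otimes>\<^bsub>Uq n\<^esub> v) x = act V u (act V v x)"
      by (intro ballI; elim cV cU) (simp add: lins)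
    show "\<forall>p\<in>{0, 1}. \<forall>p'\<in>{0, 1}. \<forall>u\<in>homog (Uq n) p. \<forall>x\<in>homog V p'. act V u x \<in> homog V ((p + p') mod 2)"
    proof (intro ballI)
      fix p p' :: nat and u x assume pp: "p \<in> {0, 1}" "p' \<in> {0, 1}" and u: "u \<in> homog (Uq n) p" and x: "x \<in> homog V p'"
      from u obtain u' where u': "u' \<in> vspan {m \<in> Word ` lists (Ugens n). par m mod 2 = p}" "u = cls (Uq n) u'"
        unfolding homog_def palg_bas[OF U] by blast
      from x obtain x' where x': "x' \<in> vspan {m \<in> Word ` lists (Agens r n). par m mod 2 = p'}" "x = cls V x'"
        unfolding homog_def palg_bas[OF V] by blast
      have "p' mod 2 = p'" using pp by auto
      with x' have x'': "x' \<in> hspan (Agens r n) p'" by (simp only:)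
      have "ua u' x' \<in> hspan (Agens r n) (p + p')"
      proof (rule vspan_wordE[OF vlin_ua_left vec.subspace_span u'(1)])
        fix ls assume "Word ls \<in> {m \<in> Word ` lists (Ugens n). par m mod 2 = p}"
        then have m: "Word ls \<in> Word ` lists (Ugens n)" and e: "par (Word ls) mod 2 = p"
          by (simp_all only: mem_Collect_eq)
        from m have ls: "ls \<in> lists (Ugens n)" by blast
        have *: "(p' + k) mod 2 = (p + p') mod 2" if "k mod 2 = p" for k
          using that mod_add_right_eq[of p' k 2] by (simp add: add.commute)
        have "(p' + par (Word ls)) mod 2 = (p + p') mod 2" by (rule *[OF e])
        with foldr_lact_homog[OF ls x''] show "ua (wd ls) x' \<in> hspan (Agens r n) (p + p')" by (simp only: ua_wd)
      qed auto
      moreover have "act V u x = cls V (ua u' x')"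
        unfolding u'(2) x'(2) using u'(1) x'(1) by (intro act) (auto simp: mem_vspan_iff)
      ultimately show "act V u x \<in> homog V ((p + p') mod 2)"
        unfolding homog_def palg_bas[OF V] by simp
    qed
  qed
  show ?thesis
    unfolding supermodule_superalgebra_def
  proof (intro conjI ballI palg_superalgebra[OF V] sm)
    fix u p a b assume u: "u \<in> carrier (Uq n)" and p: "p \<in> {0, 1::nat}" and a: "a \<in> homog V p" and b: "b \<in> carrier V"
    from a obtain x where x: "x \<in> vspan {m \<in> Word ` lists (Agens r n). par m mod 2 = p}" "a = cls V x"
      unfolding homog_def palg_bas[OF V] by blast
    obtain y where y: "y \<in> wspan (Agens r n)" "b = cls V y" using b by (rule cV)
    have "p mod 2 = p" using p by auto
    with x have x': "x \<in> hspan (Agens r n) p" by (simp only:)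
    note xw = hspan_wspan[OF x']
    let ?u = "rep u" and ?z = "lin (wcase (cowd n)) (rep u)"
    have u': "?u \<in> wspan (Ugens n)" "cls (Uq n) ?u = u" using palg_rep[OF U u] cls_rep[OF UQ u] by auto
    have "tsum (rels V) (\<lambda>m1 m2. scal ((-1) ^ (par m2 * p)) (rep (act V (cls (Uq n) (mon m1)) a \<otimes>\<^bsub>V\<^esub> act V (cls (Uq n) (mon m2)) b))) (comult n u)
      = tsum (rels V) (\<lambda>m1 m2. scal ((-1) ^ (par m2 * p)) (ua (mon m1) x \<star> ua (mon m2) y)) (comult n u)"
    proof (rule tsum_cong[OF UQ UQ VQ comult_carrier[OF u]])
      fix m1 m2 assume "m1 \<in> bas (Uq n)" "m2 \<in> bas (Uq n)"
      then have m: "mon m1 \<in> wspan (Ugens n)" "mon m2 \<in> wspan (Ugens n)" by (auto simp: palg_bas[OF U])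
      then have "act V (cls (Uq n) (mon m1)) a \<otimes>\<^bsub>V\<^esub> act V (cls (Uq n) (mon m2)) b = cls V (ua (mon m1) x \<star> ua (mon m2) y)"
        using xw y by (simp add: x(2) act palg_mult[OF V] ua_mem)
      then show "cls V (scal ((-1) ^ (par m2 * p)) (rep (act V (cls (Uq n) (mon m1)) a \<otimes>\<^bsub>V\<^esub> act V (cls (Uq n) (mon m2)) b)))
        = cls V (scal ((-1) ^ (par m2 * p)) (ua (mon m1) x \<star> ua (mon m2) y))"
        by (simp add: cls_smult[OF VQ, symmetric] coset_rep[OF qsp_sub[OF VQ]])
    qed
    also have "\<dots> = cls V (tact (rep (cls (tspace (Uq n) (Uq n)) ?z)) p x y)"
      by (simp add: tsum_def tact_def comult_eq)
    \<comment> \<open>\<open>comult\<close> is a class in U \<otimes> U; \<open>tact_trels\<close>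
      allows its representative to be replaced by the explicit expansion with
      \<open>cowd\<close>.\<close>
    also have "\<dots> = cls V (tact ?z p x y)"
    proof -
      have "rep (cls (tspace (Uq n) (Uq n)) ?z) - ?z \<in> trels (Uq n) (Uq n)"
        using rep_cls[OF qsp_tspace[OF UQ UQ], of ?z] by simp
      from tact_trels[OF this xw y(1), of p]
      have "tact (rep (cls (tspace (Uq n) (Uq n)) ?z)) p x y - tact ?z p x y \<in> rels V"
        unfolding palg_rels[OF V] by (simp only: vlin_diff[OF vlin_tact])
      then show ?thesis by (simp only: cls_eq_iff[OF VQ])
    qed
    also have "\<dots> = act V u (a \<otimes>\<^bsub>V\<^esub> b)"
      using ua_product[OF x' y(1) u'(1)] act[OF u'(1) kprod_wspan[OF xw y(1)]] u'(2)
      by (simp add: x(2) y(2) palg_mult[OF V xw y(1)])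
    finally show "act V u (a \<otimes>\<^bsub>V\<^esub> b) = tsum (rels V) (\<lambda>m1 m2. scal ((-1) ^ (par m2 * p))
        (rep (act V (cls (Uq n) (mon m1)) a \<otimes>\<^bsub>V\<^esub> act V (cls (Uq n) (mon m2)) b))) (comult n u)" ..
  next
    fix u assume u: "u \<in> carrier (Uq n)"
    let ?u = "rep u"
    have u': "?u \<in> wspan (Ugens n)" "cls (Uq n) ?u = u" using palg_rep[OF U u] cls_rep[OF UQ u] by auto
    have "ua ?u w1 = scal (counit u) w1"
    proof -
      have "ua ?u w1 = (\<Sum>m\<in>supp ?u. scal (coeff_of ?u m) (scal (case m of Word w \<Rightarrow> (\<Prod>(i, j)\<leftarrow>w. of_bool (i = j)) | _ \<Rightarrow> 0) w1))"
        unfolding ua_def lin_def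
      proof (rule sum.cong[OF refl])
        fix m assume "m \<in> supp ?u"
        then obtain ls where "m = Word ls" "ls \<in> lists (Ugens n)" using u'(1) unfolding mem_vspan_iff by blast
        then show "scal (coeff_of ?u m) (wcase (\<lambda>ls. foldr lact ls w1) m)
          = scal (coeff_of ?u m) (scal (case m of Word w \<Rightarrow> (\<Prod>(i, j)\<leftarrow>w. of_bool (i = j)) | _ \<Rightarrow> 0) w1)"
          by (simp add: foldr_lact_one)
      qed
      then show ?thesis by (simp add: counit_def vec.scale_sum_left)
    qed
    then show "act V u \<one>\<^bsub>V\<^esub> = counit u \<odot>\<^bsub>V\<^esub> \<one>\<^bsub>V\<^esub>"
      using act[OF u'(1), of w1] u'(2) by (simp add: palg_one[OF V] cls_smult[OF VQ] wd_wspan)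
  qed
qed

text \<open>Passing one letter is a single braiding, whose coefficients are entries of S by
  \<open>braid_Sc\<close>; the twist in \<open>Lword\<close> turns the remaining signs into those of
  T S.\<close>

lemma lact_gen:
  assumes ab: "a \<in> idx n" "b \<in> idx n" and c: "c \<in> idx n" and i: "0 < i"
  shows "scal ((-1) ^ (ip2 a b * ip2 i c)) (lact (a, b) (gen i c)) = (\<Sum>d\<in>idx n. scal (Sc d c a b * (-1) ^ (ip2 i d * ip2 d c)) (gen i d))"
proof -
  have n: "nrm (i, c) = (i, c)" using i by (simp add: nrm_def)
  have "gop a b [(i, c)] = braid c b (\<lambda>u s. if u = a then gen i s else 0)"
    by (simp add: gop_def n)
  also have "\<dots> = (\<Sum>d\<in>idx n. scal ((-1) ^ (ipar b * ipar d + ipar a + ipar b) * Sc d c a b) (gen i d))"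
    unfolding braid_Sc[OF c ab(2)] using ab(1) by (subst sum_single[of _ a]) auto
  finally have g: "gop a b [(i, c)] = (\<Sum>d\<in>idx n. scal ((-1) ^ (ipar b * ipar d + ipar a + ipar b) * Sc d c a b) (gen i d))" .
  show ?thesis
    unfolding lact_wd Lword_def fst_conv snd_conv g vec.scale_sum_right vec.scale_scale
  proof (rule sum.cong[OF refl])
    fix d assume d: "d \<in> idx n"
    have s: "(-1::Cq) ^ ((a + b) * c) * ((-1) ^ (b * (a + b + c)) * ((-1) ^ (b * d + a + b))) = (-1) ^ (d * (d + c))"
      if "even (d + c + a + b)" for a b c d :: nat
      unfolding power_add[symmetric]
      by (rule minus_one_cong) (use that in \<open>cases "even a"; cases "even b"; cases "even c"; simp\<close>)
    have i0: "ipar i = 0" using i by (simp add: ipar_def)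
    show "scal ((-1) ^ (ip2 a b * ip2 i c) * ((-1) ^ (ipar b * (ipar a + ipar b + par (Word [(i, c)]))) * ((-1) ^ (ipar b * ipar d + ipar a + ipar b) * Sc d c a b))) (gen i d)
      = scal (Sc d c a b * (-1) ^ (ip2 i d * ip2 d c)) (gen i d)"
    proof (cases "Sc d c a b = 0")
      case False
      then have "even (ipar d + ipar c + ipar a + ipar b)"
        using d ab c by (intro Sc_even) (auto dest: idx_nonzero)
      from s[OF this] show ?thesis by (simp add: i0 mult.commute mult.left_commute)
    qed simp
  qed
qed

text \<open>The first tensor factor of S is invariant under E_dc -> E_{-d,-c}. This is what makes
  the action formula compatible with t_ia = t_{-i,-a}.\<close>

lemma Sc_uminus: "Sc (- d) (- c) a b = Sc d c a b"
proof -
  have p: "phi (- d) a = phi d a" by (auto simp: phi_def)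
  have e: "(- d = - c \<and> a = b) = (d = c \<and> a = b)" "(- d = b \<and> - c = a) = (d = - b \<and> c = - a)" "(- d = - b \<and> - c = - a) = (d = b \<and> c = a)"
    by auto
  show ?thesis unfolding Sc_def p e by (simp only: add.commute)
qed

text \<open>For a negative row \<open>lact\<close> produces letters with positive row while T S
  keeps the row, so the two agree through t_id = t_{-i,-d}, that is, modulo the ideal.\<close>

lemma lact_gen_NA:
  assumes ab: "a \<in> idx n" "b \<in> idx n" and c: "c \<in> idx n" and i: "i \<in> idx r"
  shows "scal ((-1) ^ (ip2 a b * ip2 i c)) (lact (a, b) (gen i c)) - cfT i c a b (TS r n) \<in> NA r n"
proof (cases "0 < i")
  case True
  then show ?thesis
    by (simp add: lact_gen[OF ab c True] cfT_TS[OF i ab c] vec.subspace_0[OF ideal_gen_subspace])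
next
  case False
  then have i': "0 < - i" using i by (auto simp: idx_def)
  have c': "- c \<in> idx n" "- i \<in> idx r" using c i by auto
  let ?g = "\<lambda>d. Sc d c a b * (-1) ^ (ip2 i d * ip2 d c)"
  have w: "[(i, c)] \<in> lists (Agens r n)" "[(- i, - c)] \<in> lists (Agens r n)" using c i by (auto simp: Agens_def)
  have "map nrm [(i, c)] = map nrm [(- i, - c)]" using i by (auto simp: nrm_def idx_def)
  then have "lact (a, b) (gen i c) = lact (a, b) (gen (- i) (- c))"
    using Lword_nrm[OF w(1), of "(a, b)"] Lword_nrm[OF w(2), of "(a, b)"] by (simp only: lact_wd)
  moreover have "(-1::Cq) ^ (ip2 a b * ip2 i c) = (-1) ^ (ip2 a b * ip2 (- i) (- c))"
    using i c by (intro minus_one_cong) (auto simp: ipar_def idx_def)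
  ultimately have "scal ((-1) ^ (ip2 a b * ip2 i c)) (lact (a, b) (gen i c))
      = (\<Sum>d\<in>idx n. scal (Sc d (- c) a b * (-1) ^ (ip2 (- i) d * ip2 d (- c))) (gen (- i) d))"
    using lact_gen[OF ab c'(1) i'] by simp
  also have "\<dots> = (\<Sum>d\<in>idx n. scal (?g d) (gen (- i) (- d)))"
  proof (rule sum.reindex_bij_witness[of _ uminus uminus])
    fix d assume d: "d \<in> idx n"
    have "(-1::Cq) ^ (ip2 (- i) d * ip2 d (- c)) = (-1) ^ (ip2 i (- d) * ip2 (- d) c)"
      using i c d by (intro minus_one_cong) (auto simp: ipar_def idx_def)
    then show "scal (?g (- d)) (gen (- i) (- (- d))) = scal (Sc d (- c) a b * (-1) ^ (ip2 (- i) d * ip2 d (- c))) (gen (- i) d)"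
      using Sc_uminus[of d "- c" a b] by simp
  qed auto
  finally have *: "scal ((-1) ^ (ip2 a b * ip2 i c)) (lact (a, b) (gen i c)) = (\<Sum>d\<in>idx n. scal (?g d) (gen (- i) (- d)))" .
  have "(\<Sum>d\<in>idx n. scal (?g d) (gen i d - gen (- i) (- d))) \<in> NA r n"
  proof (intro vec.subspace_sum[OF ideal_gen_subspace] vec.subspace_scale[OF ideal_gen_subspace])
    fix d assume "d \<in> idx n"
    from gen_swap_mem_NA[OF i this, of "[]" "[]"] show "gen i d - gen (- i) (- d) \<in> NA r n" by simp
  qed
  then have "- (\<Sum>d\<in>idx n. scal (?g d) (gen i d - gen (- i) (- d))) \<in> NA r n"
    by (rule vec.subspace_neg[OF ideal_gen_subspace])
  moreover have "- (\<Sum>d\<in>idx n. scal (?g d) (gen i d - gen (- i) (- d)))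
     = scal ((-1) ^ (ip2 a b * ip2 i c)) (lact (a, b) (gen i c)) - cfT i c a b (TS r n)"
    unfolding * cfT_TS[OF i ab c] by (simp add: vec.scale_right_diff_distrib sum_subtractf)
  ultimately show ?thesis by simp
qed

text \<open>Restricted to the carriers, so that uniqueness in \<open>is_Phi\<close> is equality of
  functions.\<close>

definition Phi0 :: "nat \<Rightarrow> nat \<Rightarrow> vec set \<Rightarrow> vec set \<Rightarrow> vec set" where
  "Phi0 r n = (\<lambda>u\<in>carrier (Uq n). \<lambda>x\<in>carrier (Aalg r n). cls (Aalg r n) (ua (rep u) (rep x)))"

lemma Phi0_cls:
  assumes u: "u \<in> wspan (Ugens n)" and x: "x \<in> wspan (Agens r n)"
  shows "Phi0 r n (cls (Uq n) u) (cls (Aalg r n) x) = cls (Aalg r n) (ua u x)"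
proof -
  let ?u = "rep (cls (Uq n) u)" and ?x = "rep (cls (Aalg r n) x)"
  have c: "cls (Uq n) u \<in> carrier (Uq n)" "cls (Aalg r n) x \<in> carrier (Aalg r n)"
    using palg_closed[OF palg_Uq u] palg_closed[OF palg_Aalg x] by auto
  have "?u - u \<in> ideal_gen (Ugens n) (Urels n)" "?x - x \<in> NA r n"
    using rep_cls[OF palg_qsp[OF palg_Uq], of n u] rep_cls[OF palg_qsp[OF palg_Aalg], of r n x]
    by (simp_all add: palg_rels[OF palg_Uq] palg_rels[OF palg_Aalg])
  then have "ua (?u - u) ?x + ua u (?x - x) \<in> NA r n"
    using palg_rep[OF palg_Aalg c(2)] u by (intro vec.subspace_add[OF ideal_gen_subspace] ua_Urels ua_NA)
  then have "ua ?u ?x - ua u x \<in> rels (Aalg r n)"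
    by (simp add: palg_rels[OF palg_Aalg] vlin_diff[OF vlin_ua_left] vlin_diff[OF vlin_ua_right])
  then show ?thesis using c by (simp add: Phi0_def cls_eq_iff[OF palg_qsp[OF palg_Aalg]])
qed

lemma Lgen_wspan: "a \<in> idx n \<Longrightarrow> b \<in> idx n \<Longrightarrow> Lgen a b \<in> wspan (Ugens n)"
  by (auto simp: Lgen_def Ugens_def vec.span_zero intro!: wd_wspan_set)

lemma gen_wspan: "i \<in> idx r \<Longrightarrow> c \<in> idx n \<Longrightarrow> gen i c \<in> wspan (Agens r n)"
  by (intro wd_wspan_set) (simp add: Agens_def)

lemma is_Phi_Phi0: "is_Phi r n (Phi0 r n)"
  unfolding is_Phi_def
proof (intro conjI ballI)
  show "Phi0 r n \<in> carrier (Uq n) \<rightarrow>\<^sub>E carrier (Aalg r n) \<rightarrow>\<^sub>E carrier (Aalg r n)"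
    unfolding Phi0_def
    by (intro restrict_PiE_iff[THEN iffD2] ballI palg_closed[OF palg_Aalg] ua_mem palg_rep[OF palg_Uq] palg_rep[OF palg_Aalg])
  show "supermodule_superalgebra n (space.extend (Aalg r n) (uspace.fields (Phi0 r n)))"
    by (rule palg_supermodule_superalgebra[where r = r]) (simp_all add: palg_Aalg Phi0_cls)
  fix a b i c assume *: "a \<in> idx n" "b \<in> idx n" "i \<in> idx r" "c \<in> idx n"
  note Q = palg_qsp[OF palg_Aalg[of r n]]
  have "(-1) ^ (ip2 a b * ip2 i c) \<odot>\<^bsub>Aalg r n\<^esub> Phi0 r n (cls (Uq n) (Lgen a b)) (cls (Aalg r n) (gen i c))
     = cls (Aalg r n) (scal ((-1) ^ (ip2 a b * ip2 i c)) (lact (a, b) (gen i c)))"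
    using * by (simp add: Phi0_cls Lgen_wspan gen_wspan cls_smult[OF Q] ua_Lgen[where r = r and n = n])
  also have "\<dots> = cls (Aalg r n) (cfT i c a b (TS r n))"
    using lact_gen_NA[OF *(1,2,4,3)] unfolding palg_rels[OF palg_Aalg, symmetric] by (simp only: cls_eq_iff[OF Q])
  finally show "(-1) ^ (ip2 a b * ip2 i c) \<odot>\<^bsub>Aalg r n\<^esub> Phi0 r n (cls (Uq n) (Lgen a b)) (cls (Aalg r n) (gen i c)) =
        cls (Aalg r n) (Poly_Mapping.map_key (\<lambda>w. Tens (Mu i c) (Tens w (Mu a b))) (TS r n))"
    by (simp only: cfT_def)
qed

section \<open>Uniqueness of the action\<close>

lemma ssa_lmap_right:
  assumes "supermodule_superalgebra n V" "u \<in> carrier (Uq n)"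
  shows "lmap V V (act V u)"
  using assms by (intro lmapI) (auto simp: supermodule_superalgebra_def supermodule_def)

lemma ssa_lmap_left:
  assumes "supermodule_superalgebra n V" "x \<in> carrier V"
  shows "lmap (Uq n) V (\<lambda>u. act V u x)"
  using assms by (intro lmapI) (auto simp: supermodule_superalgebra_def supermodule_def)

lemma lmap_agree:
  assumes "qsp V" "qsp W" "lmap V W F" "lmap V W G" "x \<in> vspan B" "B \<subseteq> bas V" "\<And>m. m \<in> B \<Longrightarrow> F (cls V (mon m)) = G (cls V (mon m))"
  shows "F (cls V x) = G (cls V x)"
proof -
  have x: "x \<in> vspan (bas V)" using assms(5,6) by (auto simp: mem_vspan_iff)
  have "lin (\<lambda>m. rep (F (cls V (mon m)))) x = lin (\<lambda>m. rep (G (cls V (mon m)))) x"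
    using assms(5,7) by (intro lin_cong) (auto simp: mem_vspan_iff)
  then show ?thesis using lmap_cls[OF assms(1,2,3) x] lmap_cls[OF assms(1,2,4) x] by simp
qed

lemma lmap_cong_rels: 
  assumes "carrier V = carrier V'" "ring.add V = ring.add V'" "module.smult V = module.smult V'"
    "carrier W = carrier W'" "ring.add W = ring.add W'" "module.smult W = module.smult W'"
  shows "lmap V W F = lmap V' W' F"
  using assms by (simp add: lmap_def)

lemma lmap_extend_left [simp]: "lmap (space.extend V f) W F = lmap V W F"
  by (rule lmap_cong_rels) simp_all

lemma lmap_extend_right [simp]: "lmap V (space.extend W g) F = lmap V W F"
  by (rule lmap_cong_rels) simp_all

text \<open>The formula prescribes each L_ab on the generators t_ic. The product axiom applies
  arbitrary elements of U to both factors, so all of U has to be determined on the span of the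
  generators (\<open>S4\<close>) before words in the generators can be treated
  (\<open>S5\<close>).\<close>

lemma is_Phi_unique:
  assumes P: "is_Phi r n P"
  shows "P = Phi0 r n"
proof -
  let ?A = "Aalg r n" and ?U = "Uq n"
  let ?V = "space.extend ?A (uspace.fields P)" and ?W = "space.extend ?A (uspace.fields (Phi0 r n))"
  note Q = palg_qsp[OF palg_Aalg[of r n]] and UQ = palg_qsp[OF palg_Uq[of n]]
  note bA = palg_bas[OF palg_Aalg[of r n]] and bU = palg_bas[OF palg_Uq[of n]]
  have ssa: "supermodule_superalgebra n ?V" using P unfolding is_Phi_def by blast
  have ssa0: "supermodule_superalgebra n ?W" using is_Phi_Phi0[of r n] unfolding is_Phi_def by blast
  have lr: "lmap ?A ?A (P u)" "lmap ?A ?A (Phi0 r n u)" if "u \<in> carrier ?U" for u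
    using ssa_lmap_right[OF ssa that] ssa_lmap_right[OF ssa0 that] by simp_all
  have ll: "lmap ?U ?A (\<lambda>u. P u x)" "lmap ?U ?A (\<lambda>u. Phi0 r n u x)" if "x \<in> carrier ?A" for x
    using ssa_lmap_left[OF ssa, of x] ssa_lmap_left[OF ssa0, of x] that by simp_all
  let ?B = "(\<lambda>l. Word [l]) ` Agens r n"
  have Bw: "?B \<subseteq> Word ` lists (Agens r n)" by auto
  then have gw: "x \<in> wspan (Agens r n)" if "x \<in> vspan ?B" for x using that by (auto simp: mem_vspan_iff)
  have cU: "cls ?U (wd ls) \<in> carrier ?U" if "ls \<in> lists (Ugens n)" for ls
    using that by (intro palg_closed[OF palg_Uq] wd_wspan)
  have cA: "cls ?A x \<in> carrier ?A" if "x \<in> wspan (Agens r n)" for x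
    using that by (rule palg_closed[OF palg_Aalg])
  have S1: "P (cls ?U (gen a b)) (cls ?A (gen i c)) = Phi0 r n (cls ?U (gen a b)) (cls ?A (gen i c))"
    if "a \<in> idx n" "b \<in> idx n" "a \<le> b" "i \<in> idx r" "c \<in> idx n" for a b i c
  proof -
    let ?s = "(-1::Cq) ^ (ip2 a b * ip2 i c)"
    have g: "cls ?U (gen a b) \<in> carrier ?U" "cls ?A (gen i c) \<in> carrier ?A"
      using that by (auto intro!: cU cA gen_wspan simp: Ugens_def)
    have "?s \<odot>\<^bsub>?A\<^esub> P (cls ?U (gen a b)) (cls ?A (gen i c)) = ?s \<odot>\<^bsub>?A\<^esub> Phi0 r n (cls ?U (gen a b)) (cls ?A (gen i c))"
    proof -
      have "\<forall>F. is_Phi r n F \<longrightarrow> ?s \<odot>\<^bsub>?A\<^esub> F (cls ?U (Lgen a b)) (cls ?A (gen i c))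
        = cls ?A (Poly_Mapping.map_key (\<lambda>w. Tens (Mu i c) (Tens w (Mu a b))) (TS r n))"
        using that unfolding is_Phi_def by blast
      then show ?thesis using P is_Phi_Phi0 that(3) by (simp add: Lgen_def)
    qed
    then have "?s \<odot>\<^bsub>?A\<^esub> (?s \<odot>\<^bsub>?A\<^esub> P (cls ?U (gen a b)) (cls ?A (gen i c))) = ?s \<odot>\<^bsub>?A\<^esub> (?s \<odot>\<^bsub>?A\<^esub> Phi0 r n (cls ?U (gen a b)) (cls ?A (gen i c)))"
      by simp
    moreover have "?s \<odot>\<^bsub>?A\<^esub> (?s \<odot>\<^bsub>?A\<^esub> y) = y" if "y \<in> carrier ?A" for y
    proof -
      have "?s * ?s = 1" by (simp flip: power_add mult_2)
      then show ?thesis using that by (elim carrier_cls[OF Q]) (simp add: cls_smult[OF Q])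
    qed
    ultimately show ?thesis using lmapD(1)[OF lr(1)[OF g(1)] g(2)] lmapD(1)[OF lr(2)[OF g(1)] g(2)] by simp
  qed
  have S2: "P (cls ?U (wd [l])) (cls ?A x) = Phi0 r n (cls ?U (wd [l])) (cls ?A x)" if l: "l \<in> Ugens n" and x: "x \<in> vspan ?B" for l x
  proof (rule lmap_agree[OF Q Q lr(1) lr(2) x])
    show "cls ?U (wd [l]) \<in> carrier ?U" "cls ?U (wd [l]) \<in> carrier ?U" using l by (auto intro!: cU)
    show "?B \<subseteq> bas ?A" using Bw bA by simp
    fix m assume "m \<in> ?B"
    then obtain i c where "m = Word [(i, c)]" "i \<in> idx r" "c \<in> idx n" by (auto simp: Agens_def)
    then show "P (cls ?U (wd [l])) (cls ?A (mon m)) = Phi0 r n (cls ?U (wd [l])) (cls ?A (mon m))"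
      using S1 l by (cases l) (auto simp: Ugens_def)
  qed
  \<comment> \<open>Passing an index preserves the length of a word, hence the span of single
    letters; so \<open>S2\<close> can be iterated.\<close>
  have stable: "foldr lact ls x \<in> vspan ?B" if "ls \<in> lists (Ugens n)" "x \<in> vspan ?B" for ls x
    using that(1)
  proof (induction ls)
    case Nil
    show ?case using that(2) by simp
  next
    case (Cons l ls)
    obtain a b where l: "l = (a, b)" "b \<in> idx n" using Cons.hyps(1) by (auto simp: Ugens_def)
    have "lact (a, b) (foldr lact ls x) \<in> vspan ?B"
    proof (rule vspan_wordE[OF vlin_lact vec.subspace_span Cons.IH])
      fix w assume "Word w \<in> ?B"
      then obtain k where k: "w = [k]" "k \<in> Agens r n" by auto
      then have w: "[k] \<in> lists (Agens r n)" by simp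
      have "gop a b [k] \<in> vspan ?B"
      proof (rule subsetD[OF vec.span_mono[OF image_mono] gop_mem_homog[OF w l(2), of a]], rule subsetI)
        fix m
        assume "m \<in> {m \<in> Word ` lists (Pgens r n). even (par (Word [k]) + ipar b + par m + ipar a) \<and> (\<exists>w'. m = Word w' \<and> length w' = length [k])}"
        then have "m \<in> Word ` lists (Pgens r n)" "\<exists>w'. m = Word w' \<and> length w' = length [k]" by blast+
        then obtain w' where "m = Word w'" "w' \<in> lists (Pgens r n)" "length w' = 1" by auto
        then obtain k' where "m = Word [k']" "k' \<in> Pgens r n" by (auto simp: length_Suc_conv)
        then show "m \<in> ?B" using Pgens_Agens by blast
      qed
      then show "lact (a, b) (wd w) \<in> vspan ?B" unfolding k(1) lact_wd Lword_def by (auto intro: vec.span_scale)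
    qed auto
    then show ?case by (simp add: l(1))
  qed
  have S3: "P (cls ?U (wd ls)) (cls ?A x) = cls ?A (foldr lact ls x)" if "ls \<in> lists (Ugens n)" "x \<in> vspan ?B" for ls x
    using that(1)
  proof (induction ls)
    case Nil
    have "P \<one>\<^bsub>?U\<^esub> (cls ?A x) = cls ?A x"
      using ssa cA[OF gw[OF that(2)]] by (simp add: supermodule_superalgebra_def supermodule_def)
    then show ?case by (simp add: palg_one[OF palg_Uq])
  next
    case (Cons l ls)
    have m: "\<forall>u\<in>carrier ?U. \<forall>v\<in>carrier ?U. \<forall>x\<in>carrier ?A. P (u \<otimes>\<^bsub>?U\<^esub> v) x = P u (P v x)"
      using ssa by (simp add: supermodule_superalgebra_def supermodule_def)
    have l: "[l] \<in> lists (Ugens n)" using Cons.hyps by simp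
    have "cls ?U (wd (l # ls)) = cls ?U (wd [l]) \<otimes>\<^bsub>?U\<^esub> cls ?U (wd ls)"
      using palg_mult[OF palg_Uq wd_wspan[OF l] wd_wspan[OF Cons.hyps(2)]] by simp
    then have "P (cls ?U (wd (l # ls))) (cls ?A x) = P (cls ?U (wd [l])) (P (cls ?U (wd ls)) (cls ?A x))"
      using m cU[OF l] cU[OF Cons.hyps(2)] cA[OF gw[OF that(2)]] by simp
    also have "\<dots> = Phi0 r n (cls ?U (wd [l])) (cls ?A (foldr lact ls x))"
      unfolding Cons.IH by (rule S2[OF Cons.hyps(1) stable[OF Cons.hyps(2) that(2)]])
    also have "\<dots> = cls ?A (foldr lact (l # ls) x)"
      using Phi0_cls[OF wd_wspan[OF l] gw[OF stable[OF Cons.hyps(2) that(2)]]] by (simp add: ua_wd)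
    finally show ?case .
  qed
  have S4: "P u (cls ?A x) = Phi0 r n u (cls ?A x)" if u: "u \<in> carrier ?U" and x: "x \<in> vspan ?B" for u x
  proof (rule lmap_ext[OF UQ Q ll(1) ll(2) _ u])
    fix m assume "m \<in> bas ?U"
    then obtain ls where "m = Word ls" "ls \<in> lists (Ugens n)" unfolding bU by blast
    then show "P (cls ?U (mon m)) (cls ?A x) = Phi0 r n (cls ?U (mon m)) (cls ?A x)"
      using S3 x Phi0_cls[OF wd_wspan gw[OF x]] by (simp add: ua_wd del: in_lists_conv_set)
  qed (use cA[OF gw[OF x]] in auto)
  have S5: "\<forall>u\<in>carrier ?U. P u (cls ?A (wd w)) = Phi0 r n u (cls ?A (wd w))" if "w \<in> lists (Agens r n)" for w
    using that
  proof (induction w)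
    case Nil
    show ?case
      using ssa ssa0 by (simp add: supermodule_superalgebra_def palg_one[OF palg_Aalg])
  next
    case (Cons l w)
    show ?case
    proof
      fix u assume u: "u \<in> carrier ?U"
      let ?a = "cls ?A (wd [l])" and ?b = "cls ?A (wd w)" and ?p = "par (Word [l]) mod 2"
      have l: "[l] \<in> lists (Agens r n)" using Cons.hyps by simp
      have a: "?a \<in> homog ?A ?p" using homog_mon[OF Q, of "Word [l]"] l bA by blast
      have b: "?b \<in> carrier ?A" by (intro cA wd_wspan Cons.hyps)
      have m: "cls ?A (wd (l # w)) = ?a \<otimes>\<^bsub>?A\<^esub> ?b"
        using palg_mult[OF palg_Aalg wd_wspan[OF l] wd_wspan[OF Cons.hyps(2)]] by simp
      have p: "?p \<in> {0, 1}" by (rule mod2_mem)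
      have prod: "F u (?a \<otimes>\<^bsub>?A\<^esub> ?b) = tsum (rels ?A) (\<lambda>m1 m2. scal ((-1) ^ (par m2 * ?p))
             (rep (F (cls ?U (mon m1)) ?a \<otimes>\<^bsub>?A\<^esub> F (cls ?U (mon m2)) ?b))) (comult n u)"
        if "supermodule_superalgebra n (space.extend ?A (uspace.fields F))" for F
      proof -
        have "\<forall>u\<in>carrier (Uq n). \<forall>p\<in>{0, 1}. \<forall>a\<in>homog ?A p. \<forall>b\<in>carrier ?A.
          F u (a \<otimes>\<^bsub>?A\<^esub> b) = tsum (rels ?A) (\<lambda>m1 m2. scal ((-1) ^ (par m2 * p))
             (rep (F (cls ?U (mon m1)) a \<otimes>\<^bsub>?A\<^esub> F (cls ?U (mon m2)) b))) (comult n u)"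
          using that unfolding supermodule_superalgebra_def extend_simps homog_extend by (elim conjE) assumption
        from bspec[OF bspec[OF bspec[OF bspec[OF this u] p] a] b] show ?thesis .
      qed
      show "P u (cls ?A (wd (l # w))) = Phi0 r n u (cls ?A (wd (l # w)))"
        unfolding m prod[OF ssa] prod[OF ssa0]
      proof (rule tsum_cong[OF UQ UQ Q comult_carrier[OF u]])
        fix m1 m2 assume "m1 \<in> bas ?U" "m2 \<in> bas ?U"
        then have c: "cls ?U (mon m1) \<in> carrier ?U" "cls ?U (mon m2) \<in> carrier ?U" by (auto intro!: cls_closed[OF UQ])
        have "wd [l] \<in> vspan ?B" using l by (intro mon_in_vspan) auto
        from S4[OF c(1) this] Cons.IH c(2)
        show "cls ?A (scal ((-1) ^ (par m2 * ?p)) (rep (P (cls ?U (mon m1)) ?a \<otimes>\<^bsub>?A\<^esub> P (cls ?U (mon m2)) ?b)))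
          = cls ?A (scal ((-1) ^ (par m2 * ?p)) (rep (Phi0 r n (cls ?U (mon m1)) ?a \<otimes>\<^bsub>?A\<^esub> Phi0 r n (cls ?U (mon m2)) ?b)))"
          by simp
      qed
    qed
  qed
  have S6: "P u x = Phi0 r n u x" if u: "u \<in> carrier ?U" and x: "x \<in> carrier ?A" for u x
  proof (rule lmap_ext[OF Q Q lr(1)[OF u] lr(2)[OF u] _ x])
    fix m assume "m \<in> bas ?A"
    then obtain w where "m = Word w" "w \<in> lists (Agens r n)" unfolding bA by blast
    then show "P u (cls ?A (mon m)) = Phi0 r n u (cls ?A (mon m))" using S5 u by blast
  qed
  have PE: "F \<in> carrier ?U \<rightarrow>\<^sub>E carrier ?A \<rightarrow>\<^sub>E carrier ?A" if "is_Phi r n F" for F using that unfolding is_Phi_def by blast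
  show ?thesis
  proof (rule PiE_ext[OF PE[OF P] PE[OF is_Phi_Phi0]])
    fix u assume u: "u \<in> carrier ?U"
    show "P u = Phi0 r n u"
      by (rule PiE_ext[OF PiE_mem[OF PE[OF P] u] PiE_mem[OF PE[OF is_Phi_Phi0] u] S6[OF u]])
  qed
qed

lemma A_eq: "A r n = space.extend (Aalg r n) (uspace.fields (Phi0 r n))"
  unfolding A_def using is_Phi_Phi0 is_Phi_unique by (metis the_equality)

lemma A_ssa: "supermodule_superalgebra n (A r n)"
  unfolding A_eq using is_Phi_Phi0[of r n] unfolding is_Phi_def by blast

lemma A_rels: "rels (A r n) = NA r n"
  by (rule palg_rels[OF palg_A])

lemma A_act:
  assumes "u \<in> wspan (Ugens n)" "x \<in> wspan (Agens r n)"
  shows "act (A r n) (cls (Uq n) u) (cls (A r n) x) = cls (A r n) (ua u x)"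
  using Phi0_cls[OF assms] by (simp add: A_eq)

section \<open>Shifting row indices\<close>

definition sh :: "nat \<Rightarrow> int \<times> int \<Rightarrow> int \<times> int" where
  "sh k = (\<lambda>(i, a). (if i > 0 then i + int k else i - int k, a))"

definition iol :: "nat \<Rightarrow> vec \<Rightarrow> vec" where
  "iol k = lin (wcase (\<lambda>w. wd (map (sh k) w)))"

lemma vlin_iol: "vlin (iol k)"
  unfolding iol_def by (rule vlin_lin)

lemma iol_wd [simp]: "iol k (wd w) = wd (map (sh k) w)"
  by (simp add: iol_def)

lemma iota_eq: "iota k m n x = cls (A m n) (iol k (rep x))"
  by (simp only: iota_def iol_def sh_def)

lemma sh_zero: "sh 0 = id"
  by (auto simp: sh_def)

lemma sh_pos: "0 < i \<Longrightarrow> sh k (i, a) = (i + int k, a)"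
  by (simp add: sh_def)

lemma nrm_sh: "l \<in> Agens r n \<Longrightarrow> nrm (sh k l) = sh k (nrm l)"
  by (cases l) (auto simp: nrm_def sh_def Agens_def idx_def)

lemma par_sh: "w \<in> lists (Agens r n) \<Longrightarrow> par (Word (map (sh k) w)) = par (Word w)"
  by (induction w) (auto simp: sh_def ipar_def Agens_def idx_def)

lemma sh_Agens: "l \<in> Agens r n \<Longrightarrow> k + r \<le> m \<Longrightarrow> sh k l \<in> Agens m n"
  by (cases l) (auto simp: sh_def Agens_def idx_def)

lemma map_sh_Agens: "w \<in> lists (Agens r n) \<Longrightarrow> k + r \<le> m \<Longrightarrow> map (sh k) w \<in> lists (Agens m n)"
  using sh_Agens[of _ r n k m] by (induction w) auto

lemma iol_mem: "x \<in> wspan (Agens r n) \<Longrightarrow> k + r \<le> m \<Longrightarrow> iol k x \<in> wspan (Agens m n)"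
  unfolding iol_def
  by (erule lin_mem_vspan) (elim imageE, hypsubst, simp only: mono.case, rule wd_wspan, erule map_sh_Agens, assumption)

text \<open>\<open>rho\<close> depends on rows only through i = j and j < i, which a shift
  preserves, and the shift commutes with normalisation because negative rows move the other
  way.\<close>

lemma iol_NA:
  assumes x: "x \<in> NA r n" and m: "k + r \<le> m"
  shows "iol k x \<in> NA m n"
proof (rule NA_kill[OF vlin_iol ideal_gen_subspace x])
  fix w assume w: "w \<in> lists (Agens r n)"
  have "map (sh k) (map nrm w) = map nrm (map (sh k) w)"
    using w by (induction w) (auto simp: nrm_sh)
  with nrm_mem_NA[OF map_sh_Agens[OF w m], of "[]"]
  show "iol k (wd w) - iol k (wd (map nrm w)) \<in> NA m n"
    by (simp only: iol_wd append_Nil lists.Nil)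
next
  fix i j a b u v
  assume *: "i \<in> {1..int r}" "j \<in> {1..int r}" "a \<in> idx n" "b \<in> idx n" "u \<in> lists (Agens r n)" "v \<in> lists (Agens r n)"
  have "rho (i + int k) (j + int k) a b (\<lambda>z. wd (map (sh k) u @ z @ map (sh k) v)) \<in> NA m n"
    using * m by (intro rho_mem_NA map_sh_Agens) auto
  then show "rho i j a b (\<lambda>z. iol k (wd (u @ z @ v))) \<in> NA m n"
    using * by (simp add: rho_def sh_pos)
qed

lemma iota_cls:
  assumes x: "x \<in> wspan (Agens r n)" and m: "k + r \<le> m"
  shows "iota k m n (cls (A r n) x) = cls (A m n) (iol k x)"
proof -
  have "rep (cls (A r n) x) - x \<in> NA r n"
    using rep_cls[OF palg_qsp[OF palg_A[of r n]], of x] by (simp add: A_rels)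
  from iol_NA[OF this m] have "iol k (rep (cls (A r n) x)) - iol k x \<in> rels (A m n)"
    by (simp add: A_rels vlin_diff[OF vlin_iol])
  then show ?thesis by (simp only: iota_eq cls_eq_iff[OF palg_qsp[OF palg_A]])
qed

lemma iol_kprod:
  assumes "x \<in> wspan G" "y \<in> wspan G"
  shows "iol k (x \<star> y) = iol k x \<star> iol k y"
proof (rule bilinear_ext[OF _ _ _ _ _ assms, where f = "\<lambda>x y. iol k (x \<star> y)" and g = "\<lambda>x y. iol k x \<star> iol k y"], goal_cases)
  case (5 a b)
  then show ?case by auto
qed (intro vlin_comp[OF vlin_iol] vlin_rules vlin_iol)+

lemma crw_sh: "w \<in> lists (Agens r n) \<Longrightarrow> crw (map (sh k) w) b h = crw w b (\<lambda>u w'. h u (map (sh k) w'))"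
proof (induction w arbitrary: h rule: lists.induct)
  case (Cons l w)
  have "0 < fst (nrm l)" using nrm_idx(2)[OF Cons.hyps(1)] by simp
  then show ?case
    using Cons.IH by (cases "nrm l") (simp add: nrm_sh[OF Cons.hyps(1)] sh_pos)
qed simp

text \<open>A passing index changes columns and never looks at rows, so the action commutes with the
  shift.\<close>

lemma lact_iol:
  assumes "x \<in> wspan (Agens r n)"
  shows "lact l (iol k x) = iol k (lact l x)"
proof (rule vlin_ext[OF vlin_comp[OF vlin_lact vlin_iol] vlin_comp[OF vlin_iol vlin_lact] assms])
  fix m assume "m \<in> Word ` lists (Agens r n)"
  then obtain w where m: "m = Word w" "w \<in> lists (Agens r n)" by blast
  have "gop a b (map (sh k) w) = iol k (gop a b w)" for a b
    unfolding gop_def crw_sh[OF m(2)] crw_vlin[OF vlin_iol]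
    by (intro arg_cong[where f = "crw w b"] ext) (simp add: vlin_zero[OF vlin_iol])
  then show "lact l (iol k (mon m)) = iol k (lact l (mon m))"
    by (simp add: m(1) lact_wd Lword_def vlin_scal[OF vlin_iol] par_sh[OF m(2)] del: par.simps)
qed

lemma ua_iol:
  assumes u: "u \<in> wspan (Ugens n)" and x: "x \<in> wspan (Agens r n)"
  shows "ua u (iol k x) = iol k (ua u x)"
proof (rule vlin_ext[OF vlin_ua_left vlin_comp[OF vlin_iol vlin_ua_left] u])
  fix m assume "m \<in> Word ` lists (Ugens n)"
  then obtain ls where m: "m = Word ls" "ls \<in> lists (Ugens n)" by blast
  have "foldr lact ls (iol k x) = iol k (foldr lact ls x)"
    using m(2)
  proof (induction ls)
    case (Cons l ls)
    then show ?case using lact_iol[OF lact_foldr_mem[OF Cons.hyps(2) x]] by simp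
  qed simp
  then show "ua (mon m) (iol k x) = iol k (ua (mon m) x)" by (simp add: m(1) ua_wd)
qed

lemmas A_qsp = palg_qsp[OF palg_A] and A_bas = palg_bas[OF palg_A] and A_carrier = palg_carrier[OF palg_A]
  and A_closed = palg_closed[OF palg_A] and A_mult = palg_mult[OF palg_A]

context
  fixes k r m n :: nat
  assumes m: "k + r \<le> m"
begin

lemma iota_even_linear: "even_linear (A r n) (A m n) (iota k m n)"
proof -
  have l: "lmap (A r n) (A m n) (iota k m n)"
  proof (rule lmap_of_vlin[OF A_qsp A_qsp vlin_iol])
    show "\<And>x. x \<in> bas (A r n) \<Longrightarrow> iol k (mon x) \<in> vspan (bas (A m n))"
      unfolding A_bas by (rule iol_mem[OF _ m]) simp
    show "\<And>x. x \<in> rels (A r n) \<Longrightarrow> iol k x \<in> rels (A m n)" unfolding A_rels by (rule iol_NA[OF _ m])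
    show "\<And>x. x \<in> vspan (bas (A r n)) \<Longrightarrow> iota k m n (cls (A r n) x) = cls (A m n) (iol k x)"
      unfolding A_bas by (rule iota_cls[OF _ m])
  qed
  moreover have "iota k m n \<in> homog (A r n) p \<rightarrow> homog (A m n) p" for p
  proof (rule lmap_homog[OF A_qsp A_qsp l])
    fix t assume t: "t \<in> bas (A r n)" "par t mod 2 = p"
    then obtain w where w: "t = Word w" "w \<in> lists (Agens r n)" unfolding A_bas by blast
    have "Word (map (sh k) w) \<in> bas (A m n)" unfolding A_bas using map_sh_Agens[OF w(2) m] by blast
    from homog_mon[OF A_qsp this] show "iota k m n (cls (A r n) (mon t)) \<in> homog (A m n) p"
      using t(2) iota_cls[OF wd_wspan[OF w(2)] m] par_sh[OF w(2), of k] by (simp add: w(1) del: par.simps)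
  qed
  ultimately show ?thesis by (simp add: even_linear_iff)
qed

lemma iota_lmap: "lmap (A r n) (A m n) (iota k m n)"
  using iota_even_linear by (simp add: even_linear_iff)

lemma iota_mult:
  assumes "x \<in> carrier (A r n)" "y \<in> carrier (A r n)"
  shows "iota k m n (x \<otimes>\<^bsub>A r n\<^esub> y) = iota k m n x \<otimes>\<^bsub>A m n\<^esub> iota k m n y"
  using assms by (elim A_carrier) (simp add: A_mult iota_cls[OF _ m] kprod_wspan iol_kprod[of _ "Agens r n"] iol_mem[OF _ m])

lemma iota_one: "iota k m n \<one>\<^bsub>A r n\<^esub> = \<one>\<^bsub>A m n\<^esub>"
  by (simp add: palg_one[OF palg_A] iota_cls[OF _ m] wd_wspan)

lemma iota_hom: "supermodule_hom n (A r n) (A m n) (iota k m n)"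
  unfolding supermodule_hom_def
proof (intro conjI ballI iota_even_linear)
  fix u x assume "u \<in> carrier (Uq n)" "x \<in> carrier (A r n)"
  then show "iota k m n (act (A r n) u x) = act (A m n) u (iota k m n x)"
    by (elim A_carrier palg_carrier[OF palg_Uq])
      (simp add: A_act iota_cls[OF _ m] ua_mem iol_mem[OF _ m] ua_iol[where n = n and r = r])
qed

end

section \<open>Reordering: the inverse of the gluing map\<close>

lemma cry_add: "cry w b (\<lambda>u e. f u e + g u e) = cry w b f + cry w b g"
  by (induction w arbitrary: b f g) (simp_all add: braid_add)

lemma cry_vlin: "vlin F \<Longrightarrow> F (cry w b f) = cry w b (\<lambda>u e. F (f u e))"
  by (induction w arbitrary: b f) (simp_all add: braid_vlin)

lemma cry_scal: "cry w b (\<lambda>u e. scal c (f u e)) = scal c (cry w b f)"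
  by (rule cry_vlin[symmetric]) (intro vlin_rules)

lemma cry_minus: "cry w b (\<lambda>u e. f u e - g u e) = cry w b f - cry w b g"
  using cry_add[of w b "\<lambda>u e. f u e - g u e" g] by simp

lemma cry_braid: "cry w b (\<lambda>u e. braid p q (\<lambda>x y. F u e x y)) = braid p q (\<lambda>x y. cry w b (\<lambda>u e. F u e x y))"
  by (simp add: braid_def cry_add cry_scal)

lemma rho_cry_commute: "rho i j a b (\<lambda>z. cry w c (\<lambda>u e. F z u e)) = cry w c (\<lambda>u e. rho i j a b (\<lambda>z. F z u e))"
  unfolding rho_def by (simp add: cry_minus cry_scal cry_braid)

lemma cry_append: "cry (x @ y) b h = cry x b (\<lambda>x' k. cry y k (\<lambda>y' e. h (x' @ y') e))"
  by (induction x arbitrary: b h) simp_all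

lemma cry_mem:
  assumes W: "vec.subspace W" and w: "w \<in> lists (Agens r n)" and b: "b \<in> idx n"
    and h: "\<And>w' e. w' \<in> lists (Pgens r n) \<Longrightarrow> e \<in> idx n \<Longrightarrow> h w' e \<in> W"
  shows "cry w b h \<in> W"
  using w b h
proof (induction w arbitrary: b h)
  case Nil
  then show ?case by simp
next
  case (Cons l w)
  show ?case
    unfolding cry.simps
  proof (rule braid_mem[OF W Cons.prems(1) nrm_idx(1)[OF Cons.hyps(1)]], rule Cons.IH, assumption)
    fix x y w' e assume "x \<in> idx n" "w' \<in> lists (Pgens r n)" "e \<in> idx n"
    then show "h ((fst (nrm l), x) # w') e \<in> W"
      using nrm_idx(2)[OF Cons.hyps(1)] by (intro Cons.prems(2)) (auto simp: Pgens_def)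
  qed
qed

text \<open>The mirror image of \<open>rho_crw_two\<close>, with the index travelling rightwards
  through the relator.\<close>

lemma rho_cry_two:
  assumes "0 < i" "0 < j" "a \<noteq> 0" "b \<noteq> 0" "k \<noteq> 0"
  shows "rho i j a b (\<lambda>z. cry z k G) = braid k a (\<lambda>x y. braid y b (\<lambda>z e. rho i j x z (\<lambda>s. G s e)))"
proof -
  have n: "nrm (i, s) = (i, s)" "nrm (j, s) = (j, s)" for s using assms by (auto simp: nrm_def)
  have "braid a b (\<lambda>c d. braid k c (\<lambda>x y. braid y d (\<lambda>z e. G [(j, x), (i, z)] e)))
      = braid k a (\<lambda>x y. braid y b (\<lambda>z w. braid x z (\<lambda>u v. G [(j, u), (i, v)] w)))"
    using assms by (intro braid_relation[symmetric]) auto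
  then show ?thesis
    unfolding rho_def by (simp add: n braid_def vec.scale_right_distrib vec.scale_right_diff_distrib mult_ac)
qed

lemma rho_cry_mem:
  assumes W: "vec.subspace W" and ij: "i \<in> {1..int r}" "j \<in> {1..int r}" and ab: "a \<in> idx n" "b \<in> idx n"
    and uv: "u \<in> lists (Agens r n)" "v \<in> lists (Agens r n)" and e: "e \<in> idx n"
    and H: "\<And>k a b u v. k \<in> idx n \<Longrightarrow> a \<in> idx n \<Longrightarrow> b \<in> idx n \<Longrightarrow> u \<in> lists (Agens r n) \<Longrightarrow> v \<in> lists (Agens r n) \<Longrightarrow>
      rho i j a b (\<lambda>z. H (u @ z @ v) k) \<in> W"
  shows "rho i j a b (\<lambda>z. cry (u @ z @ v) e H) \<in> W"
  unfolding cry_append rho_cry_commute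
proof (rule cry_mem[OF W uv(1) e])
  fix u' k assume k: "k \<in> idx n" and u': "u' \<in> lists (Pgens r n)"
  have *: "rho i j a b (\<lambda>z. cry z k (\<lambda>z' l. cry v l (\<lambda>v' m. H (u' @ z' @ v') m)))
    = braid k a (\<lambda>x y. braid y b (\<lambda>s l. cry v l (\<lambda>v' m. rho i j x s (\<lambda>z'. H (u' @ z' @ v') m))))"
    using ij ab k by (subst rho_cry_two) (auto simp: rho_cry_commute dest: idx_nonzero)
  show "rho i j a b (\<lambda>z. cry z k (\<lambda>z' l. cry v l (\<lambda>v' m. H (u' @ z' @ v') m))) \<in> W"
    unfolding *
  proof (rule braid_mem[OF W k ab(1)])
    fix x y assume x: "x \<in> idx n" "y \<in> idx n"
    show "braid y b (\<lambda>s l. cry v l (\<lambda>v' m. rho i j x s (\<lambda>z'. H (u' @ z' @ v') m))) \<in> W"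
    proof (rule braid_mem[OF W x(2) ab(2)])
      fix s l assume s: "s \<in> idx n" "l \<in> idx n"
      show "cry v l (\<lambda>v' m. rho i j x s (\<lambda>z'. H (u' @ z' @ v') m)) \<in> W"
      proof (rule cry_mem[OF W uv(2) s(2)])
        fix v' m assume "v' \<in> lists (Pgens r n)" "m \<in> idx n"
        then show "rho i j x s (\<lambda>z'. H (u' @ z' @ v') m) \<in> W"
          by (intro H x s lists_Pgens_Agens u')
      qed
    qed
  qed
qed

text \<open>Two indices may be braided before or after they pass a word, by one braid relation per
  letter. Two letters with small rows can thus be moved past the left tensor factor one by one and
  still satisfy their relator.\<close>

lemma cry_cry_braid:
  assumes "w \<in> lists (Agens r n)" "a \<in> idx n" "b \<in> idx n"
  shows "braid a b (\<lambda>c d. cry w d (\<lambda>w' d'. cry w' c (\<lambda>w'' c'. H w'' c' d')))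
    = cry w b (\<lambda>w' e'. cry w' a (\<lambda>w'' e. braid e e' (\<lambda>c d. H w'' c d)))"
  using assms
proof (induction w arbitrary: a b H rule: lists.induct)
  case Nil
  show ?case by simp
next
  case (Cons l w)
  obtain i p where l: "nrm l = (i, p)" by force
  have i: "i \<in> {1..int r}" "p \<in> idx n" using nrm_idx[OF Cons.hyps(1)] l by auto
  then have n: "nrm (i, s) = (i, s)" for s by (auto simp: nrm_def)
  note ab = Cons.prems
  have "braid a b (\<lambda>c d. cry (l # w) d (\<lambda>w' d'. cry w' c (\<lambda>w'' c'. H w'' c' d')))
    = braid a b (\<lambda>c d. braid d p (\<lambda>x y. braid c x (\<lambda>x' z. cry w y (\<lambda>w' d'. cry w' z (\<lambda>w'' c'. H ((i, x') # w'') c' d')))))"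
    by (simp add: l n cry_braid)
  also have "\<dots> = braid b p (\<lambda>x y. braid a x (\<lambda>x' z. braid z y (\<lambda>u v. cry w v (\<lambda>w' d'. cry w' u (\<lambda>w'' c'. H ((i, x') # w'') c' d')))))"
    using ab i(2) by (intro braid_relation) (auto dest: idx_nonzero)
  also have "\<dots> = braid b p (\<lambda>x y. braid a x (\<lambda>x' z. cry w y (\<lambda>w' e'. cry w' z (\<lambda>w'' e. braid e e' (\<lambda>c d. H ((i, x') # w'') c d)))))"
    using ab i(2) by (intro braid_cong[where n = n] Cons.IH)
  also have "\<dots> = cry (l # w) b (\<lambda>w' e'. cry w' a (\<lambda>w'' e. braid e e' (\<lambda>c d. H w'' c d)))"
    by (simp add: l n cry_braid)
  finally show ?case .
qed

text \<open>In A_{r+k,n} the rows above k belong to the left factor, shifted by k; hence the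
  comparison with k and the subtraction.\<close>

definition dw :: "nat \<Rightarrow> int \<times> int \<Rightarrow> (int \<times> int) list \<Rightarrow> (int \<times> int) list \<Rightarrow> vec" where
  "dw k l w v = (if int k < fst (nrm l) then mon (Tens (Word ((fst (nrm l) - int k, snd (nrm l)) # w)) (Word v))
     else cry w (snd (nrm l)) (\<lambda>w' e. mon (Tens (Word w') (Word ((fst (nrm l), e) # v)))))"

text \<open>
  The action of the generator \<open>l\<close> of $A_{r+k,n}$ on $A_{r,n}\otimes A_{k,n}$: generators with large row index
  multiply from the left, the others are first moved past the left tensor factor.
\<close>

definition dl :: "nat \<Rightarrow> int \<times> int \<Rightarrow> vec \<Rightarrow> vec" where
  "dl k l = lin (tcase (\<lambda>m1 m2. wcase (\<lambda>w. wcase (\<lambda>v. dw k l w v) m2) m1))"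

lemma vlin_dl: "vlin (dl k l)"
  unfolding dl_def by (rule vlin_lin)

lemma dl_mon: "dl k l (mon (Tens (Word w) (Word v))) = dw k l w v"
  by (simp add: dl_def)

lemma vlin_foldr_dl: "vlin (foldr (dl k) ws)"
proof (induction ws)
  case (Cons l ls)
  show ?case using vlin_comp[OF vlin_dl Cons.IH] by (simp add: comp_def)
qed (simp add: id_def vlin_intros)

abbreviation NT :: "nat \<Rightarrow> nat \<Rightarrow> nat \<Rightarrow> vec set" where
  "NT r k n \<equiv> trels (A r n) (A k n)"

abbreviation TM :: "nat \<Rightarrow> nat \<Rightarrow> nat \<Rightarrow> mono set" where
  "TM r k n \<equiv> tbas (A r n) (A k n)"

lemma NT_subspace: "vec.subspace (NT r k n)"
  by (simp add: trels_def vec.subspace_span)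

lemma NT_left: "x \<in> NA r n \<Longrightarrow> y \<in> wspan (Agens k n) \<Longrightarrow> x \<boxtimes> y \<in> NT r k n"
  unfolding trels_def A_rels A_bas by (rule vec.span_base) blast

lemma NT_right: "x \<in> wspan (Agens r n) \<Longrightarrow> y \<in> NA k n \<Longrightarrow> x \<boxtimes> y \<in> NT r k n"
  unfolding trels_def A_rels A_bas by (rule vec.span_base) blast

lemma TM_iff: "Tens (Word w) (Word v) \<in> TM r k n \<longleftrightarrow> w \<in> lists (Agens r n) \<and> v \<in> lists (Agens k n)"
  unfolding Tens_tbas A_bas by blast

lemma TM_E:
  assumes "m \<in> TM r k n"
  obtains w v where "m = Tens (Word w) (Word v)" "w \<in> lists (Agens r n)" "v \<in> lists (Agens k n)"
  using assms unfolding tbas_def A_bas by blast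

lemma letter_cases:
  assumes "l \<in> Agens (r + k) n"
  shows "int k < fst (nrm l) \<Longrightarrow> (fst (nrm l) - int k, snd (nrm l)) \<in> Pgens r n"
    and "\<not> int k < fst (nrm l) \<Longrightarrow> e \<in> idx n \<Longrightarrow> (fst (nrm l), e) \<in> Pgens k n"
  using nrm_idx[OF assms] by (auto simp: Pgens_def)

lemma dw_mem:
  assumes l: "l \<in> Agens (r + k) n" and w: "w \<in> lists (Agens r n)" and v: "v \<in> lists (Agens k n)"
  shows "dw k l w v \<in> vspan (TM r k n)"
proof (cases "int k < fst (nrm l)")
  case True
  then show ?thesis
    using Pgens_Agens[OF letter_cases(1)[OF l True]] w v unfolding dw_def
    by (auto intro!: mon_in_vspan simp: TM_iff simp del: in_lists_conv_set Tens_tbas)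
next
  case False
  have "cry w (snd (nrm l)) (\<lambda>w' e. mon (Tens (Word w') (Word ((fst (nrm l), e) # v)))) \<in> vspan (TM r k n)"
  proof (rule cry_mem[OF vec.subspace_span w nrm_idx(1)[OF l]])
    fix w' e assume w': "w' \<in> lists (Pgens r n)" and e: "e \<in> idx n"
    show "mon (Tens (Word w') (Word ((fst (nrm l), e) # v))) \<in> vspan (TM r k n)"
      using lists_Pgens_Agens[OF w'] Pgens_Agens[OF letter_cases(2)[OF l False e]] v
      by (intro mon_in_vspan) (simp only: TM_iff Cons_in_lists_iff simp_thms)
  qed
  then show ?thesis using False by (simp add: dw_def)
qed

lemma dl_mem:
  assumes "l \<in> Agens (r + k) n" "z \<in> vspan (TM r k n)"
  shows "dl k l z \<in> vspan (TM r k n)"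
  by (rule vlin_span_mem[OF vlin_dl vec.subspace_span assms(2)])
    (elim imageE TM_E, hypsubst, simp only: dl_mon, rule dw_mem[OF assms(1)])

lemma foldr_dl_mem:
  assumes "ws \<in> lists (Agens (r + k) n)" "z \<in> vspan (TM r k n)"
  shows "foldr (dl k) ws z \<in> vspan (TM r k n)"
  using assms(1) by (induction ws) (simp_all add: assms(2) dl_mem)

text \<open>Relators sit in the left or right factor, and the letter has a large or a small row. A
  small letter passing a relator of the left factor is handled by \<open>rho_cry_mem\<close>; in the
  other cases a letter is put in front of a relator and the ideal absorbs it, or the relator is not
  touched.\<close>

lemma dl_NT:
  assumes l: "l \<in> Agens (r + k) n" and z: "z \<in> NT r k n"
  shows "dl k l z \<in> NT r k n"
  using z unfolding trels_def[of "A r n"]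
proof (rule vlin_span_mem[OF vlin_dl NT_subspace[unfolded trels_def]], fold trels_def)
  fix t
  assume "t \<in> {x \<boxtimes> y |x y. x \<in> rels (A r n) \<and> y \<in> vspan (bas (A k n))} \<union> {x \<boxtimes> y |x y. x \<in> vspan (bas (A r n)) \<and> y \<in> rels (A k n)}"
  then consider x y where "t = x \<boxtimes> y" "x \<in> NA r n" "y \<in> wspan (Agens k n)"
    | x y where "t = x \<boxtimes> y" "x \<in> wspan (Agens r n)" "y \<in> NA k n"
    unfolding A_rels A_bas by blast
  then show "dl k l t \<in> NT r k n"
  proof cases
    case 1
    have "dl k l (x \<boxtimes> wd v) \<in> NT r k n" if v: "v \<in> lists (Agens k n)" for v
    proof (rule NA_kill[OF vlin_comp[OF vlin_dl vtens_l] NT_subspace 1(2)])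
      fix w assume w: "w \<in> lists (Agens r n)"
      show "dl k l (wd w \<boxtimes> wd v) - dl k l (wd (map nrm w) \<boxtimes> wd v) \<in> NT r k n"
      proof (cases "int k < fst (nrm l)")
        case True
        let ?l = "(fst (nrm l) - int k, snd (nrm l))"
        have "[?l] \<in> lists (Agens r n)" using Pgens_Agens[OF letter_cases(1)[OF l True]] by simp
        from NT_left[OF nrm_mem_NA[OF w this] wd_wspan[OF v]] show ?thesis
          using True by (simp add: dl_mon dw_def vtens_simps)
      next
        case False
        then show ?thesis by (simp add: dl_mon dw_def cry_nrm vec.subspace_0[OF NT_subspace])
      qed
    next
      fix i j a b u u'
      assume *: "i \<in> {1..int r}" "j \<in> {1..int r}" "a \<in> idx n" "b \<in> idx n" "u \<in> lists (Agens r n)" "u' \<in> lists (Agens r n)"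
      show "rho i j a b (\<lambda>z. dl k l (wd (u @ z @ u') \<boxtimes> wd v)) \<in> NT r k n"
      proof (cases "int k < fst (nrm l)")
        case True
        let ?l = "(fst (nrm l) - int k, snd (nrm l))"
        have "?l # u \<in> lists (Agens r n)" using Pgens_Agens[OF letter_cases(1)[OF l True]] *(5) by simp
        from NT_left[OF rho_mem_NA[OF *(1-4) this *(6)] wd_wspan[OF v]] show ?thesis
          using True by (simp add: dl_mon dw_def rho_vlin[OF vtens_l])
      next
        case False
        have "rho i j a b (\<lambda>z. cry (u @ z @ u') (snd (nrm l)) (\<lambda>w' e. mon (Tens (Word w') (Word ((fst (nrm l), e) # v))))) \<in> NT r k n"
        proof (rule rho_cry_mem[OF NT_subspace * nrm_idx(1)[OF l]])
          fix e a b u u'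
          assume **: "e \<in> idx n" "a \<in> idx n" "b \<in> idx n" "u \<in> lists (Agens r n)" "u' \<in> lists (Agens r n)"
          have "(fst (nrm l), e) # v \<in> lists (Agens k n)" using Pgens_Agens[OF letter_cases(2)[OF l False **(1)]] v by simp
          from NT_left[OF rho_mem_NA[OF *(1,2) **(2-5)] wd_wspan[OF this]]
          show "rho i j a b (\<lambda>z. mon (Tens (Word (u @ z @ u')) (Word ((fst (nrm l), e) # v)))) \<in> NT r k n"
            by (simp add: rho_vlin[OF vtens_l])
        qed
        then show ?thesis using False by (simp add: dl_mon dw_def)
      qed
    qed
    note word = this
    show ?thesis
      unfolding 1(1) by (rule vspan_wordE[OF vlin_comp[OF vlin_dl vtens_r] NT_subspace 1(3)]) (use word in \<open>auto simp del: in_lists_conv_set\<close>)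
  next
    case 2
    have word: "dl k l (wd w \<boxtimes> y) \<in> NT r k n" if w: "w \<in> lists (Agens r n)" for w
    proof (cases "int k < fst (nrm l)")
      case True
      let ?l = "(fst (nrm l) - int k, snd (nrm l))"
      have lw: "?l # w \<in> lists (Agens r n)" using Pgens_Agens[OF letter_cases(1)[OF l True]] w by simp
      have "dl k l (wd w \<boxtimes> y) = wd (?l # w) \<boxtimes> y"
        by (rule vlin_ext[OF vlin_comp[OF vlin_dl vtens_r] vtens_r subsetD[OF ideal_gen_wspan[OF homog_Arels] 2(3)]])
          (use True in \<open>auto simp: dl_mon dw_def\<close>)
      then show ?thesis using NT_right[OF wd_wspan[OF lw] 2(3)] by simp
    next
      case False
      let ?h = "\<lambda>y w' e. wd w' \<boxtimes> (wd [(fst (nrm l), e)] \<star> y)"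
      have "vlin (\<lambda>y. cry w (snd (nrm l)) (?h y))"
        by (simp add: vlin_def kprod_simps vtens_simps cry_add cry_scal)
      then have "dl k l (wd w \<boxtimes> y) = cry w (snd (nrm l)) (?h y)"
        by (rule vlin_ext[where f = "\<lambda>y. dl k l (wd w \<boxtimes> y)", OF vlin_comp[OF vlin_dl vtens_r] _ subsetD[OF ideal_gen_wspan[OF homog_Arels] 2(3)]])
          (use False in \<open>auto simp: dl_mon dw_def\<close>)
      also have "\<dots> \<in> NT r k n"
      proof (rule cry_mem[OF NT_subspace w nrm_idx(1)[OF l]])
        fix w' e assume w': "w' \<in> lists (Pgens r n)" and e: "e \<in> idx n"
        have "[(fst (nrm l), e)] \<in> lists (Agens k n)" using Pgens_Agens[OF letter_cases(2)[OF l False e]] by simp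
        then show "?h y w' e \<in> NT r k n"
          by (intro NT_right wd_wspan lists_Pgens_Agens[OF w'] ideal_gen_left[OF homog_Arels 2(3)])
      qed
      finally show ?thesis .
    qed
    show ?thesis
      unfolding 2(1) by (rule vspan_wordE[OF vlin_comp[OF vlin_dl vtens_l] NT_subspace 2(2)]) (use word in \<open>auto simp del: in_lists_conv_set\<close>)
  qed
qed

lemma foldr_dl_NT:
  assumes "ws \<in> lists (Agens (r + k) n)" "z \<in> NT r k n"
  shows "foldr (dl k) ws z \<in> NT r k n"
  using assms(1) by (induction ws) (simp_all add: assms(2) dl_NT)

lemma foldr_dl_nrm: "foldr (dl k) (map nrm ws) z = foldr (dl k) ws z"
proof (induction ws)
  case (Cons l ws)
  have "nrm (nrm l) = nrm l" by (auto simp: nrm_def)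
  then have "dl k (nrm l) = dl k l" unfolding dl_def dw_def by (simp only:)
  then show ?case using Cons.IH by simp
qed simp

text \<open>Both rows large: a relator of the left factor. Both small: \<open>cry_cry_braid\<close>
  turns it into relators of the right factor. Row i small and j large: the relation is the very rule
  by which a small letter passes a large one. Row i large and j small: that rule is applied under
  one further braiding, and the Hecke relation evaluates the square.\<close>

lemma dl_relation_word:
  assumes ij: "i \<in> {1..int (r + k)}" "j \<in> {1..int (r + k)}" and ab: "a \<in> idx n" "b \<in> idx n"
    and w: "w \<in> lists (Agens r n)" and v: "v \<in> lists (Agens k n)"
  shows "rho i j a b (\<lambda>x. foldr (dl k) x (mon (Tens (Word w) (Word v)))) \<in> NT r k n"
proof -
  let ?z = "mon (Tens (Word w) (Word v))"
  have n: "nrm (i, c) = (i, c)" "nrm (j, c) = (j, c)" for c using ij by (auto simp: nrm_def)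
  have nn: "nrm (i - int k, c) = (i - int k, c)" if "int k < i" for i c using that by (auto simp: nrm_def)
  have hi: "dl k (i', c) (mon (Tens (Word w) (Word v))) = mon (Tens (Word ((i' - int k, c) # w)) (Word v))"
    if "int k < i'" "i' \<in> {i, j}" for i' c w v using that n by (auto simp: dl_mon dw_def)
  have lo: "dl k (i', c) (mon (Tens (Word w) (Word v))) = cry w c (\<lambda>w' e. mon (Tens (Word w') (Word ((i', e) # v))))"
    if "\<not> int k < i'" "i' \<in> {i, j}" for i' c w v using that n by (auto simp: dl_mon dw_def)
  have lolo: "dl k (i', c) (dl k (j', d) ?z) = cry w d (\<lambda>w' e'. cry w' c (\<lambda>w'' e. mon (Tens (Word w'') (Word ([(i', e), (j', e')] @ v)))))"
    if "\<not> int k < i'" "\<not> int k < j'" "i' \<in> {i, j}" "j' \<in> {i, j}" for i' j' c d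
    using that by (simp add: lo cry_vlin[OF vlin_dl])
  consider "int k < i" "int k < j" | "\<not> int k < i" "\<not> int k < j" | "\<not> int k < i" "int k < j" | "int k < i" "\<not> int k < j" by blast
  then show ?thesis
  proof cases
    case 1
    have "rho (i - int k) (j - int k) a b (\<lambda>x. wd ([] @ x @ w)) \<in> NA r n"
      using 1 ij ab w by (intro rho_mem_NA) auto
    from NT_left[OF this wd_wspan[OF v]]
    have "rho (i - int k) (j - int k) a b (\<lambda>x. wd ([] @ x @ w) \<boxtimes> wd v) \<in> NT r k n"
      by (simp only: rho_vlin[OF vtens_l])
    moreover have "rho i j a b (\<lambda>x. foldr (dl k) x ?z) = rho (i - int k) (j - int k) a b (\<lambda>x. wd ([] @ x @ w) \<boxtimes> wd v)"
      using 1 by (simp add: rho_def hi)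
    ultimately show ?thesis by (simp only:)
  next
    case 2
    have "rho i j a b (\<lambda>x. foldr (dl k) x ?z)
      = cry w b (\<lambda>w' e'. cry w' a (\<lambda>w'' e. rho i j e e' (\<lambda>x. mon (Tens (Word w'') (Word (x @ v))))))"
      using 2 cry_cry_braid[OF w ab] by (simp add: rho_def lolo cry_minus cry_scal)
    also have "\<dots> \<in> NT r k n"
    proof (rule cry_mem[OF NT_subspace w ab(2)])
      fix w' e' assume w': "w' \<in> lists (Pgens r n)" and e': "e' \<in> idx n"
      show "cry w' a (\<lambda>w'' e. rho i j e e' (\<lambda>x. mon (Tens (Word w'') (Word (x @ v))))) \<in> NT r k n"
      proof (rule cry_mem[OF NT_subspace lists_Pgens_Agens[OF w'] ab(1)])
        fix w'' e assume w'': "w'' \<in> lists (Pgens r n)" and e: "e \<in> idx n"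
        have "rho i j e e' (\<lambda>x. wd ([] @ x @ v)) \<in> NA k n"
          using 2 ij e e' v by (intro rho_mem_NA) auto
        from NT_right[OF wd_wspan[OF lists_Pgens_Agens[OF w'']] this]
        show "rho i j e e' (\<lambda>x. mon (Tens (Word w'') (Word (x @ v)))) \<in> NT r k n"
          by (simp add: rho_vlin[OF vtens_r])
      qed
    qed
    finally show ?thesis .
  next
    case 3
    then have "rho i j a b (\<lambda>x. foldr (dl k) x ?z) = 0"
      by (simp add: rho_def hi lo nn cry_vlin[OF vlin_dl])
    then show ?thesis by (simp add: vec.subspace_0[OF NT_subspace])
  next
    case 4
    have "a \<noteq> 0" "b \<noteq> 0" using ab by (auto dest: idx_nonzero)
    from braid_hecke[OF this, of "\<lambda>e f. cry w f (\<lambda>w' g. mon (Tens (Word ((i - int k, e) # w')) (Word ((j, g) # v))))"]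
    have "rho i j a b (\<lambda>x. foldr (dl k) x ?z) = 0"
      using 4 by (simp add: rho_def hi lo nn cry_vlin[OF vlin_dl])
    then show ?thesis by (simp add: vec.subspace_0[OF NT_subspace])
  qed
qed

section \<open>Mutually inverse maps between the coordinate superalgebra and the tensor
  product\<close>

abbreviation z0 :: vec where
  "z0 \<equiv> mon (Tens (Word []) (Word []))"

definition DD :: "nat \<Rightarrow> vec \<Rightarrow> vec" where
  "DD k = lin (wcase (\<lambda>ws. foldr (dl k) ws z0))"

lemma rho_add: "rho i j a b (\<lambda>x. F x + G x) = rho i j a b F + rho i j a b G"
  by (simp add: rho_def braid_add vec.scale_right_distrib)

lemma rho_scal: "rho i j a b (\<lambda>x. scal c (F x)) = scal c (rho i j a b F)"
  by (rule rho_vlin[symmetric]) (intro vlin_rules)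

lemma z0_TM: "z0 \<in> vspan (TM r k n)"
  by (intro mon_in_vspan) (simp only: TM_iff lists.Nil simp_thms)

lemma dl_relation:
  assumes ij: "i \<in> {1..int (r + k)}" "j \<in> {1..int (r + k)}" and ab: "a \<in> idx n" "b \<in> idx n" and z: "z \<in> vspan (TM r k n)"
  shows "rho i j a b (\<lambda>x. foldr (dl k) x z) \<in> NT r k n"
proof (rule vlin_span_mem[OF _ NT_subspace z])
  show "vlin (\<lambda>z. rho i j a b (\<lambda>x. foldr (dl k) x z))"
    by (simp add: vlin_def vlin_add[OF vlin_foldr_dl] vlin_scal[OF vlin_foldr_dl] rho_add rho_scal)
  fix t assume "t \<in> mon ` TM r k n"
  then show "rho i j a b (\<lambda>x. foldr (dl k) x t) \<in> NT r k n"
    by (elim imageE TM_E) (simp only: dl_relation_word[OF ij ab])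
qed

lemma DD_NA:
  assumes x: "x \<in> NA (r + k) n"
  shows "DD k x \<in> NT r k n"
  unfolding DD_def
proof (rule NA_kill[OF vlin_lin NT_subspace x])
  fix w
  show "lin (wcase (\<lambda>ws. foldr (dl k) ws z0)) (wd w) - lin (wcase (\<lambda>ws. foldr (dl k) ws z0)) (wd (map nrm w)) \<in> NT r k n"
    by (simp only: lin_mon mono.case foldr_dl_nrm diff_self vec.subspace_0[OF NT_subspace])
next
  fix i j a b u v
  assume *: "i \<in> {1..int (r + k)}" "j \<in> {1..int (r + k)}" "a \<in> idx n" "b \<in> idx n" "u \<in> lists (Agens (r + k) n)" "v \<in> lists (Agens (r + k) n)"
  have "foldr (dl k) u (rho i j a b (\<lambda>x. foldr (dl k) x (foldr (dl k) v z0))) \<in> NT r k n"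
    by (intro foldr_dl_NT dl_relation foldr_dl_mem z0_TM *)
  then show "rho i j a b (\<lambda>z. lin (wcase (\<lambda>ws. foldr (dl k) ws z0)) (wd (u @ z @ v))) \<in> NT r k n"
    by (simp only: lin_mon mono.case foldr_append rho_vlin[OF vlin_foldr_dl] o_apply)
qed

lemma foldr_dl_words:
  assumes "w \<in> lists (Agens r n)" "v \<in> lists (Agens k n)"
  shows "foldr (dl k) (map (sh k) w @ v) z0 = mon (Tens (Word (map nrm w)) (Word (map nrm v)))"
proof -
  have "foldr (dl k) v z0 = mon (Tens (Word []) (Word (map nrm v)))"
    using assms(2)
  proof (induction v)
    case (Cons l v)
    have "\<not> int k < fst (nrm l)" using nrm_idx(2)[OF Cons.hyps(1)] by simp
    then show ?case using Cons.IH by (simp add: dl_mon dw_def)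
  qed simp
  moreover have "foldr (dl k) (map (sh k) w) (mon (Tens (Word []) (Word (map nrm v)))) = mon (Tens (Word (map nrm w)) (Word (map nrm v)))"
    using assms(1)
  proof (induction w)
    case (Cons l w)
    obtain i a where l: "nrm l = (i, a)" by force
    have "0 < i" using nrm_idx(2)[OF Cons.hyps(1)] l by simp
    then have "nrm (sh k l) = (i + int k, a)" by (simp add: nrm_sh[OF Cons.hyps(1)] l sh_pos)
    then show ?case using Cons.IH \<open>0 < i\<close> by (simp add: dl_mon dw_def l)
  qed simp
  ultimately show ?thesis by simp
qed

text \<open>The gluing map on representatives, see \<open>glue_cls\<close>.\<close>

definition Gv :: "nat \<Rightarrow> vec \<Rightarrow> vec" where
  "Gv k = lin (tcase (\<lambda>m1 m2. iol k (mon m1) \<star> mon m2))"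

lemma vlin_Gv: "vlin (Gv k)"
  unfolding Gv_def by (rule vlin_lin)

lemma Gv_mon: "Gv k (mon (Tens (Word w) (Word v))) = wd (map (sh k) w @ v)"
  by (simp add: Gv_def)

lemma letter_nrm_NA:
  assumes "l \<in> Agens r n" "u \<in> lists (Agens r n)" "v \<in> lists (Agens r n)"
  shows "wd (u @ [l] @ v) - wd (u @ [nrm l] @ v) \<in> NA r n"
proof -
  obtain i a where l: "l = (i, a)" by force
  then have "i \<in> idx r" "a \<in> idx n" using assms(1) by (auto simp: Agens_def)
  then show ?thesis
    using gen_swap_mem_NA[of i r a n u v] assms(2,3) l
    by (simp add: nrm_def vec.subspace_0[OF ideal_gen_subspace])
qed

lemma Agens_mono: "w \<in> lists (Agens k n) \<Longrightarrow> k \<le> m \<Longrightarrow> w \<in> lists (Agens m n)"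
  using lists_mono[of "Agens k n" "Agens m n"] by (auto simp: Agens_def idx_def)

text \<open>For a small row j and a large row i + k the relator equates small times large with the
  braided combination of large times small. Applied along \<open>w\<close>, it carries the small
  letter to the right end while the indices follow \<open>cry\<close>.\<close>

lemma straighten:
  assumes "w \<in> lists (Agens r n)" "b \<in> idx n" "j \<in> {1..int k}" "u \<in> lists (Agens (r + k) n)" "v \<in> lists (Agens (r + k) n)"
  shows "cry w b (\<lambda>w' e. wd (u @ map (sh k) w' @ [(j, e)] @ v)) - wd (u @ [(j, b)] @ map (sh k) w @ v) \<in> NA (r + k) n"
  using assms
proof (induction w arbitrary: b u rule: lists.induct)
  case Nil
  then show ?case by (simp add: vec.subspace_0[OF ideal_gen_subspace])
next
  case (Cons l w)
  let ?N = "NA (r + k) n"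
  obtain i p where l: "nrm l = (i, p)" by force
  have i: "i \<in> {1..int r}" "p \<in> idx n" using nrm_idx[OF Cons.hyps(1)] l by auto
  let ?W = "map (sh k) w"
  have sw: "?W \<in> lists (Agens (r + k) n)" by (rule map_sh_Agens[OF Cons.hyps(2)]) simp
  have ik: "i + int k \<in> {1..int (r + k)}" "j \<in> {1..int (r + k)}" using i Cons.prems by auto
  have 1: "braid b p (\<lambda>c d. cry w d (\<lambda>w' e. wd ((u @ [(i + int k, c)]) @ map (sh k) w' @ [(j, e)] @ v))
     - wd ((u @ [(i + int k, c)]) @ [(j, d)] @ ?W @ v)) \<in> ?N"
  proof (rule braid_mem[OF ideal_gen_subspace Cons.prems(1) i(2)])
    fix c d assume c: "c \<in> idx n" "d \<in> idx n"
    have "u @ [(i + int k, c)] \<in> lists (Agens (r + k) n)"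
      using Cons.prems(3) c ik idx_positive by (auto simp: Agens_def)
    then show "cry w d (\<lambda>w' e. wd ((u @ [(i + int k, c)]) @ map (sh k) w' @ [(j, e)] @ v)) - wd ((u @ [(i + int k, c)]) @ [(j, d)] @ ?W @ v) \<in> ?N"
      by (rule Cons.IH[OF c(2) Cons.prems(2) _ Cons.prems(4)])
  qed
  have 2: "rho j (i + int k) b p (\<lambda>z. wd (u @ z @ ?W @ v)) \<in> ?N"
    using sw Cons.prems i ik by (intro rho_mem_NA) auto
  have lA: "sh k l \<in> Agens (r + k) n" by (rule sh_Agens[OF Cons.hyps(1)]) simp
  have nl: "nrm (sh k l) = (i + int k, p)" using i by (simp add: nrm_sh[OF Cons.hyps(1)] l sh_pos)
  have uj: "u @ [(j, b)] \<in> lists (Agens (r + k) n)"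
    using Cons.prems ik idx_positive by (auto simp: Agens_def)
  have Wv: "?W @ v \<in> lists (Agens (r + k) n)" using sw Cons.prems(4) by simp
  have 3: "wd ((u @ [(j, b)]) @ [sh k l] @ (?W @ v)) - wd ((u @ [(j, b)]) @ [(i + int k, p)] @ (?W @ v)) \<in> ?N"
    using letter_nrm_NA[OF lA uj Wv] by (simp only: nl)
  let ?B = "braid b p (\<lambda>c d. wd (u @ [(i + int k, c), (j, d)] @ ?W @ v))"
  have e1: "cry (l # w) b (\<lambda>w' e. wd (u @ map (sh k) w' @ [(j, e)] @ v))
     = braid b p (\<lambda>c d. cry w d (\<lambda>w' e. wd ((u @ [(i + int k, c)]) @ map (sh k) w' @ [(j, e)] @ v)))"
    using i by (simp add: l sh_pos)
  have e2: "braid b p (\<lambda>c d. cry w d (\<lambda>w' e. wd ((u @ [(i + int k, c)]) @ map (sh k) w' @ [(j, e)] @ v))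
     - wd ((u @ [(i + int k, c)]) @ [(j, d)] @ ?W @ v))
     = cry (l # w) b (\<lambda>w' e. wd (u @ map (sh k) w' @ [(j, e)] @ v)) - ?B"
    unfolding e1 by (simp add: braid_def vec.scale_right_diff_distrib)
  have e3: "rho j (i + int k) b p (\<lambda>z. wd (u @ z @ ?W @ v)) = ?B - wd (u @ [(j, b), (i + int k, p)] @ ?W @ v)"
    using Cons.prems(2) i by (simp add: rho_def)
  \<comment> \<open>\<open>1\<close> treats the rest of the word, \<open>2\<close> is the exchange
    with its first letter, and \<open>3\<close> normalises that letter.\<close>
  from vec.subspace_diff[OF ideal_gen_subspace vec.subspace_add[OF ideal_gen_subspace 1[unfolded e2] 2[unfolded e3]] 3]
  show ?case by simp
qed

text \<open>A large letter is simply put in front, and a small one is moved past the left word by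
  \<open>straighten\<close>. Thus \<open>Gv\<close> intertwines \<open>dl\<close> with left
  multiplication, and \<open>Gv_DD\<close> follows by induction on the word.\<close>

lemma Gv_dl:
  assumes l: "l \<in> Agens (r + k) n" and z: "z \<in> vspan (TM r k n)"
  shows "Gv k (dl k l z) - wd [l] \<star> Gv k z \<in> NA (r + k) n"
proof (rule vlin_span_mem[OF vlin_intros(4)[OF vlin_comp[OF vlin_Gv vlin_dl] vlin_comp[OF kprod_r vlin_Gv]] ideal_gen_subspace z])
  fix t assume "t \<in> mon ` TM r k n"
  then obtain w v where t: "t = mon (Tens (Word w) (Word v))" "w \<in> lists (Agens r n)" "v \<in> lists (Agens k n)"
    by (elim imageE TM_E) blast
  let ?N = "NA (r + k) n"
  obtain i a where il: "nrm l = (i, a)" by force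
  have i: "i \<in> {1..int (r + k)}" "a \<in> idx n" using nrm_idx[OF l] il by auto
  have sw: "map (sh k) w \<in> lists (Agens (r + k) n)" by (rule map_sh_Agens[OF t(2)]) simp
  have v: "v \<in> lists (Agens (r + k) n)" by (rule Agens_mono[OF t(3)]) simp
  have swv: "map (sh k) w @ v \<in> lists (Agens (r + k) n)" using sw v by simp
  have n: "wd [l] \<star> Gv k t - wd ((i, a) # map (sh k) w @ v) \<in> ?N"
    using letter_nrm_NA[OF l _ swv, of "[]"] by (simp add: t(1) Gv_mon il)
  show "Gv k (dl k l t) - wd [l] \<star> Gv k t \<in> ?N"
  proof (cases "int k < i")
    case True
    then have "Gv k (dl k l t) = wd ((i, a) # map (sh k) w @ v)"
      by (simp add: t(1) dl_mon dw_def il Gv_mon sh_pos)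
    then show ?thesis using vec.subspace_neg[OF ideal_gen_subspace n] by simp
  next
    case False
    then have "Gv k (dl k l t) = cry w a (\<lambda>w' e. wd ([] @ map (sh k) w' @ [(i, e)] @ v))"
      by (simp add: t(1) dl_mon dw_def il cry_vlin[OF vlin_Gv] Gv_mon)
    moreover have "cry w a (\<lambda>w' e. wd ([] @ map (sh k) w' @ [(i, e)] @ v)) - wd ([] @ [(i, a)] @ map (sh k) w @ v) \<in> ?N"
      using False i v by (intro straighten t) auto
    ultimately have "Gv k (dl k l t) - wd ((i, a) # map (sh k) w @ v) \<in> ?N" by simp
    from vec.subspace_diff[OF ideal_gen_subspace this n] show ?thesis by simp
  qed
qed

lemma Gv_DD:
  assumes x: "x \<in> wspan (Agens (r + k) n)"
  shows "Gv k (DD k x) - x \<in> NA (r + k) n"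
proof (rule vspan_wordE[OF vlin_intros(4)[OF vlin_comp[OF vlin_Gv] vlin_intros(1)] ideal_gen_subspace x])
  show "vlin (DD k)" unfolding DD_def by (rule vlin_lin)
  fix ws assume "Word ws \<in> Word ` lists (Agens (r + k) n)"
  then have ws: "ws \<in> lists (Agens (r + k) n)" by blast
  have "Gv k (foldr (dl k) ws z0) - wd ws \<in> NA (r + k) n"
    using ws
  proof (induction ws)
    case Nil
    show ?case by (simp add: Gv_mon vec.subspace_0[OF ideal_gen_subspace])
  next
    case (Cons l ws)
    have l: "wd [l] \<in> wspan (Agens (r + k) n)" using Cons.hyps by (intro wd_wspan) simp
    have "(Gv k (dl k l (foldr (dl k) ws z0)) - wd [l] \<star> Gv k (foldr (dl k) ws z0)) + wd [l] \<star> (Gv k (foldr (dl k) ws z0) - wd ws) \<in> NA (r + k) n"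
      by (intro vec.subspace_add[OF ideal_gen_subspace] Gv_dl Cons.hyps foldr_dl_mem z0_TM ideal_gen_left[OF homog_Arels Cons.IH l])
    then show ?case by (simp add: kprod_simps)
  qed
  then show "Gv k (DD k (wd ws)) - wd ws \<in> NA (r + k) n" by (simp add: DD_def)
qed auto

text \<open>The letters of the right word act first, when the left word is still empty, and the
  shifted letters after them. So no braiding takes place, and acting on 1 \<otimes> 1 rebuilds the
  pair of words up to normal forms.\<close>

lemma DD_Gv:
  assumes z: "z \<in> vspan (TM r k n)"
  shows "DD k (Gv k z) - z \<in> NT r k n"
proof -
  have vD: "vlin (DD k)" unfolding DD_def by (rule vlin_lin)
  show ?thesis
  proof (rule vlin_span_mem[OF vlin_intros(4)[OF vlin_comp[OF vD vlin_Gv] vlin_intros(1)] NT_subspace z])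
    fix t assume "t \<in> mon ` TM r k n"
    then obtain w v where t: "t = mon (Tens (Word w) (Word v))" "w \<in> lists (Agens r n)" "v \<in> lists (Agens k n)"
      by (elim imageE TM_E) blast
    have nw: "wd (map nrm w) \<in> wspan (Agens r n)"
      using t(2) Agens_nrm Pgens_Agens by (intro wd_wspan) (induction w, auto)
    have "(wd w - wd (map nrm w)) \<boxtimes> wd v + wd (map nrm w) \<boxtimes> (wd v - wd (map nrm v)) \<in> NT r k n"
      using NT_left[OF nrm_mem_NA[OF t(2), of "[]"] wd_wspan[OF t(3)]] NT_right[OF nw nrm_mem_NA[OF t(3), of "[]"]]
      by (intro vec.subspace_add[OF NT_subspace]) simp_all
    then have "- ((wd w - wd (map nrm w)) \<boxtimes> wd v + wd (map nrm w) \<boxtimes> (wd v - wd (map nrm v))) \<in> NT r k n"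
      by (rule vec.subspace_neg[OF NT_subspace])
    moreover have "DD k (Gv k t) = mon (Tens (Word (map nrm w)) (Word (map nrm v)))"
      using foldr_dl_words[OF t(2,3)] by (simp add: t(1) Gv_mon DD_def)
    ultimately show "DD k (Gv k t) - t \<in> NT r k n" by (simp add: t(1) vtens_simps)
  qed
qed

abbreviation TA :: "nat \<Rightarrow> nat \<Rightarrow> nat \<Rightarrow> space" where
  "TA r k n \<equiv> tspace (A r n) (A k n)"

lemma TA_qsp: "qsp (TA r k n)"
  by (intro qsp_tspace A_qsp)

lemma iota_bil:
  assumes "k + r \<le> m" "k' + r' \<le> m"
  shows "bil (A r n) (A r' n) (A m n) (\<lambda>x y. iota k m n x \<otimes>\<^bsub>A m n\<^esub> iota k' m n y)"
  by (rule bil_comp[OF A_qsp A_qsp A_qsp A_qsp palg_bil_mult[OF palg_A] iota_lmap[OF assms(1)] iota_lmap[OF assms(2)]])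

lemma glue_lmap: "lmap (TA r k n) (A (r + k) n) (glue n r k)"
  unfolding glue_def by (intro lmap_tlift A_qsp iota_bil) simp_all

lemma glue_pure:
  "x \<in> carrier (A r n) \<Longrightarrow> y \<in> carrier (A k n) \<Longrightarrow>
    glue n r k (pure (A r n) (A k n) x y) = iota k (r + k) n x \<otimes>\<^bsub>A (r + k) n\<^esub> iota 0 (r + k) n y"
  unfolding glue_def by (intro tlift_pure A_qsp iota_bil) simp_all

lemma glue_cls:
  assumes z: "z \<in> vspan (TM r k n)"
  shows "glue n r k (cls (TA r k n) z) = cls (A (r + k) n) (Gv k z)"
proof -
  let ?B = "A (r + k) n"
  let ?f = "tcase (\<lambda>a b. rep (iota k (r + k) n (cls (A r n) (mon a)) \<otimes>\<^bsub>?B\<^esub> iota 0 (r + k) n (cls (A k n) (mon b))))"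
  have "glue n r k (cls (TA r k n) z) = cls ?B (lin ?f z)"
    unfolding glue_def by (rule tlift_cls[OF A_qsp A_qsp A_qsp iota_bil z]) simp_all
  moreover have "lin ?f z - Gv k z \<in> rels ?B"
  proof (rule vlin_span_mem[OF vlin_intros(4)[OF vlin_lin vlin_Gv] qsp_sub[OF A_qsp] z])
    fix t assume "t \<in> mon ` TM r k n"
    then obtain w v where t: "t = mon (Tens (Word w) (Word v))" "w \<in> lists (Agens r n)" "v \<in> lists (Agens k n)"
      by (elim imageE TM_E) blast
    have "iota k (r + k) n (cls (A r n) (wd w)) \<otimes>\<^bsub>?B\<^esub> iota 0 (r + k) n (cls (A k n) (wd v)) = cls ?B (wd (map (sh k) w @ v))"
      using iota_cls[OF wd_wspan[OF t(2)], of k "r + k"] iota_cls[OF wd_wspan[OF t(3)], of 0 "r + k"]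
        A_mult[OF wd_wspan[OF map_sh_Agens[OF t(2)]] wd_wspan[OF Agens_mono[OF t(3)]], of k "r + k"]
      by (simp add: sh_zero)
    then show "lin ?f t - Gv k t \<in> rels ?B"
      using rep_cls[OF A_qsp, of "r + k" n "wd (map (sh k) w @ v)"] by (simp add: t(1) Gv_mon)
  qed
  ultimately show ?thesis by (simp only: cls_eq_iff[OF A_qsp])
qed

lemma glue_bij: "bij_betw (glue n r k) (carrier (TA r k n)) (carrier (A (r + k) n))"
proof (rule bij_betw_byWitness[where f' = "\<lambda>Z. cls (TA r k n) (DD k (rep Z))"])
  have vD: "vlin (DD k)" unfolding DD_def by (rule vlin_lin)
  have D: "cls (TA r k n) (DD k (rep (cls (A (r + k) n) x))) = cls (TA r k n) (DD k x)" for x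
  proof -
    have "rep (cls (A (r + k) n) x) - x \<in> NA (r + k) n"
      using rep_cls[OF A_qsp[of "r + k" n], of x] by (simp add: A_rels)
    from DD_NA[OF this] have "DD k (rep (cls (A (r + k) n) x)) - DD k x \<in> rels (TA r k n)"
      by (simp add: vlin_diff[OF vD])
    then show ?thesis by (simp only: cls_eq_iff[OF TA_qsp])
  qed
  have Dm: "DD k x \<in> vspan (TM r k n)" if "x \<in> wspan (Agens (r + k) n)" for x
    by (rule vspan_wordE[OF vD vec.subspace_span that])
      (use foldr_dl_mem[OF _ z0_TM, where r = r and n = n and k = k] in \<open>auto simp: DD_def\<close>)
  show "\<forall>Z\<in>carrier (TA r k n). cls (TA r k n) (DD k (rep (glue n r k Z))) = Z"
  proof
    fix Z assume "Z \<in> carrier (TA r k n)"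
    then obtain z where z: "z \<in> vspan (TM r k n)" "Z = cls (TA r k n) z"
      using carrier_cls[OF TA_qsp] by (metis tspace_simps(1))
    have "DD k (Gv k z) - z \<in> rels (TA r k n)" using DD_Gv[OF z(1)] by simp
    then show "cls (TA r k n) (DD k (rep (glue n r k Z))) = Z"
      unfolding z(2) glue_cls[OF z(1)] D by (simp only: cls_eq_iff[OF TA_qsp])
  qed
  show "\<forall>Z\<in>carrier (A (r + k) n). glue n r k (cls (TA r k n) (DD k (rep Z))) = Z"
  proof
    fix Z assume "Z \<in> carrier (A (r + k) n)"
    then obtain x where x: "x \<in> wspan (Agens (r + k) n)" "Z = cls (A (r + k) n) x" by (rule A_carrier)
    have "Gv k (DD k x) - x \<in> rels (A (r + k) n)" using Gv_DD[OF x(1)] by (simp only: A_rels)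
    then show "glue n r k (cls (TA r k n) (DD k (rep Z))) = Z"
      unfolding x(2) D glue_cls[OF Dm[OF x(1)]] by (simp only: cls_eq_iff[OF A_qsp])
  qed
  show "glue n r k ` carrier (TA r k n) \<subseteq> carrier (A (r + k) n)"
    using lmapD(1)[OF glue_lmap] by blast
  show "(\<lambda>Z. cls (TA r k n) (DD k (rep Z))) ` carrier (A (r + k) n) \<subseteq> carrier (TA r k n)"
    using cls_closed[OF TA_qsp, of "DD k (rep _)"] Dm palg_rep[OF palg_A] by fastforce
qed

section \<open>Products of supermodule homomorphisms\<close>

lemma tensor_simps [simp]:
  "carrier (tensor n V W) = carrier (tspace V W)" "ring.add (tensor n V W) = ring.add (tspace V W)"
  "module.smult (tensor n V W) = module.smult (tspace V W)" "ring.zero (tensor n V W) = ring.zero (tspace V W)"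
  "bas (tensor n V W) = tbas V W" "rels (tensor n V W) = trels V W"
  by (simp_all add: tensor_def)

lemma homog_tensor [simp]: "homog (tensor n V W) p = homog (tspace V W) p"
  by (simp add: tensor_def)

lemma lmap_tensor_left [simp]: "lmap (tensor n V W) U F = lmap (tspace V W) U F"
  by (rule lmap_cong_rels) simp_all

lemma lmap_tensor_right [simp]: "lmap U (tensor n V W) F = lmap U (tspace V W) F"
  by (rule lmap_cong_rels) simp_all

lemma tensor_act:
  "act (tensor n V W) u Z = tsum (trels V W)
        (\<lambda>m1 m2. rep (tsum (trels V W)
           (\<lambda>a b. scal ((-1) ^ (par m2 * par a))
              (rep (act V (cls (Uq n) (mon m1)) (cls V (mon a))) \<boxtimes>
               rep (act W (cls (Uq n) (mon m2)) (cls W (mon b))))) Z))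
        (comult n u)"
  by (simp add: tensor_def)

lemma ssaD:
  assumes "supermodule_superalgebra n B"
  shows "u \<in> carrier (Uq n) \<Longrightarrow> x \<in> carrier B \<Longrightarrow> act B u x \<in> carrier B"
    and "u \<in> carrier (Uq n) \<Longrightarrow> p \<in> {0, 1} \<Longrightarrow> x \<in> homog B p \<Longrightarrow> y \<in> carrier B \<Longrightarrow> act B u (x \<otimes>\<^bsub>B\<^esub> y) =
        tsum (rels B) (\<lambda>m1 m2. scal ((-1) ^ (par m2 * p))
             (rep (act B (cls (Uq n) (mon m1)) x \<otimes>\<^bsub>B\<^esub> act B (cls (Uq n) (mon m2)) y))) (comult n u)"
    and "p \<in> {0, 1} \<Longrightarrow> p' \<in> {0, 1} \<Longrightarrow> x \<in> homog B p \<Longrightarrow> y \<in> homog B p' \<Longrightarrow> x \<otimes>\<^bsub>B\<^esub> y \<in> homog B ((p + p') mod 2)"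
proof -
  note defs = supermodule_superalgebra_def supermodule_def superalgebra_def
  have 1: "\<forall>u\<in>carrier (Uq n). \<forall>x\<in>carrier B. act B u x \<in> carrier B"
    using assms unfolding defs by (elim conjE) assumption
  have 2: "\<forall>u\<in>carrier (Uq n). \<forall>p\<in>{0, 1}. \<forall>a\<in>homog B p. \<forall>b\<in>carrier B. act B u (a \<otimes>\<^bsub>B\<^esub> b) =
        tsum (rels B) (\<lambda>m1 m2. scal ((-1) ^ (par m2 * p))
             (rep (act B (cls (Uq n) (mon m1)) a \<otimes>\<^bsub>B\<^esub> act B (cls (Uq n) (mon m2)) b))) (comult n u)"
    using assms unfolding defs by (elim conjE) assumption
  have 3: "\<forall>p\<in>{0, 1}. \<forall>p'\<in>{0, 1}. \<forall>x\<in>homog B p. \<forall>y\<in>homog B p'. x \<otimes>\<^bsub>B\<^esub> y \<in> homog B ((p + p') mod 2)"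
    using assms unfolding defs by (elim conjE) assumption
  show "u \<in> carrier (Uq n) \<Longrightarrow> x \<in> carrier B \<Longrightarrow> act B u x \<in> carrier B"
    by (rule bspec[OF bspec[OF 1]])
  show "u \<in> carrier (Uq n) \<Longrightarrow> p \<in> {0, 1} \<Longrightarrow> x \<in> homog B p \<Longrightarrow> y \<in> carrier B \<Longrightarrow> act B u (x \<otimes>\<^bsub>B\<^esub> y) =
        tsum (rels B) (\<lambda>m1 m2. scal ((-1) ^ (par m2 * p))
             (rep (act B (cls (Uq n) (mon m1)) x \<otimes>\<^bsub>B\<^esub> act B (cls (Uq n) (mon m2)) y))) (comult n u)"
    by (rule bspec[OF bspec[OF bspec[OF bspec[OF 2]]]])
  show "p \<in> {0, 1} \<Longrightarrow> p' \<in> {0, 1} \<Longrightarrow> x \<in> homog B p \<Longrightarrow> y \<in> homog B p' \<Longrightarrow> x \<otimes>\<^bsub>B\<^esub> y \<in> homog B ((p + p') mod 2)"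
    by (rule bspec[OF bspec[OF bspec[OF bspec[OF 3]]]])
qed

text \<open>mul \<circ> (f \<otimes> g) is equivariant because the action on a tensor product and
  the product axiom of B involve the same comultiplication and the same Koszul sign. It is applied
  to both gluing maps and to the identification of the iterated product.\<close>

lemma tlift_supermodule_hom:
  fixes V :: "('v) uspace_scheme" and W :: "('w) uspace_scheme" and B :: "('b) uspace_scheme"
  assumes V: "qsp V" and W: "qsp W" and B: "qsp B" and ssa: "supermodule_superalgebra n B"
    and f: "supermodule_hom n V B f" and g: "supermodule_hom n W B g"
    and mult: "bil B B B (\<lambda>x y. x \<otimes>\<^bsub>B\<^esub> y)"
    and actV: "\<And>u x. u \<in> carrier (Uq n) \<Longrightarrow> x \<in> carrier V \<Longrightarrow> act V u x \<in> carrier V"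
    and actW: "\<And>u x. u \<in> carrier (Uq n) \<Longrightarrow> x \<in> carrier W \<Longrightarrow> act W u x \<in> carrier W"
  shows "supermodule_hom n (tensor n V W) B (tlift V W B (\<lambda>x y. f x \<otimes>\<^bsub>B\<^esub> g y))"
proof -
  let ?F = "tlift V W B (\<lambda>x y. f x \<otimes>\<^bsub>B\<^esub> g y)" and ?T = "tspace V W"
  note T = qsp_tspace[OF V W] and UQ = palg_qsp[OF palg_Uq[of n]]
  have lf: "lmap V B f" and lg: "lmap W B g" and hf: "\<forall>p\<in>{0, 1}. f \<in> homog V p \<rightarrow> homog B p" and hg: "\<forall>p\<in>{0, 1}. g \<in> homog W p \<rightarrow> homog B p"
    and af: "\<And>u x. u \<in> carrier (Uq n) \<Longrightarrow> x \<in> carrier V \<Longrightarrow> f (act V u x) = act B u (f x)"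
    and ag: "\<And>u x. u \<in> carrier (Uq n) \<Longrightarrow> x \<in> carrier W \<Longrightarrow> g (act W u x) = act B u (g x)"
    using f g by (simp_all add: supermodule_hom_def even_linear_iff)
  have bil: "bil V W B (\<lambda>x y. f x \<otimes>\<^bsub>B\<^esub> g y)" by (rule bil_comp[OF B B V W mult lf lg])
  have F: "lmap ?T B ?F" by (rule lmap_tlift[OF V W B bil])
  have Fp: "?F (pure V W x y) = f x \<otimes>\<^bsub>B\<^esub> g y" if "x \<in> carrier V" "y \<in> carrier W" for x y
    by (rule tlift_pure[OF V W B bil that])
  have mc: "f x \<otimes>\<^bsub>B\<^esub> g y \<in> carrier B" if "x \<in> carrier V" "y \<in> carrier W" for x y
    using lmapD(1)[OF F pure_closed[OF V W that]] Fp[OF that] by simp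
  have cV: "cls V (mon a) \<in> carrier V" if "a \<in> bas V" for a using that by (auto intro!: cls_closed[OF V])
  have cW: "cls W (mon b) \<in> carrier W" if "b \<in> bas W" for b using that by (auto intro!: cls_closed[OF W])
  have cU: "cls (Uq n) (mon a) \<in> carrier (Uq n)" if "a \<in> bas (Uq n)" for a using that by (auto intro!: cls_closed[OF UQ])
  have hom: "?F \<in> homog ?T p \<rightarrow> homog B p" for p
  proof (rule lmap_homog[OF T B F])
    fix t assume "t \<in> bas ?T" and p: "par t mod 2 = p"
    then obtain a b where t: "t = Tens a b" "a \<in> bas V" "b \<in> bas W" by (auto elim: tbasE)
    have "f (cls V (mon a)) \<in> homog B (par a mod 2)" "g (cls W (mon b)) \<in> homog B (par b mod 2)"
      using bspec[OF hf mod2_mem] bspec[OF hg mod2_mem] homog_mon[OF V t(2)] homog_mon[OF W t(3)] by blast+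
    from ssaD(3)[OF ssa mod2_mem mod2_mem this] have "f (cls V (mon a)) \<otimes>\<^bsub>B\<^esub> g (cls W (mon b)) \<in> homog B p"
      using p by (simp add: t(1) mod_add_eq)
    then show "?F (cls ?T (mon t)) \<in> homog B p"
      using Fp[OF cV[OF t(2)] cW[OF t(3)]] pure_mon[OF V W t(2,3)] by (simp only: t(1))
  qed
  have act: "?F (act (tensor n V W) u Z) = act B u (?F Z)" if u: "u \<in> carrier (Uq n)" and Z: "Z \<in> carrier ?T" for u Z
  proof -
    let ?h = "\<lambda>m1 m2 a b. scal ((-1) ^ (par m2 * par a)) (rep (act V (cls (Uq n) (mon m1)) (cls V (mon a))) \<boxtimes> rep (act W (cls (Uq n) (mon m2)) (cls W (mon b))))"
    \<comment> \<open>The product axiom of B takes a parity in {0, 1}, hence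
      \<open>par a mod 2\<close> in place of \<open>par a\<close>.\<close>
    let ?k = "\<lambda>m1 m2 a b. scal ((-1) ^ (par m2 * (par a mod 2))) (rep (act B (cls (Uq n) (mon m1)) (f (cls V (mon a))) \<otimes>\<^bsub>B\<^esub> act B (cls (Uq n) (mon m2)) (g (cls W (mon b)))))"
    note Y = comult_carrier[OF u]
    have hm: "?h m1 m2 a b \<in> vspan (bas ?T)" if "m1 \<in> bas (Uq n)" "m2 \<in> bas (Uq n)" "a \<in> bas V" "b \<in> bas W" for m1 m2 a b
      unfolding tspace_simps using that
      by (intro vec.span_scale vtens_tbas rep_mem[OF V] rep_mem[OF W] actV actW cV cW cU)
    have Fh: "cls B (rep (?F (cls ?T (?h m1 m2 a b)))) = cls B (?k m1 m2 a b)"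
      if m: "m1 \<in> bas (Uq n)" "m2 \<in> bas (Uq n)" "a \<in> bas V" "b \<in> bas W" for m1 m2 a b
    proof -
      let ?x = "act V (cls (Uq n) (mon m1)) (cls V (mon a))" and ?y = "act W (cls (Uq n) (mon m2)) (cls W (mon b))"
      have x: "?x \<in> carrier V" "?y \<in> carrier W" using m by (auto intro!: actV actW cV cW cU)
      let ?s = "(-1::Cq) ^ (par m2 * par a)"
      have s: "?s = (-1) ^ (par m2 * (par a mod 2))" by (rule minus_one_cong) simp
      have "?F (cls ?T (?h m1 m2 a b)) = ?F (?s \<odot>\<^bsub>?T\<^esub> pure V W ?x ?y)"
        by (simp only: pure_def cls_smult[OF T])
      also have "\<dots> = ?s \<odot>\<^bsub>B\<^esub> (f ?x \<otimes>\<^bsub>B\<^esub> g ?y)"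
        using lmapD(3)[OF F pure_closed[OF V W x]] Fp[OF x] by simp
      also have "\<dots> = ?s \<odot>\<^bsub>B\<^esub> cls B (rep (f ?x \<otimes>\<^bsub>B\<^esub> g ?y))"
        using cls_rep[OF B mc[OF x]] by simp
      also have "\<dots> = cls B (?k m1 m2 a b)"
        using af[OF cU[OF m(1)] cV[OF m(3)]] ag[OF cU[OF m(2)] cW[OF m(4)]] by (simp add: cls_smult[OF B] s)
      finally show ?thesis by (simp add: coset_rep[OF qsp_sub[OF B]])
    qed
    have "?F (act (tensor n V W) u Z)
      = tsum (rels B) (\<lambda>m1 m2. rep (?F (cls ?T (rep (tsum (rels ?T) (?h m1 m2) Z))))) (comult n u)"
      unfolding tensor_act tspace_simps(2)[symmetric]
      using hm by (intro tsum_push[OF UQ UQ T B F Y] rep_mem[OF T] tsum_closed[OF V W T Z])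
    also have "\<dots> = tsum (rels B) (\<lambda>m1 m2. rep (tsum (rels B) (?k m1 m2) Z)) (comult n u)"
    proof (rule tsum_cong[OF UQ UQ B Y])
      fix m1 m2 assume m: "m1 \<in> bas (Uq n)" "m2 \<in> bas (Uq n)"
      have "cls ?T (rep (tsum (rels ?T) (?h m1 m2) Z)) = tsum (rels ?T) (?h m1 m2) Z"
        using hm[OF m] by (intro cls_rep[OF T] tsum_closed[OF V W T Z])
      moreover have "?F (tsum (rels ?T) (?h m1 m2) Z) = tsum (rels B) (\<lambda>a b. rep (?F (cls ?T (?h m1 m2 a b)))) Z"
        by (rule tsum_push[OF V W T B F Z hm[OF m]])
      moreover have "\<dots> = tsum (rels B) (?k m1 m2) Z"
        by (rule tsum_cong[OF V W B Z Fh[OF m]])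
      ultimately show "cls B (rep (?F (cls ?T (rep (tsum (rels ?T) (?h m1 m2) Z))))) = cls B (rep (tsum (rels B) (?k m1 m2) Z))"
        by simp
    qed
    also have "\<dots> = tsum (rels B) (\<lambda>a b. rep (tsum (rels B) (\<lambda>m1 m2. ?k m1 m2 a b) (comult n u))) Z"
      by (rule tsum_commute[OF qsp_sub[OF B]])
    also have "\<dots> = tlift V W B (\<lambda>x y. act B u (f x \<otimes>\<^bsub>B\<^esub> g y)) Z"
      unfolding tlift_def
    proof (rule tsum_cong[OF V W B Z])
      fix a b assume a: "a \<in> bas V" "b \<in> bas W"
      have "f (cls V (mon a)) \<in> homog B (par a mod 2)"
        using bspec[OF hf mod2_mem] homog_mon[OF V a(1)] by blast
      from ssaD(2)[OF ssa u mod2_mem this lmapD(1)[OF lg cW[OF a(2)]]]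
      show "cls B (rep (tsum (rels B) (\<lambda>m1 m2. ?k m1 m2 a b) (comult n u)))
        = cls B (rep (act B u (f (cls V (mon a)) \<otimes>\<^bsub>B\<^esub> g (cls W (mon b)))))" by (simp only:)
    qed
    also have "\<dots> = act B u (?F Z)"
      by (rule tlift_push[OF V W B B ssa_lmap_right[OF ssa u] Z mc, symmetric])
    finally show ?thesis .
  qed
  show ?thesis
    unfolding supermodule_hom_def even_linear_iff using F hom act by simp
qed

section \<open>The braiding\<close>

lemma lmap_zero: "qsp V \<Longrightarrow> qsp W \<Longrightarrow> lmap V W F \<Longrightarrow> F \<zero>\<^bsub>V\<^esub> = \<zero>\<^bsub>W\<^esub>"
  using lmap_cls[OF _ _ _ vec.span_zero] by (simp add: zero_cls lin_zero)

lemma zero_homog: "qsp V \<Longrightarrow> \<zero>\<^bsub>V\<^esub> \<in> homog V p"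
  by (auto simp: zero_cls homog_def intro!: imageI vec.span_zero)

lemma add_zero: "qsp V \<Longrightarrow> x \<in> carrier V \<Longrightarrow> x \<oplus>\<^bsub>V\<^esub> \<zero>\<^bsub>V\<^esub> = x \<and> \<zero>\<^bsub>V\<^esub> \<oplus>\<^bsub>V\<^esub> x = x"
  using cls_add[of V] by (auto elim!: carrier_cls simp: zero_cls)

text \<open>The images of the even and odd part of Z split F Z; uniqueness of the splitting sends
  the part of the wrong parity to zero, and injectivity makes it vanish.\<close>

lemma homog_reflect:
  assumes V: "qsp V" and W: "superspace W" and z: "\<zero>\<^bsub>W\<^esub> \<in> homog W 0" "\<zero>\<^bsub>W\<^esub> \<in> homog W 1"
    and az: "\<And>x. x \<in> carrier W \<Longrightarrow> x \<oplus>\<^bsub>W\<^esub> \<zero>\<^bsub>W\<^esub> = x \<and> \<zero>\<^bsub>W\<^esub> \<oplus>\<^bsub>W\<^esub> x = x"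
    and Fz: "F \<zero>\<^bsub>V\<^esub> = \<zero>\<^bsub>W\<^esub>" and F: "even_linear V W F" and inj: "inj_on F (carrier V)"
    and p: "p \<in> {0, 1}" and Z: "Z \<in> carrier V" and FZ: "F Z \<in> homog W p"
  shows "Z \<in> homog V p"
proof -
  have l: "lmap V W F" and h: "\<forall>p\<in>{0, 1}. F \<in> homog V p \<rightarrow> homog W p" using F by (auto simp: even_linear_iff)
  obtain y z where yz: "y \<in> homog V 0" "z \<in> homog V 1" "Z = y \<oplus>\<^bsub>V\<^esub> z" using qsp_decomp[OF V Z] by auto
  have c: "y \<in> carrier V" "z \<in> carrier V" using yz homog_carrier[OF V] by auto
  have zc: "\<zero>\<^bsub>V\<^esub> \<in> carrier V" using zero_homog[OF V, of 0] homog_carrier[OF V] by auto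
  have FZ': "F Z \<in> carrier W" by (rule lmapD(1)[OF l Z])
  have ex: "\<exists>!(y, z). y \<in> homog W 0 \<and> z \<in> homog W 1 \<and> F Z = y \<oplus>\<^bsub>W\<^esub> z"
    using W FZ' unfolding superspace_def by (elim conjE) (rule bspec)
  have u: "y' = y'' \<and> z' = z''" if "y' \<in> homog W 0" "z' \<in> homog W 1" "F Z = y' \<oplus>\<^bsub>W\<^esub> z'"
    "y'' \<in> homog W 0" "z'' \<in> homog W 1" "F Z = y'' \<oplus>\<^bsub>W\<^esub> z''" for y' y'' z' z''
    using Uniq_D[OF conjunct2[OF iffD1[OF ex1_iff_ex_Uniq ex]], of "(y', z')" "(y'', z'')"] that by simp
  have F1: "F y \<in> homog W 0" "F z \<in> homog W 1" "F Z = F y \<oplus>\<^bsub>W\<^esub> F z"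
    using h yz lmapD(2)[OF l c] by auto
  show ?thesis
  proof (cases "p = 0")
    case True
    have "F z = \<zero>\<^bsub>W\<^esub>" using u[OF F1, of "F Z" "\<zero>\<^bsub>W\<^esub>"] FZ True z az[OF FZ'] by simp
    then have "z = \<zero>\<^bsub>V\<^esub>" by (intro inj_onD[OF inj _ c(2) zc]) (simp add: Fz)
    then show ?thesis using yz True add_zero[OF V c(1)] by simp
  next
    case False
    then have p1: "p = 1" using p by simp
    have "F y = \<zero>\<^bsub>W\<^esub>" using u[OF F1, of "\<zero>\<^bsub>W\<^esub>" "F Z"] FZ p1 z az[OF FZ'] by simp
    then have "y = \<zero>\<^bsub>V\<^esub>" by (intro inj_onD[OF inj _ c(1) zc]) (simp add: Fz)
    then show ?thesis using yz p1 add_zero[OF V c(2)] by simp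
  qed
qed

text \<open>Every identity for T is tested after applying the injective G, where it becomes one for
  M. With \<open>glue\<close> as G and \<open>swapglue\<close> as M this makes the braiding a
  homomorphism.\<close>

lemma lift_supermodule_hom:
  fixes V :: "('v) uspace_scheme" and W :: "('w) uspace_scheme" and B :: "('b) uspace_scheme"
  assumes V: "qsp V" and W: "qsp W" and B: "qsp B" and G: "supermodule_hom n W B G" and M: "supermodule_hom n V B M"
    and inj: "inj_on G (carrier W)" and T: "\<And>Z. Z \<in> carrier V \<Longrightarrow> T Z \<in> carrier W \<and> G (T Z) = M Z"
    and actV: "\<And>u x. u \<in> carrier (Uq n) \<Longrightarrow> x \<in> carrier V \<Longrightarrow> act V u x \<in> carrier V"
    and actW: "\<And>u x. u \<in> carrier (Uq n) \<Longrightarrow> x \<in> carrier W \<Longrightarrow> act W u x \<in> carrier W"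
  shows "supermodule_hom n V W T"
proof -
  have lG: "lmap W B G" and lM: "lmap V B M" and eG: "even_linear W B G" and hM: "\<forall>p\<in>{0, 1}. M \<in> homog V p \<rightarrow> homog B p"
    and aG: "\<And>u x. u \<in> carrier (Uq n) \<Longrightarrow> x \<in> carrier W \<Longrightarrow> G (act W u x) = act B u (G x)"
    and aM: "\<And>u x. u \<in> carrier (Uq n) \<Longrightarrow> x \<in> carrier V \<Longrightarrow> M (act V u x) = act B u (M x)"
    using G M by (simp_all add: supermodule_hom_def even_linear_iff)
  have eq: "x = y" if "x \<in> carrier W" "y \<in> carrier W" "G x = G y" for x y using inj_onD[OF inj that(3,1,2)] .
  have Tc: "T Z \<in> carrier W" and TG: "G (T Z) = M Z" if "Z \<in> carrier V" for Z using T[OF that] by simp_all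
  have lT: "lmap V W T"
  proof (rule lmapI)
    fix x y assume xy: "x \<in> carrier V" "y \<in> carrier V"
    have "G (T (x \<oplus>\<^bsub>V\<^esub> y)) = M x \<oplus>\<^bsub>B\<^esub> M y"
      unfolding TG[OF qsp_add_closed[OF V xy]] by (rule lmapD(2)[OF lM xy])
    moreover have "G (T x \<oplus>\<^bsub>W\<^esub> T y) = M x \<oplus>\<^bsub>B\<^esub> M y"
      unfolding lmapD(2)[OF lG Tc[OF xy(1)] Tc[OF xy(2)]] TG[OF xy(1)] TG[OF xy(2)] ..
    ultimately show "T (x \<oplus>\<^bsub>V\<^esub> y) = T x \<oplus>\<^bsub>W\<^esub> T y"
      by (intro eq[OF Tc[OF qsp_add_closed[OF V xy]] qsp_add_closed[OF W Tc[OF xy(1)] Tc[OF xy(2)]]]) simp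
  next
    fix x c assume x: "x \<in> carrier V"
    have "G (T (c \<odot>\<^bsub>V\<^esub> x)) = c \<odot>\<^bsub>B\<^esub> M x"
      unfolding TG[OF qsp_smult_closed[OF V x]] by (rule lmapD(3)[OF lM x])
    moreover have "G (c \<odot>\<^bsub>W\<^esub> T x) = c \<odot>\<^bsub>B\<^esub> M x"
      unfolding lmapD(3)[OF lG Tc[OF x]] TG[OF x] ..
    ultimately show "T (c \<odot>\<^bsub>V\<^esub> x) = c \<odot>\<^bsub>W\<^esub> T x"
      by (intro eq[OF Tc[OF qsp_smult_closed[OF V x]] qsp_smult_closed[OF W Tc[OF x]]]) simp
  qed (rule Tc)
  have hT: "T \<in> homog V p \<rightarrow> homog W p" if p: "p \<in> {0, 1}" for p
  proof
    fix Z assume Z: "Z \<in> homog V p"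
    then have Zc: "Z \<in> carrier V" using homog_carrier[OF V] by blast
    have "G (T Z) \<in> homog B p" unfolding TG[OF Zc] by (rule funcset_mem[OF bspec[OF hM p] Z])
    then show "T Z \<in> homog W p"
      by (rule homog_reflect[OF W qsp_superspace[OF B] zero_homog[OF B] zero_homog[OF B] _ lmap_zero[OF W B lG] eG inj p Tc[OF Zc], rotated])
        (rule add_zero[OF B])
  qed
  have aT: "T (act V u x) = act W u (T x)" if u: "u \<in> carrier (Uq n)" and x: "x \<in> carrier V" for u x
  proof -
    have "G (T (act V u x)) = act B u (M x)" unfolding TG[OF actV[OF u x]] by (rule aM[OF u x])
    moreover have "G (act W u (T x)) = act B u (M x)" unfolding aG[OF u Tc[OF x]] TG[OF x] ..
    ultimately show ?thesis by (intro eq[OF Tc[OF actV[OF u x]] actW[OF u Tc[OF x]]]) simp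
  qed
  show ?thesis unfolding supermodule_hom_def even_linear_iff by (intro conjI ballI lT hT aT)
qed

lemma tensor_act_closed:
  fixes V :: "('v) uspace_scheme" and W :: "('w) uspace_scheme"
  assumes V: "qsp V" and W: "qsp W" and u: "u \<in> carrier (Uq n)" and Z: "Z \<in> carrier (tspace V W)"
    and actV: "\<And>u x. u \<in> carrier (Uq n) \<Longrightarrow> x \<in> carrier V \<Longrightarrow> act V u x \<in> carrier V"
    and actW: "\<And>u x. u \<in> carrier (Uq n) \<Longrightarrow> x \<in> carrier W \<Longrightarrow> act W u x \<in> carrier W"
  shows "act (tensor n V W) u Z \<in> carrier (tspace V W)"
proof -
  note T = qsp_tspace[OF V W] and UQ = palg_qsp[OF palg_Uq[of n]]
  have Um: "cls (Uq n) (mon m) \<in> carrier (Uq n)" if "m \<in> bas (Uq n)" for m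
    by (rule cls_closed[OF UQ mon_in_vspan[OF that]])
  have i: "scal c (rep (act V (cls (Uq n) (mon m1)) (cls V (mon a))) \<boxtimes> rep (act W (cls (Uq n) (mon m2)) (cls W (mon b))))
      \<in> vspan (bas (tspace V W))"
    if m: "m1 \<in> bas (Uq n)" "m2 \<in> bas (Uq n)" and ab: "a \<in> bas V" "b \<in> bas W" for c m1 m2 a b
  proof -
    note 1 = rep_mem[OF V actV[OF Um[OF m(1)] cls_closed[OF V mon_in_vspan[OF ab(1)]]]]
      and 2 = rep_mem[OF W actW[OF Um[OF m(2)] cls_closed[OF W mon_in_vspan[OF ab(2)]]]]
    show ?thesis unfolding tspace_simps using vtens_tbas[OF 1 2] by (rule vec.span_scale)
  qed
  show ?thesis
    unfolding tensor_act tspace_simps(2)[of V W, symmetric]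
    by (rule tsum_closed[OF UQ UQ T comult_carrier[OF u]]) (rule rep_mem[OF T tsum_closed[OF V W T Z i]])
qed

lemma qsp_tensor [simp]: "qsp (tensor n V W) \<longleftrightarrow> qsp (tspace V W)"
  by (simp add: tensor_def)

lemma tlift_tensor [simp]: "tlift V W (tensor n X' Y') f Z = tlift V W (tspace X' Y') f Z"
  by (simp add: tlift_def)

section \<open>The braiding compared with multiplication in the larger coordinate
  superalgebra\<close>

definition swapglue :: "nat \<Rightarrow> nat \<Rightarrow> nat \<Rightarrow> vec set \<Rightarrow> vec set" where
  "swapglue n k r = tlift (A k n) (A r n) (A (r + k) n) (\<lambda>y x. iota 0 (r + k) n y \<otimes>\<^bsub>A (r + k) n\<^esub> iota k (r + k) n x)"

lemma A_act_closed: "u \<in> carrier (Uq n) \<Longrightarrow> x \<in> carrier (A r n) \<Longrightarrow> act (A r n) u x \<in> carrier (A r n)"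
  by (rule ssaD(1)[OF A_ssa])

lemma swapglue_pure:
  "y \<in> carrier (A k n) \<Longrightarrow> x \<in> carrier (A r n) \<Longrightarrow>
    swapglue n k r (pure (A k n) (A r n) y x) = iota 0 (r + k) n y \<otimes>\<^bsub>A (r + k) n\<^esub> iota k (r + k) n x"
  unfolding swapglue_def by (intro tlift_pure A_qsp iota_bil) simp_all

lemma swapglue_hom: "supermodule_hom n (tensor n (A k n) (A r n)) (A (r + k) n) (swapglue n k r)"
  unfolding swapglue_def
  by (rule tlift_supermodule_hom[OF A_qsp A_qsp A_qsp A_ssa iota_hom iota_hom palg_bil_mult[OF palg_A] A_act_closed A_act_closed]) simp_all

lemma glue_hom: "supermodule_hom n (tensor n (A r n) (A k n)) (A (r + k) n) (glue n r k)"
  unfolding glue_def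
  by (rule tlift_supermodule_hom[OF A_qsp A_qsp A_qsp A_ssa iota_hom iota_hom palg_bil_mult[OF palg_A] A_act_closed A_act_closed]) simp_all

lemma swapglue_lmap: "lmap (TA k r n) (A (r + k) n) (swapglue n k r)"
  using swapglue_hom[of n k r] by (simp add: supermodule_hom_def even_linear_iff)

lemma glue_inj: "Z \<in> carrier (TA r k n) \<Longrightarrow> Z' \<in> carrier (TA r k n) \<Longrightarrow> glue n r k Z = glue n r k Z' \<Longrightarrow> Z = Z'"
  using glue_bij[of n r k] by (meson bij_betw_imp_inj_on inj_onD)

context
  fixes n k r :: nat
begin

private abbreviation (input) "Ak \<equiv> A k n"
private abbreviation (input) "Ar \<equiv> A r n"
private abbreviation (input) "B \<equiv> A (r + k) n"
private abbreviation (input) "ik \<equiv> iota k (r + k) n"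
private abbreviation (input) "i0 \<equiv> iota 0 (r + k) n"
private abbreviation (input) "G \<equiv> glue n r k"

lemma ik_lmap: "lmap Ar B ik" and i0_lmap: "lmap Ak B i0"
  by (rule iota_lmap, simp)+

lemmas ik_closed = lmapD(1)[OF ik_lmap] and i0_closed = lmapD(1)[OF i0_lmap]
  and B_closed = palg_mult_closed[OF palg_A[of "r + k" n]] and B_assoc = palg_assoc[OF palg_A[of "r + k" n]]

text \<open>Associativity in B pulls the factor \<iota>_k(x') out of both sums. The hypothesis
  speaks of one fixed x', because in the uniqueness proof the value of T is known for the tail of a
  word before it is known in general.\<close>

lemma hexagon_right:
  assumes T: "\<And>f. f \<in> carrier Ak \<Longrightarrow> T (pure Ak Ar f x') \<in> carrier (TA r k n) \<and> G (T (pure Ak Ar f x')) = i0 f \<otimes>\<^bsub>B\<^esub> ik x'"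
    and Z: "Z \<in> carrier (TA r k n)" and x': "x' \<in> carrier Ar"
  defines "I \<equiv> \<lambda>e f. tlift Ar Ak (TA r k n) (\<lambda>e' f'. pure Ar Ak (e \<otimes>\<^bsub>Ar\<^esub> e') f') (T (pure Ak Ar f x'))"
  shows "tlift Ar Ak (TA r k n) I Z \<in> carrier (TA r k n)" "G (tlift Ar Ak (TA r k n) I Z) = G Z \<otimes>\<^bsub>B\<^esub> ik x'"
proof -
  note Q = A_qsp[of r n] A_qsp[of k n] and BQ = A_qsp[of "r + k" n] and TQ = TA_qsp
  have p: "pure Ar Ak (e \<otimes>\<^bsub>Ar\<^esub> e') f' \<in> carrier (TA r k n)" if "e \<in> carrier Ar" "e' \<in> carrier Ar" "f' \<in> carrier Ak" for e e' f'
    using that by (intro pure_closed Q palg_mult_closed[OF palg_A])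
  have Ic: "I e f \<in> carrier (TA r k n)" if "e \<in> carrier Ar" "f \<in> carrier Ak" for e f
    unfolding I_def using T[OF that(2)] that p by (intro tlift_closed Q TQ) auto
  have IG: "G (I e f) = (ik e \<otimes>\<^bsub>B\<^esub> i0 f) \<otimes>\<^bsub>B\<^esub> ik x'" if e: "e \<in> carrier Ar" and f: "f \<in> carrier Ak" for e f
  proof -
    let ?W = "T (pure Ak Ar f x')"
    have W: "?W \<in> carrier (TA r k n)" "G ?W = i0 f \<otimes>\<^bsub>B\<^esub> ik x'" using T[OF f] by auto
    have "G (I e f) = tlift Ar Ak B (\<lambda>e' f'. G (pure Ar Ak (e \<otimes>\<^bsub>Ar\<^esub> e') f')) ?W"
      unfolding I_def using p[OF e] by (intro tlift_push[OF Q TQ BQ glue_lmap W(1)])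
    also have "\<dots> = tlift Ar Ak B (\<lambda>e' f'. ik e \<otimes>\<^bsub>B\<^esub> (ik e' \<otimes>\<^bsub>B\<^esub> i0 f')) ?W"
    proof (rule tlift_cong[OF Q BQ W(1)])
      fix a b assume "a \<in> bas Ar" "b \<in> bas Ak"
      then have c: "cls Ar (mon a) \<in> carrier Ar" "cls Ak (mon b) \<in> carrier Ak" by (auto intro!: cls_closed[OF Q(1)] cls_closed[OF Q(2)])
      show "G (pure Ar Ak (e \<otimes>\<^bsub>Ar\<^esub> cls Ar (mon a)) (cls Ak (mon b))) = ik e \<otimes>\<^bsub>B\<^esub> (ik (cls Ar (mon a)) \<otimes>\<^bsub>B\<^esub> i0 (cls Ak (mon b)))"
        using glue_pure[OF palg_mult_closed[OF palg_A e c(1)] c(2)] iota_mult[of k r "r + k", OF _ e c(1)] B_assoc[OF ik_closed[OF e] ik_closed[OF c(1)] i0_closed[OF c(2)]]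
        by simp
    qed
    also have "\<dots> = ik e \<otimes>\<^bsub>B\<^esub> G ?W"
      unfolding glue_def
      by (rule tlift_push[OF Q BQ BQ palg_lmap_mult(1)[OF palg_A ik_closed[OF e]] W(1), symmetric]) (intro B_closed ik_closed i0_closed)
    finally show ?thesis unfolding W(2) using B_assoc[OF ik_closed[OF e] i0_closed[OF f] ik_closed[OF x']] by simp
  qed
  show "tlift Ar Ak (TA r k n) I Z \<in> carrier (TA r k n)" by (intro tlift_closed Q TQ Z Ic)
  have "G (tlift Ar Ak (TA r k n) I Z) = tlift Ar Ak B (\<lambda>e f. G (I e f)) Z"
    by (intro tlift_push[OF Q TQ BQ glue_lmap Z] Ic)
  also have "\<dots> = tlift Ar Ak B (\<lambda>e f. (ik e \<otimes>\<^bsub>B\<^esub> i0 f) \<otimes>\<^bsub>B\<^esub> ik x') Z"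
    by (rule tlift_cong[OF Q BQ Z]) (intro IG cls_closed[OF Q(1)] cls_closed[OF Q(2)] mon_in_vspan)
  also have "\<dots> = G Z \<otimes>\<^bsub>B\<^esub> ik x'"
    unfolding glue_def
    by (rule tlift_push[OF Q BQ BQ palg_lmap_mult(2)[OF palg_A ik_closed[OF x']] Z, symmetric]) (intro B_closed ik_closed i0_closed)
  finally show "G (tlift Ar Ak (TA r k n) I Z) = G Z \<otimes>\<^bsub>B\<^esub> ik x'" .
qed

text \<open>The inner values of T stay unevaluated: when this is applied in the uniqueness proof,
  they are known only for single letters e.\<close>

lemma hexagon_left:
  assumes T: "\<And>e. e \<in> carrier Ar \<Longrightarrow> T (pure Ak Ar y e) \<in> carrier (TA r k n)"
    and Z: "Z \<in> carrier (TA r k n)"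
  defines "I \<equiv> \<lambda>e f. tlift Ar Ak (TA r k n) (\<lambda>e' f'. pure Ar Ak e' (f' \<otimes>\<^bsub>Ak\<^esub> f)) (T (pure Ak Ar y e))"
  shows "tlift Ar Ak (TA r k n) I Z \<in> carrier (TA r k n)"
    "G (tlift Ar Ak (TA r k n) I Z) = tlift Ar Ak B (\<lambda>e f. G (T (pure Ak Ar y e)) \<otimes>\<^bsub>B\<^esub> i0 f) Z"
proof -
  note Q = A_qsp[of r n] A_qsp[of k n] and BQ = A_qsp[of "r + k" n] and TQ = TA_qsp
  have p: "pure Ar Ak e' (f' \<otimes>\<^bsub>Ak\<^esub> f) \<in> carrier (TA r k n)" if "f \<in> carrier Ak" "e' \<in> carrier Ar" "f' \<in> carrier Ak" for f e' f'
    using that by (intro pure_closed Q palg_mult_closed[OF palg_A])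
  have Ic: "I e f \<in> carrier (TA r k n)" if "e \<in> carrier Ar" "f \<in> carrier Ak" for e f
    unfolding I_def using T[OF that(1)] that p by (intro tlift_closed Q TQ) auto
  have IG: "G (I e f) = G (T (pure Ak Ar y e)) \<otimes>\<^bsub>B\<^esub> i0 f" if e: "e \<in> carrier Ar" and f: "f \<in> carrier Ak" for e f
  proof -
    let ?W = "T (pure Ak Ar y e)"
    note W = T[OF e]
    have "G (I e f) = tlift Ar Ak B (\<lambda>e' f'. G (pure Ar Ak e' (f' \<otimes>\<^bsub>Ak\<^esub> f))) ?W"
      unfolding I_def using p[OF f] by (intro tlift_push[OF Q TQ BQ glue_lmap W])
    also have "\<dots> = tlift Ar Ak B (\<lambda>e' f'. (ik e' \<otimes>\<^bsub>B\<^esub> i0 f') \<otimes>\<^bsub>B\<^esub> i0 f) ?W"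
    proof (rule tlift_cong[OF Q BQ W])
      fix a b assume "a \<in> bas Ar" "b \<in> bas Ak"
      then have c: "cls Ar (mon a) \<in> carrier Ar" "cls Ak (mon b) \<in> carrier Ak" by (auto intro!: cls_closed[OF Q(1)] cls_closed[OF Q(2)])
      show "G (pure Ar Ak (cls Ar (mon a)) (cls Ak (mon b) \<otimes>\<^bsub>Ak\<^esub> f)) = (ik (cls Ar (mon a)) \<otimes>\<^bsub>B\<^esub> i0 (cls Ak (mon b))) \<otimes>\<^bsub>B\<^esub> i0 f"
        using glue_pure[OF c(1) palg_mult_closed[OF palg_A c(2) f]] iota_mult[of 0 k "r + k", OF _ c(2) f] B_assoc[OF ik_closed[OF c(1)] i0_closed[OF c(2)] i0_closed[OF f]]
        by simp
    qed
    also have "\<dots> = G ?W \<otimes>\<^bsub>B\<^esub> i0 f"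
      unfolding glue_def
      by (rule tlift_push[OF Q BQ BQ palg_lmap_mult(2)[OF palg_A i0_closed[OF f]] W, symmetric]) (intro B_closed ik_closed i0_closed)
    finally show ?thesis .
  qed
  show "tlift Ar Ak (TA r k n) I Z \<in> carrier (TA r k n)" by (intro tlift_closed Q TQ Z Ic)
  have "G (tlift Ar Ak (TA r k n) I Z) = tlift Ar Ak B (\<lambda>e f. G (I e f)) Z"
    by (intro tlift_push[OF Q TQ BQ glue_lmap Z] Ic)
  also have "\<dots> = tlift Ar Ak B (\<lambda>e f. G (T (pure Ak Ar y e)) \<otimes>\<^bsub>B\<^esub> i0 f) Z"
    by (rule tlift_cong[OF Q BQ Z]) (intro IG cls_closed[OF Q(1)] cls_closed[OF Q(2)] mon_in_vspan)
  finally show "G (tlift Ar Ak (TA r k n) I Z) = tlift Ar Ak B (\<lambda>e f. G (T (pure Ak Ar y e)) \<otimes>\<^bsub>B\<^esub> i0 f) Z" .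
qed

lemma i0_mult_glue:
  assumes y: "y \<in> carrier Ak" and Z: "Z \<in> carrier (TA r k n)"
  shows "tlift Ar Ak B (\<lambda>e f. (i0 y \<otimes>\<^bsub>B\<^esub> ik e) \<otimes>\<^bsub>B\<^esub> i0 f) Z = i0 y \<otimes>\<^bsub>B\<^esub> G Z"
proof -
  note Q = A_qsp[of r n] A_qsp[of k n] and BQ = A_qsp[of "r + k" n]
  have "tlift Ar Ak B (\<lambda>e f. (i0 y \<otimes>\<^bsub>B\<^esub> ik e) \<otimes>\<^bsub>B\<^esub> i0 f) Z = tlift Ar Ak B (\<lambda>e f. i0 y \<otimes>\<^bsub>B\<^esub> (ik e \<otimes>\<^bsub>B\<^esub> i0 f)) Z"
    by (rule tlift_cong[OF Q BQ Z])
      (intro B_assoc i0_closed[OF y] ik_closed i0_closed cls_closed[OF Q(1)] cls_closed[OF Q(2)] mon_in_vspan)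
  also have "\<dots> = i0 y \<otimes>\<^bsub>B\<^esub> G Z"
    unfolding glue_def
    by (rule tlift_push[OF Q BQ BQ palg_lmap_mult(1)[OF palg_A i0_closed[OF y]] Z, symmetric]) (intro B_closed ik_closed i0_closed)
  finally show ?thesis .
qed

private abbreviation (input) "gexpr i j a b \<equiv> scal ((-1) ^ (ipar a * ipar b) * qvar powi phi b a) (gen i a \<boxtimes> gen j b) +
           scal (of_bool (b < a) * xi) (gen i b \<boxtimes> gen j a) +
           scal (of_bool (-b < a) * (-1) ^ ipar a * xi) (gen i (-b) \<boxtimes> gen j (-a))"

text \<open>The prescribed value of \<Theta> on generators is the braiding of (b,a), and the relator
  for the rows j < k + i identifies its image under gluing with t_jb t_{k+i,a}. That it combines
  pairs of single letters is what the induction for uniqueness relies on.\<close>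

lemma gexpr:
  assumes ij: "i \<in> {1..int r}" "j \<in> {1..int k}" and ab: "a \<in> idx n" "b \<in> idx n"
  shows "gexpr i j a b \<in> vspan ((\<lambda>(l, l'). Tens (Word [l]) (Word [l'])) ` (Agens r n \<times> Agens k n))"
    and "G (cls (TA r k n) (gexpr i j a b)) = i0 (cls Ak (gen j b)) \<otimes>\<^bsub>B\<^esub> ik (cls Ar (gen i a))"
proof -
  let ?S = "(\<lambda>(l, l'). Tens (Word [l]) (Word [l'])) ` (Agens r n \<times> Agens k n)"
  have e: "gexpr i j a b = braid b a (\<lambda>c d. gen i c \<boxtimes> gen j d)" by (simp only: braid_def)
  have gA: "(i, c) \<in> Agens r n" "(j, c) \<in> Agens k n" if "c \<in> idx n" for c
    using that ij idx_positive by (auto simp: Agens_def)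
  show m: "gexpr i j a b \<in> vspan ?S"
    unfolding e
  proof (rule braid_mem[OF vec.subspace_span ab(2,1)])
    fix c d assume "c \<in> idx n" "d \<in> idx n"
    then show "gen i c \<boxtimes> gen j d \<in> vspan ?S" unfolding vtens_mon using gA by (intro mon_in_vspan) force
  qed
  have "?S \<subseteq> TM r k n" by (auto simp: A_bas)
  then have m': "gexpr i j a b \<in> vspan (TM r k n)" using m vec.span_mono[OF image_mono] by blast
  have i': "0 < i" "j < i + int k" using ij by auto
  have "rho j (i + int k) b a (\<lambda>z. wd ([] @ z @ [])) \<in> NA (r + k) n"
    using ij ab by (intro rho_mem_NA) auto
  then have "Gv k (gexpr i j a b) - wd [(j, b), (i + int k, a)] \<in> NA (r + k) n"
    unfolding e unfolding braid_vlin[OF vlin_Gv] unfolding vtens_mon Gv_mon using i' by (simp add: rho_def sh_pos)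
  then have "cls B (Gv k (gexpr i j a b)) = cls B (wd [(j, b), (i + int k, a)])"
    unfolding A_rels[symmetric] by (simp only: cls_eq_iff[OF A_qsp])
  also have "\<dots> = i0 (cls Ak (gen j b)) \<otimes>\<^bsub>B\<^esub> ik (cls Ar (gen i a))"
  proof -
    have w: "gen j b \<in> wspan (Agens k n)" "gen i a \<in> wspan (Agens r n)" using gA ab by (auto intro!: wd_wspan_set)
    have w': "iol 0 (gen j b) \<in> wspan (Agens (r + k) n)" "iol k (gen i a) \<in> wspan (Agens (r + k) n)"
      using iol_mem[OF w(1), of 0 "r + k"] iol_mem[OF w(2), of k "r + k"] by auto
    show ?thesis
      using iota_cls[OF w(1), of 0 "r + k"] iota_cls[OF w(2), of k "r + k"] A_mult[OF w'] i' by (simp add: sh_zero sh_pos)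
  qed
  finally show "G (cls (TA r k n) (gexpr i j a b)) = i0 (cls Ak (gen j b)) \<otimes>\<^bsub>B\<^esub> ik (cls Ar (gen i a))"
    unfolding glue_cls[OF m'] .
qed

lemma pure_gens:
  assumes "i \<in> {1..int r}" "j \<in> {1..int k}" "a \<in> idx n" "b \<in> idx n"
  shows "cls (TA k r n) (gen j b \<boxtimes> gen i a) = pure Ak Ar (cls Ak (gen j b)) (cls Ar (gen i a))"
  using assms idx_positive by (intro pure_cls[OF A_qsp A_qsp, symmetric]) (auto simp: A_bas intro!: gen_wspan)

text \<open>Under the injective gluing map the conditions on \<Theta> become unit laws,
  associativity and a relator in A_{r+k,n}. Conversely they fix the glued value on generators and,
  through the two hexagon identities, on all products.\<close>

lemma is_Theta_iff:
  "is_Theta n k r T \<longleftrightarrow> T \<in> carrier (TA k r n) \<rightarrow>\<^sub>E carrier (TA r k n) \<and> (\<forall>Z\<in>carrier (TA k r n). G (T Z) = swapglue n k r Z)"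
proof
  assume R: "T \<in> carrier (TA k r n) \<rightarrow>\<^sub>E carrier (TA r k n) \<and> (\<forall>Z\<in>carrier (TA k r n). G (T Z) = swapglue n k r Z)"
  have T: "T Z \<in> carrier (TA r k n)" "G (T Z) = swapglue n k r Z" if "Z \<in> carrier (TA k r n)" for Z using R that by auto
  note pc = pure_closed[OF A_qsp[of k n] A_qsp[of r n]] and pc' = pure_closed[OF A_qsp[of r n] A_qsp[of k n]]
  have Tp: "T (pure Ak Ar y x) \<in> carrier (TA r k n) \<and> G (T (pure Ak Ar y x)) = i0 y \<otimes>\<^bsub>B\<^esub> ik x" if "y \<in> carrier Ak" "x \<in> carrier Ar" for y x
    using T[OF pc[OF that]] swapglue_pure[OF that] by simp
  have one: "i0 \<one>\<^bsub>Ak\<^esub> = \<one>\<^bsub>B\<^esub>" "ik \<one>\<^bsub>Ar\<^esub> = \<one>\<^bsub>B\<^esub>" by (rule iota_one, simp)+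
  note oc = palg_one_closed[OF palg_A]
  have ikm: "ik (x \<otimes>\<^bsub>Ar\<^esub> x') = ik x \<otimes>\<^bsub>B\<^esub> ik x'" if "x \<in> carrier Ar" "x' \<in> carrier Ar" for x x'
    using iota_mult[of k r "r + k", OF _ that] by simp
  have i0m: "i0 (y \<otimes>\<^bsub>Ak\<^esub> y') = i0 y \<otimes>\<^bsub>B\<^esub> i0 y'" if "y \<in> carrier Ak" "y' \<in> carrier Ak" for y y'
    using iota_mult[of 0 k "r + k", OF _ that] by simp
  have hom: "supermodule_hom n (tensor n Ak Ar) (tensor n Ar Ak) T"
  proof (rule lift_supermodule_hom[OF _ _ A_qsp glue_hom swapglue_hom], unfold tensor_simps qsp_tensor)
    show "inj_on G (carrier (TA r k n))" by (rule inj_onI) (rule glue_inj)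
  qed (use T in \<open>auto intro: TA_qsp tensor_act_closed[OF A_qsp A_qsp _ _ A_act_closed A_act_closed]\<close>)
  show "is_Theta n k r T"
    unfolding is_Theta_def Let_def tensor_simps tlift_tensor
  proof (intro conjI ballI hom)
    show "T \<in> carrier (TA k r n) \<rightarrow>\<^sub>E carrier (TA r k n)" using R by blast
  next
    fix x assume x: "x \<in> carrier Ar"
    show "T (pure Ak Ar \<one>\<^bsub>Ak\<^esub> x) = pure Ar Ak x \<one>\<^bsub>Ak\<^esub>"
      by (rule glue_inj[OF conjunct1[OF Tp[OF oc x]] pc'[OF x oc]])
        (simp add: conjunct2[OF Tp[OF oc x]] glue_pure[OF x oc] one palg_unit[OF palg_A ik_closed[OF x]])
  next
    fix y assume y: "y \<in> carrier Ak"
    show "T (pure Ak Ar y \<one>\<^bsub>Ar\<^esub>) = pure Ar Ak \<one>\<^bsub>Ar\<^esub> y"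
      by (rule glue_inj[OF conjunct1[OF Tp[OF y oc]] pc'[OF oc y]])
        (simp add: conjunct2[OF Tp[OF y oc]] glue_pure[OF oc y] one palg_unit[OF palg_A i0_closed[OF y]])
  next
    fix i j a b assume ij: "i \<in> {1..int r}" "j \<in> {1..int k}" and ab: "a \<in> idx n" "b \<in> idx n"
    have c: "cls Ak (gen j b) \<in> carrier Ak" "cls Ar (gen i a) \<in> carrier Ar"
      using ij ab idx_positive by (auto intro!: A_closed gen_wspan)
    have S: "(\<lambda>(l, l'). Tens (Word [l]) (Word [l'])) ` (Agens r n \<times> Agens k n) \<subseteq> TM r k n" by (auto simp: A_bas)
    have m: "gexpr i j a b \<in> vspan (TM r k n)"
      using gexpr(1)[OF ij ab] vec.span_mono[OF image_mono[OF S]] by blast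
    have "T (cls (TA k r n) (gen j b \<boxtimes> gen i a)) = cls (TA r k n) (gexpr i j a b)"
      unfolding pure_gens[OF ij ab]
      by (rule glue_inj[OF conjunct1[OF Tp[OF c]] cls_closed[OF TA_qsp]])
        (simp only: tspace_simps m, simp only: conjunct2[OF Tp[OF c]] gexpr(2)[OF ij ab])
    then show "T (coset (trels Ak Ar) (gen j b \<boxtimes> gen i a)) = coset (trels Ar Ak) (gexpr i j a b)"
      by (simp only: tspace_simps)
  next
    fix y x x' assume y: "y \<in> carrier Ak" and x: "x \<in> carrier Ar" "x' \<in> carrier Ar"
    let ?R = "tlift Ar Ak (TA r k n)
          (\<lambda>e f. tlift Ar Ak (TA r k n) (\<lambda>e' f'. pure Ar Ak (e \<otimes>\<^bsub>Ar\<^esub> e') f') (T (pure Ak Ar f x'))) (T (pure Ak Ar y x))"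
    have h: "?R \<in> carrier (TA r k n)" "G ?R = G (T (pure Ak Ar y x)) \<otimes>\<^bsub>B\<^esub> ik x'"
      by (rule hexagon_right[where T = T and x' = x', OF Tp[OF _ x(2)] conjunct1[OF Tp[OF y x(1)]] x(2)], assumption)+
    show "T (pure Ak Ar y (x \<otimes>\<^bsub>Ar\<^esub> x')) = ?R"
      by (rule glue_inj[OF conjunct1[OF Tp[OF y palg_mult_closed[OF palg_A x]]] h(1)])
        (simp only: h(2) conjunct2[OF Tp[OF y palg_mult_closed[OF palg_A x]]] conjunct2[OF Tp[OF y x(1)]]
          ikm[OF x] B_assoc[OF i0_closed[OF y] ik_closed[OF x(1)] ik_closed[OF x(2)]])
  next
    fix y y' x assume y: "y \<in> carrier Ak" "y' \<in> carrier Ak" and x: "x \<in> carrier Ar"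
    note Z = Tp[OF y(2) x]
    let ?R = "tlift Ar Ak (TA r k n)
          (\<lambda>e f. tlift Ar Ak (TA r k n) (\<lambda>e' f'. pure Ar Ak e' (f' \<otimes>\<^bsub>Ak\<^esub> f)) (T (pure Ak Ar y e))) (T (pure Ak Ar y' x))"
    have h: "?R \<in> carrier (TA r k n)"
      "G ?R = tlift Ar Ak B (\<lambda>e f. G (T (pure Ak Ar y e)) \<otimes>\<^bsub>B\<^esub> i0 f) (T (pure Ak Ar y' x))"
      by (rule hexagon_left[where T = T and y = y, OF conjunct1[OF Tp[OF y(1)]] conjunct1[OF Z]], assumption)+
    have "tlift Ar Ak B (\<lambda>e f. G (T (pure Ak Ar y e)) \<otimes>\<^bsub>B\<^esub> i0 f) (T (pure Ak Ar y' x))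
      = tlift Ar Ak B (\<lambda>e f. (i0 y \<otimes>\<^bsub>B\<^esub> ik e) \<otimes>\<^bsub>B\<^esub> i0 f) (T (pure Ak Ar y' x))"
      by (rule tlift_cong[OF A_qsp A_qsp A_qsp conjunct1[OF Z]]) (simp only: conjunct2[OF Tp[OF y(1) cls_closed[OF A_qsp mon_in_vspan]]])
    also have "\<dots> = i0 y \<otimes>\<^bsub>B\<^esub> G (T (pure Ak Ar y' x))" by (rule i0_mult_glue[OF y(1) conjunct1[OF Z]])
    finally have *: "tlift Ar Ak B (\<lambda>e f. G (T (pure Ak Ar y e)) \<otimes>\<^bsub>B\<^esub> i0 f) (T (pure Ak Ar y' x)) = i0 y \<otimes>\<^bsub>B\<^esub> G (T (pure Ak Ar y' x))" .
    show "T (pure Ak Ar (y \<otimes>\<^bsub>Ak\<^esub> y') x) = ?R"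
      by (rule glue_inj[OF conjunct1[OF Tp[OF palg_mult_closed[OF palg_A y] x]] h(1)])
        (simp only: h(2) * conjunct2[OF Tp[OF palg_mult_closed[OF palg_A y] x]] conjunct2[OF Z] i0m[OF y]
          B_assoc[OF i0_closed[OF y(1)] i0_closed[OF y(2)] ik_closed[OF x]])
  qed
next
  assume R: "is_Theta n k r T"
  have PE: "T \<in> carrier (TA k r n) \<rightarrow>\<^sub>E carrier (TA r k n)"
    and lT: "lmap (TA k r n) (TA r k n) T"
    and C3: "\<And>x. x \<in> carrier Ar \<Longrightarrow> T (pure Ak Ar \<one>\<^bsub>Ak\<^esub> x) = pure Ar Ak x \<one>\<^bsub>Ak\<^esub>"
    and C4: "\<And>y. y \<in> carrier Ak \<Longrightarrow> T (pure Ak Ar y \<one>\<^bsub>Ar\<^esub>) = pure Ar Ak \<one>\<^bsub>Ar\<^esub> y"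
    and C5: "\<And>i j a b. i \<in> {1..int r} \<Longrightarrow> j \<in> {1..int k} \<Longrightarrow> a \<in> idx n \<Longrightarrow> b \<in> idx n \<Longrightarrow>
        T (cls (TA k r n) (gen j b \<boxtimes> gen i a)) = cls (TA r k n) (gexpr i j a b)"
    and C6: "\<And>y x x'. y \<in> carrier Ak \<Longrightarrow> x \<in> carrier Ar \<Longrightarrow> x' \<in> carrier Ar \<Longrightarrow> T (pure Ak Ar y (x \<otimes>\<^bsub>Ar\<^esub> x')) = tlift Ar Ak (TA r k n)
          (\<lambda>e f. tlift Ar Ak (TA r k n) (\<lambda>e' f'. pure Ar Ak (e \<otimes>\<^bsub>Ar\<^esub> e') f') (T (pure Ak Ar f x'))) (T (pure Ak Ar y x))"
    and C7: "\<And>y y' x. y \<in> carrier Ak \<Longrightarrow> y' \<in> carrier Ak \<Longrightarrow> x \<in> carrier Ar \<Longrightarrow> T (pure Ak Ar (y \<otimes>\<^bsub>Ak\<^esub> y') x) = tlift Ar Ak (TA r k n)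
          (\<lambda>e f. tlift Ar Ak (TA r k n) (\<lambda>e' f'. pure Ar Ak e' (f' \<otimes>\<^bsub>Ak\<^esub> f)) (T (pure Ak Ar y e))) (T (pure Ak Ar y' x))"
    using R unfolding is_Theta_def Let_def supermodule_hom_def even_linear_iff
    by (simp_all only: tensor_simps tlift_tensor lmap_tensor_left lmap_tensor_right tspace_simps)
  note pc = pure_closed[OF A_qsp[of k n] A_qsp[of r n]]
  note Q = A_qsp[of r n] A_qsp[of k n] and BQ = A_qsp[of "r + k" n]
  have Tc: "T (pure Ak Ar y x) \<in> carrier (TA r k n)" if "y \<in> carrier Ak" "x \<in> carrier Ar" for y x
    by (rule lmapD(1)[OF lT pc[OF that]])
  let ?Q = "\<lambda>y x. G (T (pure Ak Ar y x)) = i0 y \<otimes>\<^bsub>B\<^esub> ik x"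
  have one: "i0 \<one>\<^bsub>Ak\<^esub> = \<one>\<^bsub>B\<^esub>" "ik \<one>\<^bsub>Ar\<^esub> = \<one>\<^bsub>B\<^esub>" by (rule iota_one, simp)+
  note oc = palg_one_closed[OF palg_A]
  have Q1: "?Q \<one>\<^bsub>Ak\<^esub> x" if x: "x \<in> carrier Ar" for x
    using C3[OF x] glue_pure[OF x oc[of k n]] palg_unit[OF palg_A ik_closed[OF x]] one by simp
  have Q1': "?Q y \<one>\<^bsub>Ar\<^esub>" if y: "y \<in> carrier Ak" for y
    using C4[OF y] glue_pure[OF oc[of r n] y] palg_unit[OF palg_A i0_closed[OF y]] one by simp
  have nrmc: "cls (A r' n) (wd [l]) = cls (A r' n) (wd [nrm l])" if "l \<in> Agens r' n" for r' l
    using letter_nrm_NA[OF that, of "[]" "[]"] unfolding A_rels[symmetric] by (simp add: cls_eq_iff[OF A_qsp])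
  let ?S = "(\<lambda>(l, l'). Tens (Word [l]) (Word [l'])) ` (Agens r n \<times> Agens k n)"
  have lett: "?Q (cls Ak (wd [l'])) (cls Ar (wd [l])) \<and> (\<exists>z\<in>vspan ?S. T (pure Ak Ar (cls Ak (wd [l'])) (cls Ar (wd [l]))) = cls (TA r k n) z)"
    if l: "l \<in> Agens r n" "l' \<in> Agens k n" for l l'
  proof -
    obtain i a j b where n: "nrm l = (i, a)" "nrm l' = (j, b)" by force
    then have ij: "i \<in> {1..int r}" "j \<in> {1..int k}" "a \<in> idx n" "b \<in> idx n"
      using nrm_idx[OF l(1)] nrm_idx[OF l(2)] by auto
    show ?thesis
      unfolding nrmc[OF l(1)] nrmc[OF l(2)] n pure_gens[OF ij, symmetric] C5[OF ij]
      using gexpr[OF ij] by blast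
  qed
  have gc: "cls (A r' n) (wd w) \<in> carrier (A r' n)" if "w \<in> lists (Agens r' n)" for r' w
    by (rule A_closed[OF wd_wspan[OF that]])
  have Sb: "?S \<subseteq> bas (TA r k n)" by (auto simp: A_bas)
  \<comment> \<open>The word y is built up from the right: once its last letter has been braided
    with \<open>l\<close>, the result combines pairs of single letters by \<open>lett\<close>, so
    only single letters meet the rest of y and the induction hypothesis covers them.\<close>
  have U2: "?Q (cls Ak (wd y)) (cls Ar (wd [l]))" if "y \<in> lists (Agens k n)" "l \<in> Agens r n" for y l
    using that
  proof (induction y arbitrary: l rule: rev_induct)
    case Nil
    show ?case using Q1[OF gc[of "[l]"]] Nil.prems(2) by (simp add: palg_one[OF palg_A])
  next
    case (snoc l' y)
    have y: "y \<in> lists (Agens k n)" and l': "[l'] \<in> lists (Agens k n)" "l' \<in> Agens k n" and l: "[l] \<in> lists (Agens r n)" "l \<in> Agens r n"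
      using snoc.prems by auto
    let ?y = "cls Ak (wd y)" and ?l' = "cls Ak (wd [l'])" and ?l = "cls Ar (wd [l])"
    have yl: "cls Ak (wd (y @ [l'])) = ?y \<otimes>\<^bsub>Ak\<^esub> ?l'"
      using A_mult[OF wd_wspan[OF y] wd_wspan[OF l'(1)]] by simp
    let ?Z = "T (pure Ak Ar ?l' ?l)"
    have Z: "?Z \<in> carrier (TA r k n)" by (rule Tc[OF gc[OF l'(1)] gc[OF l(1)]])
    obtain z where z: "z \<in> vspan ?S" "?Z = cls (TA r k n) z" using lett[OF l(2) l'(2)] by blast
    have ly: "lmap Ar B (\<lambda>e. G (T (pure Ak Ar ?y e)))"
      using bil_pure[OF Q(2,1)] gc[OF y] unfolding bil_def[OF Q(2,1)]
      by (intro lmap_comp[OF lmap_comp[OF _ lT] glue_lmap]) blast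
    have ly': "lmap Ar B (\<lambda>e. i0 ?y \<otimes>\<^bsub>B\<^esub> ik e)"
      by (rule lmap_comp[OF ik_lmap palg_lmap_mult(1)[OF palg_A i0_closed[OF gc[OF y]]]])
    note b1 = bil_comp[OF BQ BQ Q palg_bil_mult[OF palg_A] ly i0_lmap] and b2 = bil_comp[OF BQ BQ Q palg_bil_mult[OF palg_A] ly' i0_lmap]
    have "G (T (pure Ak Ar (?y \<otimes>\<^bsub>Ak\<^esub> ?l') ?l)) = tlift Ar Ak B (\<lambda>e f. G (T (pure Ak Ar ?y e)) \<otimes>\<^bsub>B\<^esub> i0 f) ?Z"
      unfolding C7[OF gc[OF y] gc[OF l'(1)] gc[OF l(1)]] by (rule hexagon_left(2)[where T = T and y = ?y, OF Tc[OF gc[OF y]] Z])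
    also have "\<dots> = tlift Ar Ak B (\<lambda>e f. (i0 ?y \<otimes>\<^bsub>B\<^esub> ik e) \<otimes>\<^bsub>B\<^esub> i0 f) ?Z"
      unfolding z(2)
    proof (rule lmap_agree[OF TA_qsp BQ lmap_tlift[OF Q BQ b1] lmap_tlift[OF Q BQ b2] z(1) Sb])
      fix t assume "t \<in> ?S"
      then obtain p p' where t: "t = Tens (Word [p]) (Word [p'])" "p \<in> Agens r n" "p' \<in> Agens k n" by auto
      have p: "[p] \<in> lists (Agens r n)" "[p'] \<in> lists (Agens k n)" using t by auto
      have "cls (TA r k n) (mon t) = pure Ar Ak (cls Ar (wd [p])) (cls Ak (wd [p']))"
        unfolding t(1) using p by (intro pure_mon[OF Q, symmetric]) (auto simp: A_bas)
      then show "tlift Ar Ak B (\<lambda>e f. G (T (pure Ak Ar ?y e)) \<otimes>\<^bsub>B\<^esub> i0 f) (cls (TA r k n) (mon t))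
        = tlift Ar Ak B (\<lambda>e f. (i0 ?y \<otimes>\<^bsub>B\<^esub> ik e) \<otimes>\<^bsub>B\<^esub> i0 f) (cls (TA r k n) (mon t))"
        using tlift_pure[OF Q BQ b1 gc[OF p(1)] gc[OF p(2)]] tlift_pure[OF Q BQ b2 gc[OF p(1)] gc[OF p(2)]] snoc.IH[OF y t(2)]
        by simp
    qed
    also have "\<dots> = i0 ?y \<otimes>\<^bsub>B\<^esub> G ?Z" by (rule i0_mult_glue[OF gc[OF y] Z])
    also have "\<dots> = i0 (?y \<otimes>\<^bsub>Ak\<^esub> ?l') \<otimes>\<^bsub>B\<^esub> ik ?l"
      using lett[OF l(2) l'(2)] iota_mult[of 0 k "r + k", OF _ gc[OF y] gc[OF l'(1)]]
        B_assoc[OF i0_closed[OF gc[OF y]] i0_closed[OF gc[OF l'(1)]] ik_closed[OF gc[OF l(1)]]] by simp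
    finally show ?case unfolding yl .
  qed
  have bp: "lmap Ak (TA k r n) (\<lambda>y. pure Ak Ar y x)" if "x \<in> carrier Ar" for x
    using bil_pure[OF Q(2,1)] that unfolding bil_def[OF Q(2,1)] by blast
  have U3: "?Q y (cls Ar (wd [l]))" if l: "l \<in> Agens r n" and y: "y \<in> carrier Ak" for y l
  proof (rule lmap_ext[OF Q(2) BQ _ _ _ y])
    have c: "cls Ar (wd [l]) \<in> carrier Ar" using l by (intro gc) simp
    show "lmap Ak B (\<lambda>y. G (T (pure Ak Ar y (cls Ar (wd [l])))))" by (rule lmap_comp[OF lmap_comp[OF bp[OF c] lT] glue_lmap])
    show "lmap Ak B (\<lambda>y. i0 y \<otimes>\<^bsub>B\<^esub> ik (cls Ar (wd [l])))" by (rule lmap_comp[OF i0_lmap palg_lmap_mult(2)[OF palg_A ik_closed[OF c]]])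
    fix t assume "t \<in> bas Ak"
    then obtain w where "t = Word w" "w \<in> lists (Agens k n)" unfolding A_bas by blast
    then show "?Q (cls Ak (mon t)) (cls Ar (wd [l]))" using U2 l by blast
  qed
  \<comment> \<open>The statement keeps y arbitrary, because braiding y with the first letter of x
    leaves arbitrary elements to meet the tail of x.\<close>
  have U4: "\<forall>y\<in>carrier Ak. ?Q y (cls Ar (wd x))" if "x \<in> lists (Agens r n)" for x
    using that
  proof (induction x)
    case Nil
    show ?case using Q1' by (simp add: palg_one[OF palg_A])
  next
    case (Cons l x)
    show ?case
    proof
      fix y assume y: "y \<in> carrier Ak"
      have l: "[l] \<in> lists (Agens r n)" using Cons.hyps by simp
      let ?l = "cls Ar (wd [l])" and ?x = "cls Ar (wd x)"
      note lx = gc[OF l] gc[OF Cons.hyps(2)]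
      have e: "cls Ar (wd (l # x)) = ?l \<otimes>\<^bsub>Ar\<^esub> ?x"
        using A_mult[OF wd_wspan[OF l] wd_wspan[OF Cons.hyps(2)]] by simp
      have hyp: "T (pure Ak Ar h ?x) \<in> carrier (TA r k n) \<and> ?Q h ?x" if "h \<in> carrier Ak" for h
        using Tc[OF that lx(2)] bspec[OF Cons.IH that] by (rule conjI)
      have "G (T (pure Ak Ar y (?l \<otimes>\<^bsub>Ar\<^esub> ?x))) = G (T (pure Ak Ar y ?l)) \<otimes>\<^bsub>B\<^esub> ik ?x"
        unfolding C6[OF y lx]
        by (rule hexagon_right(2)[where T = T and x' = ?x, OF hyp Tc[OF y lx(1)] lx(2)])
      also have "\<dots> = i0 y \<otimes>\<^bsub>B\<^esub> ik (?l \<otimes>\<^bsub>Ar\<^esub> ?x)"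
        using U3[OF Cons.hyps(1) y] iota_mult[of k r "r + k", OF _ lx] B_assoc[OF i0_closed[OF y] ik_closed[OF lx(1)] ik_closed[OF lx(2)]] by simp
      finally show "?Q y (cls Ar (wd (l # x)))" unfolding e .
    qed
  qed
  have "G (T Z) = swapglue n k r Z" if Z: "Z \<in> carrier (TA k r n)" for Z
  proof (rule tspace_ext[OF Q(2,1) BQ lmap_comp[OF lT glue_lmap] swapglue_lmap Z])
    fix a b assume "a \<in> bas Ak" "b \<in> bas Ar"
    then obtain v w where vw: "a = Word v" "b = Word w" "v \<in> lists (Agens k n)" "w \<in> lists (Agens r n)" unfolding A_bas by blast
    show "G (T (pure Ak Ar (cls Ak (mon a)) (cls Ar (mon b)))) = swapglue n k r (pure Ak Ar (cls Ak (mon a)) (cls Ar (mon b)))"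
      unfolding vw(1,2) swapglue_pure[OF gc[OF vw(3)] gc[OF vw(4)]] by (rule bspec[OF U4[OF vw(4)] gc[OF vw(3)]])
  qed
  with PE show "T \<in> carrier (TA k r n) \<rightarrow>\<^sub>E carrier (TA r k n) \<and> (\<forall>Z\<in>carrier (TA k r n). G (T Z) = swapglue n k r Z)" by blast
qed

lemma is_Theta_Theta: "is_Theta n k r (Theta n k r)"
proof -
  \<comment> \<open>The restriction makes the map extensional, as \<open>is_Theta\<close>
    demands.\<close>
  let ?T = "\<lambda>Z\<in>carrier (TA k r n). inv_into (carrier (TA r k n)) G (swapglue n k r Z)"
  have im: "G ` carrier (TA r k n) = carrier B" using glue_bij[of n r k] by (simp add: bij_betw_def)
  have "is_Theta n k r ?T"
    unfolding is_Theta_iff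
    using lmapD(1)[OF swapglue_lmap] im by (auto intro!: inv_into_into f_inv_into_f)
  moreover have "T = T'" if "is_Theta n k r T" "is_Theta n k r T'" for T T'
  proof -
    have 1: "T \<in> carrier (TA k r n) \<rightarrow>\<^sub>E carrier (TA r k n)" "T' \<in> carrier (TA k r n) \<rightarrow>\<^sub>E carrier (TA r k n)"
      and 2: "\<forall>Z\<in>carrier (TA k r n). G (T Z) = swapglue n k r Z" "\<forall>Z\<in>carrier (TA k r n). G (T' Z) = swapglue n k r Z"
      using that unfolding is_Theta_iff by blast+
    show ?thesis
    proof (rule PiE_ext[OF 1])
      fix Z assume Z: "Z \<in> carrier (TA k r n)"
      show "T Z = T' Z"
        by (rule glue_inj[OF PiE_mem[OF 1(1) Z] PiE_mem[OF 1(2) Z]]) (use 2 Z in simp)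
    qed
  qed
  ultimately show ?thesis unfolding Theta_def by (metis theI)
qed

lemma Theta_closed: "Z \<in> carrier (TA k r n) \<Longrightarrow> Theta n k r Z \<in> carrier (TA r k n)"
  and glue_Theta: "Z \<in> carrier (TA k r n) \<Longrightarrow> G (Theta n k r Z) = swapglue n k r Z"
  using is_Theta_Theta unfolding is_Theta_iff by auto

end

section \<open>Transport of structure\<close>

text \<open>Each axiom for P is an equation between elements of its carrier, which the injective f
  turns into the same axiom in B; homogeneity is reflected by \<open>homog_reflect\<close>. In this
  way associativity of the braided product is inherited from A_{m,n}.\<close>

lemma transport_supermodule_superalgebra:
  fixes P :: "('p) uspace_scheme" and B :: "('b) uspace_scheme"
  assumes P: "qsp P" and B: "qsp B" and f: "supermodule_hom n P B f" and bij: "bij_betw f (carrier P) (carrier B)"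
    and mc: "\<And>x y. x \<in> carrier P \<Longrightarrow> y \<in> carrier P \<Longrightarrow> x \<otimes>\<^bsub>P\<^esub> y \<in> carrier P"
    and fm: "\<And>x y. x \<in> carrier P \<Longrightarrow> y \<in> carrier P \<Longrightarrow> f (x \<otimes>\<^bsub>P\<^esub> y) = f x \<otimes>\<^bsub>B\<^esub> f y"
    and oc: "\<one>\<^bsub>P\<^esub> \<in> carrier P" and fo: "f \<one>\<^bsub>P\<^esub> = \<one>\<^bsub>B\<^esub>"
    and ac: "\<And>u x. u \<in> carrier (Uq n) \<Longrightarrow> x \<in> carrier P \<Longrightarrow> act P u x \<in> carrier P"
    and lm: "\<And>x. x \<in> carrier B \<Longrightarrow> lmap B B (\<lambda>y. x \<otimes>\<^bsub>B\<^esub> y)"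
    and ssa: "supermodule_superalgebra n B"
  shows "supermodule_superalgebra n P" "f \<in> ring_iso P B"
proof -
  have lf: "lmap P B f" and ef: "even_linear P B f" and hf: "\<forall>p\<in>{0, 1}. f \<in> homog P p \<rightarrow> homog B p"
    and fact: "\<And>u x. u \<in> carrier (Uq n) \<Longrightarrow> x \<in> carrier P \<Longrightarrow> f (act P u x) = act B u (f x)"
    using f by (simp_all add: supermodule_hom_def even_linear_iff)
  note fc = lmapD(1)[OF lf] and fa = lmapD(2)[OF lf] and fs = lmapD(3)[OF lf]
  have inj: "inj_on f (carrier P)" using bij by (rule bij_betw_imp_inj_on)
  have eq: "x = y" if "x \<in> carrier P" "y \<in> carrier P" "f x = f y" for x y using inj_onD[OF inj that(3,1,2)] .
  note cl = mc ac qsp_add_closed[OF P] qsp_smult_closed[OF P] oc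
  have hb: "f x \<in> homog B p" if "p \<in> {0, 1}" "x \<in> homog P p" for x p
    by (rule funcset_mem[OF bspec[OF hf that(1)] that(2)])
  have hr: "Z \<in> homog P p" if p: "p \<in> {0, 1}" and Z: "Z \<in> carrier P" and fZ: "f Z \<in> homog B p" for Z p
    using fZ
    by (rule homog_reflect[OF P qsp_superspace[OF B] zero_homog[OF B] zero_homog[OF B] _ lmap_zero[OF P B lf] ef inj p Z, rotated])
      (rule add_zero[OF B])
  have hc: "x \<in> carrier P" if "x \<in> homog P p" for x p using that homog_carrier[OF P] by blast
  have m2: "(p + p') mod 2 \<in> {0, 1}" for p p' :: nat by (cases "even (p + p')") (auto simp: even_iff_mod_2_eq_zero odd_iff_mod_2_eq_one)
  have sa: "superalgebra B" and sm: "supermodule n B"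
    and counit: "\<And>u. u \<in> carrier (Uq n) \<Longrightarrow> act B u \<one>\<^bsub>B\<^esub> = counit u \<odot>\<^bsub>B\<^esub> \<one>\<^bsub>B\<^esub>"
    using ssa by (simp_all add: supermodule_superalgebra_def)
  have rB: "ring B" and o0: "\<one>\<^bsub>B\<^esub> \<in> homog B 0"
    and sml: "\<And>c x y. x \<in> carrier B \<Longrightarrow> y \<in> carrier B \<Longrightarrow> (c \<odot>\<^bsub>B\<^esub> x) \<otimes>\<^bsub>B\<^esub> y = c \<odot>\<^bsub>B\<^esub> (x \<otimes>\<^bsub>B\<^esub> y)"
    and smr: "\<And>c x y. x \<in> carrier B \<Longrightarrow> y \<in> carrier B \<Longrightarrow> x \<otimes>\<^bsub>B\<^esub> (c \<odot>\<^bsub>B\<^esub> y) = c \<odot>\<^bsub>B\<^esub> (x \<otimes>\<^bsub>B\<^esub> y)"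
    using sa unfolding superalgebra_def by blast+
  interpret B: ring B by (rule rB)
  have rP: "ring P"
  proof (rule ringI)
    show "abelian_group P" using qsp_module[OF P] by (rule module.axioms(2))
    show "monoid P"
    proof (rule monoidI)
      fix x y z assume x: "x \<in> carrier P" "y \<in> carrier P" "z \<in> carrier P"
      show "x \<otimes>\<^bsub>P\<^esub> y \<otimes>\<^bsub>P\<^esub> z = x \<otimes>\<^bsub>P\<^esub> (y \<otimes>\<^bsub>P\<^esub> z)"
        by (rule eq) (simp_all add: x cl fm fc B.m_assoc)
    next
      fix x assume x: "x \<in> carrier P"
      show "\<one>\<^bsub>P\<^esub> \<otimes>\<^bsub>P\<^esub> x = x" by (rule eq) (simp_all add: x cl fm fc fo)
      show "x \<otimes>\<^bsub>P\<^esub> \<one>\<^bsub>P\<^esub> = x" by (rule eq) (simp_all add: x cl fm fc fo)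
    qed (rule mc oc; assumption)+
  next
    fix x y z assume x: "x \<in> carrier P" "y \<in> carrier P" "z \<in> carrier P"
    show "(x \<oplus>\<^bsub>P\<^esub> y) \<otimes>\<^bsub>P\<^esub> z = x \<otimes>\<^bsub>P\<^esub> z \<oplus>\<^bsub>P\<^esub> y \<otimes>\<^bsub>P\<^esub> z"
      by (rule eq) (simp_all add: x cl fm fa fc B.l_distr)
    show "z \<otimes>\<^bsub>P\<^esub> (x \<oplus>\<^bsub>P\<^esub> y) = z \<otimes>\<^bsub>P\<^esub> x \<oplus>\<^bsub>P\<^esub> z \<otimes>\<^bsub>P\<^esub> y"
      by (rule eq) (simp_all add: x cl fm fa fc B.r_distr)
  qed
  have saP: "superalgebra P"
    unfolding superalgebra_def
  proof (intro conjI allI ballI qsp_superspace[OF P] rP)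
    fix c x y assume x: "x \<in> carrier P" "y \<in> carrier P"
    show "(c \<odot>\<^bsub>P\<^esub> x) \<otimes>\<^bsub>P\<^esub> y = c \<odot>\<^bsub>P\<^esub> (x \<otimes>\<^bsub>P\<^esub> y)"
      by (rule eq) (simp_all add: x cl fm fs fc sml)
    show "x \<otimes>\<^bsub>P\<^esub> (c \<odot>\<^bsub>P\<^esub> y) = c \<odot>\<^bsub>P\<^esub> (x \<otimes>\<^bsub>P\<^esub> y)"
      by (rule eq) (simp_all add: x cl fm fs fc smr)
  next
    show "\<one>\<^bsub>P\<^esub> \<in> homog P 0" by (rule hr) (simp_all add: oc fo o0)
  next
    fix p p' :: nat and x y assume p: "p \<in> {0, 1}" "p' \<in> {0, 1}" and x: "x \<in> homog P p" "y \<in> homog P p'"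
    show "x \<otimes>\<^bsub>P\<^esub> y \<in> homog P ((p + p') mod 2)"
      by (rule hr[OF m2 mc[OF hc[OF x(1)] hc[OF x(2)]]], unfold fm[OF hc[OF x(1)] hc[OF x(2)]])
        (rule ssaD(3)[OF ssa p hb[OF p(1) x(1)] hb[OF p(2) x(2)]])
  qed
  note UQ = palg_qsp[OF palg_Uq[of n]]
  have Uadd: "u \<oplus>\<^bsub>Uq n\<^esub> v \<in> carrier (Uq n)" "c \<odot>\<^bsub>Uq n\<^esub> u \<in> carrier (Uq n)" "u \<otimes>\<^bsub>Uq n\<^esub> v \<in> carrier (Uq n)" "\<one>\<^bsub>Uq n\<^esub> \<in> carrier (Uq n)"
    if "u \<in> carrier (Uq n)" "v \<in> carrier (Uq n)" for u v c
    using that by (auto intro: qsp_add_closed[OF UQ] qsp_smult_closed[OF UQ] palg_mult_closed[OF palg_Uq] palg_one_closed[OF palg_Uq])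
  have U1: "\<one>\<^bsub>Uq n\<^esub> \<in> carrier (Uq n)" by (rule palg_one_closed[OF palg_Uq])
  have sm1: "\<And>u x y. u \<in> carrier (Uq n) \<Longrightarrow> x \<in> carrier B \<Longrightarrow> y \<in> carrier B \<Longrightarrow> act B u (x \<oplus>\<^bsub>B\<^esub> y) = act B u x \<oplus>\<^bsub>B\<^esub> act B u y"
    and sm2: "\<And>u v x. u \<in> carrier (Uq n) \<Longrightarrow> v \<in> carrier (Uq n) \<Longrightarrow> x \<in> carrier B \<Longrightarrow> act B (u \<oplus>\<^bsub>Uq n\<^esub> v) x = act B u x \<oplus>\<^bsub>B\<^esub> act B v x"
    and sm3: "\<And>c u x. u \<in> carrier (Uq n) \<Longrightarrow> x \<in> carrier B \<Longrightarrow> act B u (c \<odot>\<^bsub>B\<^esub> x) = c \<odot>\<^bsub>B\<^esub> act B u x"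
    and sm4: "\<And>c u x. u \<in> carrier (Uq n) \<Longrightarrow> x \<in> carrier B \<Longrightarrow> act B (c \<odot>\<^bsub>Uq n\<^esub> u) x = c \<odot>\<^bsub>B\<^esub> act B u x"
    and sm5: "\<And>x. x \<in> carrier B \<Longrightarrow> act B \<one>\<^bsub>Uq n\<^esub> x = x"
    and sm6: "\<And>u v x. u \<in> carrier (Uq n) \<Longrightarrow> v \<in> carrier (Uq n) \<Longrightarrow> x \<in> carrier B \<Longrightarrow> act B (u \<otimes>\<^bsub>Uq n\<^esub> v) x = act B u (act B v x)"
    and sm7: "\<And>p p' u x. p \<in> {0, 1} \<Longrightarrow> p' \<in> {0, 1} \<Longrightarrow> u \<in> homog (Uq n) p \<Longrightarrow> x \<in> homog B p' \<Longrightarrow> act B u x \<in> homog B ((p + p') mod 2)"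
    using sm unfolding supermodule_def by metis+
  have smP: "supermodule n P"
    unfolding supermodule_def
  proof (intro conjI allI ballI qsp_superspace[OF P] ac)
    fix u x y assume x: "u \<in> carrier (Uq n)" "x \<in> carrier P" "y \<in> carrier P"
    show "act P u (x \<oplus>\<^bsub>P\<^esub> y) = act P u x \<oplus>\<^bsub>P\<^esub> act P u y"
      by (rule eq) (simp_all add: x cl fact fa fc sm1)
  next
    fix u v x assume x: "u \<in> carrier (Uq n)" "v \<in> carrier (Uq n)" "x \<in> carrier P"
    show "act P (u \<oplus>\<^bsub>Uq n\<^esub> v) x = act P u x \<oplus>\<^bsub>P\<^esub> act P v x"
      by (rule eq) (simp_all add: x cl Uadd fact fa fc sm2)
    show "act P (u \<otimes>\<^bsub>Uq n\<^esub> v) x = act P u (act P v x)"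
      by (rule eq) (simp_all add: x cl Uadd fact fc sm6)
  next
    fix c u x assume x: "u \<in> carrier (Uq n)" "x \<in> carrier P"
    show "act P u (c \<odot>\<^bsub>P\<^esub> x) = c \<odot>\<^bsub>P\<^esub> act P u x"
      by (rule eq) (simp_all add: x cl fact fs fc sm3)
    show "act P (c \<odot>\<^bsub>Uq n\<^esub> u) x = c \<odot>\<^bsub>P\<^esub> act P u x"
      by (rule eq) (simp_all add: x cl Uadd(2)[OF x(1) x(1)] fact fs fc sm4)
  next
    fix x assume x: "x \<in> carrier P"
    show "act P \<one>\<^bsub>Uq n\<^esub> x = x" by (rule eq) (simp_all add: x cl U1 fact fc sm5)
  next
    fix p p' :: nat and u x assume p: "p \<in> {0, 1}" "p' \<in> {0, 1}" and u: "u \<in> homog (Uq n) p" and x: "x \<in> homog P p'"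
    have uc: "u \<in> carrier (Uq n)" using u homog_carrier[OF UQ] by blast
    show "act P u x \<in> homog P ((p + p') mod 2)"
      by (rule hr[OF m2 ac[OF uc hc[OF x]]], unfold fact[OF uc hc[OF x]]) (rule sm7[OF p u hb[OF p(2) x]])
  qed
  show "supermodule_superalgebra n P"
    unfolding supermodule_superalgebra_def
  proof (intro conjI ballI saP smP)
    fix u and p :: nat and a b assume u: "u \<in> carrier (Uq n)" and p: "p \<in> {0, 1}" and a: "a \<in> homog P p" and b: "b \<in> carrier P"
    note ac' = hc[OF a] and C = comult_carrier[OF u]
    let ?h = "\<lambda>m1 m2. scal ((-1) ^ (par m2 * p)) (rep (act P (cls (Uq n) (mon m1)) a \<otimes>\<^bsub>P\<^esub> act P (cls (Uq n) (mon m2)) b))"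
    let ?k = "\<lambda>m1 m2. scal ((-1) ^ (par m2 * p)) (rep (act B (cls (Uq n) (mon m1)) (f a) \<otimes>\<^bsub>B\<^esub> act B (cls (Uq n) (mon m2)) (f b)))"
    have Um: "cls (Uq n) (mon m) \<in> carrier (Uq n)" if "m \<in> bas (Uq n)" for m
      by (rule cls_closed[OF UQ mon_in_vspan[OF that]])
    have xc: "act P (cls (Uq n) (mon m1)) a \<otimes>\<^bsub>P\<^esub> act P (cls (Uq n) (mon m2)) b \<in> carrier P"
      if "m1 \<in> bas (Uq n)" "m2 \<in> bas (Uq n)" for m1 m2
      by (rule mc[OF ac[OF Um[OF that(1)] ac'] ac[OF Um[OF that(2)] b]])
    have yc: "act B (cls (Uq n) (mon m1)) (f a) \<otimes>\<^bsub>B\<^esub> act B (cls (Uq n) (mon m2)) (f b) \<in> carrier B"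
      if "m1 \<in> bas (Uq n)" "m2 \<in> bas (Uq n)" for m1 m2
      by (intro B.m_closed ssaD(1)[OF ssa] Um that fc ac' b)
    have h: "?h m1 m2 \<in> vspan (bas P)" if "m1 \<in> bas (Uq n)" "m2 \<in> bas (Uq n)" for m1 m2
      by (intro vec.span_scale rep_mem[OF P] xc that)
    have k: "?k m1 m2 \<in> vspan (bas B)" if "m1 \<in> bas (Uq n)" "m2 \<in> bas (Uq n)" for m1 m2
      by (intro vec.span_scale rep_mem[OF B] yc that)
    have fh: "f (cls P (?h m1 m2)) = cls B (?k m1 m2)" if m: "m1 \<in> bas (Uq n)" "m2 \<in> bas (Uq n)" for m1 m2
    proof -
      have "f (cls P (?h m1 m2)) = (-1) ^ (par m2 * p) \<odot>\<^bsub>B\<^esub> f (act P (cls (Uq n) (mon m1)) a \<otimes>\<^bsub>P\<^esub> act P (cls (Uq n) (mon m2)) b)"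
        unfolding cls_smult[OF P, symmetric] cls_rep[OF P xc[OF m]] by (rule fs[OF xc[OF m]])
      also have "\<dots> = (-1) ^ (par m2 * p) \<odot>\<^bsub>B\<^esub> (act B (cls (Uq n) (mon m1)) (f a) \<otimes>\<^bsub>B\<^esub> act B (cls (Uq n) (mon m2)) (f b))"
        by (simp only: fm[OF ac[OF Um[OF m(1)] ac'] ac[OF Um[OF m(2)] b]] fact[OF Um[OF m(1)] ac'] fact[OF Um[OF m(2)] b])
      also have "\<dots> = cls B (?k m1 m2)"
        unfolding cls_smult[OF B, symmetric] cls_rep[OF B yc[OF m]] ..
      finally show ?thesis .
    qed
    show "act P u (a \<otimes>\<^bsub>P\<^esub> b) = tsum (rels P) ?h (comult n u)"
    proof (rule eq[OF ac[OF u mc[OF ac' b]] tsum_closed[OF UQ UQ P C h]])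
      have "f (tsum (rels P) ?h (comult n u)) = tsum (rels B) (\<lambda>m1 m2. rep (f (cls P (?h m1 m2)))) (comult n u)"
        by (rule tsum_push[OF UQ UQ P B lf C h])
      also have "\<dots> = tsum (rels B) ?k (comult n u)"
        by (rule tsum_cong[OF UQ UQ B C]) (simp only: fh cls_rep[OF B cls_closed[OF B k]])
      also have "\<dots> = act B u (f a \<otimes>\<^bsub>B\<^esub> f b)" by (rule ssaD(2)[OF ssa u p hb[OF p a] fc[OF b], symmetric])
      also have "\<dots> = f (act P u (a \<otimes>\<^bsub>P\<^esub> b))" by (simp only: fact[OF u mc[OF ac' b]] fm[OF ac' b])
      finally show "f (act P u (a \<otimes>\<^bsub>P\<^esub> b)) = f (tsum (rels P) ?h (comult n u))" by (rule sym)
    qed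
  next
    fix u assume u: "u \<in> carrier (Uq n)"
    show "act P u \<one>\<^bsub>P\<^esub> = counit u \<odot>\<^bsub>P\<^esub> \<one>\<^bsub>P\<^esub>"
      by (rule eq) (simp_all add: u cl fact fs fo counit)
  qed
  show "f \<in> ring_iso P B"
    using bij by (intro ring_iso_memI fc fm fa fo)
qed

section \<open>The iterated braided tensor product\<close>

lemma braided_tensor_simps [simp]:
  "carrier (braided_tensor n V W T) = carrier (tspace V W)" "ring.add (braided_tensor n V W T) = ring.add (tspace V W)"
  "module.smult (braided_tensor n V W T) = module.smult (tspace V W)" "ring.zero (braided_tensor n V W T) = ring.zero (tspace V W)"
  "bas (braided_tensor n V W T) = tbas V W" "rels (braided_tensor n V W T) = trels V W"
  "act (braided_tensor n V W T) = act (tensor n V W)" "\<one>\<^bsub>braided_tensor n V W T\<^esub> = pure V W \<one>\<^bsub>V\<^esub> \<one>\<^bsub>W\<^esub>"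
  by (simp_all add: braided_tensor_def Let_def)

lemma braided_tensor_mult:
  "x \<otimes>\<^bsub>braided_tensor n V W T\<^esub> y = tlift V W (tspace V W) (\<lambda>a b. tlift V W (tspace V W) (\<lambda>c d.
     tlift V W (tspace V W) (\<lambda>e h. pure V W (a \<otimes>\<^bsub>V\<^esub> e) (h \<otimes>\<^bsub>W\<^esub> d)) (T (pure W V b c))) y) x"
  by (simp add: braided_tensor_def Let_def)

lemma qsp_braided_tensor [simp]: "qsp (braided_tensor n V W T) \<longleftrightarrow> qsp (tspace V W)"
  by (simp add: qsp_def tspace_simps)

lemma homog_braided_tensor [simp]: "homog (braided_tensor n V W T) p = homog (tensor n V W) p"
  by (simp add: homog_def)

lemma tmap_lmap_pure:
  assumes Q: "qsp V" "qsp W" "qsp V'" "qsp W'" and f: "lmap V V' f" and g: "lmap W W' g"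
  shows "lmap (tspace V W) (tspace V' W') (tmap V W V' W' f g)"
    and "x \<in> carrier V \<Longrightarrow> y \<in> carrier W \<Longrightarrow> tmap V W V' W' f g (pure V W x y) = pure V' W' (f x) (g y)"
proof -
  note b = bil_comp[OF Q(3,4,1,2) bil_pure[OF Q(3,4)] f g] and T = qsp_tspace[OF Q(3,4)]
  show "lmap (tspace V W) (tspace V' W') (tmap V W V' W' f g)"
    unfolding tmap_def by (rule lmap_tlift[OF Q(1,2) T b])
  show "x \<in> carrier V \<Longrightarrow> y \<in> carrier W \<Longrightarrow> tmap V W V' W' f g (pure V W x y) = pure V' W' (f x) (g y)"
    unfolding tmap_def by (rule tlift_pure[OF Q(1,2) T b])
qed

lemma id_lmap: "lmap V V id"
  by (rule lmapI) simp_all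

lemma tmap_inverse:
  assumes Q: "qsp V" "qsp W" "qsp V'" "qsp W'" and f: "lmap V V' f" "lmap V' V f'" and g: "lmap W W' g" "lmap W' W g'"
    and inv: "\<And>x. x \<in> carrier V \<Longrightarrow> f' (f x) = x" "\<And>x. x \<in> carrier W \<Longrightarrow> g' (g x) = x"
    and Z: "Z \<in> carrier (tspace V W)"
  shows "tmap V' W' V W f' g' (tmap V W V' W' f g Z) = Z"
proof -
  note t = tmap_lmap_pure[OF Q f(1) g(1)] and t' = tmap_lmap_pure[OF Q(3,4,1,2) f(2) g(2)]
  have "tmap V' W' V W f' g' (tmap V W V' W' f g Z) = id Z"
  proof (rule tspace_ext[OF Q(1,2) qsp_tspace[OF Q(1,2)] lmap_comp[OF t(1) t'(1)] id_lmap Z])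
    fix a b assume "a \<in> bas V" "b \<in> bas W"
    then have c: "cls V (mon a) \<in> carrier V" "cls W (mon b) \<in> carrier W"
      by (auto intro!: cls_closed[OF Q(1)] cls_closed[OF Q(2)])
    show "tmap V' W' V W f' g' (tmap V W V' W' f g (pure V W (cls V (mon a)) (cls W (mon b)))) = id (pure V W (cls V (mon a)) (cls W (mon b)))"
      using c by (simp add: t(2) t'(2) lmapD(1)[OF f(1)] lmapD(1)[OF g(1)] inv)
  qed
  then show ?thesis by simp
qed

lemma lmap_inv_into:
  assumes V: "qsp V" and f: "lmap V W f" and bij: "bij_betw f (carrier V) (carrier W)"
  shows "lmap W V (inv_into (carrier V) f)"
proof -
  have c: "inv_into (carrier V) f y \<in> carrier V" "f (inv_into (carrier V) f y) = y" if "y \<in> carrier W" for y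
    using that bij by (simp_all add: bij_betw_def inv_into_into f_inv_into_f)
  have e: "inv_into (carrier V) f (f x) = x" if "x \<in> carrier V" for x
    using that bij by (simp add: bij_betw_def)
  show ?thesis
  proof (rule lmapI)
    fix x y assume xy: "x \<in> carrier W" "y \<in> carrier W"
    show "inv_into (carrier V) f (x \<oplus>\<^bsub>W\<^esub> y) = inv_into (carrier V) f x \<oplus>\<^bsub>V\<^esub> inv_into (carrier V) f y"
      using e[OF qsp_add_closed[OF V c(1)[OF xy(1)] c(1)[OF xy(2)]]] unfolding lmapD(2)[OF f c(1)[OF xy(1)] c(1)[OF xy(2)]] c(2)[OF xy(1)] c(2)[OF xy(2)] .
  next
    fix x k assume x: "x \<in> carrier W"
    show "inv_into (carrier V) f (k \<odot>\<^bsub>W\<^esub> x) = k \<odot>\<^bsub>V\<^esub> inv_into (carrier V) f x"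
      using e[OF qsp_smult_closed[OF V c(1)[OF x]]] unfolding lmapD(3)[OF f c(1)[OF x]] c(2)[OF x] .
  qed (rule c(1))
qed

text \<open>Closure and evaluation in one statement, so that the three nested sums of the braided
  product can be peeled off from the inside.\<close>

lemma tlift_eval:
  assumes Q: "qsp V" "qsp W" "qsp U" "qsp U'" and F: "lmap U U' F" and Z: "Z \<in> carrier (tspace V W)"
    and f: "\<And>x y. x \<in> carrier V \<Longrightarrow> y \<in> carrier W \<Longrightarrow> f x y \<in> carrier U \<and> F (f x y) = h x y"
  shows "tlift V W U f Z \<in> carrier U \<and> F (tlift V W U f Z) = tlift V W U' h Z"
proof
  show "tlift V W U f Z \<in> carrier U" using f by (intro tlift_closed[OF Q(1-3) Z]) blast
  have "F (tlift V W U f Z) = tlift V W U' (\<lambda>x y. F (f x y)) Z"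
    using f by (intro tlift_push[OF Q F Z]) blast
  also have "\<dots> = tlift V W U' h Z"
    by (rule tlift_cong[OF Q(1,2,4) Z]) (intro conjunct2[OF f] cls_closed[OF Q(1)] cls_closed[OF Q(2)] mon_in_vspan)
  finally show "F (tlift V W U f Z) = tlift V W U' h Z" .
qed

text \<open>The content of the induction: f is an equivariant multiplicative bijection onto A_{m,n}.
  The axioms for P itself are obtained once, at the end, by transport along f.\<close>

definition power_invariant :: "nat \<Rightarrow> nat \<Rightarrow> uspace \<Rightarrow> (vec set \<Rightarrow> vec set) \<Rightarrow> bool" where
  "power_invariant n m P f \<longleftrightarrow> qsp P \<and> supermodule_hom n P (A m n) f \<and> bij_betw f (carrier P) (carrier (A m n)) \<and>
     (\<forall>x\<in>carrier P. \<forall>y\<in>carrier P. x \<otimes>\<^bsub>P\<^esub> y \<in> carrier P \<and> f (x \<otimes>\<^bsub>P\<^esub> y) = f x \<otimes>\<^bsub>A m n\<^esub> f y) \<and>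
     \<one>\<^bsub>P\<^esub> \<in> carrier P \<and> f \<one>\<^bsub>P\<^esub> = \<one>\<^bsub>A m n\<^esub> \<and>
     (\<forall>u\<in>carrier (Uq n). \<forall>x\<in>carrier P. act P u x \<in> carrier P)"

text \<open>F sends x \<otimes> y to \<iota>_1(f x) \<iota>_0(y), and the transported braiding
  satisfies F(T(b \<otimes> c)) = \<iota>_0(b) \<iota>_1(f c). So the braided product of a \<otimes>
  b and c \<otimes> d goes to \<iota>_1(f a) \<iota>_0(b) \<iota>_1(f c) \<iota>_0(d), the product
  of the two images.\<close>

lemma power_invariant_Suc:
  fixes P :: uspace and f :: "vec set \<Rightarrow> vec set" and m n :: nat
  assumes inv: "power_invariant n m P f"
  defines "T \<equiv> tmap (A m n) (A 1 n) P (A 1 n) (inv_into (carrier P) f) id \<circ> Theta n 1 m \<circ> tmap (A 1 n) P (A 1 n) (A m n) id f"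
    and "F \<equiv> glue n m 1 \<circ> tmap P (A 1 n) (A m n) (A 1 n) f id"
  shows "power_invariant n (Suc m) (braided_tensor n P (A 1 n) T) F"
proof -
  let ?g = "inv_into (carrier P) f" and ?A = "A 1 n" and ?M = "A m n" and ?B = "A (m + 1) n"
  let ?Q = "tspace P ?A" and ?i = "\<lambda>x. iota 1 (m + 1) n (f x)" and ?j = "iota 0 (m + 1) n"
  have P: "qsp P" and f: "supermodule_hom n P ?M f" and bij: "bij_betw f (carrier P) (carrier ?M)"
    and mc: "\<And>x y. x \<in> carrier P \<Longrightarrow> y \<in> carrier P \<Longrightarrow> x \<otimes>\<^bsub>P\<^esub> y \<in> carrier P"
    and fm: "\<And>x y. x \<in> carrier P \<Longrightarrow> y \<in> carrier P \<Longrightarrow> f (x \<otimes>\<^bsub>P\<^esub> y) = f x \<otimes>\<^bsub>?M\<^esub> f y"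
    and oc: "\<one>\<^bsub>P\<^esub> \<in> carrier P" and fo: "f \<one>\<^bsub>P\<^esub> = \<one>\<^bsub>?M\<^esub>"
    and ac: "\<And>u x. u \<in> carrier (Uq n) \<Longrightarrow> x \<in> carrier P \<Longrightarrow> act P u x \<in> carrier P"
    using inv unfolding power_invariant_def by blast+
  have lf: "lmap P ?M f" and ef: "even_linear P ?M f"
    and fact: "\<And>u x. u \<in> carrier (Uq n) \<Longrightarrow> x \<in> carrier P \<Longrightarrow> f (act P u x) = act ?M u (f x)"
    using f by (simp_all add: supermodule_hom_def even_linear_iff)
  note fc = lmapD(1)[OF lf] and lg = lmap_inv_into[OF P lf bij]
  have gf: "?g (f x) = x" if "x \<in> carrier P" for x using that bij by (simp add: bij_betw_def)
  have fg: "f (?g y) = y" if "y \<in> carrier ?M" for y using that bij by (simp add: bij_betw_def f_inv_into_f)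
  note AQ = A_qsp[of 1 n] and MQ = A_qsp[of m n] and BQ = A_qsp[of "m + 1" n]
  note QQ = qsp_tspace[OF P AQ]
  have lj: "lmap ?A ?B ?j" by (rule iota_lmap) simp
  have li0: "lmap ?M ?B (iota 1 (m + 1) n)" by (rule iota_lmap) simp
  note li = lmap_comp[OF lf li0]
  note ic = lmapD(1)[OF li] and jc = lmapD(1)[OF lj]
  note BA = palg_A[of "m + 1" n] and Bas = palg_assoc[OF palg_A[of "m + 1" n]] and Bc = palg_mult_closed[OF palg_A[of "m + 1" n]]
  have im: "?i (x \<otimes>\<^bsub>P\<^esub> y) = ?i x \<otimes>\<^bsub>?B\<^esub> ?i y" if "x \<in> carrier P" "y \<in> carrier P" for x y
    unfolding fm[OF that] by (rule iota_mult[OF _ fc[OF that(1)] fc[OF that(2)]]) simp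
  have jm: "?j (x \<otimes>\<^bsub>?A\<^esub> y) = ?j x \<otimes>\<^bsub>?B\<^esub> ?j y" if "x \<in> carrier ?A" "y \<in> carrier ?A" for x y
    by (rule iota_mult[OF _ that]) simp
  note t = tmap_lmap_pure[OF P AQ MQ AQ lf id_lmap] and t' = tmap_lmap_pure[OF MQ AQ P AQ lg id_lmap]
    and s = tmap_lmap_pure[OF AQ P AQ MQ id_lmap lf]
  have lF: "lmap ?Q ?B F" unfolding F_def comp_def by (rule lmap_comp[OF t(1) glue_lmap])
  have Fp: "F (pure P ?A x y) = ?i x \<otimes>\<^bsub>?B\<^esub> ?j y" if "x \<in> carrier P" "y \<in> carrier ?A" for x y
    unfolding F_def comp_def t(2)[OF that] using glue_pure[OF fc[OF that(1)], of y 1] that(2) by simp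
  \<comment> \<open>F as a single \<open>tlift\<close>, the form to which \<open>tlift_push\<close>
    and \<open>tlift_supermodule_hom\<close> apply.\<close>
  let ?H = "tlift P ?A ?B (\<lambda>x y. ?i x \<otimes>\<^bsub>?B\<^esub> ?j y)"
  note bH = bil_comp[OF BQ BQ P AQ palg_bil_mult[OF BA] li lj]
  have FH: "F Z = ?H Z" if "Z \<in> carrier ?Q" for Z
  proof (rule tspace_ext[OF P AQ BQ lF lmap_tlift[OF P AQ BQ bH] that])
    fix a b assume ab: "a \<in> bas P" "b \<in> bas ?A"
    have c: "cls P (mon a) \<in> carrier P" "cls ?A (mon b) \<in> carrier ?A"
      by (rule cls_closed[OF P mon_in_vspan[OF ab(1)]], rule cls_closed[OF AQ mon_in_vspan[OF ab(2)]])
    show "F (pure P ?A (cls P (mon a)) (cls ?A (mon b))) = ?H (pure P ?A (cls P (mon a)) (cls ?A (mon b)))"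
      unfolding Fp[OF c] tlift_pure[OF P AQ BQ bH c] ..
  qed
  have hi: "supermodule_hom n P ?B ?i"
    unfolding supermodule_hom_def even_linear_iff
  proof (intro conjI ballI li)
    have I: "even_linear ?M ?B (iota 1 (m + 1) n)" and Ia: "\<And>u x. u \<in> carrier (Uq n) \<Longrightarrow> x \<in> carrier ?M \<Longrightarrow>
        iota 1 (m + 1) n (act ?M u x) = act ?B u (iota 1 (m + 1) n x)"
      using iota_hom[where r = m and k = 1 and m = "m + 1" and n = n] by (simp_all add: supermodule_hom_def)
    show "?i \<in> homog P p \<rightarrow> homog ?B p" if p: "p \<in> {0, 1}" for p
      using I ef p unfolding even_linear_iff by blast
    show "?i (act P u x) = act ?B u (?i x)" if "u \<in> carrier (Uq n)" "x \<in> carrier P" for u x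
      unfolding fact[OF that] by (rule Ia[OF that(1) fc[OF that(2)]])
  qed
  have hj: "supermodule_hom n ?A ?B ?j" by (rule iota_hom) simp
  have hH: "supermodule_hom n (tensor n P ?A) ?B ?H"
    by (rule tlift_supermodule_hom[OF P AQ BQ A_ssa hi hj palg_bil_mult[OF BA] ac A_act_closed])
  have actQ: "act (tensor n P ?A) u Z \<in> carrier ?Q" if "u \<in> carrier (Uq n)" "Z \<in> carrier ?Q" for u Z
    by (rule tensor_act_closed[OF P AQ that ac A_act_closed])
  have hF: "supermodule_hom n (braided_tensor n P ?A T) ?B F"
    unfolding supermodule_hom_def even_linear_def braided_tensor_simps homog_braided_tensor
  proof (intro conjI ballI allI)
    show "F \<in> carrier ?Q \<rightarrow> carrier ?B" using lmapD(1)[OF lF] by blast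
    show "F (x \<oplus>\<^bsub>?Q\<^esub> y) = F x \<oplus>\<^bsub>?B\<^esub> F y" if "x \<in> carrier ?Q" "y \<in> carrier ?Q" for x y by (rule lmapD(2)[OF lF that])
    show "F (c \<odot>\<^bsub>?Q\<^esub> x) = c \<odot>\<^bsub>?B\<^esub> F x" if "x \<in> carrier ?Q" for c x by (rule lmapD(3)[OF lF that])
    show "F \<in> homog (tensor n P ?A) p \<rightarrow> homog ?B p" if p: "p \<in> {0, 1}" for p
    proof
      fix Z assume Z: "Z \<in> homog (tensor n P ?A) p"
      then have Zc: "Z \<in> carrier ?Q" using homog_carrier[OF QQ] by auto
      show "F Z \<in> homog ?B p" unfolding FH[OF Zc] using hH p Z unfolding supermodule_hom_def even_linear_def by blast
    qed
    show "F (act (tensor n P ?A) u x) = act ?B u (F x)" if "u \<in> carrier (Uq n)" "x \<in> carrier ?Q" for u x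
      unfolding FH[OF that(2)] FH[OF actQ[OF that]] using hH that unfolding supermodule_hom_def by simp
  qed
  have bF: "bij_betw F (carrier ?Q) (carrier ?B)"
    unfolding F_def
  proof (rule bij_betw_trans[OF _ glue_bij])
    show "bij_betw (tmap P ?A ?M ?A f id) (carrier ?Q) (carrier (TA m 1 n))"
    proof (rule bij_betwI[where g = "tmap ?M ?A P ?A ?g id"])
      show "tmap P ?A ?M ?A f id \<in> carrier ?Q \<rightarrow> carrier (TA m 1 n)" using lmapD(1)[OF t(1)] by blast
      show "tmap ?M ?A P ?A ?g id \<in> carrier (TA m 1 n) \<rightarrow> carrier ?Q" using lmapD(1)[OF t'(1)] by blast
      show "tmap ?M ?A P ?A ?g id (tmap P ?A ?M ?A f id x) = x" if "x \<in> carrier ?Q" for x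
        by (rule tmap_inverse[OF P AQ MQ AQ lf lg id_lmap id_lmap gf _ that]) simp_all
      show "tmap P ?A ?M ?A f id (tmap ?M ?A P ?A ?g id y) = y" if "y \<in> carrier (TA m 1 n)" for y
        by (rule tmap_inverse[OF MQ AQ P AQ lg lf id_lmap id_lmap fg _ that]) simp_all
    qed
  qed
  have FT: "T (pure ?A P b c) \<in> carrier ?Q \<and> F (T (pure ?A P b c)) = ?j b \<otimes>\<^bsub>?B\<^esub> ?i c"
    if b: "b \<in> carrier ?A" and c: "c \<in> carrier P" for b c
  proof
    have p: "pure ?A ?M b (f c) \<in> carrier (TA 1 m n)" by (rule pure_closed[OF AQ MQ b fc[OF c]])
    have e: "T (pure ?A P b c) = tmap ?M ?A P ?A ?g id (Theta n 1 m (pure ?A ?M b (f c)))"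
      unfolding T_def comp_def s(2)[OF b c] by simp
    note th = Theta_closed[OF p]
    show "T (pure ?A P b c) \<in> carrier ?Q" unfolding e by (rule lmapD(1)[OF t'(1) th])
    \<comment> \<open>The last factor of T is inverted by the first factor of F, which leaves
      \<open>glue\<close> after \<open>Theta\<close>, that is \<open>swapglue\<close>.\<close>
    have "F (T (pure ?A P b c)) = glue n m 1 (Theta n 1 m (pure ?A ?M b (f c)))"
      unfolding e F_def comp_def by (rule arg_cong[OF tmap_inverse[OF MQ AQ P AQ lg lf id_lmap id_lmap fg _ th]]) simp_all
    then show "F (T (pure ?A P b c)) = ?j b \<otimes>\<^bsub>?B\<^esub> ?i c"
      unfolding glue_Theta[OF p] swapglue_pure[OF b fc[OF c]] .
  qed
  have K: "tlift P ?A ?Q (\<lambda>e h. pure P ?A (a \<otimes>\<^bsub>P\<^esub> e) (h \<otimes>\<^bsub>?A\<^esub> d)) (T (pure ?A P b c)) \<in> carrier ?Q \<and>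
      F (tlift P ?A ?Q (\<lambda>e h. pure P ?A (a \<otimes>\<^bsub>P\<^esub> e) (h \<otimes>\<^bsub>?A\<^esub> d)) (T (pure ?A P b c)))
        = (?i a \<otimes>\<^bsub>?B\<^esub> ?j b) \<otimes>\<^bsub>?B\<^esub> (?i c \<otimes>\<^bsub>?B\<^esub> ?j d)"
    if a: "a \<in> carrier P" and b: "b \<in> carrier ?A" and c: "c \<in> carrier P" and d: "d \<in> carrier ?A" for a b c d
  proof -
    let ?W = "T (pure ?A P b c)"
    have W: "?W \<in> carrier ?Q" "F ?W = ?j b \<otimes>\<^bsub>?B\<^esub> ?i c" using FT[OF b c] by blast+
    have pt: "pure P ?A (a \<otimes>\<^bsub>P\<^esub> e) (h \<otimes>\<^bsub>?A\<^esub> d) \<in> carrier ?Q \<and> F (pure P ?A (a \<otimes>\<^bsub>P\<^esub> e) (h \<otimes>\<^bsub>?A\<^esub> d))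
        = (?i a \<otimes>\<^bsub>?B\<^esub> (?i e \<otimes>\<^bsub>?B\<^esub> ?j h)) \<otimes>\<^bsub>?B\<^esub> ?j d"
      if e: "e \<in> carrier P" and h: "h \<in> carrier ?A" for e h
    proof
      note hd = palg_mult_closed[OF palg_A h d]
      show "pure P ?A (a \<otimes>\<^bsub>P\<^esub> e) (h \<otimes>\<^bsub>?A\<^esub> d) \<in> carrier ?Q" by (rule pure_closed[OF P AQ mc[OF a e] hd])
      show "F (pure P ?A (a \<otimes>\<^bsub>P\<^esub> e) (h \<otimes>\<^bsub>?A\<^esub> d)) = (?i a \<otimes>\<^bsub>?B\<^esub> (?i e \<otimes>\<^bsub>?B\<^esub> ?j h)) \<otimes>\<^bsub>?B\<^esub> ?j d"
        unfolding Fp[OF mc[OF a e] hd] im[OF a e] jm[OF h d]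
        by (simp only: Bas ic[OF a] ic[OF e] jc[OF h] jc[OF d] Bc)
    qed
    note ev = tlift_eval[OF P AQ QQ BQ lF W(1) pt]
    \<comment> \<open>Multiplication by \<iota>_1(f a) on the left and \<iota>_0(d) on the right is
      linear, so it comes out of the sum over T(b \<otimes> c).\<close>
    have lmul: "lmap ?B ?B (\<lambda>z. (?i a \<otimes>\<^bsub>?B\<^esub> z) \<otimes>\<^bsub>?B\<^esub> ?j d)"
      by (rule lmap_comp[OF palg_lmap_mult(1)[OF BA ic[OF a]] palg_lmap_mult(2)[OF BA jc[OF d]]])
    have "tlift P ?A ?B (\<lambda>e h. (?i a \<otimes>\<^bsub>?B\<^esub> (?i e \<otimes>\<^bsub>?B\<^esub> ?j h)) \<otimes>\<^bsub>?B\<^esub> ?j d) ?W = (?i a \<otimes>\<^bsub>?B\<^esub> ?H ?W) \<otimes>\<^bsub>?B\<^esub> ?j d"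
      by (rule tlift_push[OF P AQ BQ BQ lmul W(1), symmetric]) (intro Bc ic jc)
    also have "\<dots> = (?i a \<otimes>\<^bsub>?B\<^esub> ?j b) \<otimes>\<^bsub>?B\<^esub> (?i c \<otimes>\<^bsub>?B\<^esub> ?j d)"
      unfolding FH[OF W(1), symmetric] W(2) by (simp only: Bas ic[OF a] ic[OF c] jc[OF b] jc[OF d] Bc)
    finally show ?thesis using ev by simp
  qed
  have mult: "x \<otimes>\<^bsub>braided_tensor n P ?A T\<^esub> y \<in> carrier ?Q \<and> F (x \<otimes>\<^bsub>braided_tensor n P ?A T\<^esub> y) = F x \<otimes>\<^bsub>?B\<^esub> F y"
    if x: "x \<in> carrier ?Q" and y: "y \<in> carrier ?Q" for x y
  proof -
    let ?K = "\<lambda>a b c d. tlift P ?A ?Q (\<lambda>e h. pure P ?A (a \<otimes>\<^bsub>P\<^esub> e) (h \<otimes>\<^bsub>?A\<^esub> d)) (T (pure ?A P b c))"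
    have Hy: "?H y \<in> carrier ?B" using lmapD(1)[OF lF y] unfolding FH[OF y] .
    have L: "tlift P ?A ?Q (?K a b) y \<in> carrier ?Q \<and> F (tlift P ?A ?Q (?K a b) y) = (?i a \<otimes>\<^bsub>?B\<^esub> ?j b) \<otimes>\<^bsub>?B\<^esub> ?H y"
      if a: "a \<in> carrier P" and b: "b \<in> carrier ?A" for a b
    proof -
      note ab = Bc[OF ic[OF a] jc[OF b]]
      have "tlift P ?A ?B (\<lambda>c d. (?i a \<otimes>\<^bsub>?B\<^esub> ?j b) \<otimes>\<^bsub>?B\<^esub> (?i c \<otimes>\<^bsub>?B\<^esub> ?j d)) y = (?i a \<otimes>\<^bsub>?B\<^esub> ?j b) \<otimes>\<^bsub>?B\<^esub> ?H y"
        by (rule tlift_push[OF P AQ BQ BQ palg_lmap_mult(1)[OF BA ab] y, symmetric]) (intro Bc ic jc)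
      then show ?thesis using tlift_eval[OF P AQ QQ BQ lF y K[OF a b]] by simp
    qed
    have "tlift P ?A ?B (\<lambda>a b. (?i a \<otimes>\<^bsub>?B\<^esub> ?j b) \<otimes>\<^bsub>?B\<^esub> ?H y) x = ?H x \<otimes>\<^bsub>?B\<^esub> ?H y"
      by (rule tlift_push[OF P AQ BQ BQ palg_lmap_mult(2)[OF BA Hy] x, symmetric]) (intro Bc ic jc)
    then show ?thesis
      unfolding braided_tensor_mult FH[OF x] FH[OF y] using tlift_eval[OF P AQ QQ BQ lF x L] by simp
  qed
  note o1 = palg_one_closed[OF palg_A[of 1 n]]
  have one: "pure P ?A \<one>\<^bsub>P\<^esub> \<one>\<^bsub>?A\<^esub> \<in> carrier ?Q" "F (pure P ?A \<one>\<^bsub>P\<^esub> \<one>\<^bsub>?A\<^esub>) = \<one>\<^bsub>?B\<^esub>"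
  proof -
    show "pure P ?A \<one>\<^bsub>P\<^esub> \<one>\<^bsub>?A\<^esub> \<in> carrier ?Q" by (rule pure_closed[OF P AQ oc o1])
    have "iota 1 (m + 1) n \<one>\<^bsub>?M\<^esub> = \<one>\<^bsub>?B\<^esub>" "?j \<one>\<^bsub>?A\<^esub> = \<one>\<^bsub>?B\<^esub>" by (rule iota_one, simp)+
    then show "F (pure P ?A \<one>\<^bsub>P\<^esub> \<one>\<^bsub>?A\<^esub>) = \<one>\<^bsub>?B\<^esub>"
      unfolding Fp[OF oc o1] fo by (simp only: palg_unit(1)[OF BA palg_one_closed[OF BA]])
  qed
  show ?thesis
    unfolding power_invariant_def Suc_eq_plus1 braided_tensor_simps qsp_braided_tensor
    using QQ hF bF mult one actQ by blast
qed

text \<open>The induction starts at one factor, as \<open>tpower n 0\<close> is undefined; there the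
  identification is the identity.\<close>

lemma tpower_invariant: "power_invariant n (Suc m) (fst (tpower n (Suc m))) (snd (tpower n (Suc m)))"
proof (induction m)
  case 0
  have "supermodule_hom n (A 1 n) (A 1 n) id" by (simp add: supermodule_hom_def even_linear_def)
  then show ?case
    unfolding tpower.simps fst_conv snd_conv
    unfolding power_invariant_def One_nat_def[symmetric]
    by (intro conjI ballI A_qsp bij_betw_id A_act_closed)
      (simp_all only: id_apply palg_mult_closed[OF palg_A] palg_one_closed[OF palg_A])
next
  case (Suc m)
  show ?case using power_invariant_Suc[OF Suc.IH] by (simp only: tpower.simps Let_def fst_conv snd_conv)
qed

theorem corollary3p7:
  fixes r n :: nat
  assumes "r \<ge> 1" and "n \<ge> 1"
  shows "isomorphic_supermodule_superalgebras n (braided_power n r) (A r n)"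
proof -
  obtain m where r: "r = Suc m" using \<open>r \<ge> 1\<close> by (cases r) auto
  let ?P = "fst (tpower n r)" and ?f = "snd (tpower n r)"
  have inv: "power_invariant n r ?P ?f" unfolding r by (rule tpower_invariant)
  then have f: "supermodule_hom n ?P (A r n) ?f" and "qsp ?P" "bij_betw ?f (carrier ?P) (carrier (A r n))"
    by (simp_all add: power_invariant_def)
  note tr = transport_supermodule_superalgebra[OF this(2) A_qsp this(1,3) _ _ _ _ _ palg_lmap_mult(1)[OF palg_A] A_ssa]
  have "supermodule_superalgebra n ?P" "?f \<in> ring_iso ?P (A r n)"
    by (rule tr; use inv in \<open>simp add: power_invariant_def\<close>)+
  then show ?thesis
    using A_ssa f unfolding isomorphic_supermodule_superalgebras_def supermodule_superalgebra_iso_def braided_power_def by blast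
qed

end
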